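(* Let $\mathfrak g$ be a complex semisimple Lie algebra, $P\supset B\supset H$ a standard parabolic subgroup of the adjoint group $G$, $t\in\mathbb C^m$ with $m=\dim H^2(G/P)$, and let $\mathfrak l_\Delta\subset\mathfrak g_K\supset\tilde{\mathfrak u}_K$ be the Lie algebras associated to $t$ as in the context. Then the Hochschild-Serre spectral sequence of the Lie algebra $\mathfrak g_K$, the ideal $\tilde{\mathfrak u}_K$, the subalgebra $\mathfrak l_\Delta$ and trivial coefficients $\mathbb C$, which converges to $H^*(\mathfrak g_K,\mathfrak l_\Delta)$ and has $E_2$-term $$H^*(\mathfrak g_K/\tilde{\mathfrak u}_K,\mathfrak l_\Delta;H^*(\tilde{\mathfrak u}_K,\mathbb C)),$$ degenerates at the $E_2$-term.
   Context: Let $\mathfrak h=\mathrm{Lie}(H)$, let $\mathfrak l$ be the Levi subalgebra of $\mathfrak p=\mathrm{Lie}(P)$ containing $\mathfrak h$, and let $\alpha_1,\dots,\alpha_n$ be the simple roots for the positive system in which the roots of $\mathfrak b$ are positive, numbered so that $\mathfrak l$ is generated by $\mathfrak h$ and $\mathfrak g_{\pm\alpha_i}$, $i\in\{m+1,\dots,n\}$. Let $K=\{m+1,\dots,n\}\cup\{1\le q\le m:t_q\ne0\}$. Let $\mathfrak l_K$ be the Levi subalgebra generated by $\mathfrak h$ and $\mathfrak g_{\pm\alpha_i}$, $i\in K$; let $\mathfrak u_{K,+}$ (resp. $\mathfrak u_{K,-}$) be the span of the positive (resp. negative) root spaces not contained in $\mathfrak l_K$. For $V\subset\mathfrak g$ let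 $V_\Delta\subset\mathfrak g\times\mathfrak g$ be its image under the diagonal map; write $\mathfrak l_{K,\Delta}=(\mathfrak l_K)_\Delta$. Put $\tilde{\mathfrak u}_K=(\mathfrak u_{K,-}\times\{0\})+(\{0\}\times\mathfrak u_{K,+})$ and $\mathfrak g_K=\mathfrak l_{K,\Delta}+\tilde{\mathfrak u}_K$, a subalgebra of $\mathfrak g\times\mathfrak g$ containing $\mathfrak l_\Delta$, in which $\tilde{\mathfrak u}_K$ is an ideal with $\mathfrak g_K/\tilde{\mathfrak u}_K\cong\mathfrak l_K$ and $\tilde{\mathfrak u}_K\cap\mathfrak l_\Delta=0$. Relative cohomology: $H^*(\mathfrak a,\mathfrak k;M)$ is the cohomology of the Chevalley-Eilenberg subcomplex $C^n(\mathfrak a,\mathfrak k;M)=\mathrm{Hom}_{\mathfrak k}(\Lambda^n(\mathfrak a/\mathfrak k),M)$; $H^*(\mathfrak a,\mathfrak k)$ means trivial coefficients $\mathbb C$. The Hochschild-Serre spectral sequence for an ideal $I\subset\mathfrak a$ is the spectral sequence of the complex $C^n=C^n(\mathfrak a,\mathfrak k;M)$ with filtration $F_pC^n=\{f: f(x_1,\dots,x_n)=0$ whenever at least $n-p+1$ of the $x_i$ lie in $I\}$. "Degenerates at $E_2$" means all differentials $d_r$ with $r\ge2$ vanish. *)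

theory Defs
  imports
    "HOL-Algebra.AbelCoset"
    "HOL-Algebra.Module"
    "HOL-Analysis.Product_Vector"
    "HOL-Library.Set_Algebras"
begin

section \<open>Vector spaces, Lie algebras and quotients as records\<close>

text \<open>
  Complex vector spaces that arise as quotients are HOL-Algebra module records over the complex
  numbers. The ring fields \<open>mult\<close> and \<open>one\<close> of such a record carry no meaning.
\<close>

record 'a lie_algebra = "(complex, 'a) module" +
  bracket :: "'a \<Rightarrow> 'a \<Rightarrow> 'a"

definition quot_space :: "(complex, 'a) module \<Rightarrow> 'a set \<Rightarrow> (complex, 'a set) module" where
  "quot_space V W = \<lparr>carrier = a_rcosets\<^bsub>V\<^esub> W, monoid.mult = undefined, one = undefined,
     zero = W, add = set_add V, smult = (\<lambda>c X. \<Union>x\<in>X. W +>\<^bsub>V\<^esub> (c \<odot>\<^bsub>V\<^esub> x))\<rparr>"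

definition lie_quot :: "'a lie_algebra \<Rightarrow> 'a set \<Rightarrow> 'a set lie_algebra" where
  "lie_quot A I = \<lparr>carrier = a_rcosets\<^bsub>A\<^esub> I, monoid.mult = undefined, one = undefined,
     zero = I, add = set_add A, smult = (\<lambda>c X. \<Union>x\<in>X. I +>\<^bsub>A\<^esub> (c \<odot>\<^bsub>A\<^esub> x)),
     bracket = (\<lambda>X Y. \<Union>x\<in>X. \<Union>y\<in>Y. I +>\<^bsub>A\<^esub> bracket A x y)\<rparr>"

definition vs_isomorphic :: "(complex, 'a) module \<Rightarrow> (complex, 'b) module \<Rightarrow> bool" where
  "vs_isomorphic V W \<longleftrightarrow> (\<exists>\<phi>\<in>iso (add_monoid V) (add_monoid W).
     \<forall>c. \<forall>x\<in>carrier V. \<phi> (c \<odot>\<^bsub>V\<^esub> x) = c \<odot>\<^bsub>W\<^esub> \<phi> x)"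


section \<open>Relative Lie algebra cohomology\<close>

definition args :: "'a set \<Rightarrow> nat \<Rightarrow> 'a list set" where
  "args S n = {xs. length xs = n \<and> set xs \<subseteq> S}"

text \<open>
  A module over a Lie algebra is a vector space \<open>M\<close> together with an action \<open>act\<close>.
  An element of \<open>Hom(\<Lambda>\<^sup>n(A), M)\<close> is an alternating \<open>n\<close>-linear map on
  argument lists, normalised to be zero off the lists of length \<open>n\<close> over \<open>A\<close>. It belongs to
  \<open>Hom\<^sub>k(\<Lambda>\<^sup>n(A/k), M)\<close> if it vanishes as soon as one argument lies in \<open>k\<close>, and is
  \<open>k\<close>-equivariant.
\<close>

definition alternating_maps :: "'a lie_algebra \<Rightarrow> (complex, 'm) module \<Rightarrow> nat \<Rightarrow> ('a list \<Rightarrow> 'm) set" where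
  "alternating_maps A M n = {f.
     (\<forall>xs. xs \<notin> args (carrier A) n \<longrightarrow> f xs = \<zero>\<^bsub>M\<^esub>) \<and>
     (\<forall>xs\<in>args (carrier A) n. f xs \<in> carrier M) \<and>
     (\<forall>xs\<in>args (carrier A) n. \<forall>i<n. \<forall>x\<in>carrier A. \<forall>y\<in>carrier A.
        f (xs[i := x \<oplus>\<^bsub>A\<^esub> y]) = f (xs[i := x]) \<oplus>\<^bsub>M\<^esub> f (xs[i := y])) \<and>
     (\<forall>xs\<in>args (carrier A) n. \<forall>i<n. \<forall>c. \<forall>x\<in>carrier A.
        f (xs[i := c \<odot>\<^bsub>A\<^esub> x]) = c \<odot>\<^bsub>M\<^esub> f (xs[i := x])) \<and>
     (\<forall>xs\<in>args (carrier A) n. \<forall>i<n. \<forall>j<n. i \<noteq> j \<and> xs ! i = xs ! j \<longrightarrow> f xs = \<zero>\<^bsub>M\<^esub>)}"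

definition rel_cochains ::
  "'a lie_algebra \<Rightarrow> 'a set \<Rightarrow> (complex, 'm) module \<Rightarrow> ('a \<Rightarrow> 'm \<Rightarrow> 'm) \<Rightarrow> nat
    \<Rightarrow> (complex, 'a list \<Rightarrow> 'm) module" where
  "rel_cochains A k M act n = \<lparr>
     carrier = {f \<in> alternating_maps A M n.
       (\<forall>xs\<in>args (carrier A) n. set xs \<inter> k \<noteq> {} \<longrightarrow> f xs = \<zero>\<^bsub>M\<^esub>) \<and>
       (\<forall>x\<in>k. \<forall>xs\<in>args (carrier A) n.
          act x (f xs) = (\<Oplus>\<^bsub>M\<^esub>i\<in>{..<n}. f (xs[i := bracket A x (xs ! i)])))},
     monoid.mult = undefined, one = undefined,
     zero = (\<lambda>xs. \<zero>\<^bsub>M\<^esub>), add = (\<lambda>f g xs. f xs \<oplus>\<^bsub>M\<^esub> g xs), smult = (\<lambda>c f xs. c \<odot>\<^bsub>M\<^esub> f xs)\<rparr>"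

text \<open>The Chevalley-Eilenberg differential; \<open>nths xs (- {i, j})\<close> omits the entries \<open>i\<close> and \<open>j\<close>.\<close>

definition ce_diff ::
  "'a lie_algebra \<Rightarrow> (complex, 'm) module \<Rightarrow> ('a \<Rightarrow> 'm \<Rightarrow> 'm) \<Rightarrow> nat \<Rightarrow> ('a list \<Rightarrow> 'm) \<Rightarrow> ('a list \<Rightarrow> 'm)" where
  "ce_diff A M act n f = (\<lambda>xs. if xs \<in> args (carrier A) (Suc n) then
     (\<Oplus>\<^bsub>M\<^esub>i\<in>{..n}. ((-1) ^ i) \<odot>\<^bsub>M\<^esub> act (xs ! i) (f (nths xs (- {i})))) \<oplus>\<^bsub>M\<^esub>
     (\<Oplus>\<^bsub>M\<^esub>j\<in>{..n}. \<Oplus>\<^bsub>M\<^esub>i\<in>{..<j}.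
        ((-1) ^ (i + j)) \<odot>\<^bsub>M\<^esub> f (bracket A (xs ! i) (xs ! j) # nths xs (- {i, j})))
     else \<zero>\<^bsub>M\<^esub>)"

definition cocycles :: "(nat \<Rightarrow> (complex, 'c) module) \<Rightarrow> (nat \<Rightarrow> 'c \<Rightarrow> 'c) \<Rightarrow> nat \<Rightarrow> 'c set" where
  "cocycles C d n = {f \<in> carrier (C n). d n f = \<zero>\<^bsub>C (Suc n)\<^esub>}"

definition coboundaries :: "(nat \<Rightarrow> (complex, 'c) module) \<Rightarrow> (nat \<Rightarrow> 'c \<Rightarrow> 'c) \<Rightarrow> nat \<Rightarrow> 'c set" where
  "coboundaries C d n = (case n of 0 \<Rightarrow> {\<zero>\<^bsub>C 0\<^esub>} | Suc m \<Rightarrow> d m ` carrier (C m))"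

definition cohomology ::
  "(nat \<Rightarrow> (complex, 'c) module) \<Rightarrow> (nat \<Rightarrow> 'c \<Rightarrow> 'c) \<Rightarrow> nat \<Rightarrow> (complex, 'c set) module" where
  "cohomology C d n = quot_space ((C n)\<lparr>carrier := cocycles C d n\<rparr>) (coboundaries C d n)"

definition rel_cohomology ::
  "'a lie_algebra \<Rightarrow> 'a set \<Rightarrow> (complex, 'm) module \<Rightarrow> ('a \<Rightarrow> 'm \<Rightarrow> 'm) \<Rightarrow> nat
    \<Rightarrow> (complex, ('a list \<Rightarrow> 'm) set) module" where
  "rel_cohomology A k M act = cohomology (rel_cochains A k M act) (ce_diff A M act)"

definition trivial_module :: "(complex, complex) module" where
  "trivial_module = \<lparr>carrier = UNIV, monoid.mult = undefined, one = undefined,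
     zero = 0, add = (+), smult = (*)\<rparr>"

definition trivial_action :: "'a \<Rightarrow> complex \<Rightarrow> complex" where
  "trivial_action x z = 0"


section \<open>The spectral sequence of a filtered complex\<close>

text \<open>
  The complex is \<open>C\<^sup>0 \<rightarrow> C\<^sup>1 \<rightarrow> \<dots>\<close> with a decreasing filtration
  \<open>F p n \<subseteq> C\<^sup>n\<close>. The pages are indexed by the filtration degree \<open>p\<close> and the
  \<^emph>\<open>total\<close> degree \<open>n\<close>, so that the usual term of bidegree \<open>(p, q)\<close> is found at
  \<open>n = p + q\<close>, and \<open>d\<^sub>r\<close> goes from \<open>(p, n)\<close> to \<open>(p + r, n + 1)\<close>:
  \<open>Z\<^sub>r\<^sup>p = {f \<in> F\<^sub>p. d f \<in> F\<^sub>p\<^sub>+\<^sub>r}\<close> and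
  \<open>E\<^sub>r\<^sup>p = Z\<^sub>r\<^sup>p / (Z\<^sub>r\<^sub>-\<^sub>1\<^sup>p\<^sup>+\<^sup>1 + d Z\<^sub>r\<^sub>-\<^sub>1\<^sup>p\<^sup>-\<^sup>r\<^sup>+\<^sup>1)\<close>.
\<close>

definition ss_cycles ::
  "(nat \<Rightarrow> 'c \<Rightarrow> 'c) \<Rightarrow> (int \<Rightarrow> nat \<Rightarrow> 'c set) \<Rightarrow> int \<Rightarrow> int \<Rightarrow> nat \<Rightarrow> 'c set" where
  "ss_cycles d F r p n = {f \<in> F p n. d n f \<in> F (p + r) (Suc n)}"

definition ss_bounds ::
  "(nat \<Rightarrow> (complex, 'c) module) \<Rightarrow> (nat \<Rightarrow> 'c \<Rightarrow> 'c) \<Rightarrow> (int \<Rightarrow> nat \<Rightarrow> 'c set)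
    \<Rightarrow> int \<Rightarrow> int \<Rightarrow> nat \<Rightarrow> 'c set" where
  "ss_bounds C d F r p n = ss_cycles d F (r - 1) (p + 1) n <+>\<^bsub>C n\<^esub>
     (case n of 0 \<Rightarrow> {\<zero>\<^bsub>C 0\<^esub>} | Suc m \<Rightarrow> d m ` ss_cycles d F (r - 1) (p - r + 1) m)"

definition ss_page ::
  "(nat \<Rightarrow> (complex, 'c) module) \<Rightarrow> (nat \<Rightarrow> 'c \<Rightarrow> 'c) \<Rightarrow> (int \<Rightarrow> nat \<Rightarrow> 'c set)
    \<Rightarrow> int \<Rightarrow> int \<Rightarrow> nat \<Rightarrow> (complex, 'c set) module" where
  "ss_page C d F r p n = quot_space ((C n)\<lparr>carrier := ss_cycles d F r p n\<rparr>) (ss_bounds C d F r p n)"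

definition ss_diff ::
  "(nat \<Rightarrow> (complex, 'c) module) \<Rightarrow> (nat \<Rightarrow> 'c \<Rightarrow> 'c) \<Rightarrow> (int \<Rightarrow> nat \<Rightarrow> 'c set)
    \<Rightarrow> int \<Rightarrow> int \<Rightarrow> nat \<Rightarrow> 'c set \<Rightarrow> 'c set" where
  "ss_diff C d F r p n X = (\<Union>f\<in>X. ss_bounds C d F r (p + r) (Suc n) +>\<^bsub>C (Suc n)\<^esub> d n f)"

definition ss_degenerates_at ::
  "(nat \<Rightarrow> (complex, 'c) module) \<Rightarrow> (nat \<Rightarrow> 'c \<Rightarrow> 'c) \<Rightarrow> (int \<Rightarrow> nat \<Rightarrow> 'c set) \<Rightarrow> int \<Rightarrow> bool" where
  "ss_degenerates_at C d F s \<longleftrightarrow> (\<forall>r\<ge>s. \<forall>p n. \<forall>X\<in>carrier (ss_page C d F r p n).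
     ss_diff C d F r p n X = \<zero>\<^bsub>ss_page C d F r (p + r) (Suc n)\<^esub>)"

text \<open>The filtration induced on cohomology: the classes represented by a cocycle in \<open>F\<^sub>p\<close>.\<close>

definition cohomology_filtration ::
  "(nat \<Rightarrow> (complex, 'c) module) \<Rightarrow> (nat \<Rightarrow> 'c \<Rightarrow> 'c) \<Rightarrow> (int \<Rightarrow> nat \<Rightarrow> 'c set)
    \<Rightarrow> int \<Rightarrow> nat \<Rightarrow> 'c set set" where
  "cohomology_filtration C d F p n = {X \<in> carrier (cohomology C d n). X \<inter> F p n \<noteq> {}}"

definition ss_converges_to_cohomology ::
  "(nat \<Rightarrow> (complex, 'c) module) \<Rightarrow> (nat \<Rightarrow> 'c \<Rightarrow> 'c) \<Rightarrow> (int \<Rightarrow> nat \<Rightarrow> 'c set) \<Rightarrow> bool" where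
  "ss_converges_to_cohomology C d F \<longleftrightarrow>
     (\<forall>n. (\<exists>p. cohomology_filtration C d F p n = carrier (cohomology C d n)) \<and>
          (\<exists>p. cohomology_filtration C d F p n = {\<zero>\<^bsub>cohomology C d n\<^esub>})) \<and>
     (\<forall>p n. \<exists>r0. \<forall>r\<ge>r0. vs_isomorphic (ss_page C d F r p n)
        (quot_space ((cohomology C d n)\<lparr>carrier := cohomology_filtration C d F p n\<rparr>)
           (cohomology_filtration C d F (p + 1) n)))"


section \<open>The Hochschild-Serre spectral sequence of an ideal\<close>

definition hs_filtration ::
  "'a lie_algebra \<Rightarrow> 'a set \<Rightarrow> 'a set \<Rightarrow> (complex, 'm) module \<Rightarrow> ('a \<Rightarrow> 'm \<Rightarrow> 'm)
    \<Rightarrow> int \<Rightarrow> nat \<Rightarrow> ('a list \<Rightarrow> 'm) set" where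
  "hs_filtration A I k M act p n = {f \<in> carrier (rel_cochains A k M act n).
     \<forall>xs\<in>args (carrier A) n.
       int n - p + 1 \<le> int (card {i. i < n \<and> xs ! i \<in> I}) \<longrightarrow> f xs = \<zero>\<^bsub>M\<^esub>}"

definition hs_page ::
  "'a lie_algebra \<Rightarrow> 'a set \<Rightarrow> 'a set \<Rightarrow> (complex, 'm) module \<Rightarrow> ('a \<Rightarrow> 'm \<Rightarrow> 'm)
    \<Rightarrow> int \<Rightarrow> int \<Rightarrow> nat \<Rightarrow> (complex, ('a list \<Rightarrow> 'm) set) module" where
  "hs_page A I k M act =
     ss_page (rel_cochains A k M act) (ce_diff A M act) (hs_filtration A I k M act)"

definition hs_degenerates_at ::
  "'a lie_algebra \<Rightarrow> 'a set \<Rightarrow> 'a set \<Rightarrow> (complex, 'm) module \<Rightarrow> ('a \<Rightarrow> 'm \<Rightarrow> 'm) \<Rightarrow> int \<Rightarrow> bool" where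
  "hs_degenerates_at A I k M act =
     ss_degenerates_at (rel_cochains A k M act) (ce_diff A M act) (hs_filtration A I k M act)"

definition hs_converges ::
  "'a lie_algebra \<Rightarrow> 'a set \<Rightarrow> 'a set \<Rightarrow> (complex, 'm) module \<Rightarrow> ('a \<Rightarrow> 'm \<Rightarrow> 'm) \<Rightarrow> bool" where
  "hs_converges A I k M act \<longleftrightarrow>
     ss_converges_to_cohomology (rel_cochains A k M act) (ce_diff A M act) (hs_filtration A I k M act)"

definition ideal_cohomology ::
  "'a lie_algebra \<Rightarrow> 'a set \<Rightarrow> (complex, 'm) module \<Rightarrow> ('a \<Rightarrow> 'm \<Rightarrow> 'm) \<Rightarrow> nat
    \<Rightarrow> (complex, ('a list \<Rightarrow> 'm) set) module" where
  "ideal_cohomology A I M act = rel_cohomology (A\<lparr>carrier := I\<rparr>) {\<zero>\<^bsub>A\<^esub>} M act"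

text \<open>The action of \<open>A\<close> on cochains of the ideal \<open>I\<close>, and the action of \<open>A/I\<close> it induces on \<open>H\<^sup>q(I, M)\<close>.\<close>

definition lie_derivative ::
  "'a lie_algebra \<Rightarrow> 'a set \<Rightarrow> (complex, 'm) module \<Rightarrow> ('a \<Rightarrow> 'm \<Rightarrow> 'm) \<Rightarrow> nat
    \<Rightarrow> 'a \<Rightarrow> ('a list \<Rightarrow> 'm) \<Rightarrow> ('a list \<Rightarrow> 'm)" where
  "lie_derivative A I M act q x f = (\<lambda>ys. if ys \<in> args I q then
     act x (f ys) \<ominus>\<^bsub>M\<^esub> (\<Oplus>\<^bsub>M\<^esub>i\<in>{..<q}. f (ys[i := bracket A x (ys ! i)])) else \<zero>\<^bsub>M\<^esub>)"

definition quot_action ::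
  "'a lie_algebra \<Rightarrow> 'a set \<Rightarrow> (complex, 'm) module \<Rightarrow> ('a \<Rightarrow> 'm \<Rightarrow> 'm) \<Rightarrow> nat
    \<Rightarrow> 'a set \<Rightarrow> ('a list \<Rightarrow> 'm) set \<Rightarrow> ('a list \<Rightarrow> 'm) set" where
  "quot_action A I M act q X \<omega> = (\<Union>x\<in>X. \<Union>f\<in>\<omega>.
     \<zero>\<^bsub>ideal_cohomology A I M act q\<^esub>
       +>\<^bsub>rel_cochains (A\<lparr>carrier := I\<rparr>) {\<zero>\<^bsub>A\<^esub>} M act q\<^esub> lie_derivative A I M act q x f)"

text \<open>\<open>H\<^sup>p(A/I, k; H\<^sup>q(I, M))\<close>, where \<open>k\<close> acts through its image in \<open>A/I\<close>.\<close>

definition hs_E2_term ::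
  "'a lie_algebra \<Rightarrow> 'a set \<Rightarrow> 'a set \<Rightarrow> (complex, 'm) module \<Rightarrow> ('a \<Rightarrow> 'm \<Rightarrow> 'm) \<Rightarrow> nat \<Rightarrow> nat
    \<Rightarrow> (complex, ('a set list \<Rightarrow> ('a list \<Rightarrow> 'm) set) set) module" where
  "hs_E2_term A I k M act p q = rel_cohomology (lie_quot A I) ((\<lambda>x. I +>\<^bsub>A\<^esub> x) ` k)
     (ideal_cohomology A I M act q) (quot_action A I M act q) p"


section \<open>Complex Lie algebras and root spaces\<close>

locale complex_lie_algebra = vector_space scale
  for scale :: "complex \<Rightarrow> 'a::ab_group_add \<Rightarrow> 'a" +
  fixes lie :: "'a \<Rightarrow> 'a \<Rightarrow> 'a"
  assumes lie_add_left: "lie (x + y) z = lie x z + lie y z"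
    and lie_add_right: "lie x (y + z) = lie x y + lie x z"
    and lie_scale_left: "lie (scale c x) y = scale c (lie x y)"
    and lie_scale_right: "lie x (scale c y) = scale c (lie x y)"
    and lie_self: "lie x x = 0"
    and jacobi: "lie x (lie y z) + lie y (lie z x) + lie z (lie x y) = 0"
begin

definition subalgebra :: "'a set \<Rightarrow> bool" where
  "subalgebra S \<longleftrightarrow> subspace S \<and> (\<forall>x\<in>S. \<forall>y\<in>S. lie x y \<in> S)"

definition lie_ideal :: "'a set \<Rightarrow> bool" where
  "lie_ideal S \<longleftrightarrow> subspace S \<and> (\<forall>x. \<forall>y\<in>S. lie x y \<in> S)"

primrec derived_series :: "'a set \<Rightarrow> nat \<Rightarrow> 'a set" where
  "derived_series S 0 = S"
| "derived_series S (Suc i) = span {lie x y | x y. x \<in> derived_series S i \<and> y \<in> derived_series S i}"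

definition solvable :: "'a set \<Rightarrow> bool" where
  "solvable S \<longleftrightarrow> (\<exists>i. derived_series S i = {0})"

definition semisimple :: bool where
  "semisimple \<longleftrightarrow> (\<exists>B. finite B \<and> span B = UNIV) \<and> (\<forall>S. lie_ideal S \<and> solvable S \<longrightarrow> S = {0})"

definition toral :: "'a set \<Rightarrow> bool" where
  "toral S \<longleftrightarrow> subalgebra S \<and> (\<forall>x\<in>S. span {v. \<exists>c. lie x v = scale c v} = UNIV)"

definition cartan_subalgebra :: "'a set \<Rightarrow> bool"
  \<comment> \<open>the maximal toral subalgebras are the Lie algebras of the maximal tori of the adjoint group\<close>
  where "cartan_subalgebra S \<longleftrightarrow> toral S \<and> (\<forall>T. toral T \<and> S \<subseteq> T \<longrightarrow> T = S)"

definition borel_subalgebra :: "'a set \<Rightarrow> bool" where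
  "borel_subalgebra S \<longleftrightarrow> subalgebra S \<and> solvable S \<and>
     (\<forall>T. subalgebra T \<and> solvable T \<and> S \<subseteq> T \<longrightarrow> T = S)"

definition root_space :: "'a set \<Rightarrow> ('a \<Rightarrow> complex) \<Rightarrow> 'a set" where
  "root_space h \<beta> = {x. \<forall>y\<in>h. lie y x = scale (\<beta> y) x}"

text \<open>
  Roots are functionals on \<open>h\<close>, represented as functions that are zero off \<open>h\<close>. They need
  not be required to be linear on \<open>h\<close>, since \<open>\<beta>\<close> is linear as soon as
  \<open>root_space h \<beta> \<noteq> {0}\<close>.
\<close>

definition roots :: "'a set \<Rightarrow> ('a \<Rightarrow> complex) set" where
  "roots h = {\<beta>. (\<forall>y. y \<notin> h \<longrightarrow> \<beta> y = 0) \<and> (\<exists>y\<in>h. \<beta> y \<noteq> 0) \<and> root_space h \<beta> \<noteq> {0}}"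

definition positive_roots :: "'a set \<Rightarrow> 'a set \<Rightarrow> ('a \<Rightarrow> complex) set" where
  "positive_roots h b = {\<beta> \<in> roots h. root_space h \<beta> \<subseteq> b}"

definition simple_roots :: "'a set \<Rightarrow> 'a set \<Rightarrow> ('a \<Rightarrow> complex) set" where
  "simple_roots h b = {\<beta> \<in> positive_roots h b.
     \<not> (\<exists>\<gamma>\<in>positive_roots h b. \<exists>\<delta>\<in>positive_roots h b. \<beta> = (\<lambda>y. \<gamma> y + \<delta> y))}"

definition levi_subalgebra :: "'a set \<Rightarrow> 'a set \<Rightarrow> 'a set" where
  "levi_subalgebra h p =
     span (h \<union> (\<Union>\<beta>\<in>{\<beta> \<in> roots h. root_space h \<beta> \<subseteq> p \<and> root_space h (- \<beta>) \<subseteq> p}. root_space h \<beta>))"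

end


section \<open>The Lie algebras attached to a standard parabolic and a parameter\<close>

text \<open>
  \<open>h \<subseteq> b \<subseteq> p\<close> are the Lie algebras of \<open>H \<subseteq> B \<subseteq> P\<close>; \<open>\<alpha> 1, \<dots>, \<alpha> n\<close>
  are the simple roots, those with index greater than \<open>m\<close> being the simple roots of the Levi
  subalgebra. As the Schubert divisors of \<open>G/P\<close> correspond to the simple roots outside the Levi
  subalgebra, \<open>m\<close> is the dimension of \<open>H\<^sup>2(G/P)\<close>.
\<close>

locale standard_parabolic = complex_lie_algebra scale lie
  for scale :: "complex \<Rightarrow> 'a::ab_group_add \<Rightarrow> 'a" and lie :: "'a \<Rightarrow> 'a \<Rightarrow> 'a" +
  fixes h b p :: "'a set" and m n :: nat and \<alpha> :: "nat \<Rightarrow> 'a \<Rightarrow> complex"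
  assumes semisimple: semisimple
    and cartan: "cartan_subalgebra h"
    and borel: "borel_subalgebra b" "h \<subseteq> b"
    and parabolic: "subalgebra p" "b \<subseteq> p"
    and simple: "bij_betw \<alpha> {1..n} (simple_roots h b)"
    and m_le_n: "m \<le> n"
    and levi: "levi_subalgebra h p =
      subalgebra hull (h \<union> (\<Union>i\<in>{m+1..n}. root_space h (\<alpha> i) \<union> root_space h (- \<alpha> i)))"
begin

definition K :: "(nat \<Rightarrow> complex) \<Rightarrow> nat set" where
  "K t = {m+1..n} \<union> {q. 1 \<le> q \<and> q \<le> m \<and> t q \<noteq> 0}"

definition l_K :: "(nat \<Rightarrow> complex) \<Rightarrow> 'a set" where
  "l_K t = subalgebra hull (h \<union> (\<Union>i\<in>K t. root_space h (\<alpha> i) \<union> root_space h (- \<alpha> i)))"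

definition u_K_plus :: "(nat \<Rightarrow> complex) \<Rightarrow> 'a set" where
  "u_K_plus t = span (\<Union>\<beta>\<in>{\<beta> \<in> positive_roots h b. \<not> root_space h \<beta> \<subseteq> l_K t}. root_space h \<beta>)"

definition u_K_minus :: "(nat \<Rightarrow> complex) \<Rightarrow> 'a set" where
  "u_K_minus t = span (\<Union>\<beta>\<in>{\<beta> \<in> positive_roots h b. \<not> root_space h (- \<beta>) \<subseteq> l_K t}. root_space h (- \<beta>))"

definition diagonal :: "'a set \<Rightarrow> ('a \<times> 'a) set" where
  "diagonal V = (\<lambda>x. (x, x)) ` V"

definition tilde_u_K :: "(nat \<Rightarrow> complex) \<Rightarrow> ('a \<times> 'a) set" where
  "tilde_u_K t = (u_K_minus t \<times> {0}) + ({0} \<times> u_K_plus t)"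

definition l_diagonal :: "('a \<times> 'a) set" where
  "l_diagonal = diagonal (levi_subalgebra h p)"

definition g_K :: "(nat \<Rightarrow> complex) \<Rightarrow> ('a \<times> 'a) lie_algebra" where
  "g_K t = \<lparr>carrier = diagonal (l_K t) + tilde_u_K t, monoid.mult = undefined, one = undefined,
     zero = 0, add = (+), smult = module_prod.scale scale scale,
     bracket = (\<lambda>x y. (lie (fst x) (fst y), lie (snd x) (snd y)))\<rparr>"

end

end

theory Submission
  imports
    Defs
    "HOL-Library.Function_Algebras"
    "HOL-Library.Multiset"
    "HOL-Computational_Algebra.Fundamental_Theorem_Algebra"
begin

text \<open>
  The algebra \<open>g_K\<close> is the semidirect product of \<open>L\<close>, the diagonal copy of \<open>l_K\<close>, and the ideal
  \<open>I\<close>, which is \<open>tilde_u_K\<close>. As \<open>l_K\<close> is reductive and acts on the cochains of \<open>I\<close> with real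
  weights, averaging with its Casimir operator yields \<open>L\<close>-equivariant linear maps \<open>sigma\<close> that lower the
  degree of cochains of \<open>I\<close> by one and satisfy \<open>d sigma d = d\<close>. Hence \<open>z \<mapsto> z - d (sigma z)\<close> chooses
  equivariantly a cocycle in each class of \<open>H\<^sup>q(I)\<close>. In a semidirect product the differential raises the
  filtration degree by at most one, so extending these representatives by zero turns a cocycle of the
  \<open>E\<^sub>2\<close>-complex into a cocycle of the whole complex. Every class on the second page is therefore
  represented by a genuine cocycle, and all later differentials vanish.
\<close>

section \<open>Linear algebra over the complex numbers\<close>

text \<open>Complete reducibility is wanted for \<open>l_K\<close>, which is only reductive, so the
  centre has to be controlled as well. Here \<open>h\<close> acts diagonally with weights that are
  real on the elements dual to the roots, and this lets a single operator decide everything. The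
  Casimir operator is formed with the Killing form of the whole algebra restricted to
  \<open>l_K\<close>, hence it also sees the centre. On a vector of highest weight \<open>mu\<close>
  it acts by the length of \<open>mu\<close> plus the inner products of \<open>mu\<close> with the
  positive roots; these terms are nonnegative and vanish together only for \<open>mu = 0\<close>. So
  each module is the direct sum of its invariants and of the Casimir image. Applied to Hom spaces,
  this corrects any generalized inverse of the differential to an equivariant one. Equivariance
  under all of \<open>l_K\<close>, not just under \<open>l\<close>, is essential: the differential
  along \<open>l_K\<close> of a leading term is made from the action of \<open>l_K\<close>, and the
  choice of representatives has to commute with it. The root theory is derived from the absence of
  solvable ideals and from the maximality of \<open>h\<close> and \<open>b\<close>.\<close>

locale complex_space = vector_space scale for scale :: "complex => 'b::ab_group_add => 'b"
begin

sublocale endo: vector_space_pair scale scale by unfold_locales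

abbreviation lin :: "('b => 'b) => bool" where
  "lin \<equiv> Vector_Spaces.linear scale scale"

lemmas lin_add = endo.linear_add
  and lin_scale = endo.linear_scale
  and lin_0 = endo.linear_0
  and lin_diff = endo.linear_diff
  and lin_neg = endo.linear_neg
  and lin_sum = endo.linear_sum

lemma linI:
  assumes "!!x y. T (x + y) = T x + T y" "!!c x. T (scale c x) = scale c (T x)"
  shows "lin T" using assms vector_space_axioms by (simp add: Vector_Spaces.linear_iff)

lemma lin_comp: "lin S ==> lin T ==> lin (%x. S (T x))" by (intro linI) (simp_all add: lin_add lin_scale)

lemma lin_plus: "lin S ==> lin T ==> lin (%x. S x + T x)"
  by (intro linI) (simp_all add: lin_add lin_scale algebra_simps)

lemma lin_minus: "lin S ==> lin T ==> lin (%x. S x - T x)"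
  by (intro linI) (simp_all add: lin_add lin_scale algebra_simps)

lemma lin_scale_const: "lin (%x. scale c x)" by (intro linI) (simp_all add: algebra_simps)

lemma lin_shift: "lin T ==> lin (%x. T x - scale c x)" by (intro lin_minus lin_scale_const)

lemma lin_funpow: "lin T ==> lin (T ^^ k)" by (induction k) (auto intro!: linI simp: lin_add lin_scale)

lemma lin_eq_on_span:
  assumes "lin S" "lin T" "x : span B" "!!b. b : B ==> S b = T b"
  shows "S x = T x" using endo.linear_eq_on[OF assms] .

lemma funpow_0_mono:
  assumes "lin T" "(T ^^ k) x = 0" "k <= l"
  shows "(T ^^ l) x = 0"
proof -
  have "(T ^^ l) x = (T ^^ (l - k)) ((T ^^ k) x)" using assms(3) by (metis comp_apply funpow_add le_add_diff_inverse2)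
  then show ?thesis using assms lin_0[OF lin_funpow[OF assms(1)]] by simp
qed

lemma funpow_closed: "(!!x. x : V ==> T x : V) ==> x : V ==> (T ^^ k) x : V" by (induction k) auto

lemma basis_in_spanning:
  assumes "V <= span F" "finite F"
  obtains B where "B <= V" "independent B" "V <= span B" "finite B" "card B = dim V"
  using basis_exists[of V] independent_span_bound[OF assms(2)] assms(1) by (metis subset_trans)

text \<open>Finiteness enters only through \<open>V <= span F\<close>, because cochains live in the
  infinite-dimensional space of all functions on lists. The image of a basis of \<open>V\<close> is
  independent with \<open>dim V\<close> elements, hence a basis of \<open>V\<close> again.\<close>

lemma inj_imp_surj_on_subspace:
  assumes T: "lin T" and V: "subspace V" "V <= span F" "finite F"
    and TV: "!!v. v : V ==> T v : V" and inj: "!!v. v : V ==> T v = 0 ==> v = 0"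
  shows "T ` V = V"
proof
  show "T ` V <= V" using TV by auto
  obtain B where B: "B <= V" "independent B" "V <= span B" "finite B" "card B = dim V"
    using basis_in_spanning[OF V(2,3)] by blast
  have sB: "span B = V" using B V(1) by (metis span_minimal subset_antisym)
  have io: "inj_on T (span B)" unfolding sB by (rule inj_onI) (metis T V(1) eq_iff_diff_eq_0 inj lin_diff subspace_diff)
  have ind: "independent (T ` B)" using endo.linear_independent_injective_image[OF T B(2) io] .
  have TB: "T ` B <= V" using B(1) TV by auto
  obtain C where C: "T ` B <= C" "C <= V" "independent C" "V <= span C"
    using maximal_independent_subset_extend[OF TB ind] by metis
  have "card C = dim V" using basis_card_eq_dim C by simp
  moreover have "card (T ` B) = card B" using io span_superset by (metis card_image inj_on_subset)
  moreover have "finite C" using independent_span_bound[OF B(4) C(3)] C(2) B(3) by auto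
  ultimately have "C = T ` B" using C(1) B(5) by (metis card_subset_eq)
  then have "V <= span (T ` B)" using C by simp
  also have "... = T ` span B" using endo.linear_span_image[OF T] by simp
  finally show "V <= T ` V" using sB by simp
qed

text \<open>If \<open>T\<close> and its square have the same kernel on \<open>V\<close>, then
  \<open>T\<close> is injective on its own image, maps that image onto itself, and
  \<open>T v\<close> is also of the form \<open>T (T w)\<close>.\<close>

lemma ker_plus_image:
  assumes T: "lin T" and V: "subspace V" "V <= span F" "finite F"
    and TV: "!!v. v : V ==> T v : V" and ker: "!!v. v : V ==> T (T v) = 0 ==> T v = 0"
    and v: "v : V"
  obtains w where "w : V" "T (v - T w) = 0"
proof -
  have "T ` (T ` V) = T ` V"
  proof (rule inj_imp_surj_on_subspace[OF T _ _ V(3)])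
    show "subspace (T ` V)" using endo.linear_subspace_image[OF T V(1)] .
    show "T ` V <= span F" using TV V(2) by auto
  qed (use TV ker in auto)
  then have "T v : T ` (T ` V)" using v by simp
  then obtain w where "w : V" "T v = T (T w)" by blast
  then show ?thesis using that[of w] by (simp add: T lin_diff)
qed

text \<open>Choose \<open>i\<close> separating \<open>mu\<close> from \<open>mu0\<close> and apply
  \<open>opr i\<close> minus the scalar \<open>wt mu0 i\<close>: the component at \<open>mu0\<close>
  dies, and the one at \<open>mu\<close> is multiplied by a nonzero number. With
  \<open>V = {0}\<close> this is the independence of vectors of different weights.\<close>

lemma weight_components_mem:
  fixes opr :: "'i => 'b => 'b"
  assumes lin: "!!i. i : H ==> lin (opr i)" and V: "subspace V"
    and st: "!!i v. i : H ==> v : V ==> opr i v : V"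
    and "finite M" and sep: "!!mu nu. mu : M ==> nu : M ==> mu ~= nu ==> EX i:H. wt mu i ~= wt nu i"
    and wt: "!!mu i. mu : M ==> i : H ==> opr i (c mu) = scale (wt mu i) (c mu)"
    and "(\<Sum>mu\<in>M. c mu) : V"
  shows "ALL mu:M. c mu : V" using assms(4-)
proof (induction M arbitrary: c rule: finite_induct)
  case (insert mu0 M)
  have cM: "c mu : V" if mu: "mu : M" for mu
  proof -
    obtain i where i: "i : H" "wt mu i ~= wt mu0 i" using insert.prems(1)[of mu mu0] insert.hyps mu by auto
    have "opr i (\<Sum>mu\<in>insert mu0 M. c mu) - scale (wt mu0 i) (\<Sum>mu\<in>insert mu0 M. c mu) : V"
      using V st[OF i(1)] insert.prems by (simp add: subspace_diff subspace_scale)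
    also have "opr i (\<Sum>mu\<in>insert mu0 M. c mu) - scale (wt mu0 i) (\<Sum>mu\<in>insert mu0 M. c mu) =
      (\<Sum>mu\<in>M. scale (wt mu i - wt mu0 i) (c mu))" using insert.hyps insert.prems(2) i
      by (simp add: lin_add[OF lin] lin_sum[OF lin] scale_sum_right scale_left_diff_distrib
          sum_subtractf scale_right_distrib)
    finally have *: "(\<Sum>mu\<in>M. scale (wt mu i - wt mu0 i) (c mu)) : V" .
    have "ALL mu:M. scale (wt mu i - wt mu0 i) (c mu) : V" by (rule insert.IH[OF _ _ *])
        (use insert.prems lin in \<open>auto simp: lin_scale scale_left_commute mult.commute\<close>)
    then have "scale (1 / (wt mu i - wt mu0 i)) (scale (wt mu i - wt mu0 i) (c mu)) : V"
      using mu V subspace_scale by blast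
    then show ?thesis using i by simp
  qed
  then have "(\<Sum>mu\<in>M. c mu) : V" using V by (simp add: subspace_sum)
  moreover have "c mu0 + (\<Sum>mu\<in>M. c mu) : V" using insert by simp
  ultimately have "c mu0 : V" using V subspace_diff by (metis add_diff_cancel_right')
  with cM show ?case by auto
qed simp

lemma span_subspaces_sum:
  assumes "v : span (\<Union>mu\<in>M. W mu)" "!!mu. mu : M ==> subspace (W mu)"
  shows "EX M' c. finite M' & M' <= M & (ALL mu:M'. c mu : W mu) & v = (\<Sum>mu\<in>M'. c mu)" using assms(1)
proof (induction rule: span_induct_alt)
  case base
  show ?case by (rule exI[of _ "{}"]) auto
next
  case (step a x y)
  from step obtain M' c where M: "finite M'" "M' <= M" "ALL mu:M'. c mu : W mu" "y = (\<Sum>mu\<in>M'. c mu)" by auto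
  from step obtain mu where mu: "mu : M" "x : W mu" by auto
  define c' where "c' = c(mu := scale a x + (if mu : M' then c mu else 0))"
  have "scale a x + y = (\<Sum>nu\<in>insert mu M'. c' nu)"
  proof -
    have "(\<Sum>nu\<in>insert mu M'. c' nu) = c' mu + (\<Sum>nu\<in>M' - {mu}. c' nu)" using M(1) by (simp add: sum.insert_remove)
    also have "(\<Sum>nu\<in>M' - {mu}. c' nu) = (\<Sum>nu\<in>M' - {mu}. c nu)" by (rule sum.cong) (auto simp: c'_def)
    finally show ?thesis using M by (simp add: c'_def sum.remove[of M' mu] add.assoc)
  qed
  moreover have "ALL nu:insert mu M'. c' nu : W nu"
    using M mu assms(2) by (auto simp: c'_def subspace_add subspace_scale)
  ultimately show ?case using M mu by (intro exI[of _ "insert mu M'"] exI[of _ c']) auto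
qed

text \<open>The weight components of a vector of \<open>V\<close> never leave \<open>V\<close>, so a
  decomposition of a larger space restricts to \<open>V\<close>.\<close>

lemma stable_subspace_weights:
  fixes opr :: "'i => 'b => 'b" and wt :: "'w => 'i => complex"
  assumes lin: "!!i. i : H ==> lin (opr i)" and V: "subspace V"
    and st: "!!i v. i : H ==> v : V ==> opr i v : V"
    and sep: "!!mu nu. mu : M ==> nu : M ==> mu ~= nu ==> EX i:H. wt mu i ~= wt nu i"
    and VM: "V <= span (\<Union>mu\<in>M. {v. ALL i:H. opr i v = scale (wt mu i) v})"
  shows "V <= span (\<Union>mu\<in>M. {v : V. ALL i:H. opr i v = scale (wt mu i) v})"
proof
  fix v assume v: "v : V"
  define W where "W mu = {v. ALL i:H. opr i v = scale (wt mu i) v}" for mu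
  have sub: "subspace (W mu)" for mu unfolding W_def by (rule subspaceI)
      (use lin in \<open>auto simp: lin_0 lin_add lin_scale scale_right_distrib scale_left_commute\<close>)
  obtain M' c where M: "finite M'" "M' <= M" "ALL mu:M'. c mu : W mu" "v = (\<Sum>mu\<in>M'. c mu)"
    using span_subspaces_sum[of v W M] v VM sub unfolding W_def by blast
  have "ALL mu:M'. c mu : V"
  proof (rule weight_components_mem[OF lin V st, where wt = wt])
    show "(\<Sum>mu\<in>M'. c mu) : V" using M v by simp
    show "EX i:H. wt mu i ~= wt nu i" if "mu : M'" "nu : M'" "mu ~= nu" for mu nu using that M(2) sep[of mu nu] by blast
  qed (use M in \<open>auto simp: W_def\<close>)
  then show "v : span (\<Union>mu\<in>M. {v : V. ALL i:H. opr i v = scale (wt mu i) v})"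
    unfolding M(4) using M by (intro span_sum span_base) (auto simp: W_def)
qed

text \<open>A joint eigenspace of the operators treated so far is stable under the next commuting
  one, hence splits into eigenspaces of it.\<close>

lemma common_eigenvectors_span:
  assumes "finite Y" "!!T. T : Y ==> lin T"
    "!!S T x. S : Y ==> T : Y ==> S (T x) = T (S x)"
    "!!T. T : Y ==> span {v. EX c. T v = scale c v} = UNIV"
  shows "span {v. ALL T:Y. EX c. T v = scale c v} = UNIV" using assms
proof (induction Y rule: finite_induct)
  case (insert T Y)
  have "v : span {v. ALL T:insert T Y. EX c. T v = scale c v}" if v: "ALL T:Y. EX c. T v = scale c v" for v
  proof -
    obtain c where c: "!!T. T : Y ==> T v = scale (c T) v" using v by metis
    define V where "V = {u. ALL T:Y. T u = scale (c T) u}"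
    have U: "span (\<Union>c. {u. T u = scale c u}) = UNIV"
    proof -
      have "(\<Union>c. {u. T u = scale c u}) = {v. EX c. T v = scale c v}" by auto
      then show ?thesis using insert.prems(3)[of T] by simp
    qed
    have "V <= span (\<Union>c\<in>UNIV. {v : V. ALL i:{()}. T v = scale (c::complex) v})"
    proof (rule stable_subspace_weights[where opr = "%_. T" and wt = "%c _. c"])
      show "subspace V" unfolding V_def by (rule subspaceI)
          (use insert.prems(1) in \<open>auto simp: lin_0 lin_add lin_scale scale_right_distrib scale_left_commute\<close>)
      show "T u : V" if "u : V" for u
        using that unfolding V_def by (auto simp: insert.prems(2)[of _ T] lin_scale[OF insert.prems(1)])
    qed (use insert.prems U in auto)
    moreover have "v : V" using c by (simp add: V_def)
    moreover have "(\<Union>c\<in>UNIV. {v : V. ALL i:{()}. T v = scale (c::complex) v}) <=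
      {v. ALL T:insert T Y. EX c. T v = scale c v}" by (auto simp: V_def)
    ultimately show ?thesis using span_mono by blast
  qed
  then have "{v. ALL T:Y. EX c. T v = scale c v} <= span {v. ALL T:insert T Y. EX c. T v = scale c v}" by blast
  then have "span {v. ALL T:Y. EX c. T v = scale c v} <= span {v. ALL T:insert T Y. EX c. T v = scale c v}"
    by (rule span_minimal) simp
  moreover have "span {v. ALL T:Y. EX c. T v = scale c v} = UNIV" using insert.prems by (intro insert.IH) auto
  ultimately show ?case by auto
qed simp

end

section \<open>Generalized eigenspaces and functional calculus\<close>

context complex_space
begin

definition gen_eig :: "('b => 'b) => complex => 'b set" where
  "gen_eig T mu = {v. EX k. ((%x. T x - scale mu x) ^^ k) v = 0}"

lemma gen_eig_0I: "(T ^^ k) v = 0 ==> v : gen_eig T 0" by (auto simp: gen_eig_def)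

lemma gen_eig_0D: "v : gen_eig T 0 ==> EX k. (T ^^ k) v = 0" by (auto simp: gen_eig_def)

lemma subspace_gen_eig:
  assumes "lin T"
  shows "subspace (gen_eig T mu)"
proof (rule subspaceI)
  note l = lin_shift[OF assms, of mu]
  note lk = lin_funpow[OF l]
  show "0 : gen_eig T mu" by (auto simp: gen_eig_def intro!: exI[of _ 0])
  show "x + y : gen_eig T mu" if xy: "x : gen_eig T mu" "y : gen_eig T mu" for x y
  proof -
    obtain k l' where k: "((%x. T x - scale mu x) ^^ k) x = 0" "((%x. T x - scale mu x) ^^ l') y = 0"
      using xy by (auto simp: gen_eig_def)
    then have "((%x. T x - scale mu x) ^^ max k l') (x + y) = 0"
      using funpow_0_mono[OF l k(1), of "max k l'"] funpow_0_mono[OF l k(2), of "max k l'"]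
      by (simp add: lin_add[OF lk])
    then show ?thesis unfolding gen_eig_def by blast
  qed
  show "scale c x : gen_eig T mu" if "x : gen_eig T mu" for c x
    using that by (auto simp: gen_eig_def lin_scale[OF lk])
qed

lemma funpow_commute:
  assumes "!!x. S (T x) = T (S x)"
  shows "S ((T ^^ k) x) = (T ^^ k) (S x)" using assms by (induction k) auto

lemma gen_eig_commute:
  assumes "lin S" "!!x. S (T x) = T (S x)" "v : gen_eig T mu"
  shows "S v : gen_eig T mu"
proof -
  obtain k where k: "((%x. T x - scale mu x) ^^ k) v = 0" using assms(3) by (auto simp: gen_eig_def)
  have "S (((%x. T x - scale mu x) ^^ k) v) = ((%x. T x - scale mu x) ^^ k) (S v)"
    by (rule funpow_commute) (simp add: assms lin_diff lin_scale)
  then show ?thesis using k lin_0[OF assms(1)] by (auto simp: gen_eig_def)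
qed

text \<open>On the generalized eigenspace of \<open>mu\<close>, \<open>T - nu\<close> is the nonzero
  scalar \<open>mu - nu\<close> plus the nilpotent \<open>T - mu\<close>. The solution for
  \<open>u\<close> is built from the one for \<open>(T - mu) u\<close>, which takes one power less
  to vanish.\<close>

lemma shift_solve:
  assumes T: "lin T" and W: "subspace W" "!!w. w : W ==> T w : W" and ne: "mu ~= nu"
    and "u : W" "((%x. T x - scale mu x) ^^ k) u = 0"
  shows "EX v:W. ((%x. T x - scale mu x) ^^ k) v = 0 & T v - scale nu v = u" using assms(5,6)
proof (induction k arbitrary: u)
  case 0
  then show ?case using W T by (intro bexI[of _ 0]) (auto simp: lin_0 subspace_0)
next
  case (Suc k)
  let ?f = "%x. T x - scale mu x"
  note lk = lin_funpow[OF lin_shift[OF T]]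
  have "?f u : W" using Suc.prems W by (simp add: subspace_diff subspace_scale)
  moreover have "(?f ^^ k) (?f u) = 0" using Suc.prems(2) by (simp add: funpow_Suc_right del: funpow.simps)
  ultimately obtain v' where v': "v' : W" "(?f ^^ k) v' = 0" "T v' - scale nu v' = ?f u" using Suc.IH by blast
  define v where "v = scale (1 / (mu - nu)) (u - v')"
  have "v : W" using v' Suc.prems W by (simp add: v_def subspace_diff subspace_scale)
  moreover have "(?f ^^ Suc k) v = 0" unfolding v_def lin_scale[OF lk] lin_diff[OF lk]
    using Suc.prems(2) funpow_0_mono[OF lin_shift[OF T] v'(2), of "Suc k"] by (simp del: funpow.simps)
  moreover have "T v - scale nu v = u"
  proof -
    have "T v - scale nu v = scale (1 / (mu - nu)) ((T u - scale nu u) - (T v' - scale nu v'))"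
      unfolding v_def lin_scale[OF T] lin_diff[OF T] by (simp add: algebra_simps)
    also have "(T u - scale nu u) - (T v' - scale nu v') = scale (mu - nu) u"
      unfolding v'(3) by (simp add: algebra_simps)
    finally show ?thesis using ne by simp
  qed
  ultimately show ?case by blast
qed

text \<open>A root \<open>z\<close> gives \<open>p = (X - z) q\<close>, and \<open>q\<close>
  annihilates \<open>T w - z w\<close>. The factors are kept as a list with repetitions, so
  multiplicities never have to be counted.\<close>

lemma poly_annihilator_imp_factors:
  assumes T: "lin T"
  shows "p ~= 0 ==> (\<Sum>i\<le>degree p. scale (coeff p i) ((T ^^ i) w)) = 0 ==>
    EX ls. fold (%l w. T w - scale l w) ls w = 0"
proof (induction "degree p" arbitrary: p w)
  case 0
  then have "coeff p 0 ~= 0" by (metis leading_coeff_0_iff)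
  then have "w = 0" using 0 by simp
  then show ?case by (intro exI[of _ "[]"]) simp
next
  case (Suc d)
  have "~ constant (poly p)" using Suc.hyps(2) constant_degree[of p] by simp
  then obtain z where "poly p z = 0" using fundamental_theorem_of_algebra by blast
  then obtain q where q: "p = [:- z, 1:] * q" unfolding poly_eq_0_iff_dvd by auto
  have q0: "q ~= 0" using q Suc.prems by auto
  have dp: "degree p = Suc (degree q)" unfolding q by (subst degree_mult_eq) (use q0 in simp_all)
  have c: "coeff p i = (if i = 0 then 0 else coeff q (i - 1)) - z * coeff q i" for i
    unfolding q by (cases i) (auto simp: coeff_pCons)
  have "(\<Sum>i\<le>degree q. scale (coeff q i) ((T ^^ i) (T w - scale z w))) =
    (\<Sum>i\<le>degree q. scale (coeff q i) ((T ^^ Suc i) w)) - (\<Sum>i\<le>degree q. scale (z * coeff q i) ((T ^^ i) w))"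
    by (simp add: sum_subtractf[symmetric] lin_diff[OF lin_funpow[OF T]] lin_scale[OF lin_funpow[OF T]]
        scale_right_diff_distrib funpow_Suc_right mult.commute del: funpow.simps)
  also have "(\<Sum>i\<le>degree q. scale (coeff q i) ((T ^^ Suc i) w)) =
    (\<Sum>i\<le>degree p. scale (if i = 0 then 0 else coeff q (i - 1)) ((T ^^ i) w))"
    unfolding dp by (subst sum.atMost_Suc_shift) (simp del: funpow.simps sum.atMost_Suc)
  also have "(\<Sum>i\<le>degree q. scale (z * coeff q i) ((T ^^ i) w)) =
    (\<Sum>i\<le>degree p. scale (z * coeff q i) ((T ^^ i) w))" unfolding dp by (simp add: coeff_eq_0)
  also have "(\<Sum>i\<le>degree p. scale (if i = 0 then 0 else coeff q (i - 1)) ((T ^^ i) w)) - ... =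
    (\<Sum>i\<le>degree p. scale (coeff p i) ((T ^^ i) w))" by (simp add: c sum_subtractf[symmetric] scale_left_diff_distrib)
  finally have "(\<Sum>i\<le>degree q. scale (coeff q i) ((T ^^ i) (T w - scale z w))) = 0" using Suc.prems by simp
  then obtain ls where "fold (%l w. T w - scale l w) ls (T w - scale z w) = 0"
    using Suc.hyps(1)[of q "T w - scale z w"] Suc.hyps(2) dp q0 by auto
  then show ?case by (intro exI[of _ "z # ls"]) simp
qed

lemma annihilating_factors:
  assumes T: "lin T" and F: "finite F" and W: "!!i. (T ^^ i) w : span F"
  shows "EX ls. fold (%l w. T w - scale l w) ls w = 0"
proof -
  define d where "d = card F"
  have "EX c. (EX i<=d. c i ~= 0) & (\<Sum>i\<le>d. scale (c i) ((T ^^ i) w)) = 0"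
  \<comment> \<open>Linear dependence is a property of sets, so a repetition among the powers, which
    is already a relation, is treated apart.\<close>
  proof (cases "inj_on (%i. (T ^^ i) w) {..d}")
    case False
    then obtain i j where ij: "i <= d" "j <= d" "i ~= j" "(T ^^ i) w = (T ^^ j) w" by (auto simp: inj_on_def)
    define c :: "nat => complex" where "c l = (if l = i then 1 else 0) - (if l = j then 1 else 0)" for l
    have "(\<Sum>l\<le>d. scale (c l) ((T ^^ l) w)) = 0"
      using ij by (simp add: c_def scale_left_diff_distrib sum_subtractf if_distrib[of "%a. scale a _"] cong: if_cong)
    moreover have "c i ~= 0" using ij by (simp add: c_def)
    ultimately show ?thesis using ij by blast
  next
    case True
    let ?S = "(%i. (T ^^ i) w) ` {..d}"
    have "card ?S = Suc d" using True by (simp add: card_image)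
    then have "dependent ?S" using independent_span_bound[OF F, of ?S] W by (auto simp: d_def)
    then obtain u where u: "EX v:?S. u v ~= 0" "(\<Sum>v\<in>?S. scale (u v) v) = 0" by (auto simp: dependent_finite)
    have "(\<Sum>i\<le>d. scale (u ((T ^^ i) w)) ((T ^^ i) w)) = 0" using u(2) by (simp add: sum.reindex[OF True])
    then show ?thesis using u(1) by (intro exI[of _ "%i. u ((T ^^ i) w)"]) auto
  qed
  then obtain c i where c: "i <= d" "c i ~= 0" "(\<Sum>i\<le>d. scale (c i) ((T ^^ i) w)) = 0" by blast
  define p where "p = (\<Sum>i\<le>d. monom (c i) i)"
  have cp: "coeff p j = (if j <= d then c j else 0)" for j by (simp add: p_def coeff_sum)
  have "p ~= 0" using c cp by (metis coeff_0)
  moreover have "degree p <= d" by (rule degree_le) (simp add: cp)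
  then have "(\<Sum>i\<le>degree p. scale (coeff p i) ((T ^^ i) w)) = (\<Sum>i\<le>d. scale (coeff p i) ((T ^^ i) w))"
    by (intro sum.mono_neutral_left) (auto simp: coeff_eq_0)
  then have "(\<Sum>i\<le>degree p. scale (coeff p i) ((T ^^ i) w)) = 0" using c(3) by (simp add: cp)
  ultimately show ?thesis using poly_annihilator_imp_factors[OF T] by blast
qed

text \<open>Split \<open>(T - l) w\<close> by induction and solve \<open>(T - l) v = c mu\<close>
  for each \<open>mu\<close> other than \<open>l\<close>. The remainder of \<open>w\<close> is sent
  by \<open>T - l\<close> into the generalized eigenspace of \<open>l\<close>, so it lies there
  itself.\<close>

lemma gen_eigs_span_aux:
  assumes T: "lin T" and W: "subspace W" "!!w. w : W ==> T w : W"
  shows "w : W ==> fold (%l w. T w - scale l w) ls w = 0 ==> w : span (\<Union>mu. W \<inter> gen_eig T mu)"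
proof (induction ls arbitrary: w)
  case Nil
  then show ?case by (simp add: span_zero)
next
  case (Cons l ls)
  let ?f = "%mu x. T x - scale mu x"
  have sub: "subspace (W \<inter> gen_eig T mu)" for mu using subspace_inter[OF W(1) subspace_gen_eig[OF T]] .
  have "?f l w : W" using W Cons.prems by (simp add: subspace_diff subspace_scale)
  then have "?f l w : span (\<Union>mu. W \<inter> gen_eig T mu)" using Cons by simp
  then obtain M c where M: "finite M" "ALL mu:M. c mu : W \<inter> gen_eig T mu" "?f l w = (\<Sum>mu\<in>M. c mu)"
    using span_subspaces_sum[of "?f l w" "%mu. W \<inter> gen_eig T mu" UNIV] sub by auto
  have "EX v. v : W \<inter> gen_eig T mu & (mu ~= l --> ?f l v = c mu)" if mu: "mu : M" for mu
  proof (cases "mu = l")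
    case False
    obtain k where k: "(?f mu ^^ k) (c mu) = 0" "c mu : W" using M(2) mu by (auto simp: gen_eig_def)
    obtain v where "v : W" "(?f mu ^^ k) v = 0" "?f l v = c mu" using shift_solve[OF T W False k(2) k(1)] by blast
    then show ?thesis by (auto simp: gen_eig_def)
  qed (use sub subspace_0 in blast)
  then obtain v where v: "!!mu. mu : M ==> v mu : W \<inter> gen_eig T mu"
    "!!mu. mu : M ==> mu ~= l ==> ?f l (v mu) = c mu" by metis
  define u where "u = w - (\<Sum>mu\<in>M - {l}. v mu)"
  have uW: "u : W" unfolding u_def using v Cons.prems W by (intro subspace_diff subspace_sum) auto
  have "?f l u = ?f l w - (\<Sum>mu\<in>M - {l}. ?f l (v mu))"
    unfolding u_def by (simp add: lin_diff[OF lin_shift[OF T]] lin_sum[OF lin_shift[OF T]])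
  also have "(\<Sum>mu\<in>M - {l}. ?f l (v mu)) = (\<Sum>mu\<in>M - {l}. c mu)" using v by (intro sum.cong) auto
  also have "?f l w - ... = (if l : M then c l else 0)" using M(1) by (simp add: M(3) sum_diff1)
  finally have "?f l u : gen_eig T l"
    using M(2) subspace_0[OF subspace_gen_eig[OF T]] by (auto split: if_splits)
  then obtain k where "(?f l ^^ k) (?f l u) = 0" unfolding gen_eig_def by blast
  then have "(?f l ^^ Suc k) u = 0" by (simp add: funpow_Suc_right del: funpow.simps)
  then have "u : W \<inter> gen_eig T l" using uW unfolding gen_eig_def by blast
  then have "u + (\<Sum>mu\<in>M - {l}. v mu) : span (\<Union>mu. W \<inter> gen_eig T mu)"
    using v by (intro span_add span_sum) (auto intro: span_base)
  then show ?case by (simp add: u_def)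
qed

lemma gen_eigs_span:
  assumes T: "lin T" and W: "subspace W" "!!w. w : W ==> T w : W" and F: "W <= span F" "finite F"
  shows "W <= span (\<Union>mu. W \<inter> gen_eig T mu)"
proof
  fix w assume w: "w : W"
  have "(T ^^ i) w : span F" for i using funpow_closed[of W T w i] W(2) w F(1) by blast
  then obtain ls where "fold (%l w. T w - scale l w) ls w = 0" using annihilating_factors[OF T F(2)] by blast
  then show "w : span (\<Union>mu. W \<inter> gen_eig T mu)" using gen_eigs_span_aux[OF T W] w by blast
qed

lemma gen_eig_inter:
  assumes T: "lin T" and "v : gen_eig T mu" "v : gen_eig T nu" "mu ~= nu"
  shows "v = 0"
proof -
  let ?f = "%mu x. T x - scale mu x"
  obtain l where l: "(?f nu ^^ l) v = 0" using assms by (auto simp: gen_eig_def)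
  obtain k where "(?f mu ^^ k) v = 0" using assms by (auto simp: gen_eig_def)
  then show ?thesis using l
  proof (induction k arbitrary: v)
    case (Suc k)
    have "(?f nu ^^ l) (?f mu v) = ?f mu ((?f nu ^^ l) v)"
      by (rule funpow_commute[symmetric]) (simp add: lin_diff[OF T] lin_scale[OF T] algebra_simps)
    also have "... = 0" using Suc.prems(2) by (simp add: lin_0[OF T])
    finally have "?f mu v = 0" using Suc.IH[of "?f mu v"] Suc.prems(1) by (simp add: funpow_Suc_right del: funpow.simps)
    then have *: "T v = scale mu v" by simp
    have "(?f nu ^^ j) v = scale ((mu - nu) ^ j) v" for j
    proof (induction j)
      case (Suc j)
      have "(?f nu ^^ Suc j) v = ?f nu (scale ((mu - nu) ^ j) v)" by (simp add: Suc)
      also have "... = scale ((mu - nu) ^ Suc j) v" unfolding lin_scale[OF T] * by (simp add: algebra_simps)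
      finally show ?case .
    qed simp
    then show ?case using Suc.prems(2) assms(4) by simp
  qed simp
qed

text \<open>The power of \<open>T - nu\<close> that kills \<open>c nu\<close> preserves the other
  generalized eigenspaces and is injective on them.\<close>

lemma gen_eigs_direct:
  assumes T: "lin T" and "finite M" "!!mu. mu : M ==> c mu : gen_eig T mu" "(\<Sum>mu\<in>M. c mu) = 0"
  shows "ALL mu:M. c mu = 0" using assms(2-)
proof (induction M arbitrary: c rule: finite_induct)
  case (insert nu M)
  let ?f = "%mu x. T x - scale mu x"
  obtain k where k: "(?f nu ^^ k) (c nu) = 0" using insert.prems(1)[of nu] by (auto simp: gen_eig_def)
  note lk = lin_funpow[OF lin_shift[OF T]]
  have "(?f nu ^^ k) (\<Sum>mu\<in>insert nu M. c mu) = 0" using insert.prems(2) by (simp add: lin_0[OF lk])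
  then have "(\<Sum>mu\<in>M. (?f nu ^^ k) (c mu)) = 0" using insert.hyps k by (simp add: lin_add[OF lk] lin_sum[OF lk])
  moreover have "(?f nu ^^ k) (c mu) : gen_eig T mu" if "mu : M" for mu by (rule gen_eig_commute[OF lk])
      (auto intro: funpow_commute[symmetric] simp: insert.prems that lin_diff[OF T] lin_scale[OF T])
  ultimately have *: "ALL mu:M. (?f nu ^^ k) (c mu) = 0" by (intro insert.IH) auto
  have M0: "c mu = 0" if "mu : M" for mu
  proof (rule gen_eig_inter[OF T])
    show "c mu : gen_eig T nu" using * that unfolding gen_eig_def by blast
    show "c mu : gen_eig T mu" using insert.prems that by simp
  qed (use insert.hyps that in auto)
  then have "c nu = 0" using insert by simp
  with M0 show ?case by simp
qed simp

lemma subset_spanning_basis: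
  assumes "span S = UNIV"
  obtains B where "B <= S" "independent B" "span B = UNIV"
  using assms maximal_independent_subset[of S] span_mono span_span by (metis top.extremum_uniqueI)

text \<open>With the identity for \<open>phi\<close> this is the semisimple part of
  \<open>T\<close>; with complex conjugation it is the operator behind Cartan's criterion. It is
  defined on a basis of generalized eigenvectors and then has to be checked on all of them.\<close>

lemma spectral_calculus:
  assumes T: "lin T" and F: "finite F" "span F = UNIV"
  shows "EX S. lin S & (ALL mu v. v : gen_eig T mu --> S v = scale (phi mu) v)"
proof -
  have "UNIV <= span (\<Union>mu. UNIV \<inter> gen_eig T mu)" using gen_eigs_span[OF T, of UNIV F] F by simp
  then have "span (\<Union>mu. gen_eig T mu) = UNIV" by auto
  then obtain B where B: "B <= (\<Union>mu. gen_eig T mu)" "independent B" "span B = UNIV"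
    by (rule subset_spanning_basis)
  then obtain e where e: "!!b. b : B ==> b : gen_eig T (e b)" by (metis UN_iff subsetD)
  define S where "S = endo.construct B (%b. scale (phi (e b)) b)"
  have S: "lin S" "!!b. b : B ==> S b = scale (phi (e b)) b"
    using B unfolding S_def by (auto intro: endo.linear_construct simp: endo.construct_basis)
  have "S v = scale (phi mu) v" if v: "v : gen_eig T mu" for mu v
  proof -
    have "v : span B" using B by simp
    then obtain t r where t: "finite t" "t <= B" "v = (\<Sum>b\<in>t. scale (r b) b)" unfolding span_explicit by blast
    define M where "M = insert mu (e ` t)"
    define c where "c nu = (\<Sum>b | b : t & e b = nu. scale (r b) b)" for nu
    have fM: "finite M" using t by (simp add: M_def)
    have et: "e ` t <= M" by (auto simp: M_def)
    have cv: "(\<Sum>nu\<in>M. c nu) = v" unfolding c_def t(3) using sum.group[OF t(1) fM et] by simp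
    \<comment> \<open>The vector \<open>v\<close> has two expansions, the grouped one and the one
      with the single term \<open>v\<close>; their difference vanishes termwise.\<close>
    have "ALL nu:M. c nu - (if nu = mu then v else 0) = 0"
    proof (rule gen_eigs_direct[OF T fM])
      show "(\<Sum>nu\<in>M. c nu - (if nu = mu then v else 0)) = 0" using fM cv by (simp add: sum_subtractf M_def)
      fix nu
      have "c nu : gen_eig T nu" unfolding c_def
        using e t by (intro subspace_sum subspace_scale subspace_gen_eig[OF T]) auto
      then show "c nu - (if nu = mu then v else 0) : gen_eig T nu"
        using v subspace_diff[OF subspace_gen_eig[OF T]] by auto
    qed
    then have c: "!!nu. nu : M ==> c nu = (if nu = mu then v else 0)" by auto
    have "S v = (\<Sum>b\<in>t. scale (r b) (scale (phi (e b)) b))"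
      unfolding t(3) using t(2) S by (simp add: lin_sum lin_scale subset_eq)
    also have "... = (\<Sum>nu\<in>M. \<Sum>b | b : t & e b = nu. scale (r b) (scale (phi (e b)) b))"
      by (rule sum.group[OF t(1) fM et, symmetric])
    also have "... = (\<Sum>nu\<in>M. scale (phi nu) (c nu))"
      unfolding c_def scale_sum_right by (intro sum.cong) (auto simp: mult.commute)
    also have "... = (\<Sum>nu\<in>M. if nu = mu then scale (phi mu) v else 0)" by (rule sum.cong) (auto simp: c)
    also have "... = scale (phi mu) v" using fM by (simp add: M_def)
    finally show ?thesis .
  qed
  with S show ?thesis by blast
qed

end

section \<open>The trace\<close>

locale findim_complex_space = complex_space scale for scale :: "complex => 'b::ab_group_add => 'b" +
  assumes finite_span: "EX F. finite F & span F = UNIV"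
begin

definition trace :: "('b => 'b) => complex" where
  "trace T = (\<Sum>b\<in>extend_basis {}. representation (extend_basis {}) (T b) b)"

lemma finite_independent: "independent B ==> finite B" using finite_span independent_span_bound by (metis subset_UNIV)

text \<open>Two bases at once: with \<open>S\<close> the identity this is independence of the basis,
  with equal bases it is the symmetry of the trace of a product.\<close>

lemma trace_commute_aux:
  assumes S: "lin S" and T: "lin T" and B: "independent B" "span B = UNIV"
    and C: "independent C" "span C = UNIV"
  shows "(\<Sum>b\<in>B. representation B (S (T b)) b) = (\<Sum>c\<in>C. representation C (T (S c)) c)"
proof -
  note fin = finite_independent[OF B(1)] finite_independent[OF C(1)]
  have 1: "representation B (S (T b)) b = (\<Sum>c\<in>C. representation C (T b) c * representation B (S c) b)" for b
  proof -
    have "S (T b) = S (\<Sum>c\<in>C. scale (representation C (T b) c) c)" using C fin by (simp add: sum_representation_eq)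
    also have "... = (\<Sum>c\<in>C. scale (representation C (T b) c) (S c))" by (simp add: lin_sum[OF S] lin_scale[OF S])
    finally show ?thesis using B by (simp add: representation_sum representation_scale)
  qed
  have 2: "representation C (T (S c)) c = (\<Sum>b\<in>B. representation B (S c) b * representation C (T b) c)" for c
  proof -
    have "T (S c) = T (\<Sum>b\<in>B. scale (representation B (S c) b) b)" using B fin by (simp add: sum_representation_eq)
    also have "... = (\<Sum>b\<in>B. scale (representation B (S c) b) (T b))" by (simp add: lin_sum[OF T] lin_scale[OF T])
    finally show ?thesis using C by (simp add: representation_sum representation_scale)
  qed
  show ?thesis unfolding 1 2 by (subst sum.swap) (simp add: mult.commute)
qed

lemma extend_basis_empty: "independent (extend_basis {})" "span (extend_basis {}) = UNIV"
  using independent_extend_basis span_extend_basis independent_empty by blast+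

lemma trace_basis:
  assumes "lin T" "independent B" "span B = UNIV"
  shows "trace T = (\<Sum>b\<in>B. representation B (T b) b)" unfolding trace_def
  using trace_commute_aux[OF linear_ident assms(1) extend_basis_empty assms(2,3)] by simp

lemma trace_commute: "lin S ==> lin T ==> trace (%x. S (T x)) = trace (%x. T (S x))"
  unfolding trace_def by (rule trace_commute_aux) (simp_all add: extend_basis_empty)

lemma trace_add: "trace (%x. S x + T x) = trace S + trace T"
  unfolding trace_def using extend_basis_empty by (simp add: representation_add sum.distrib)

lemma trace_scale: "trace (%x. scale c (T x)) = c * trace T"
  unfolding trace_def using extend_basis_empty by (simp add: representation_scale sum_distrib_left)

lemma trace_diff: "trace (%x. S x - T x) = trace S - trace T"
  unfolding trace_def using extend_basis_empty by (simp add: representation_diff sum_subtractf)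

lemma trace_eigenbasis:
  assumes "lin T" "independent B" "span B = UNIV" "!!b. b : B ==> T b = scale (c b) b"
  shows "trace T = (\<Sum>b\<in>B. c b)" unfolding trace_basis[OF assms(1-3)] using assms
  by (intro sum.cong) (simp_all add: representation_scale representation_basis span_base)

lemma nilpotent_uniform:
  assumes N: "lin N" "!!v. EX k. (N ^^ k) v = 0"
  shows "EX k. ALL v. (N ^^ k) v = 0"
proof -
  define B where "B = extend_basis {}"
  note B = extend_basis_empty[folded B_def]
  obtain k where k: "!!v. (N ^^ k v) v = 0" using N(2) by metis
  define K where "K = Max (k ` B)"
  have "(N ^^ K) b = 0" if "b : B" for b
    using funpow_0_mono[OF N(1) k[of b], of K] that finite_independent[OF B(1)] by (simp add: K_def)
  then have "(N ^^ K) v = 0" for v using lin_eq_on_span[OF lin_funpow[OF N(1)] endo.linear_zero, of v B] B(2) by auto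
  then show ?thesis by blast
qed

text \<open>In a basis adapted to the kernels of the powers of \<open>N\<close>, every new vector is
  mapped into the span of the earlier ones, so its diagonal entry is zero.\<close>

lemma trace_nilpotent:
  assumes N: "lin N" "!!v. EX k. (N ^^ k) v = 0"
  shows "trace N = 0"
proof -
  have flag: "EX B. B <= {v. (N ^^ k) v = 0} & independent B & {v. (N ^^ k) v = 0} <= span B &
      (\<Sum>b\<in>B. representation B (N b) b) = 0" for k
  proof (induction k)
    case 0
    show ?case by (rule exI[of _ "{}"]) (auto simp: independent_empty)
  next
    case (Suc k)
    then obtain B where B: "B <= {v. (N ^^ k) v = 0}" "independent B" "{v. (N ^^ k) v = 0} <= span B"
      "(\<Sum>b\<in>B. representation B (N b) b) = 0" by blast
    have "B <= {v. (N ^^ Suc k) v = 0}" using B(1) lin_0[OF N(1)] by auto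
    then obtain C where C: "B <= C" "C <= {v. (N ^^ Suc k) v = 0}" "independent C"
      "{v. (N ^^ Suc k) v = 0} <= span C" using maximal_independent_subset_extend[OF _ B(2)] by metis
    have NC: "N c : span B" if "c : C" for c
    proof -
      have "(N ^^ Suc k) c = 0" using that C(2) by blast
      then have "(N ^^ k) (N c) = 0" by (simp add: funpow_Suc_right del: funpow.simps)
      then show ?thesis using B(3) by blast
    qed
    have rep: "representation C (N c) = representation B (N c)" if "c : C" for c
      using NC[OF that] by (intro representation_extend[OF C(3) _ C(1)])
    have "(\<Sum>c\<in>C. representation C (N c) c) = (\<Sum>b\<in>B. representation B (N b) b)"
      using C(1) representation_ne_zero finite_independent[OF C(3)]
      by (intro sum.mono_neutral_cong_right) (auto simp: rep)
    then show ?case using C B(4) by (intro exI[of _ C]) simp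
  qed
  obtain k where "ALL v. (N ^^ k) v = 0" using nilpotent_uniform[OF N] by blast
  then have "{v. (N ^^ k) v = 0} = UNIV" by auto
  with flag[of k] show ?thesis using trace_basis[OF N(1)] by (metis top.extremum_uniqueI)
qed

end

section \<open>Engel's theorem and Cartan's criterion\<close>

sublocale complex_lie_algebra \<subseteq> complex_space scale by unfold_locales

context complex_lie_algebra
begin

lemma lie_antisym: "lie y x = - lie x y"
proof -
  have "lie (x + y) (x + y) = lie x y + lie y x" unfolding lie_add_left lie_add_right by (simp add: lie_self)
  then have "lie x y + lie y x = 0" by (metis lie_self)
  then show ?thesis by (simp add: eq_neg_iff_add_eq_0 add.commute)
qed

lemma lin_lie: "lin (lie x)" by (rule linI) (simp_all add: lie_add_right lie_scale_right)

lemma lin_lie_left: "lin (%x. lie x y)" by (rule linI) (simp_all add: lie_add_left lie_scale_left)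

lemmas lie_0_right [simp] = lin_0[OF lin_lie]
  and lie_0_left [simp] = lin_0[OF lin_lie_left]
  and lie_neg_right = lin_neg[OF lin_lie]
  and lie_neg_left = lin_neg[OF lin_lie_left]
  and lie_diff_right = lin_diff[OF lin_lie]
  and lie_diff_left = lin_diff[OF lin_lie_left]
  and lie_sum_right = lin_sum[OF lin_lie]
  and lie_sum_left = lin_sum[OF lin_lie_left]

lemma lie_lie_left: "lie (lie x y) z = lie x (lie y z) - lie y (lie x z)"
proof -
  have "lie x (lie y z) - lie y (lie x z) - lie (lie x y) z = 0"
    using jacobi[of x y z] lie_antisym[of "lie x y" z] lie_antisym[of x z] by (simp add: lie_neg_right)
  then show ?thesis by (simp add: algebra_simps)
qed

lemma lie_lie_right: "lie x (lie y z) = lie (lie x y) z + lie y (lie x z)" by (simp add: lie_lie_left)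

lemma subalg_subspace: "subalgebra S ==> subspace S"
  and subalg_lie: "subalgebra S ==> x : S ==> y : S ==> lie x y : S" by (auto simp: subalgebra_def)

lemma lie_span_closed:
  assumes "!!x y. x : A ==> y : B ==> lie x y : C" "subspace C" "x : span A" "y : span B"
  shows "lie x y : C"
proof -
  have 1: "lie x b : C" if "b : B" for b using assms(3)
  proof (induction rule: span_induct_alt)
    case (step c a z)
    then show ?case using assms(1)[of a b] that assms(2)
      by (simp add: lie_add_left lie_scale_left subspace_add subspace_scale)
  qed (use assms(2) subspace_0 in simp)
  show ?thesis using assms(4)
  proof (induction rule: span_induct_alt)
    case (step c b z)
    then show ?case using 1 assms(2) by (simp add: lie_add_right lie_scale_right subspace_add subspace_scale)
  qed (use assms(2) subspace_0 in simp)
qed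

lemma derived_series_subset:
  assumes "subalgebra S" shows "derived_series S i <= S & subalgebra (derived_series S i)"
proof (induction i)
  case (Suc i)
  let ?D = "derived_series S i"
  have sp: "span {lie x y | x y. x : ?D & y : ?D} <= ?D" using Suc by (intro span_minimal) (auto simp: subalgebra_def)
  have "subalgebra (span {lie x y | x y. x : ?D & y : ?D})"
    unfolding subalgebra_def using sp by (auto intro!: span_base)
  with sp Suc show ?case by auto
qed (use assms in simp)

lemma derived_series_shift: "derived_series (derived_series S (Suc 0)) i = derived_series S (Suc i)"
  by (induction i) simp_all

lemma solvable_derivedI: "solvable (derived_series S (Suc 0)) ==> solvable S"
  unfolding solvable_def derived_series_shift by blast

text \<open>By the Leibniz rule, \<open>D - (mu + nu)\<close> sends a bracket to the sum of the
  brackets with \<open>(D - mu) y\<close> and with \<open>(D - nu) z\<close>; each term lowers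
  \<open>a + b\<close>.\<close>

lemma bracket_gen_eig:
  assumes D: "lin D" "!!y z. D (lie y z) = lie (D y) z + lie y (D z)"
    and "y : gen_eig D mu" "z : gen_eig D nu"
  shows "lie y z : gen_eig D (mu + nu)"
proof -
  let ?f = "%mu x. D x - scale mu x"
  obtain a b where "(?f mu ^^ a) y = 0" "(?f nu ^^ b) z = 0" using assms(3,4) by (auto simp: gen_eig_def)
  then have "(?f (mu + nu) ^^ (a + b)) (lie y z) = 0"
  proof (induction "a + b" arbitrary: a b y z)
    case (Suc n)
    note lk = lin_funpow[OF lin_shift[OF D(1)]]
    have l: "?f (mu + nu) (lie y z) = lie (?f mu y) z + lie y (?f nu z)"
      by (simp add: D(2) lie_diff_left lie_diff_right lie_scale_left lie_scale_right algebra_simps)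
    have 1: "(?f (mu + nu) ^^ n) (lie (?f mu y) z) = 0"
    proof (cases a)
      case 0
      then have "y = 0" using Suc.prems by simp
      then show ?thesis by (simp add: lin_0[OF D(1)] lin_0[OF lk])
    next
      case (Suc a')
      with Suc.prems have "(?f mu ^^ a') (?f mu y) = 0" by (simp add: funpow_Suc_right del: funpow.simps)
      with Suc.hyps(1)[of a' b "?f mu y" z] Suc.prems Suc.hyps(2) Suc show ?thesis by simp
    qed
    have 2: "(?f (mu + nu) ^^ n) (lie y (?f nu z)) = 0"
    proof (cases b)
      case 0
      then have "z = 0" using Suc.prems by simp
      then show ?thesis by (simp add: lin_0[OF D(1)] lin_0[OF lk])
    next
      case (Suc b')
      with Suc.prems have "(?f nu ^^ b') (?f nu z) = 0" by (simp add: funpow_Suc_right del: funpow.simps)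
      with Suc.hyps(1)[of a b' y "?f nu z"] Suc.prems Suc.hyps(2) Suc show ?thesis by simp
    qed
    have "(?f (mu + nu) ^^ Suc n) (lie y z) = (?f (mu + nu) ^^ n) (?f (mu + nu) (lie y z))"
      by (simp add: funpow_Suc_right del: funpow.simps)
    also have "... = 0" unfolding l lin_add[OF lk] 1 2 by simp
    finally show ?case using Suc.hyps(2) by simp
  qed simp
  then show ?thesis unfolding gen_eig_def by blast
qed

text \<open>Additivity of \<open>phi\<close> matches the addition of eigenvalues under the bracket.
  Both the identity and complex conjugation are additive, and both are used.\<close>

lemma spectral_derivation:
  assumes D: "lin D" "!!y z. D (lie y z) = lie (D y) z + lie y (D z)"
    and sp: "span (\<Union>mu. gen_eig D mu) = UNIV"
    and S: "lin S" "!!mu v. v : gen_eig D mu ==> S v = scale (phi mu) v"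
    and phi: "!!mu nu. phi (mu + nu) = phi mu + phi nu"
  shows "S (lie y z) = lie (S y) z + lie y (S z)"
proof -
  have eq: "S (lie y z) = lie (S y) z + lie y (S z)"
    if "y : gen_eig D mu" "z : gen_eig D nu" for y z mu nu
    using S(2)[OF bracket_gen_eig[OF D that]] S(2)[OF that(1)] S(2)[OF that(2)]
    by (simp add: phi lie_scale_left lie_scale_right scale_left_distrib)
  have l: "lin (%z. S (lie y z))" "lin (%z. lie (S y) z + lie y (S z))"
    "lin (%y. S (lie y z))" "lin (%y. lie (S y) z + lie y (S z))" for y z
    using lin_comp[OF S(1) lin_lie[of y]] lin_plus[OF lin_lie[of "S y"] lin_comp[OF lin_lie[of y] S(1)]]
      lin_comp[OF S(1) lin_lie_left[of z]] lin_plus[OF lin_comp[OF lin_lie_left[of z] S(1)] lin_lie_left[of "S z"]]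
    by simp_all
  have eq2: "S (lie y z) = lie (S y) z + lie y (S z)" if "y : gen_eig D mu" for y z mu
    by (rule lin_eq_on_span[OF l(1,2), of _ "\<Union>mu. gen_eig D mu"]) (use eq that sp in auto)
  show ?thesis by (rule lin_eq_on_span[OF l(3,4), of _ "\<Union>mu. gen_eig D mu"]) (use eq2 sp in auto)
qed

end

section \<open>Nilpotency from traces, and functionals represented by forms\<close>

context findim_complex_space
begin

lemma finite_dimensional: "finite_dimensional_vector_space scale (extend_basis {})"
  using extend_basis_empty finite_independent by unfold_locales auto

lemma dim_strict_mono:
  assumes "subspace M" "subspace L" "M \<subset> L"
  shows "dim M < dim L" using finite_dimensional_vector_space.dim_psubset[OF finite_dimensional, of M L] assms
  by (simp add: span_eq_iff[THEN iffD2])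

lemma finite_spanning: obtains F where "finite F" "span F = UNIV" using finite_span by blast

lemma gen_eigs_span_UNIV: "lin T ==> span (\<Union>mu. gen_eig T mu) = UNIV"
  using finite_span gen_eigs_span[of T UNIV] by auto

text \<open>On the generalized eigenspace of \<open>mu\<close> the operator is \<open>phi mu\<close>
  times the nilpotent \<open>T - mu\<close>.\<close>

lemma nilpotent_part:
  assumes T: "lin T" and S: "lin S" "!!mu v. v : gen_eig T mu ==> S v = scale mu v"
    and R: "lin R" "!!mu v. v : gen_eig T mu ==> R v = scale (phi mu) v"
  shows "EX k. ((%x. R (T x - S x)) ^^ k) v = 0"
proof -
  let ?N = "%x. R (T x - S x)"
  have lN: "lin ?N" using R(1) lin_minus[OF T S(1)] by (rule lin_comp)
  have "gen_eig T mu <= gen_eig ?N 0" for mu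
  proof
    fix v assume v: "v : gen_eig T mu"
    let ?f = "%x. T x - scale mu x"
    have mem: "(?f ^^ k) v : gen_eig T mu" for k
      by (rule gen_eig_commute[OF lin_funpow[OF lin_shift[OF T]] _ v])
        (simp add: funpow_commute[of T] lin_diff[OF T] lin_scale[OF T])
    have "(?N ^^ k) v = scale (phi mu ^ k) ((?f ^^ k) v)" for k
    proof (induction k)
      case (Suc k)
      have "(?N ^^ Suc k) v = scale (phi mu ^ k) (?N ((?f ^^ k) v))" using Suc lin_scale[OF lN] by simp
      also have "?N ((?f ^^ k) v) = R ((?f ^^ Suc k) v)" using S(2)[OF mem] by simp
      also have "... = scale (phi mu) ((?f ^^ Suc k) v)" using R(2)[OF mem] .
      finally show ?case by (simp add: mult.commute)
    qed simp
    moreover obtain k where "(?f ^^ k) v = 0" using v by (auto simp: gen_eig_def)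
    ultimately have "(?N ^^ k) v = 0" by simp
    then show "v : gen_eig ?N 0" by (rule gen_eig_0I)
  qed
  then have "span (\<Union>mu. gen_eig T mu) <= gen_eig ?N 0"
    by (intro span_minimal subspace_gen_eig[OF lN]) auto
  then show ?thesis using gen_eigs_span_UNIV[OF T] gen_eig_0D by blast
qed

text \<open>The trace of \<open>R T\<close> is the sum of \<open>|mu|\<^sup>2\<close> over the eigenvalues \<open>mu\<close> of \<open>T\<close>.\<close>

lemma nilpotent_if_trace_cnj_zero:
  assumes T: "lin T" and R: "lin R" "!!mu v. v : gen_eig T mu ==> R v = scale (cnj mu) v"
    and tr: "trace (%x. R (T x)) = 0"
  shows "EX k. (T ^^ k) v = 0"
proof -
  obtain F where F: "finite F" "span F = UNIV" by (rule finite_spanning)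
  obtain S where S: "lin S" "!!mu v. v : gen_eig T mu ==> S v = scale mu v"
    using spectral_calculus[OF T F, of "%x. x"] by blast
  have lN: "lin (%x. R (T x - S x))" using R(1) lin_minus[OF T S(1)] by (rule lin_comp)
  obtain B where B: "B <= (\<Union>mu. gen_eig T mu)" "independent B" "span B = UNIV"
    using subset_spanning_basis[OF gen_eigs_span_UNIV[OF T]] by blast
  then obtain e where e: "!!b. b : B ==> b : gen_eig T (e b)" by (metis UN_iff subsetD)
  have "trace (%x. R (T x - S x) + R (S x)) = trace (%x. R (T x))" by (simp add: lin_add[OF R(1), symmetric])
  then have "trace (%x. R (T x - S x)) + trace (%x. R (S x)) = 0" by (simp add: trace_add tr)
  moreover have "trace (%x. R (T x - S x)) = 0" by (rule trace_nilpotent[OF lN nilpotent_part[OF T S R]])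
  moreover have "trace (%x. R (S x)) = (\<Sum>b\<in>B. cnj (e b) * e b)" using S(2)[OF e] R(2)[OF e]
    by (intro trace_eigenbasis[OF lin_comp[OF R(1) S(1)] B(2,3)]) (simp add: lin_scale[OF R(1)] mult.commute)
  ultimately have "(\<Sum>b\<in>B. cnj (e b) * e b) = 0" by simp
  moreover have "cnj (e b) * e b = complex_of_real ((cmod (e b))\<^sup>2)" for b by (metis complex_norm_square mult.commute)
  ultimately have "complex_of_real (\<Sum>b\<in>B. (cmod (e b))\<^sup>2) = 0" by simp
  then have "(\<Sum>b\<in>B. (cmod (e b))\<^sup>2) = 0" by (simp only: of_real_eq_0_iff)
  then have "e b = 0" if "b : B" for b
    using that sum_nonneg_eq_0_iff[OF finite_independent[OF B(2)], of "%b. (cmod (e b))\<^sup>2"] by simp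
  then have "B <= gen_eig T 0" using e by force
  then have "span B <= gen_eig T 0" by (rule span_minimal) (rule subspace_gen_eig[OF T])
  then show ?thesis using B(3) gen_eig_0D by blast
qed

text \<open>The map sending \<open>v\<close> to the vector with coordinates \<open>beta v b\<close>
  in a basis of \<open>V\<close> is injective, hence onto. The subspace is kept as a parameter
  because the Killing form is used both on the whole algebra and on \<open>h\<close>.\<close>

lemma nondegenerate_represents:
  assumes V: "subspace V"
    and beta: "!!x y w. beta (x + y) w = beta x w + beta y w" "!!c x w. beta (scale c x) w = c * beta x w"
      "!!x v w. beta x (v + w) = beta x v + beta x w" "!!c x w. beta x (scale c w) = c * beta x w"
    and nd: "!!v. v : V ==> (!!w. w : V ==> beta v w = 0) ==> v = 0"
    and phi: "!!v w. v : V ==> w : V ==> phi (v + w) = phi v + phi w" "!!c v. v : V ==> phi (scale c v) = c * phi v"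
  obtains v where "v : V" "!!w. w : V ==> beta v w = phi w"
proof -
  obtain F where F: "finite F" "span F = UNIV" by (rule finite_spanning)
  obtain B where B: "B <= V" "independent B" "V <= span B" using basis_exists[of V] by metis
  note fB = finite_independent[OF B(2)]
  have ext: "beta x w = psi w"
    if psi: "!!v w. v : V ==> w : V ==> psi (v + w) = psi v + psi w" "!!c v. v : V ==> psi (scale c v) = c * psi v"
    and eq: "!!b. b : B ==> beta x b = psi b" and w: "w : V" for psi x w
  proof -
    have "w : span B" using w B by auto
    then have "w : V & beta x w = psi w"
    proof (induction rule: span_induct_alt)
      case base
      show ?case using psi(2)[of 0 0] beta(4)[of x 0 0] V by (simp add: subspace_0)
    next
      case (step c b y)
      have "b : V" using step B by auto
      then show ?case using step V by (simp add: subspace_add subspace_scale beta psi eq)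
    qed
    then show ?thesis ..
  qed
  define Psi where "Psi v = (\<Sum>b\<in>B. scale (beta v b) b)" for v
  have l: "lin Psi" unfolding Psi_def by (rule linI) (simp_all add: beta scale_left_distrib sum.distrib scale_sum_right)
  have coeffs: "ALL b:B. c b = 0" if "(\<Sum>b\<in>B. scale (c b) b) = 0" for c
    using B(2) that fB by (auto simp: dependent_finite)
  have "Psi ` V = V"
  proof (rule inj_imp_surj_on_subspace[OF l V _ F(1)])
    show "V <= span F" using F by simp
    show "Psi v : V" if "v : V" for v unfolding Psi_def using B V by (intro subspace_sum subspace_scale) auto
    show "v = 0" if "v : V" "Psi v = 0" for v
    proof (rule nd[OF that(1)])
      fix w assume w: "w : V"
      show "beta v w = 0" using coeffs[OF that(2)[unfolded Psi_def]] w by (subst ext[of "%_. 0"]) auto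
    qed
  qed
  moreover have "(\<Sum>b\<in>B. scale (phi b) b) : V" using B V by (intro subspace_sum subspace_scale) auto
  ultimately obtain v where v: "v : V" "Psi v = (\<Sum>b\<in>B. scale (phi b) b)" by (metis imageE)
  have "(\<Sum>b\<in>B. scale (beta v b - phi b) b) = 0" using v(2) by (simp add: Psi_def scale_left_diff_distrib sum_subtractf)
  then have "ALL b:B. beta v b - phi b = 0" by (rule coeffs)
  then have "beta v w = phi w" if "w : V" for w using ext[OF phi _ that, of v] by simp
  with v(1) show ?thesis using that by blast
qed

end

section \<open>Engel's theorem\<close>

locale findim_lie_algebra = complex_lie_algebra scale lie + findim_complex_space scale
  for scale :: "complex => 'a::ab_group_add => 'a" and lie
begin

text \<open>Nilpotency of the action on \<open>W\<close> modulo \<open>U\<close>, with an exponent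
  that may depend on the element and on the vector.\<close>

definition nil_on :: "'a set => 'a set => 'a set => bool" where
  "nil_on L W U \<longleftrightarrow> (ALL x:L. ALL w:W. EX k. (lie x ^^ k) w : U)"

lemma nil_on_mono: "nil_on L W U ==> M <= L ==> W' <= W ==> U <= U' ==> nil_on M W' U'"
  unfolding nil_on_def by (meson subset_iff)

text \<open>Take a proper subalgebra of largest dimension. Adjoining an element that normalizes it
  gives a larger subalgebra, which must be everything.\<close>

lemma maximal_proper_subalgebra:
  assumes "subalgebra L" "L ~= {0}"
  obtains M where "subalgebra M" "M \<subset> L"
    "!!z. z : L ==> z ~: M ==> (!!x. x : M ==> lie x z : M) ==> L <= span (insert z M)"
proof -
  let ?P = "%M. subalgebra M & M \<subset> L"
  have "?P {0}" using assms subspace_0[OF subalg_subspace[OF assms(1)]]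
    by (auto simp: subalgebra_def subspace_single_0)
  moreover have "dim M <= dim L" if "?P M" for M
    using dim_strict_mono[of M L] that assms(1) subalg_subspace by fastforce
  ultimately have "EX M. ?P M & (ALL M'. ?P M' --> dim M' <= dim M)"
    using ex_has_greatest_nat[of ?P "{0}" dim "Suc (dim L)"] by (simp add: less_Suc_eq_le)
  then obtain M where M: "?P M" and max: "!!M'. ?P M' ==> dim M' <= dim M" by metis
  have "L <= span (insert z M)" if z: "z : L" "z ~: M" "!!x. x : M ==> lie x z : M" for z
  proof (rule ccontr)
    assume n: "~ L <= span (insert z M)"
    have MS: "M <= span (insert z M)" using span_superset by blast
    have br: "lie x y : M" if "x : insert z M" "y : insert z M" for x y
      using that z(3) M lie_antisym[of z] subspace_neg[OF subalg_subspace] subspace_0[OF subalg_subspace]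
      by (auto simp: lie_self subalg_lie) 
    have "subalgebra (span (insert z M))" unfolding subalgebra_def
    proof (intro conjI ballI)
      fix x y assume "x : span (insert z M)" "y : span (insert z M)"
      then have "lie x y : M" by (intro lie_span_closed[OF br]) (use M subalg_subspace in auto)
      then show "lie x y : span (insert z M)" using MS by blast
    qed simp
    moreover have "span (insert z M) <= L" using z M assms subalg_subspace by (intro span_minimal) auto
    ultimately have P: "?P (span (insert z M))" using n by blast
    have "z : span (insert z M)" by (simp add: span_base)
    then have "M \<subset> span (insert z M)" using MS z(2) by blast
    then have "dim M < dim (span (insert z M))" using M subalg_subspace by (intro dim_strict_mono) auto
    then show False using max[OF P] by simp
  qed
  with M show ?thesis using that by blast
qed

text \<open>Engel's theorem, relative to a stable subspace \<open>U\<close> so that no quotients are needed.\<close>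

lemma engel:
  assumes "subalgebra L" "nil_on L L {0}" "subspace U" "subspace W" "U \<subset> W"
    "!!x w. x : L ==> w : W ==> lie x w : W" "!!x w. x : L ==> w : U ==> lie x w : U" "nil_on L W U"
  shows "EX w:W - U. ALL x:L. lie x w : U" using assms
proof (induction "dim L" arbitrary: L U W rule: less_induct)
  case less
  show ?case
  proof (cases "L = {0}")
    case True
    then show ?thesis using less.prems(3,5) subspace_0 by auto
  next
    case False
    obtain M where M: "subalgebra M" "M \<subset> L"
      "!!z. z : L ==> z ~: M ==> (!!x. x : M ==> lie x z : M) ==> L <= span (insert z M)"
      using maximal_proper_subalgebra[OF less.prems(1) False] by metis
    have sM: "subspace M" and sL: "subspace L" using M less.prems subalg_subspace by auto
    have dM: "dim M < dim L" using dim_strict_mono[OF sM sL M(2)] .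
    have nM: "nil_on M M {0}" "nil_on M L M" "nil_on M W U"
      using nil_on_mono[OF less.prems(2)] nil_on_mono[OF less.prems(8)] M(2) subspace_0[OF sM] by auto
    \<comment> \<open>The induction hypothesis for \<open>M\<close> is used twice: on
      \<open>L\<close> modulo \<open>M\<close> it gives an element \<open>z\<close> normalizing
      \<open>M\<close>, on \<open>W\<close> modulo \<open>U\<close> it gives a vector
      \<open>w0\<close> killed by \<open>M\<close>.\<close>
    have "EX w:L - M. ALL x:M. lie x w : M" by (rule less.hyps[OF dM M(1) nM(1) sM sL M(2) _ _ nM(2)])
        (use M(2) subalg_lie[OF less.prems(1)] subalg_lie[OF M(1)] in blast)+
    then obtain z where z: "z : L" "z ~: M" "!!x. x : M ==> lie x z : M" by blast
    then have L: "L <= span (insert z M)" using M(3) by blast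
    have "EX w:W - U. ALL x:M. lie x w : U" by (rule less.hyps[OF dM M(1) nM(1) less.prems(3,4,5) _ _ nM(3)])
        (use M(2) less.prems(6,7) in blast)+
    then obtain w0 where w0: "w0 : W" "w0 ~: U" "!!x. x : M ==> lie x w0 : U" by blast
    define W' where "W' = {w:W. ALL m:M. lie m w : U}"
    have W'z: "lie z w : W'" if "w : W'" for w
    proof -
      have "lie m (lie z w) : U" if m: "m : M" for m unfolding lie_lie_right[of m z w] using \<open>w : W'\<close> m z less.prems
        by (intro subspace_add) (auto simp: W'_def)
      then show ?thesis using that z less.prems by (auto simp: W'_def)
    qed
    \<comment> \<open>The last power of \<open>z\<close> that keeps \<open>w0\<close> outside
      \<open>U\<close> gives a vector killed modulo \<open>U\<close> by \<open>z\<close> and still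
      by \<open>M\<close>, hence by all of \<open>L\<close>.\<close>
    obtain k where k: "(lie z ^^ k) w0 : U" "!!j. j < k ==> (lie z ^^ j) w0 ~: U"
    proof -
      have "EX k. (lie z ^^ k) w0 : U" using less.prems(8) z w0 unfolding nil_on_def by blast
      then show ?thesis using that[of "LEAST k. (lie z ^^ k) w0 : U"] by (metis (mono_tags, lifting) LeastI not_less_Least)
    qed
    then obtain j where j: "k = Suc j" using w0 by (cases k) auto
    define w where "w = (lie z ^^ j) w0"
    have w: "w : W'" "w ~: U" "lie z w : U"
      using k j funpow_closed[of W' "lie z" w0 j] W'z w0 by (auto simp: w_def W'_def)
    have "lie x w : U" if "x : L" for x
    proof -
      have "x : span (insert z M)" using that L by blast
      moreover have "lie x' w' : U" if "x' : insert z M" "w' : {w}" for x' w' using that w by (auto simp: W'_def)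
      ultimately show ?thesis using lie_span_closed[of "insert z M" "{w}" U x w] less.prems(3) by (simp add: span_base)
    qed
    then show ?thesis using w by (auto simp: W'_def)
  qed
qed

text \<open>Engel gives an element normalizing a maximal proper subalgebra \<open>M\<close>; then
  \<open>L\<close> lies in the span of \<open>M\<close> and that element, so all brackets fall into
  \<open>M\<close>.\<close>

lemma nil_derived_proper:
  assumes "subalgebra L" "nil_on L L {0}" "L ~= {0}"
  shows "derived_series L (Suc 0) \<subset> L"
proof -
  obtain M where M: "subalgebra M" "M \<subset> L"
      "!!z. z : L ==> z ~: M ==> (!!x. x : M ==> lie x z : M) ==> L <= span (insert z M)"
    using maximal_proper_subalgebra[OF assms(1,3)] by metis
  have sM: "subspace M" and sL: "subspace L" using M assms subalg_subspace by auto
  have nM: "nil_on M M {0}" "nil_on M L M" using nil_on_mono[OF assms(2)] M(2) subspace_0[OF sM] by auto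
  have "EX w:L - M. ALL x:M. lie x w : M" by (rule engel[OF M(1) nM(1) sM sL M(2) _ _ nM(2)])
      (use M(2) subalg_lie[OF assms(1)] subalg_lie[OF M(1)] in blast)+
  then obtain z where z: "z : L" "z ~: M" "!!x. x : M ==> lie x z : M" by blast
  then have L: "L <= span (insert z M)" using M(3) by blast
  have br: "lie x y : M" if "x : insert z M" "y : insert z M" for x y
    using that z(3) M(1) lie_antisym[of z] subspace_neg[OF sM] subspace_0[OF sM] by (auto simp: lie_self subalg_lie)
  have "lie x y : M" if "x : L" "y : L" for x y using lie_span_closed[OF br sM] that L by blast
  then have "derived_series L (Suc 0) <= M" unfolding derived_series.simps by (intro span_minimal sM) auto
  then show ?thesis using M by blast
qed

lemma nil_solvable:
  assumes "subalgebra L" "nil_on L L {0}"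
  shows "solvable L" using assms
proof (induction "dim L" arbitrary: L rule: less_induct)
  case less
  show ?case
  proof (cases "L = {0}")
    case True
    then have "derived_series L 0 = {0}" by simp
    then show ?thesis unfolding solvable_def by blast
  next
    case False
    let ?D = "derived_series L (Suc 0)"
    have D: "subalgebra ?D" "?D \<subset> L"
      using derived_series_subset[OF less.prems(1)] nil_derived_proper[OF less.prems False] by blast+
    have "solvable ?D"
    proof (rule less.hyps)
      show "dim ?D < dim L" using D less.prems subalg_subspace by (intro dim_strict_mono) blast+
      show "nil_on ?D ?D {0}" using nil_on_mono[OF less.prems(2)] D by blast
    qed (fact D)
    then show ?thesis by (rule solvable_derivedI)
  qed
qed

section \<open>The Killing form and Cartan's criterion\<close>

definition killing :: "'a => 'a => complex" where
  "killing x y = trace (%z. lie x (lie y z))"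

lemma killing_add_left: "killing (x + y) z = killing x z + killing y z"
  unfolding killing_def by (simp add: lie_add_left trace_add)

lemma killing_scale_left: "killing (scale c x) z = c * killing x z"
  unfolding killing_def by (simp add: lie_scale_left trace_scale)

lemma killing_commute: "killing x y = killing y x" unfolding killing_def by (rule trace_commute) (rule lin_lie)+

lemma killing_add_right: "killing z (x + y) = killing z x + killing z y"
  by (simp add: killing_commute[of z] killing_add_left)

lemma killing_scale_right: "killing z (scale c x) = c * killing z x"
  by (simp add: killing_commute[of z] killing_scale_left)

lemma killing_0 [simp]: "killing 0 x = 0" "killing x 0 = 0"
  using killing_scale_left[of 0 0 x] killing_scale_right[of x 0 0] by auto

lemma killing_sum_left: "killing (\<Sum>i\<in>I. f i) z = (\<Sum>i\<in>I. killing (f i) z)"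
  by (induction I rule: infinite_finite_induct) (simp_all add: killing_add_left)

lemma killing_sum_right: "killing z (\<Sum>i\<in>I. f i) = (\<Sum>i\<in>I. killing z (f i))"
  by (simp add: killing_commute[of z] killing_sum_left)

lemma killing_diff_left: "killing (x - y) z = killing x z - killing y z" using killing_add_left[of "x - y" y z] by simp

lemma killing_neg_left: "killing (- x) z = - killing x z" using killing_diff_left[of 0 x z] by simp

lemma killing_neg_right: "killing z (- x) = - killing z x" by (simp add: killing_commute[of z] killing_neg_left)

lemma killing_invariant: "killing (lie x y) z = killing x (lie y z)"
proof -
  have "killing (lie x y) z = trace (%v. lie x (lie y (lie z v))) - trace (%v. lie y (lie x (lie z v)))"
    unfolding killing_def by (simp add: lie_lie_left trace_diff)
  also have "trace (%v. lie y (lie x (lie z v))) = trace (%v. lie x (lie z (lie y v)))"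
    by (rule trace_commute) (intro lin_lie lin_comp[OF lin_lie])+
  also have "trace (%v. lie x (lie y (lie z v))) - ... = killing x (lie y z)"
    unfolding killing_def by (simp add: lie_lie_left trace_diff lie_diff_right)
  finally show ?thesis .
qed

lemma killing_vanishes_on_span:
  assumes "!!y. y : B ==> killing x y = 0" "y : span B"
  shows "killing x y = 0"
  using assms(2) by (induction rule: span_induct_alt) (simp_all add: killing_add_right killing_scale_right assms(1))

text \<open>Cartan's criterion. For \<open>x\<close> in the derived algebra of \<open>S\<close>, let
  \<open>R\<close> be the semisimple part of \<open>ad x\<close> with conjugated eigenvalues. It is
  a derivation, so the trace of \<open>R\<close> composed with \<open>ad x\<close> is a sum of terms
  \<open>killing b (R a)\<close>. They vanish since \<open>b\<close> is orthogonal to everything,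
  hence \<open>ad x\<close> is nilpotent and Engel applies.\<close>

lemma killing_radical_solvable:
  defines "S \<equiv> {x. ALL y. killing x y = 0}"
  shows "lie_ideal S & solvable S"
proof -
  have id: "lie_ideal S" unfolding lie_ideal_def
  proof (intro conjI allI ballI)
    show "subspace S" unfolding S_def by (rule subspaceI) (auto simp: killing_add_left killing_scale_left)
    show "lie x y : S" if "y : S" for x y
      using that by (auto simp: S_def lie_antisym[of x] killing_neg_left killing_invariant)
  qed
  then have sub: "subalgebra S" unfolding lie_ideal_def subalgebra_def by blast
  let ?D = "derived_series S (Suc 0)"
  have "nil_on ?D ?D {0}" unfolding nil_on_def
  proof (intro ballI)
    fix x w assume x: "x : ?D"
    obtain F where F: "finite F" "span F = UNIV" by (rule finite_spanning)
    obtain R where R: "lin R" "!!mu v. v : gen_eig (lie x) mu ==> R v = scale (cnj mu) v"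
      using spectral_calculus[OF lin_lie F, of x cnj] by blast
    have Rd: "R (lie y z) = lie (R y) z + lie y (R z)" for y z
      by (rule spectral_derivation[OF lin_lie lie_lie_right gen_eigs_span_UNIV[OF lin_lie] R complex_cnj_add])
    have "trace (%v. R (lie x v)) = 0" using x unfolding derived_series.simps
    proof (induction rule: span_induct_alt)
      case base
      show ?case using trace_scale[of 0 "%_. 0"] by (simp add: lin_0[OF R(1)])
    next
      case (step c x y)
      then obtain a b where ab: "x = lie a b" "a : S" "b : S" by auto
      have "trace (%v. R (lie x v)) = trace (%v. R (lie a (lie b v))) - trace (%v. R (lie b (lie a v)))"
        by (simp add: ab lie_lie_left lin_diff[OF R(1)] trace_diff)
      also have "trace (%v. R (lie b (lie a v))) = trace (%v. lie a (R (lie b v)))"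
        by (rule trace_commute[of "%v. R (lie b v)" "lie a"]) (intro lin_lie lin_comp[OF R(1)])+
      also have "trace (%v. R (lie a (lie b v))) - ... = killing b (R a)"
        unfolding killing_commute[of b] by (simp add: trace_diff[symmetric] Rd[of a] killing_def)
      also have "... = 0" using ab(3) by (simp add: S_def)
      finally show ?case using step by (simp add: lie_add_left lie_scale_left lin_add[OF R(1)] lin_scale[OF R(1)] trace_add trace_scale)
    qed
    then show "EX k. (lie x ^^ k) w : {0}" using nilpotent_if_trace_cnj_zero[OF lin_lie R] by simp
  qed
  then have "solvable ?D" using derived_series_subset[OF sub] nil_solvable by blast
  then show ?thesis using id solvable_derivedI by blast
qed

end

section \<open>Semisimple Lie algebras and their roots\<close>

context complex_space
begin

text \<open>On an eigenvector of eigenvalue \<open>c\<close> the square acts by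
  \<open>c * c\<close>, which vanishes only together with \<open>c\<close>.\<close>

lemma diagonalizable_square_zero:
  assumes T: "lin T" "span {v. EX c. T v = scale c v} = UNIV" and "T (T x) = 0"
  shows "T x = 0"
proof -
  have "(\<Union>c\<in>UNIV. {v. T v = scale c v}) = {v. EX c. T v = scale c v}" by auto
  then have "x : span (\<Union>c\<in>UNIV. {v. T v = scale c v})" using T by simp
  then obtain M w where M: "finite M" "ALL c:M. T (w c) = scale c (w c)" "x = (\<Sum>c\<in>M. w c)"
    using span_subspaces_sum[of x "%c. {v. T v = scale c v}" UNIV]
    by (auto simp: subspace_def lin_0[OF T(1)] lin_add[OF T(1)] lin_scale[OF T(1)] scale_right_distrib mult.commute)
  have Tx: "T x = (\<Sum>c\<in>M. scale c (w c))" using M by (simp add: lin_sum[OF T(1)])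
  then have "(\<Sum>c\<in>M. scale (c * c) (w c)) = 0" using assms(3) M(2) by (simp add: lin_sum[OF T(1)] lin_scale[OF T(1)])
  then have "ALL c:M. scale (c * c) (w c) : {0}"
    by (intro weight_components_mem[where H = "{()}" and opr = "%_. T" and wt = "%c _. c"])
      (use T M in \<open>auto simp: lin_0 lin_scale mult.commute mult.left_commute\<close>)
  then have "ALL c:M. scale c (w c) = 0" by auto
  then show ?thesis unfolding Tx by (rule sum.neutral)
qed

text \<open>For \<open>a = 2\<close> this is the representation theory of sl2.\<close>

lemma string_weight:
  assumes A: "lin A" and F: "lin F"
    and comm: "!!j. A (F ((F ^^ j) v)) = F (A ((F ^^ j) v)) + scale (c - of_nat j * a) ((F ^^ j) v)"
    and v: "F (A v) = 0" "v ~= 0" and nil: "(F ^^ K) v = 0"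
  shows "EX n::nat. c = of_nat n * a / 2"
proof -
  \<comment> \<open>At the last nonzero power \<open>F^j v\<close> the left side is zero for this
    \<open>j\<close>, so the scalar on the right must vanish, and this determines
    \<open>c\<close>.\<close>
  have step: "A ((F ^^ Suc j) v) = scale (of_nat (Suc j) * (c - of_nat j * a / 2)) ((F ^^ j) v)" for j
  proof (induction j)
    case 0
    then show ?case using comm[of 0] v by simp
  next
    case (Suc j)
    have "A ((F ^^ Suc (Suc j)) v) = F (A ((F ^^ Suc j) v)) + scale (c - of_nat (Suc j) * a) ((F ^^ Suc j) v)"
      using comm[of "Suc j"] by simp
    also have "... = scale (of_nat (Suc j) * (c - of_nat j * a / 2) + (c - of_nat (Suc j) * a)) ((F ^^ Suc j) v)"
      unfolding Suc lin_scale[OF F] by (simp add: scale_left_distrib)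
    also have "of_nat (Suc j) * (c - of_nat j * a / 2) + (c - of_nat (Suc j) * a) =
      of_nat (Suc (Suc j)) * (c - of_nat (Suc j) * a / 2)" by (simp add: field_simps)
    finally show ?case .
  qed
  define k where "k = (LEAST k. (F ^^ k) v = 0)"
  have k: "(F ^^ k) v = 0" unfolding k_def using nil by (rule LeastI)
  have "k ~= 0" using k v(2) by (metis funpow_0)
  then obtain j where j: "k = Suc j" by (cases k) auto
  have "(F ^^ j) v ~= 0" using j not_less_Least[of j "%k. (F ^^ k) v = 0"] by (simp add: k_def)
  moreover have "scale (of_nat (Suc j) * (c - of_nat j * a / 2)) ((F ^^ j) v) = 0"
    using step[of j] k j lin_0[OF A] by simp
  ultimately have "of_nat (Suc j) * (c - of_nat j * a / 2) = 0" by simp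
  then have "c = of_nat j * a / 2" by (simp del: of_nat_Suc)
  then show ?thesis by blast
qed

end

context findim_complex_space
begin

text \<open>As \<open>A\<close> and \<open>N\<close> commute, the powers of their product contain
  the powers of \<open>N\<close>, so the product is nilpotent.\<close>

lemma trace_commuting_nilpotent:
  assumes "lin A" "lin N" "!!v. A (N v) = N (A v)" "!!v. EX k. (N ^^ k) v = 0"
  shows "trace (%v. A (N v)) = 0"
proof (rule trace_nilpotent[OF lin_comp[OF assms(1,2)]])
  fix v
  have "((%v. A (N v)) ^^ k) v = (A ^^ k) ((N ^^ k) v)" for k
  proof (induction k)
    case (Suc k)
    have "N ((A ^^ k) w) = (A ^^ k) (N w)" for w by (rule funpow_commute) (simp add: assms(3))
    then show ?case by (simp add: Suc)
  qed simp
  then show "EX k. ((%v. A (N v)) ^^ k) v = 0" using assms(4)[of v] lin_0[OF lin_funpow[OF assms(1)]] by metis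
qed

end

section \<open>Inner derivations, Jordan decomposition and toral subalgebras\<close>

locale semisimple_lie_algebra = complex_lie_algebra scale lie for scale :: "complex => 'a::ab_group_add => 'a" and lie +
  assumes semisimple_axiom: semisimple
begin

sublocale findim_lie_algebra using semisimple_axiom by unfold_locales (auto simp: semisimple_def)

lemma killing_nondegenerate: "(!!y. killing x y = 0) ==> x = 0"
  using killing_radical_solvable semisimple_axiom unfolding semisimple_def by blast

lemma lie_faithful:
  assumes "!!y. lie x y = 0" shows "x = 0"
proof (rule killing_nondegenerate)
  show "killing x y = 0" for y unfolding killing_def using assms trace_scale[of 0 "%_. 0"] by simp
qed

text \<open>Let \<open>z\<close> represent the functional that sends \<open>y\<close> to the trace
  of \<open>D\<close> composed with \<open>ad y\<close>. For \<open>E = D - ad z\<close>, the number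
  \<open>killing (E y) w\<close> is the trace of \<open>E\<close> composed with
  \<open>ad [y,w]\<close>, which is zero by the choice of \<open>z\<close>.\<close>

lemma derivation_inner:
  assumes D: "lin D" "!!y z. D (lie y z) = lie (D y) z + lie y (D z)"
  obtains z where "!!y. D y = lie z y"
proof -
  obtain z where z: "!!y. killing z y = trace (%v. D (lie y v))"
    using nondegenerate_represents[of UNIV killing "%y. trace (%v. D (lie y v))"]
      killing_nondegenerate by (auto simp: killing_add_left killing_add_right killing_scale_left killing_scale_right
        lie_add_left lie_scale_left lin_add[OF D(1)] lin_scale[OF D(1)] trace_add trace_scale)
  define E where "E y = D y - lie z y" for y
  have lE: "lin E" unfolding E_def by (rule lin_minus[OF D(1) lin_lie])
  have dE: "lie (E y) u = E (lie y u) - lie y (E u)" for y u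
    by (simp add: E_def D(2) lie_lie_right[of z] lie_diff_left lie_diff_right)
  have "E y = 0" for y
  proof (rule killing_nondegenerate)
    fix w
    have "killing (E y) w = trace (%v. E (lie y (lie w v))) - trace (%v. lie y (E (lie w v)))"
      unfolding killing_def dE by (rule trace_diff)
    also have "trace (%v. lie y (E (lie w v))) = trace (%v. E (lie w (lie y v)))"
      by (rule trace_commute[of "lie y" "%v. E (lie w v)"]) (intro lin_lie lin_comp[OF lE])+
    also have "trace (%v. E (lie y (lie w v))) - ... = trace (%v. E (lie (lie y w) v))"
      by (simp add: trace_diff[symmetric] lie_lie_left lin_diff[OF lE])
    also have "... = trace (%v. D (lie (lie y w) v)) - killing z (lie y w)"
      unfolding E_def killing_def by (rule trace_diff)
    finally show "killing (E y) w = 0" by (simp add: z)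
  qed
  then show ?thesis using that[of z] by (simp add: E_def)
qed

text \<open>Eigenvalues add under brackets, so the semisimple part of \<open>ad x\<close> is a
  derivation, hence of the form \<open>ad z\<close>.\<close>

lemma jordan_decomposition:
  obtains z where "!!mu v. v : gen_eig (lie x) mu ==> lie z v = scale mu v"
    "!!v. EX k. (lie (x - z) ^^ k) v = 0"
proof -
  obtain F where F: "finite F" "span F = UNIV" by (rule finite_spanning)
  obtain S where S: "lin S" "!!mu v. v : gen_eig (lie x) mu ==> S v = scale mu v"
    using spectral_calculus[OF lin_lie F, of x "%x. x"] by blast
  have "S (lie y z) = lie (S y) z + lie y (S z)" for y z by (rule spectral_derivation[where phi = "%x. x",
          OF lin_lie[of x] lie_lie_right gen_eigs_span_UNIV[OF lin_lie] S refl])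
  then obtain z where z: "!!y. S y = lie z y" using derivation_inner[OF S(1)] by blast
  have "EX k. ((%v. lie x v - S v) ^^ k) v = 0" for v
    by (rule nilpotent_part[OF lin_lie S linear_ident, where phi = "%_. 1"]) simp_all
  then have "EX k. (lie (x - z) ^^ k) v = 0" for v by (simp add: z lie_diff_left[abs_def])
  moreover have "lie z v = scale mu v" if "v : gen_eig (lie x) mu" for mu v using S(2)[OF that] z by simp
  ultimately show ?thesis using that by blast
qed

text \<open>An eigenvector \<open>v\<close> of \<open>ad x\<close> in \<open>S\<close> satisfies
  \<open>[v,[v,x]] = 0\<close>, and as \<open>ad v\<close> is diagonalizable, already
  \<open>[v,x] = 0\<close>. So zero is the only eigenvalue of \<open>ad x\<close> on
  \<open>S\<close>.\<close>

lemma toral_abelian: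
  assumes "toral S" "x : S" "y : S" shows "lie x y = 0"
proof -
  have sub: "subspace S" and cl: "!!u v. u : S ==> v : S ==> lie u v : S"
    and diag: "!!u. u : S ==> span {v. EX c. lie u v = scale c v} = UNIV"
    using assms(1) by (auto simp: toral_def subalgebra_def)
  have "lie x v = 0" if "v : S" "lie x v = scale c v" for v c
  proof -
    have "lie v x = scale (- c) v" using that(2) lie_antisym[of x v] by (metis add.inverse_inverse scale_minus_left)
    then have "lie v (lie v x) = 0" by (simp only: lie_scale_right lie_self scale_zero_right)
    then have "lie v x = 0" using diagonalizable_square_zero[OF lin_lie diag] that by blast
    then show ?thesis using lie_antisym[of v x] by simp
  qed
  then have "(\<Union>c\<in>UNIV. {v : S. ALL i:{()}. lie x v = scale (c::complex) v}) <= {v. lie x v = 0}" by auto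
  moreover have "(\<Union>c. {v. lie x v = scale c v}) = {v. EX c. lie x v = scale c v}" by auto
  then have "S <= span (\<Union>c\<in>UNIV. {v : S. ALL i:{()}. lie x v = scale (c::complex) v})"
    by (intro stable_subspace_weights[where opr = "%_. lie x" and wt = "%c _. c"])
      (use lin_lie sub cl assms diag[of x] in auto)
  moreover have "subspace {v. lie x v = 0}" by (auto simp: subspace_def lie_add_right lie_scale_right)
  ultimately show ?thesis using assms(3) span_minimal by blast
qed

lemma subspace_root_space: "subspace (root_space h alpha)"
  by (auto simp: subspace_def root_space_def lie_add_right lie_scale_right scale_right_distrib mult.commute)

lemma lie_root_space:
  assumes "x : root_space h alpha" "y : root_space h beta"
  shows "lie x y : root_space h (alpha + beta)" unfolding root_space_def
proof (intro CollectI ballI)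
  fix z assume "z : h"
  then have "lie z x = scale (alpha z) x" "lie z y = scale (beta z) y" using assms by (auto simp: root_space_def)
  then show "lie z (lie x y) = scale ((alpha + beta) z) (lie x y)"
    unfolding lie_lie_right[of z x y] by (simp add: lie_scale_left lie_scale_right scale_left_distrib)
qed

lemma killing_root_space:
  assumes "x : root_space h alpha" "y : root_space h beta" "z : h" "alpha z + beta z ~= 0"
  shows "killing x y = 0"
proof -
  have "alpha z * killing x y = killing (lie z x) y" using assms by (simp add: root_space_def killing_scale_left)
  also have "... = - killing x (lie z y)"
    using killing_invariant[of x z y] by (simp add: lie_antisym[of z x] killing_neg_left)
  also have "... = - (beta z * killing x y)" using assms by (simp add: root_space_def killing_scale_right)
  finally have "(alpha z + beta z) * killing x y = 0" by (simp add: algebra_simps)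
  then show ?thesis using assms(4) by simp
qed

end

section \<open>A Cartan subalgebra is its own centralizer\<close>

locale cartan_lie_algebra = semisimple_lie_algebra scale lie for scale :: "complex => 'a::ab_group_add => 'a" and lie +
  fixes h :: "'a set"
  assumes cartan_axiom: "cartan_subalgebra h"
begin

abbreviation "g \<equiv> root_space h"

lemma toral_h: "toral h" and subspace_h: "subspace h" and subalgebra_h: "subalgebra h"
  using cartan_axiom by (auto simp: cartan_subalgebra_def toral_def subalgebra_def)

lemma h_abelian: "x : h ==> y : h ==> lie x y = 0" using toral_abelian[OF toral_h] .

text \<open>Functionals on \<open>h\<close> are extended by zero.\<close>

definition hdual :: "('a => complex) set" where
  "hdual = {alpha. ALL y. y ~: h --> alpha y = 0}"

lemma hdual_zero: "0 : hdual"
  and hdual_plus: "alpha : hdual ==> beta : hdual ==> alpha + beta : hdual"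
  and hdual_minus: "alpha : hdual ==> - alpha : hdual"
  and hdual_diff: "alpha : hdual ==> beta : hdual ==> alpha - beta : hdual" by (auto simp: hdual_def)

lemma hdual_eqI: "alpha : hdual ==> beta : hdual ==> (!!y. y : h ==> alpha y = beta y) ==> alpha = beta"
proof (rule ext)
  show "alpha y = beta y" if "alpha : hdual" "beta : hdual" "!!y. y : h ==> alpha y = beta y" for y
    using that by (cases "y : h") (auto simp: hdual_def)
qed

lemma roots_hdual: "alpha : roots h ==> alpha : hdual" by (auto simp: roots_def hdual_def)

lemma zero_not_root: "0 ~: roots h" by (auto simp: roots_def)

lemma rootI: "alpha : hdual ==> alpha ~= 0 ==> x : g alpha ==> x ~= 0 ==> alpha : roots h"
  using hdual_eqI[OF _ hdual_zero, of alpha] unfolding roots_def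
  by (metis (mono_tags, lifting) hdual_def mem_Collect_eq singletonD zero_fun_apply)

text \<open>Simultaneous diagonalization is done for a finite basis of \<open>h\<close>; a common
  eigenvector for the basis is one for all of \<open>h\<close>, and its eigenvalues form the
  weight.\<close>

lemma weight_decomposition: "span (\<Union>alpha\<in>hdual. g alpha) = UNIV"
proof -
  obtain B where B: "B <= h" "independent B" "h <= span B" using basis_exists[of h] by metis
  note fB = finite_independent[OF B(2)]
  have com: "lie x (lie y v) = lie y (lie x v)" if "x : h" "y : h" for x y v
    using lie_lie_right[of x y v] h_abelian[OF that] by simp
  have sp: "span {v. ALL T:lie ` B. EX c. T v = scale c v} = UNIV"
  proof (rule common_eigenvectors_span)
    show "S (T x) = T (S x)" if "S : lie ` B" "T : lie ` B" for S T x using that com B(1) by blast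
  qed (use fB B(1) toral_h in \<open>auto simp: lin_lie toral_def\<close>)
  have "v : span (\<Union>alpha\<in>hdual. g alpha)" if v: "ALL T:lie ` B. EX c. T v = scale c v" for v
  proof -
    have "EX c. lie y v = scale c v" if "y : h" for y
    proof -
      have "y : span B" using that B by auto
      then show ?thesis
      proof (induction rule: span_induct_alt)
        case base
        show ?case by (intro exI[of _ 0]) simp
      next
        case (step c b y)
        then show ?case using v by (auto simp: lie_add_left lie_scale_left scale_left_distrib[symmetric])
      qed
    qed
    then obtain c where c: "!!y. y : h ==> lie y v = scale (c y) v" by metis
    define alpha where "alpha y = (if y : h then c y else 0)" for y
    have "alpha : hdual" "v : g alpha" using c by (auto simp: hdual_def root_space_def alpha_def)
    then show ?thesis using span_base by blast
  qed
  then have "{v. ALL T:lie ` B. EX c. T v = scale c v} <= span (\<Union>alpha\<in>hdual. g alpha)" by auto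
  then show ?thesis using sp span_minimal[OF _ subspace_span] by blast
qed

lemma h_subset_centralizer: "h <= g 0" using h_abelian by (auto simp: root_space_def)

lemma killing_centralizer_weight:
  assumes "x : g 0" "y : g beta" "beta : hdual" "beta ~= 0" shows "killing x y = 0"
proof -
  obtain z where "z : h" "beta z ~= 0" using assms(3,4) hdual_eqI[OF _ hdual_zero, of beta] by auto
  then show ?thesis using killing_root_space[OF assms(1,2)] by simp
qed

lemma centralizer_nondegenerate:
  assumes "x : g 0" "!!y. y : g 0 ==> killing x y = 0"
  shows "x = 0"
proof (rule killing_nondegenerate)
  fix y
  have "killing x y = 0" if "y : (\<Union>alpha\<in>hdual. g alpha)" for y
    using that assms killing_centralizer_weight[OF assms(1)] by (cases "y : g 0") auto
  then show "killing x y = 0" using killing_vanishes_on_span weight_decomposition by blast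
qed

text \<open>Sums of commuting diagonalizable operators are diagonalizable, so \<open>z\<close> and
  \<open>h\<close> together span a toral subalgebra; maximality puts \<open>z\<close> into
  \<open>h\<close>.\<close>

lemma diagonalizable_centralizer:
  assumes "z : g 0" "span {v. EX c. lie z v = scale c v} = UNIV"
  shows "z : h"
proof -
  let ?T = "span (insert z h)"
  have hz: "lie z y = 0" "lie y z = 0" if "y : h" for y
    using that assms(1) lie_antisym[of y z] by (auto simp: root_space_def)
  have "lie x y : {0}" if "x : ?T" "y : ?T" for x y
    by (rule lie_span_closed[OF _ _ that]) (use hz h_abelian lie_self in \<open>auto simp: subspace_0\<close>)
  then have sub: "subalgebra ?T" unfolding subalgebra_def using subspace_0[OF subspace_span] by auto
  have "span {v. EX c. lie x v = scale c v} = UNIV" if x: "x : ?T" for x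
  proof -
    obtain k where "x - scale k z : span h" using x span_breakdown_eq by blast
    then have k: "x - scale k z : h" using subspace_h by (simp add: span_eq_iff[THEN iffD2])
    define y where "y = x - scale k z"
    have y: "y : h" "x = scale k z + y" using k by (auto simp: y_def)
    have com: "lie y (lie z v) = lie z (lie y v)" for v using lie_lie_right[of y z v] hz[OF y(1)] by simp
    have "span {v. ALL T:{lie z, lie y}. EX c. T v = scale c v} = UNIV"
      by (rule common_eigenvectors_span) (use assms y toral_h com in \<open>auto simp: lin_lie toral_def\<close>)
    moreover have "{v. ALL T:{lie z, lie y}. EX c. T v = scale c v} <= {v. EX c. lie x v = scale c v}"
      by (auto simp: y(2) lie_add_left lie_scale_left scale_left_distrib[symmetric])
    ultimately show ?thesis using span_mono by blast
  qed
  then have "toral ?T" using sub by (simp add: toral_def)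
  moreover have "h <= ?T" using span_superset by blast
  ultimately have "?T = h" using cartan_axiom unfolding cartan_subalgebra_def by blast
  then show ?thesis using span_base by blast
qed

text \<open>The semisimple part kills whatever \<open>ad x\<close> kills, in particular
  \<open>h\<close>; being diagonalizable, it belongs to \<open>h\<close>.\<close>

lemma centralizer_jordan:
  assumes "x : g 0"
  obtains z where "z : h" "x - z : g 0" "!!v. EX k. (lie (x - z) ^^ k) v = 0"
proof -
  obtain z where z: "!!mu v. v : gen_eig (lie x) mu ==> lie z v = scale mu v"
    "!!v. EX k. (lie (x - z) ^^ k) v = 0" using jordan_decomposition[of x] by blast
  have "lie z y = 0" if "y : h" for y
  proof -
    have "lie y x = 0" using assms that by (simp add: root_space_def)
    then have "lie x y = 0" using lie_antisym[of x y] by simp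
    then show ?thesis using z(1)[OF gen_eig_0I[of 1 "lie x" y]] by simp
  qed
  then have z0: "z : g 0" using lie_antisym[of z] by (simp add: root_space_def)
  have "(\<Union>mu. gen_eig (lie x) mu) <= {v. EX c. lie z v = scale c v}" using z(1) by blast
  then have "span {v. EX c. lie z v = scale c v} = UNIV"
    using gen_eigs_span_UNIV[OF lin_lie, of x] span_mono by blast
  then have "z : h" using diagonalizable_centralizer z0 by blast
  moreover have "x - z : g 0" using subspace_diff[OF subspace_root_space assms z0] .
  ultimately show ?thesis using that z(2) by blast
qed

lemma killing_commuting_nilpotent:
  assumes "lie x y = 0" "!!v. EX k. (lie y ^^ k) v = 0"
  shows "killing x y = 0" unfolding killing_def
proof (rule trace_commuting_nilpotent[OF lin_lie lin_lie _ assms(2)])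
  show "lie x (lie y v) = lie y (lie x v)" for v unfolding lie_lie_right[of x y v] assms(1) by simp
qed

text \<open>An element of the centralizer is an element of \<open>h\<close> plus a nilpotent one
  commuting with \<open>y\<close>, and the nilpotent part is orthogonal to \<open>y\<close>. Thus
  \<open>y\<close> is orthogonal to the whole centralizer.\<close>

lemma killing_h_nondegenerate:
  assumes y: "y : h" and 0: "!!z. z : h ==> killing y z = 0"
  shows "y = 0"
proof (rule centralizer_nondegenerate)
  show "y : g 0" using y h_subset_centralizer by blast
  fix x assume "x : g 0"
  then obtain z where z: "z : h" "x - z : g 0" "!!v. EX k. (lie (x - z) ^^ k) v = 0" using centralizer_jordan by blast
  have "lie y (x - z) = 0" using z(2) y by (simp add: root_space_def)
  then have "killing y (x - z) = 0" using killing_commuting_nilpotent z(3) by blast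
  then show "killing y x = 0" using 0[OF z(1)] killing_add_right[of y "x - z" z] by simp
qed

lemma subalgebra_centralizer: "subalgebra (g 0)"
  unfolding subalgebra_def using subspace_root_space lie_root_space[of _ h 0 _ 0] by (metis add_0)

lemma nilpotent_central_zero:
  assumes "n : g 0" "!!c. c : g 0 ==> lie c n = 0" "!!v. EX k. (lie n ^^ k) v = 0"
  shows "n = 0"
proof (rule centralizer_nondegenerate[OF assms(1)])
  show "killing n y = 0" if "y : g 0" for y
    unfolding killing_commute[of n] by (rule killing_commuting_nilpotent[OF assms(2)[OF that] assms(3)])
qed

lemma centralizer_h: "g 0 = h"
proof
  have hC: "lie c z = 0" if "z : h" "c : g 0" for z c using that lie_antisym[of c z] by (simp add: root_space_def)
  \<comment> \<open>On the centralizer \<open>ad x\<close> coincides with its nilpotent part,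
    because the semisimple part lies in \<open>h\<close> and acts there by zero.\<close>
  have nil: "nil_on (g 0) (g 0) {0}" unfolding nil_on_def
  proof (intro ballI)
    fix x w assume x: "x : g 0" and w: "w : g 0"
    obtain z where z: "z : h" "x - z : g 0" "!!v. EX k. (lie (x - z) ^^ k) v = 0"
      using centralizer_jordan[OF x] by blast
    have "(lie x ^^ k) w : g 0 & (lie x ^^ k) w = (lie (x - z) ^^ k) w" for k
    proof (induction k)
      case (Suc k)
      have "(lie x ^^ k) w : g 0" using Suc by blast
      then have "lie z ((lie x ^^ k) w) = 0" using z(1) by (simp add: root_space_def)
      then have "lie x ((lie x ^^ k) w) = lie (x - z) ((lie x ^^ k) w)" by (simp add: lie_diff_left)
      moreover have "lie x ((lie x ^^ k) w) : g 0" using Suc x subalg_lie[OF subalgebra_centralizer] by blast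
      ultimately show ?case using Suc by (metis comp_apply funpow.simps(2))
    next
      case 0
      show ?case using w by (metis funpow_0)
    qed
    moreover obtain k where "(lie (x - z) ^^ k) w = 0" using z(3) by blast
    ultimately show "EX k. (lie x ^^ k) w : {0}" by (metis singletonI)
  qed
  let ?D = "derived_series (g 0) (Suc 0)"
  have D: "subalgebra ?D" "?D <= g 0" using derived_series_subset[OF subalgebra_centralizer] by blast+
  have kD: "killing y d = 0" if y: "y : h" and d: "d : ?D" for y d
  proof (rule killing_vanishes_on_span[OF _ d[unfolded derived_series.simps]])
    fix d assume "d : {lie x y |x y. x : g 0 & y : g 0}"
    then obtain a b where "d = lie a b" "a : g 0" by auto
    then show "killing y d = 0" using killing_invariant[of y a b] y by (simp add: root_space_def)
  qed
  have abel: "lie a b = 0" if "a : g 0" "b : g 0" for a b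
  proof (rule ccontr)
    assume ne: "lie a b ~= 0"
    have mem: "lie x w : ?D" if "x : g 0" "w : g 0" for x w
      unfolding derived_series.simps using that by (intro span_base) auto
    have "lie a b : ?D" using mem that .
    then have ps: "{0} \<subset> ?D" using ne subspace_0[OF subalg_subspace[OF D(1)]] by blast
    \<comment> \<open>If the derived algebra were nonzero, Engel would give a nonzero central
      \<open>w\<close> in it. The nilpotent part of \<open>w\<close> is central too, hence zero, so
      \<open>w\<close> lies in \<open>h\<close>; but \<open>h\<close> is orthogonal to the derived
      algebra and its form is nondegenerate.\<close>
    have "EX w:?D - {0}. ALL x:g 0. lie x w : {0}"
    proof (rule engel[OF subalgebra_centralizer nil _ subalg_subspace[OF D(1)] ps])
      show "nil_on (g 0) ?D {0}" using nil_on_mono[OF nil] D by blast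
      show "lie x w : ?D" if "x : g 0" "w : ?D" for x w using mem[OF that(1)] that(2) D(2) by blast
    qed (auto simp: subspace_def)
    then obtain w where w: "w : ?D" "w ~= 0" "!!x. x : g 0 ==> lie x w = 0" by blast
    obtain z where z: "z : h" "w - z : g 0" "!!v. EX k. (lie (w - z) ^^ k) v = 0"
      using centralizer_jordan[of w] w(1) D(2) by blast
    have "w - z = 0" by (rule nilpotent_central_zero[OF z(2) _ z(3)]) (simp add: lie_diff_right w(3) hC[OF z(1)])
    then have wh: "w : h" using z(1) by simp
    then have "w = 0" using killing_h_nondegenerate[OF wh] kD[OF _ w(1)] by (metis killing_commute)
    then show False using w(2) by simp
  qed
  show "g 0 <= h"
  proof
    fix x assume x: "x : g 0"
    obtain z where z: "z : h" "x - z : g 0" "!!v. EX k. (lie (x - z) ^^ k) v = 0"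
      using centralizer_jordan[OF x] by blast
    have "x - z = 0" by (rule nilpotent_central_zero[OF z(2) _ z(3)]) (use abel z(2) in blast)
    then show "x : h" using z(1) by simp
  qed
qed (rule h_subset_centralizer)

end

lemma negative_half_multiple_zero:
  fixes a :: complex
  assumes "- a = of_nat n * a / 2" shows "a = 0"
proof -
  have "of_nat n * a / 2 * 2 = - a * 2" using assms by simp
  then have "of_nat n * a = - (2 * a)" by simp
  then have "of_nat (n + 2) * a = 0" by (simp add: distrib_right)
  then show ?thesis by (metis add_2_eq_Suc' mult_eq_0_iff nat.distinct(1) of_nat_eq_0_iff)
qed

section \<open>Roots, root strings and root lengths\<close>

context cartan_lie_algebra
begin

lemma root_weightD: "alpha : hdual ==> x : g alpha ==> x ~= 0 ==> alpha = 0 \<or> alpha : roots h" using rootI by blast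

lemma root_space_nonzero: "alpha : roots h ==> EX x:g alpha. x ~= 0"
  using subspace_0[OF subspace_root_space, of h alpha] by (auto simp: roots_def)

lemma hdual_separated:
  "alpha : hdual ==> beta : hdual ==> alpha ~= beta ==> EX y:h. alpha y ~= beta y" using hdual_eqI by blast

text \<open>A root missing among the weights of the basis would give a relation between vectors of
  distinct weights. That all roots occur also bounds their number.\<close>

lemma weight_basis:
  obtains B w where "finite B" "independent B" "span B = UNIV"
    "!!b. b : B ==> w b = 0 \<or> w b : roots h" "!!b. b : B ==> b : g (w b)" "roots h <= w ` B"
proof -
  obtain B where B: "B <= (\<Union>alpha\<in>hdual. g alpha)" "independent B" "span B = UNIV"
    using subset_spanning_basis[OF weight_decomposition] by blast
  then have "ALL b:B. EX alpha. alpha : hdual & b : g alpha" by blast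
  then obtain w where w: "!!b. b : B ==> w b : hdual" "!!b. b : B ==> b : g (w b)" by metis
  have fB: "finite B" using finite_independent B by blast
  have nz: "b ~= 0" if "b : B" for b using that B(2) dependent_zero by blast
  have 1: "w b = 0 \<or> w b : roots h" if "b : B" for b using root_weightD w nz that by blast
  have "alpha : w ` B" if alpha: "alpha : roots h" for alpha
  proof (rule ccontr)
    assume n: "alpha ~: w ` B"
    obtain v where v: "v : g alpha" "v ~= 0" using root_space_nonzero[OF alpha] by blast
    have "v : span B" using B by simp
    then obtain r where r: "v = (\<Sum>b\<in>B. scale (r b) b)" using span_finite[OF fB] by auto
    define c where "c mu = (if mu = alpha then - v else (\<Sum>b | b : B & w b = mu. scale (r b) b))" for mu
    have s: "(\<Sum>mu\<in>w ` B. c mu) = v"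
    proof -
      have "(\<Sum>mu\<in>w ` B. c mu) = (\<Sum>mu\<in>w ` B. \<Sum>b | b : B & w b = mu. scale (r b) b)"
        using n by (intro sum.cong) (auto simp: c_def)
      also have "... = v" unfolding r by (rule sum.group[OF fB]) (use fB in auto)
      finally show ?thesis .
    qed
    have cg: "c mu : g mu" for mu
      using w v by (auto simp: c_def intro!: subspace_neg subspace_sum subspace_scale subspace_root_space)
    have "ALL mu:insert alpha (w ` B). c mu : {0}"
    proof (rule weight_components_mem[where H = h and opr = lie and wt = "%mu. mu"])
      show "EX i:h. mu i ~= nu i" if "mu : insert alpha (w ` B)" "nu : insert alpha (w ` B)" "mu ~= nu" for mu nu
        using that w(1) roots_hdual[OF alpha] by (intro hdual_separated) auto
      show "lie i (c mu) = scale (mu i) (c mu)" if "i : h" for i mu using cg[of mu] that by (simp add: root_space_def)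
      show "(\<Sum>mu\<in>insert alpha (w ` B). c mu) : {0}" using fB n s by (simp add: c_def)
    qed (use fB lin_lie in auto)
    then show False using v(2) by (simp add: c_def)
  qed
  then show ?thesis using that[of B w] fB B 1 w(2) by blast
qed

lemma finite_roots: "finite (roots h)" using weight_basis finite_surj by metis

definition hlinear :: "('a => complex) => bool" where
  "hlinear mu \<longleftrightarrow> (ALL x:h. ALL y:h. mu (x + y) = mu x + mu y) & (ALL c. ALL x:h. mu (scale c x) = c * mu x)"

lemma hlinear_plus: "hlinear mu ==> hlinear nu ==> hlinear (mu + nu)"
  and hlinear_minus: "hlinear mu ==> hlinear (- mu)"
  and hlinear_zero: "hlinear 0" by (auto simp: hlinear_def algebra_simps)

lemma hlinear_diff: "hlinear mu ==> hlinear nu ==> hlinear (mu - nu)" by (auto simp: hlinear_def algebra_simps)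

lemma root_hlinear: assumes "alpha : roots h" shows "hlinear alpha"
proof -
  obtain v where v: "v : g alpha" "v ~= 0" using root_space_nonzero[OF assms] by blast
  have eq: "scale (alpha y) v = lie y v" if "y : h" for y using v that by (simp add: root_space_def)
  have "scale (alpha (x + y)) v = scale (alpha x + alpha y) v" if "x : h" "y : h" for x y
    using that subspace_h by (simp add: eq subspace_add lie_add_left scale_left_distrib)
  moreover have "scale (alpha (scale c x)) v = scale (c * alpha x) v" if "x : h" for x c
    unfolding scale_scale[symmetric] using that subspace_h by (simp add: eq subspace_scale lie_scale_left del: scale_scale)
  ultimately show ?thesis using v(2) by (simp add: hlinear_def)
qed

text \<open>The element representing \<open>mu\<close> under the Killing form, so that
  \<open>mu (dualv nu)\<close> is the inner product of weights. Normalized coroots would require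
  dividing by root lengths, which are not yet known to be nonzero.\<close>

definition dualv :: "('a => complex) => 'a" where
  "dualv mu = (SOME t. t : h & (ALL y:h. killing t y = mu y))"

lemma dualv: assumes "hlinear mu" shows "dualv mu : h" "!!y. y : h ==> killing (dualv mu) y = mu y"
proof -
  have "EX t. t : h & (ALL y:h. killing t y = mu y)" by (rule nondegenerate_represents[OF subspace_h, of killing mu])
      (use assms killing_h_nondegenerate in \<open>auto simp: killing_add_left killing_add_right
        killing_scale_left killing_scale_right hlinear_def\<close>)
  then have "dualv mu : h & (ALL y:h. killing (dualv mu) y = mu y)" unfolding dualv_def by (rule someI_ex)
  then show "dualv mu : h" "!!y. y : h ==> killing (dualv mu) y = mu y" by auto
qed

lemma dualv_symmetric: "hlinear mu ==> hlinear nu ==> mu (dualv nu) = nu (dualv mu)"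
  using dualv killing_commute by metis

lemma root_space_shift:
  assumes "x : g alpha" "v : g beta" shows "(lie x ^^ k) v : g (beta + (%y. of_nat k * alpha y))"
proof (induction k)
  case 0
  have "beta + (%y. of_nat 0 * alpha y) = beta" by auto
  then show ?case using assms by simp
next
  case (Suc k)
  have eq: "alpha + (beta + (%y. of_nat k * alpha y)) = beta + (%y. of_nat (Suc k) * alpha y)"
    by (rule ext) (simp add: algebra_simps)
  show ?case using lie_root_space[OF assms(1) Suc] by (simp only: eq funpow.simps(2) comp_apply)
qed

text \<open>The weights \<open>beta + k alpha\<close> are pairwise different, and only finitely many
  weights occur.\<close>

lemma root_vector_nilpotent:
  assumes alpha: "alpha : roots h" and x: "x : g alpha" shows "EX k. (lie x ^^ k) v = 0"
proof -
  have "g beta <= gen_eig (lie x) 0" if beta: "beta : hdual" for beta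
  proof
    fix v assume v: "v : g beta"
    let ?s = "%k::nat. beta + (%y. of_nat k * alpha y)"
    obtain y where y: "y : h" "alpha y ~= 0" using alpha by (auto simp: roots_def)
    have "inj ?s"
    proof (rule injI)
      fix k l assume "?s k = ?s l"
      then have "?s k y = ?s l y" by (rule fun_cong)
      then show "k = l" using y by simp
    qed
    then have "infinite (range ?s)" using finite_imageD infinite_UNIV_nat by blast
    then have "~ range ?s <= insert 0 (roots h)" using finite_roots finite_subset by blast
    then obtain k where k: "?s k ~: insert 0 (roots h)" by blast
    have "?s k : hdual" using beta roots_hdual[OF alpha] by (auto simp: hdual_def)
    then have "(lie x ^^ k) v = 0" using root_weightD root_space_shift[OF x v, of k] k by blast
    then show "v : gen_eig (lie x) 0" by (rule gen_eig_0I)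
  qed
  then have "span (\<Union>alpha\<in>hdual. g alpha) <= gen_eig (lie x) 0"
    by (intro span_minimal subspace_gen_eig lin_lie) auto
  then show ?thesis using weight_decomposition gen_eig_0D by blast
qed

text \<open>A weight space is orthogonal to all others except the opposite one, so a root vector
  orthogonal to the latter would lie in the radical of the form.\<close>

lemma root_pairing:
  assumes "alpha : roots h" "x : g alpha" "x ~= 0" shows "- alpha : roots h & (EX y:g (- alpha). killing x y = 1)"
proof -
  have "EX y:g (- alpha). killing x y ~= 0"
  proof (rule ccontr)
    assume n: "~ ?thesis"
    have "killing x y = 0" if y: "y : (\<Union>beta\<in>hdual. g beta)" for y
    proof -
      obtain beta where beta: "beta : hdual" "y : g beta" using y by blast
      show ?thesis
      proof (cases "beta = - alpha")
        case False
        then obtain z where "z : h" "beta z ~= (- alpha) z"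
          using hdual_separated[OF beta(1) hdual_minus[OF roots_hdual[OF assms(1)]]] by blast
        then show ?thesis using killing_root_space[OF assms(2) beta(2)] by (auto simp: add_eq_0_iff)
      qed (use n beta in auto)
    qed
    then have "killing x y = 0" for y
      using killing_vanishes_on_span[of "\<Union>beta\<in>hdual. g beta" x y] weight_decomposition by simp
    then have "x = 0" by (rule killing_nondegenerate)
    then show False using assms by simp
  qed
  then obtain y where y: "y : g (- alpha)" "killing x y ~= 0" by blast
  then have "y ~= 0" by auto
  moreover have "- alpha ~= 0" using assms(1) zero_not_root by (metis neg_equal_0_iff_equal)
  ultimately have "- alpha : roots h" using rootI[OF hdual_minus[OF roots_hdual[OF assms(1)]] _ y(1)] by blast
  moreover have "scale (1 / killing x y) y : g (- alpha)" "killing x (scale (1 / killing x y) y) = 1"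
    using y by (auto simp: killing_scale_right intro: subspace_scale[OF subspace_root_space])
  ultimately show ?thesis by blast
qed

lemma root_minus: "alpha : roots h ==> - alpha : roots h" using root_pairing root_space_nonzero by blast

text \<open>Both sides lie in \<open>h\<close>, and by invariance they pair equally with every
  element of \<open>h\<close>.\<close>

lemma lie_opposite_roots:
  assumes alpha: "alpha : roots h" and x: "x : g alpha" and y: "y : g (- alpha)"
  shows "lie x y = scale (killing x y) (dualv alpha)"
proof -
  note t = dualv[OF root_hlinear[OF alpha]]
  have "lie x y : g (alpha + - alpha)" using lie_root_space[OF x y] .
  then have xy: "lie x y : h" by (simp add: centralizer_h)
  have "lie x y - scale (killing x y) (dualv alpha) = 0"
  proof (rule killing_h_nondegenerate)
    show "lie x y - scale (killing x y) (dualv alpha) : h"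
      using xy t(1) by (intro subspace_diff subspace_scale subspace_h)
    fix z assume z: "z : h"
    have "killing (lie x y) z = - killing x (lie z y)"
      unfolding killing_invariant by (simp add: lie_antisym[of z y] killing_neg_right)
    also have "... = alpha z * killing x y" using y z by (simp add: root_space_def killing_neg_right killing_scale_right)
    finally show "killing (lie x y - scale (killing x y) (dualv alpha)) z = 0"
      using t(2)[OF z] by (simp add: killing_diff_left killing_scale_left)
  qed
  then show ?thesis by simp
qed

text \<open>The sl2 argument for the unnormalized triple with \<open>[x,y] = dualv alpha\<close>:
  the factor \<open>alpha (dualv alpha)\<close> is carried along, its nonvanishing being proved only
  later from this.\<close>

lemma root_string_weight:
  assumes alpha: "alpha : roots h" and x: "x : g alpha" and y: "y : g (- alpha)" and xy: "killing x y = 1"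
    and v: "v : g beta" "v ~= 0" "lie y (lie x v) = 0"
  shows "EX n::nat. beta (dualv alpha) = of_nat n * alpha (dualv alpha) / 2"
proof -
  note t = dualv[OF root_hlinear[OF alpha]]
  obtain K where K: "(lie y ^^ K) v = 0" using root_vector_nilpotent[OF root_minus[OF alpha] y] by blast
  show ?thesis
  proof (rule string_weight[OF lin_lie lin_lie _ v(3,2) K])
    fix j
    have "(lie y ^^ j) v : g (beta + (%z. of_nat j * (- alpha) z))" by (rule root_space_shift[OF y v(1)])
    then have "lie (dualv alpha) ((lie y ^^ j) v) = scale (beta (dualv alpha) - of_nat j * alpha (dualv alpha)) ((lie y ^^ j) v)"
      using t(1) by (simp add: root_space_def)
    then show "lie x (lie y ((lie y ^^ j) v)) = lie y (lie x ((lie y ^^ j) v)) +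
        scale (beta (dualv alpha) - of_nat j * alpha (dualv alpha)) ((lie y ^^ j) v)"
      using lie_lie_right[of x y "(lie y ^^ j) v"] lie_opposite_roots[OF alpha x y] xy by simp
  qed
qed

lemma root_string_top:
  assumes alpha: "alpha : roots h" and x: "x : g alpha" and v: "v : g beta" "v ~= 0"
  obtains k where "(lie x ^^ k) v : g (beta + (%y. of_nat k * alpha y))" "(lie x ^^ k) v ~= 0"
    "lie x ((lie x ^^ k) v) = 0"
proof -
  define K where "K = (LEAST k. (lie x ^^ k) v = 0)"
  have K: "(lie x ^^ K) v = 0" unfolding K_def using root_vector_nilpotent[OF alpha x] by (rule LeastI_ex)
  have "K ~= 0" using K v(2) by (metis funpow_0)
  then obtain k where k: "K = Suc k" by (cases K) auto
  then have "(lie x ^^ k) v ~= 0" using not_less_Least[of k "%k. (lie x ^^ k) v = 0"] by (simp add: K_def)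
  moreover have "lie x ((lie x ^^ k) v) = 0" using K k by simp
  ultimately show ?thesis using that root_space_shift[OF x v(1)] by blast
qed

text \<open>At the top of the \<open>alpha\<close>-string through \<open>v\<close> the string
  argument applies; going back down subtracts an integral multiple of \<open>alpha\<close>.\<close>

lemma weight_dualv:
  assumes alpha: "alpha : roots h" and v: "v : g beta" "v ~= 0"
  shows "EX m::int. beta (dualv alpha) = of_int m / 2 * alpha (dualv alpha)"
proof -
  obtain x where x: "x : g alpha" "x ~= 0" using root_space_nonzero[OF alpha] by blast
  obtain y where y: "y : g (- alpha)" "killing x y = 1" using root_pairing[OF alpha x] by blast
  obtain k where k: "(lie x ^^ k) v : g (beta + (%y. of_nat k * alpha y))" "(lie x ^^ k) v ~= 0"
    "lie x ((lie x ^^ k) v) = 0" using root_string_top[OF alpha x(1) v] by blast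
  obtain n :: nat where "beta (dualv alpha) + of_nat k * alpha (dualv alpha) = of_nat n * alpha (dualv alpha) / 2"
    using root_string_weight[OF alpha x(1) y k(1,2)] k(3) by auto
  then have "beta (dualv alpha) = of_int (int n - 2 * int k) / 2 * alpha (dualv alpha)" by (simp add: field_simps)
  then show ?thesis by blast
qed

lemma killing_h_sum:
  assumes "finite B" "independent B" "span B = UNIV" "!!b. b : B ==> b : g (w b)" "x : h" "y : h"
  shows "killing x y = (\<Sum>b\<in>B. w b x * w b y)" unfolding killing_def
proof (rule trace_eigenbasis[OF _ assms(2,3)])
  show "lin (%z. lie x (lie y z))" by (intro lin_comp[OF lin_lie] lin_lie)
  show "lie x (lie y b) = scale (w b x * w b y) b" if "b : B" for b
    using assms(4)[OF that] assms(5,6) by (simp add: root_space_def lie_scale_right mult.commute)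
qed

text \<open>Write \<open>c\<close> for \<open>alpha (dualv alpha)\<close>. Computing the form on
  \<open>dualv alpha\<close> as a trace gives \<open>c = c^2 q\<close>, where \<open>q\<close> is a
  sum of squares of half integers, so \<open>c = 1 / q\<close> once \<open>c\<close> is
  nonzero.\<close>

lemma root_norm_positive:
  assumes alpha: "alpha : roots h" shows "EX r>0. alpha (dualv alpha) = complex_of_real r"
proof -
  note t = dualv[OF root_hlinear[OF alpha]]
  obtain B w where B: "finite B" "independent B" "span B = UNIV" "!!b. b : B ==> b : g (w b)"
    using weight_basis by metis
  have nz: "b ~= 0" if "b : B" for b using that B(2) dependent_zero by blast
  obtain m :: "'a => int" where m: "!!b. b : B ==> w b (dualv alpha) = of_int (m b) / 2 * alpha (dualv alpha)"
    using weight_dualv[OF alpha B(4) nz] by metis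
  have eq: "alpha (dualv alpha) = (alpha (dualv alpha))\<^sup>2 * complex_of_real (\<Sum>b\<in>B. (of_int (m b) / 2)\<^sup>2)"
  proof -
    have "alpha (dualv alpha) = killing (dualv alpha) (dualv alpha)" using t by simp
    also have "... = (\<Sum>b\<in>B. w b (dualv alpha) * w b (dualv alpha))" by (rule killing_h_sum[OF B t(1) t(1)])
    also have "... = (\<Sum>b\<in>B. (alpha (dualv alpha))\<^sup>2 * (of_int (m b) / 2)\<^sup>2)"
      by (rule sum.cong) (simp_all add: m power2_eq_square)
    finally show ?thesis by (simp add: sum_distrib_left)
  qed
  \<comment> \<open>If this number were zero, every weight would vanish on
    \<open>dualv alpha\<close>, which would then be central.\<close>
  have ne: "alpha (dualv alpha) ~= 0"
  proof
    assume 0: "alpha (dualv alpha) = 0"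
    have "lie (dualv alpha) b = 0" if "b : B" for b using B(4)[OF that] t(1) m[OF that] 0 by (simp add: root_space_def)
    then have "lie (dualv alpha) v = 0" for v using lin_eq_on_span[OF lin_lie endo.linear_zero, of v B] B(3) by auto
    then have "dualv alpha = 0" by (rule lie_faithful)
    then have "alpha y = 0" if "y : h" for y using t(2)[OF that] by simp
    then show False using alpha by (auto simp: roots_def)
  qed
  define q where "q = (\<Sum>b\<in>B. (of_int (m b) / 2 :: real)\<^sup>2)"
  have "alpha (dualv alpha) * (alpha (dualv alpha) * complex_of_real q) = alpha (dualv alpha) * 1"
    using eq unfolding q_def[symmetric] by (simp add: power2_eq_square mult.assoc)
  then have 1: "alpha (dualv alpha) * complex_of_real q = 1" using ne mult_left_cancel by blast
  then have "q ~= 0" by (metis mult_zero_right of_real_0 zero_neq_one)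
  moreover have "q >= 0" unfolding q_def by (rule sum_nonneg) simp
  ultimately have "q > 0" by linarith
  moreover have "alpha (dualv alpha) = complex_of_real (1 / q)" using 1 \<open>q ~= 0\<close> by (simp add: field_simps)
  ultimately show ?thesis by (intro exI[of _ "1 / q"]) simp
qed

lemma root_norm_nonzero: "alpha : roots h ==> alpha (dualv alpha) ~= 0" using root_norm_positive by fastforce

text \<open>Subtract from \<open>z\<close> the multiple of \<open>x\<close> that makes the rest
  \<open>u\<close> orthogonal to \<open>y\<close>; then \<open>u\<close> commutes with
  \<open>y\<close>. If \<open>u\<close> were nonzero, the string argument with \<open>x\<close> and
  \<open>y\<close> exchanged would give \<open>- c = n c / 2\<close> for the nonzero number
  \<open>c = alpha (dualv alpha)\<close>.\<close>

lemma root_space_one_dim: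
  assumes alpha: "alpha : roots h" and x: "x : g alpha" "x ~= 0" and z: "z : g alpha"
  obtains c where "z = scale c x"
proof -
  obtain y where y: "y : g (- alpha)" "killing x y = 1" using root_pairing[OF alpha x] by blast
  define u where "u = z - scale (killing z y) x"
  have u: "u : g alpha" unfolding u_def using x z by (intro subspace_diff subspace_scale subspace_root_space)
  have "killing u y = 0" by (simp add: u_def killing_diff_left killing_scale_left y)
  then have "lie u y = 0" using lie_opposite_roots[OF alpha u y(1)] by simp
  then have yu: "lie x (lie y u) = 0" using lie_antisym[of u y] by simp
  have "u = 0"
  proof (rule ccontr)
    assume "u ~= 0"
    moreover have "x : g (- (- alpha))" "killing y x = 1" using x y killing_commute[of y x] by auto
    ultimately obtain n :: nat where n: "alpha (dualv (- alpha)) = of_nat n * (- alpha) (dualv (- alpha)) / 2"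
      using root_string_weight[OF root_minus[OF alpha] y(1) _ _ u _ yu] by blast
    have d: "alpha (dualv (- alpha)) = - alpha (dualv alpha)"
      using dualv_symmetric[OF root_hlinear[OF alpha] hlinear_minus[OF root_hlinear[OF alpha]]] by simp
    have "- alpha (dualv alpha) = of_nat n * alpha (dualv alpha) / 2" using n by (simp add: d)
    then show False using root_norm_nonzero[OF alpha] negative_half_multiple_zero by blast
  qed
  then show ?thesis using that[of "killing z y"] by (simp add: u_def)
qed

text \<open>If \<open>[x,v] = 0\<close>, then \<open>v\<close> is the top of its string, so
  \<open>beta\<close> is nonnegative on \<open>dualv alpha\<close>. Since \<open>[y,u]\<close> is a
  multiple of \<open>v\<close>, it is killed by \<open>x\<close>, and the reversed string argument
  makes \<open>alpha + beta\<close> nonpositive there. But the second value exceeds the first by a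
  positive number.\<close>

lemma lie_roots_nonzero:
  assumes alpha: "alpha : roots h" and beta: "beta : roots h" and s: "alpha + beta : roots h"
    and x: "x : g alpha" "x ~= 0" and v: "v : g beta" "v ~= 0"
  shows "lie x v ~= 0"
proof
  assume 0: "lie x v = 0"
  obtain y where y: "y : g (- alpha)" "killing x y = 1" using root_pairing[OF alpha x] by blast
  obtain n :: nat where n: "beta (dualv alpha) = of_nat n * alpha (dualv alpha) / 2"
    using root_string_weight[OF alpha x(1) y v] 0 by auto
  obtain u where u: "u : g (alpha + beta)" "u ~= 0" using root_space_nonzero[OF s] by blast
  have "lie y u : g (- alpha + (alpha + beta))" using lie_root_space[OF y(1) u(1)] .
  then have "lie y u : g beta" by simp
  then obtain c where "lie y u = scale c v" using root_space_one_dim[OF beta v] by blast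
  then have xyu: "lie x (lie y u) = 0" using 0 by (simp add: lie_scale_right)
  have "x : g (- (- alpha))" "killing y x = 1" using x y killing_commute[of y x] by auto
  then obtain k :: nat where k: "(alpha + beta) (dualv (- alpha)) = of_nat k * (- alpha) (dualv (- alpha)) / 2"
    using root_string_weight[OF root_minus[OF alpha] y(1) _ _ u xyu] by blast
  have d: "gamma (dualv (- alpha)) = - gamma (dualv alpha)" if "hlinear gamma" for gamma
    using dualv_symmetric[OF that hlinear_minus[OF root_hlinear[OF alpha]]]
      dualv_symmetric[OF that root_hlinear[OF alpha]] by simp
  have k': "- (alpha (dualv alpha) + beta (dualv alpha)) = of_nat k * alpha (dualv alpha) / 2"
    using k by (simp add: d root_hlinear alpha beta)
  have "- alpha (dualv alpha) = of_nat k * alpha (dualv alpha) / 2 + of_nat n * alpha (dualv alpha) / 2"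
    using k' unfolding n by (metis add.commute add.inverse_inverse add_minus_cancel minus_add_distrib)
  then have "- alpha (dualv alpha) = of_nat (k + n) * alpha (dualv alpha) / 2"
    by (simp add: add_divide_distrib distrib_right)
  then show False using root_norm_nonzero[OF alpha] negative_half_multiple_zero by blast
qed

text \<open>A negative value on \<open>dualv alpha\<close> means that \<open>v\<close> is not the
  top of its \<open>alpha\<close>-string, so \<open>[x,v]\<close> is a nonzero vector of weight
  \<open>alpha + beta\<close>.\<close>

lemma root_add_if_negative:
  assumes alpha: "alpha : roots h" and beta: "beta : roots h" and neg: "Re (beta (dualv alpha)) < 0" and ne: "alpha + beta ~= 0"
  shows "alpha + beta : roots h"
proof -
  obtain x where x: "x : g alpha" "x ~= 0" using root_space_nonzero[OF alpha] by blast
  obtain v where v: "v : g beta" "v ~= 0" using root_space_nonzero[OF beta] by blast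
  obtain y where y: "y : g (- alpha)" "killing x y = 1" using root_pairing[OF alpha x] by blast
  have "lie x v ~= 0"
  proof
    assume 0: "lie x v = 0"
    obtain n :: nat where n: "beta (dualv alpha) = of_nat n * alpha (dualv alpha) / 2"
      using root_string_weight[OF alpha x(1) y v] 0 by auto
    obtain r where r: "r > 0" "alpha (dualv alpha) = complex_of_real r" using root_norm_positive[OF alpha] by blast
    then have "real n * r < 0" using neg unfolding n by simp
    then show False using mult_nonneg_nonneg[of "real n" r] r by linarith
  qed
  then show ?thesis
    using rootI[OF hdual_plus[OF roots_hdual[OF alpha] roots_hdual[OF beta]] ne lie_root_space[OF x(1) v(1)]] by blast
qed

end

section \<open>Borel subalgebras and positive roots\<close>

lemma sum_mset_fun_apply: "(\<Sum>\<^sub># M) y = (\<Sum>f\<in>#M. f y)" for M :: "('a => complex) multiset" by (induction M) simp_all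

lemma Re_sum_mset: "Re (\<Sum>f\<in>#M. phi f) = (\<Sum>f\<in>#M. Re (phi f))" by (induction M) simp_all

lemma sum_mset_nonneg_real: "(!!f. f :# M ==> phi f >= (0::real)) ==> (\<Sum>f\<in>#M. phi f) >= 0" by (induction M) auto

context cartan_lie_algebra
begin

text \<open>Opposite members are excluded as well: this describes the roots of a solvable subalgebra
  that contains \<open>h\<close>.\<close>

definition closed_roots :: "('a => complex) set => bool" where
  "closed_roots S \<longleftrightarrow> S <= roots h & (ALL beta:S. ALL gamma:S. beta + gamma : roots h --> beta + gamma : S) & (ALL beta:S. - beta ~: S)"

lemma closed_roots_uminus:
  assumes "closed_roots S" shows "closed_roots (uminus ` S)"
proof -
  have S: "S <= roots h" "!!beta gamma. beta : S ==> gamma : S ==> beta + gamma : roots h ==> beta + gamma : S"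
    "!!beta. beta : S ==> - beta ~: S" using assms by (auto simp: closed_roots_def)
  have "- beta + - gamma : uminus ` S" if "beta : S" "gamma : S" "- beta + - gamma : roots h" for beta gamma
  proof -
    have "- (- beta + - gamma) = beta + gamma" by simp
    then have "beta + gamma : S" using S(2) that root_minus by metis
    moreover have "- beta + - gamma = - (beta + gamma)" by simp
    ultimately show ?thesis by blast
  qed
  moreover have "- (- beta) ~: uminus ` S" if "beta : S" for beta using S(3) that by (metis imageE minus_minus)
  moreover have "uminus ` S <= roots h" using S(1) root_minus by blast
  ultimately show ?thesis unfolding closed_roots_def by blast
qed

text \<open>If a sum vanishes, pairing it with \<open>dualv beta\<close> for a summand
  \<open>beta\<close> exhibits a summand \<open>gamma\<close> that is negative there. Then
  \<open>beta + gamma\<close> is in \<open>S\<close>, and merging the two gives a shorter vanishing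
  sum.\<close>

lemma closed_roots_sum_nonzero:
  "closed_roots S ==> set_mset M <= S ==> M ~= {#} ==> \<Sum>\<^sub># M ~= 0"
proof (induction "size M" arbitrary: M rule: less_induct)
  case less
  show ?case
  proof
    assume 0: "\<Sum>\<^sub># M = 0"
    obtain beta N where M: "M = add_mset beta N" using less.prems(3) by (metis multiset_cases)
    have S: "S <= roots h" "!!beta gamma. beta : S ==> gamma : S ==> beta + gamma : roots h ==> beta + gamma : S"
      "!!beta. beta : S ==> - beta ~: S" using less.prems(1) by (auto simp: closed_roots_def)
    have beta: "beta : S" "beta : roots h" using less.prems(2) M S by auto
    obtain r where r: "r > 0" "beta (dualv beta) = complex_of_real r" using root_norm_positive[OF beta(2)] by blast
    have "(\<Sum>\<^sub># M) (dualv beta) = 0" using 0 by simp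
    then have "beta (dualv beta) + (\<Sum>f\<in>#N. f (dualv beta)) = 0" by (simp add: M sum_mset_fun_apply)
    then have "Re (beta (dualv beta)) + (\<Sum>f\<in>#N. Re (f (dualv beta))) = 0"
      by (metis Re_sum_mset plus_complex.simps(1) zero_complex.simps(1))
    then have "(\<Sum>f\<in>#N. Re (f (dualv beta))) < 0" using r by simp
    then obtain gamma where gamma: "gamma :# N" "Re (gamma (dualv beta)) < 0"
      using sum_mset_nonneg_real[of N "%f. Re (f (dualv beta))"] by force
    have gammaS: "gamma : S" using gamma(1) less.prems(2) M by auto
    have "beta + gamma ~= 0" using S(3)[OF beta(1)] gammaS by (metis add.commute add_eq_0_iff)
    then have bg: "beta + gamma : S" using root_add_if_negative[OF beta(2), of gamma] gamma(2) S beta(1) gammaS by blast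
    obtain N' where N': "N = add_mset gamma N'" using gamma(1) by (metis insert_DiffM)
    have "\<Sum>\<^sub># (add_mset (beta + gamma) N') ~= 0" by (rule less.hyps) (use less.prems M N' bg in auto)
    then show False using 0 by (simp add: M N' add.assoc)
  qed
qed

text \<open>Adding nonempty sums from \<open>T\<close> is a strict order, because such sums are
  never zero.\<close>

lemma minimal_weight:
  assumes T: "closed_roots T" and X: "finite X" "X ~= {}"
  shows "EX m:X. ALL y:X. ALL M. set_mset M <= T --> M ~= {#} --> m ~= y + \<Sum>\<^sub># M"
proof -
  define lt where "lt beta gamma \<longleftrightarrow> (EX M. M ~= {#} & set_mset M <= T & gamma = beta + \<Sum>\<^sub># M)" for beta gamma
  have irr: "~ lt beta beta" for beta
    using closed_roots_sum_nonzero[OF T] unfolding lt_def by (metis add_cancel_right_right)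
  have tr: "lt beta delta" if l: "lt beta gamma" "lt gamma delta" for beta gamma delta
  proof -
    obtain M N where "M ~= {#}" "set_mset M <= T" "gamma = beta + \<Sum>\<^sub># M"
      "set_mset N <= T" "delta = gamma + \<Sum>\<^sub># N" using l unfolding lt_def by blast
    then show ?thesis unfolding lt_def by (intro exI[of _ "M + N"]) (auto simp: add.assoc)
  qed
  have "wf {(x, y). x : X & y : X & lt x y}"
  proof (rule finite_acyclic_wf)
    show "finite {(x, y). x : X & y : X & lt x y}" by (rule finite_subset[of _ "X \<times> X"]) (use X in auto)
    have "trans {(x, y). x : X & y : X & lt x y}" unfolding trans_def using tr by blast
    then show "acyclic {(x, y). x : X & y : X & lt x y}" using irr by (simp add: acyclic_def trancl_id)
  qed
  moreover obtain x0 where "x0 : X" using X by blast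
  ultimately obtain z where "z : X" "!!y. (y, z) : {(x, y). x : X & y : X & lt x y} ==> y ~: X" by (rule wfE_min) blast
  then show ?thesis unfolding lt_def by blast
qed

lemma root_space_subset:
  assumes "beta : roots h" "subspace V" "v : g beta" "v ~= 0" "v : V"
  shows "g beta <= V"
proof
  fix z assume "z : g beta"
  then obtain c where "z = scale c v" using root_space_one_dim assms by blast
  then show "z : V" using assms by (simp add: subspace_scale)
qed

text \<open>Root spaces are lines, so an \<open>h\<close>-stable subspace contains each of them or
  meets it only in zero.\<close>

lemma h_stable_subspace:
  assumes V: "subspace V" "!!y v. y : h ==> v : V ==> lie y v : V" "h <= V"
  shows "V = span (h \<union> (\<Union>beta\<in>{beta : roots h. g beta <= V}. g beta))"
proof
  let ?W = "span (h \<union> (\<Union>beta\<in>{beta : roots h. g beta <= V}. g beta))"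
  show "?W <= V" using V by (intro span_minimal) auto
  have "V <= span (\<Union>mu\<in>hdual. {v : V. ALL i:h. lie i v = scale (mu i) v})"
  proof (rule stable_subspace_weights[where opr = lie and wt = "%mu. mu"])
    show "V <= span (\<Union>mu\<in>hdual. {v. ALL i:h. lie i v = scale (mu i) v})"
      using weight_decomposition by (simp add: root_space_def)
  qed (use V hdual_separated lin_lie in auto)
  also have "... <= ?W"
  proof (rule span_minimal[OF _ subspace_span], rule subsetI)
    fix v assume "v : (\<Union>mu\<in>hdual. {v : V. ALL i:h. lie i v = scale (mu i) v})"
    then obtain mu where mu: "mu : hdual" "v : V" "v : g mu" by (auto simp: root_space_def)
    show "v : ?W"
    proof (cases "v = 0")
      case False
      then consider "mu = 0" | "mu : roots h" using root_weightD mu by blast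
      then show ?thesis
      proof cases
        case 1
        then have "v : h" using mu(3) centralizer_h by blast
        then show ?thesis by (intro span_base) blast
      next
        case 2
        then have "g mu <= V" using root_space_subset V(1) mu False by blast
        then show ?thesis using 2 mu(3) by (intro span_base) blast
      qed
    qed (simp add: span_zero)
  qed
  finally show "V <= ?W" .
qed

lemma lie_root_spaces_cases:
  assumes "beta : roots h" "gamma : roots h" "beta + gamma ~= 0" "x : g beta" "y : g gamma"
  shows "lie x y = 0 \<or> beta + gamma : roots h & lie x y : g (beta + gamma)"
proof (cases "lie x y = 0")
  case False
  have m: "lie x y : g (beta + gamma)" using lie_root_space[OF assms(4,5)] .
  show ?thesis
    using rootI[OF hdual_plus[OF roots_hdual[OF assms(1)] roots_hdual[OF assms(2)]] assms(3) m False] m by simp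
qed simp

lemma lie_h_root: "y : h ==> x : g beta ==> lie y x : g beta"
  using subspace_scale[OF subspace_root_space] by (simp add: root_space_def)

lemma lie_root_h: "y : h ==> x : g beta ==> lie x y : g beta"
  using subspace_neg[OF subspace_root_space lie_h_root[of y x]] lie_antisym[of x y] by simp

lemma closed_roots_no_opposite: "closed_roots S ==> beta : S ==> gamma : S ==> beta + gamma ~= 0"
  unfolding closed_roots_def by (metis add.commute add_eq_0_iff)

text \<open>The derived series is carried by the iterates of \<open>Q\<close>, which forms the sums
  of two members that stay in \<open>T\<close>. A minimal member of a nonempty set is not such a
  sum, so the iterates shrink strictly and become empty.\<close>

lemma closed_roots_subalgebra:
  assumes T: "closed_roots T"
  shows "subalgebra (span (h \<union> (\<Union>beta\<in>T. g beta)))" "solvable (span (h \<union> (\<Union>beta\<in>T. g beta)))"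
proof -
  let ?b = "span (h \<union> (\<Union>beta\<in>T. g beta))"
  have TR: "T <= roots h" and fT: "finite T" using T finite_roots finite_subset by (auto simp: closed_roots_def)
  define Q where "Q X = {beta + gamma |beta gamma. beta : X & gamma : X & beta + gamma : T}" for X
  have rr: "lie x y : span (\<Union>beta\<in>Q X. g beta)" if asm: "beta : X" "gamma : X" "x : g beta" "y : g gamma" "X <= T" for x y beta gamma X
  proof -
    have "beta + gamma ~= 0" using closed_roots_no_opposite[OF T, of beta gamma] asm by blast
    moreover have "beta : roots h" "gamma : roots h" using asm TR by auto
    ultimately consider "lie x y = 0" | "beta + gamma : roots h" "lie x y : g (beta + gamma)"
      using lie_root_spaces_cases[of beta gamma x y] asm(3,4) by blast
    then show ?thesis
    proof cases
      case 2
      then have "beta + gamma : T" using T asm unfolding closed_roots_def by blast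
      then have "beta + gamma : Q X" using asm unfolding Q_def by blast
      then show ?thesis using 2 by (intro span_base) blast
    qed (simp add: span_zero)
  qed
  have QT: "Q X <= T" for X by (auto simp: Q_def)
  have br: "lie x y : span (\<Union>beta\<in>T. g beta)" if xy: "x : ?b" "y : ?b" for x y
  proof (rule lie_span_closed[OF _ subspace_span xy])
    fix x y assume x: "x : h \<union> (\<Union>beta\<in>T. g beta)" and y: "y : h \<union> (\<Union>beta\<in>T. g beta)"
    show "lie x y : span (\<Union>beta\<in>T. g beta)"
    proof (cases "x : h")
      case True
      show ?thesis
      proof (cases "y : h")
        case False
        then obtain gamma where "gamma : T" "y : g gamma" using y by blast
        then show ?thesis using lie_h_root[OF True] by (intro span_base) blast
      qed (use True h_abelian span_zero in auto)
    next
      case False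
      then obtain beta where beta: "beta : T" "x : g beta" using x by blast
      show ?thesis
      proof (cases "y : h")
        case True
        then show ?thesis using beta lie_root_h by (intro span_base) blast
      next
        case False
        then obtain gamma where "gamma : T" "y : g gamma" using y by blast
        then have "lie x y : span (\<Union>beta\<in>Q T. g beta)" using rr beta by blast
        moreover have "(\<Union>beta\<in>Q T. g beta) <= (\<Union>beta\<in>T. g beta)" using QT by blast
        ultimately show ?thesis using span_mono by blast
      qed
    qed
  qed
  have sb: "span (\<Union>beta\<in>T. g beta) <= ?b" by (rule span_mono) blast
  show sub: "subalgebra ?b" unfolding subalgebra_def using br sb by blast
  have der: "derived_series ?b (Suc i) <= span (\<Union>beta\<in>(Q ^^ i) T. g beta) & (Q ^^ i) T <= T" for i
  proof (induction i)
    case 0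
    have "{lie x y |x y. x : ?b & y : ?b} <= span (\<Union>beta\<in>T. g beta)" using br by blast
    then have "derived_series ?b (Suc 0) <= span (\<Union>beta\<in>T. g beta)"
      unfolding derived_series.simps by (rule span_minimal) (rule subspace_span)
    then show ?case unfolding funpow_0 by simp
  next
    case (Suc i)
    let ?X = "(Q ^^ i) T"
    have X: "?X <= T" using Suc by blast
    have "lie x y : span (\<Union>beta\<in>Q ?X. g beta)"
      if "x : derived_series ?b (Suc i)" "y : derived_series ?b (Suc i)" for x y
      by (rule lie_span_closed[OF _ subspace_span, of "\<Union>beta\<in>?X. g beta" "\<Union>beta\<in>?X. g beta"])
        (use rr X Suc that in blast)+
    then have "derived_series ?b (Suc (Suc i)) <= span (\<Union>beta\<in>Q ?X. g beta)"
      unfolding derived_series.simps(2)[of _ "Suc i"] by (intro span_minimal subspace_span) blast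
    then show ?case using QT by simp
  qed
  have mono: "Q X <= Q Y" if "X <= Y" for X Y using that by (auto simp: Q_def) 
  have dec: "(Q ^^ Suc i) T <= (Q ^^ i) T" for i by (induction i) (use QT mono in auto)
  have strict: "(Q ^^ Suc i) T \<subset> (Q ^^ i) T" if ne: "(Q ^^ i) T ~= {}" for i
  proof (rule ccontr)
    assume "~ ?thesis"
    then have eq: "Q ((Q ^^ i) T) = (Q ^^ i) T" using dec[of i] by auto
    let ?X = "(Q ^^ i) T"
    have X: "?X <= T" using der by blast
    obtain m where m: "m : ?X" "!!y M. y : ?X ==> set_mset M <= T ==> M ~= {#} ==> m ~= y + \<Sum>\<^sub># M"
      using minimal_weight[OF T finite_subset[OF X fT] ne] by metis
    then obtain beta gamma where "m = beta + gamma" "beta : ?X" "gamma : ?X" using eq unfolding Q_def by blast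
    then show False using m(2)[of beta "{#gamma#}"] X by auto
  qed
  have "EX i. (Q ^^ i) T = {}"
  proof (rule ccontr)
    assume n: "~ ?thesis"
    have "card ((Q ^^ i) T) + i <= card T" for i
    proof (induction i)
      case (Suc i)
      have "finite ((Q ^^ i) T)" using der fT finite_subset by blast
      then have "card ((Q ^^ Suc i) T) < card ((Q ^^ i) T)" using strict[of i] n by (intro psubset_card_mono) auto
      then show ?case using Suc by simp
    qed simp
    from this[of "Suc (card T)"] show False by simp
  qed
  then obtain i where "(Q ^^ i) T = {}" by blast
  then have "derived_series ?b (Suc i) <= {0}" using der[of i] by simp
  moreover have "0 : derived_series ?b (Suc i)" by (simp add: span_zero)
  ultimately show "solvable ?b" unfolding solvable_def by blast
qed

text \<open>Brackets of root vectors are nonzero when the weights add up to a root, which gives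
  closedness. Opposite roots would provide an sl2 triple whose vectors survive in every term of the
  derived series.\<close>

lemma solvable_subalgebra_positive_roots:
  assumes b: "subalgebra b" "solvable b"
  shows "closed_roots (positive_roots h b)" unfolding closed_roots_def
proof (intro conjI ballI impI notI)
  show "positive_roots h b <= roots h" by (auto simp: positive_roots_def)
  fix beta assume "beta : positive_roots h b"
  then have beta: "beta : roots h" "g beta <= b" by (auto simp: positive_roots_def)
  obtain x where x: "x : g beta" "x ~= 0" using root_space_nonzero[OF beta(1)] by blast
  {
    fix gamma assume "gamma : positive_roots h b" and s: "beta + gamma : roots h"
    then have gamma: "gamma : roots h" "g gamma <= b" by (auto simp: positive_roots_def)
    obtain y where y: "y : g gamma" "y ~= 0" using root_space_nonzero[OF gamma(1)] by blast
    have "lie x y : b" using x y beta gamma subalg_lie[OF b(1)] by blast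
    then have "g (beta + gamma) <= b"
      using root_space_subset[OF s subalg_subspace[OF b(1)] lie_root_space[OF x(1) y(1)]
          lie_roots_nonzero[OF beta(1) gamma(1) s x y]] by blast
    then show "beta + gamma : positive_roots h b" using s by (simp add: positive_roots_def)
  }
  assume "- beta : positive_roots h b"
  then have m: "g (- beta) <= b" by (simp add: positive_roots_def)
  obtain y where y: "y : g (- beta)" "killing x y = 1" using root_pairing[OF beta(1) x] by blast
  define t where "t = dualv beta"
  have t: "lie x y = t" using lie_opposite_roots[OF beta(1) x(1) y(1)] y(2) by (simp add: t_def)
  have th: "t : h" unfolding t_def by (rule dualv[OF root_hlinear[OF beta(1)]])
  define c where "c = beta t"
  have c: "c ~= 0" using root_norm_nonzero[OF beta(1)] by (simp add: c_def t_def)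
  have tx: "lie t x = scale c x" "lie t y = scale (- c) y" using x(1) y(1) th by (auto simp: root_space_def c_def)
  have "x : derived_series b i & y : derived_series b i" for i
  proof (induction i)
    case 0
    then show ?case using x y beta m by auto
  next
    case (Suc i)
    let ?D = "derived_series b i"
    have sub: "subalgebra ?D" using derived_series_subset[OF b(1)] by blast
    have tD: "t : ?D" using subalg_lie[OF sub] Suc t by metis
    have "lie t x : derived_series b (Suc i)" "lie t y : derived_series b (Suc i)"
      using tD Suc by (auto intro!: span_base)
    then have "scale (1 / c) (lie t x) : derived_series b (Suc i)" "scale (- (1 / c)) (lie t y) : derived_series b (Suc i)"
      by (auto intro!: subspace_scale[OF subspace_span] simp del: scale_minus_left)
    then show ?case using c by (simp only: tx) simp
  qed
  moreover obtain i where "derived_series b i = {0}" using b(2) solvable_def by blast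
  ultimately show False using x(2) by blast
qed

text \<open>If neither \<open>alpha\<close> nor \<open>- alpha\<close> were positive, one of them could be added to the positive roots.\<close>

lemma borel_all_roots:
  assumes b: "borel_subalgebra b" "h <= b" and alpha: "alpha : roots h"
  shows "alpha : positive_roots h b \<or> - alpha : positive_roots h b"
proof (rule ccontr)
  let ?S = "positive_roots h b"
  assume n: "~ ?thesis"
  have sb: "subalgebra b" "solvable b" using b by (auto simp: borel_subalgebra_def)
  have S: "closed_roots ?S" using solvable_subalgebra_positive_roots[OF sb] .
  define G where "G eps = {beta : roots h. EX M k. set_mset M <= ?S & beta = \<Sum>\<^sub># M + (%y. of_nat k * eps y)}" for eps :: "'a => complex"
  \<comment> \<open>If no such positive combination vanished, the roots in the cone
    \<open>G eps\<close> would form a closed set, and its solvable subalgebra would contradict the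
    maximality of \<open>b\<close>.\<close>
  have key: "EX M k. M ~= {#} & set_mset M <= ?S & k > (0::nat) & \<Sum>\<^sub># M + (%y. of_nat k * eps y) = 0"
    if eps: "eps : roots h" "eps ~: ?S" for eps
  proof (rule ccontr)
    assume no: "~ ?thesis"
    have ne: "\<Sum>\<^sub># M + (%y. of_nat k * eps y) ~= 0" if M: "set_mset M <= ?S" "M ~= {#} \<or> k > 0" for M and k :: nat
    proof
      assume 0: "\<Sum>\<^sub># M + (%y. of_nat k * eps y) = 0"
      show False
      proof (cases "k = 0")
        case True
        then have "\<Sum>\<^sub># M = 0" using 0 by (auto simp: fun_eq_iff)
        then show False using closed_roots_sum_nonzero[OF S M(1)] M(2) True by auto
      next
        case False
        show False
        proof (cases "M = {#}")
          case True
          then have "of_nat k * eps y = 0" for y using 0 by (auto simp: fun_eq_iff)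
          then show False using False zero_not_root eps(1) by (metis mult_eq_0_iff of_nat_eq_0_iff zero_fun_apply ext)
        qed (use no 0 M False in blast)
      qed
    qed
    have G: "closed_roots (G eps)" unfolding closed_roots_def
    proof (intro conjI ballI impI notI)
      show "G eps <= roots h" by (auto simp: G_def)
      fix beta assume beta: "beta : G eps"
      then obtain M k where M: "set_mset M <= ?S" "beta = \<Sum>\<^sub># M + (%y. of_nat k * eps y)" by (auto simp: G_def)
      have sum: "\<Sum>\<^sub># M + (%y. of_nat k * eps y) + (\<Sum>\<^sub># N + (%y. of_nat l * eps y)) =
        \<Sum>\<^sub># (M + N) + (%y. of_nat (k + l) * eps y)" for N l by (rule ext) (simp add: algebra_simps)
      {
        fix gamma assume "gamma : G eps" "beta + gamma : roots h"
        then obtain N l where N: "set_mset N <= ?S" "gamma = \<Sum>\<^sub># N + (%y. of_nat l * eps y)" by (auto simp: G_def)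
        have "beta + gamma = \<Sum>\<^sub># (M + N) + (%y. of_nat (k + l) * eps y)" unfolding M N by (rule sum)
        moreover have "set_mset (M + N) <= ?S" using M N by simp
        ultimately show "beta + gamma : G eps" using \<open>beta + gamma : roots h\<close> unfolding G_def by blast
      }
      assume "- beta : G eps"
      then obtain N l where N: "set_mset N <= ?S" "- beta = \<Sum>\<^sub># N + (%y. of_nat l * eps y)" by (auto simp: G_def)
      have "beta + - beta = \<Sum>\<^sub># (M + N) + (%y. of_nat (k + l) * eps y)" unfolding N(2) unfolding M(2) by (rule sum)
      then have "\<Sum>\<^sub># (M + N) + (%y. of_nat (k + l) * eps y) = 0" by simp
      moreover have "M + N ~= {#} \<or> k + l > 0"
      proof (rule ccontr)
        assume "~ ?thesis"
        then have "beta = 0" using M(2) by (auto simp: fun_eq_iff)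
        then show False using beta zero_not_root by (auto simp: G_def)
      qed
      moreover have "set_mset (M + N) <= ?S" using M N by simp
      ultimately show False using ne[of "M + N" "k + l"] by blast
    qed
    have SG: "?S <= G eps"
    proof
      fix beta assume "beta : ?S"
      then have "beta : roots h" "set_mset {#beta#} <= ?S" by (auto simp: positive_roots_def)
      moreover have "beta = \<Sum>\<^sub># {#beta#} + (%y. of_nat 0 * eps y)" by (rule ext) simp
      ultimately show "beta : G eps" unfolding G_def by blast
    qed
    have "eps = \<Sum>\<^sub># {#} + (%y. of_nat 1 * eps y)" by (rule ext) simp
    moreover have "set_mset {#} <= ?S" by simp
    ultimately have "eps : G eps" using eps(1) unfolding G_def by blast
    have "b = span (h \<union> (\<Union>beta\<in>{beta : roots h. g beta <= b}. g beta))"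
      using h_stable_subspace[of b] sb b(2) subalg_subspace subalg_lie by blast
    also have "... <= span (h \<union> (\<Union>beta\<in>G eps. g beta))" using SG by (intro span_mono) (auto simp: positive_roots_def)
    finally have "b <= span (h \<union> (\<Union>beta\<in>G eps. g beta))" .
    then have bG: "b = span (h \<union> (\<Union>beta\<in>G eps. g beta))"
      using b(1) closed_roots_subalgebra[OF G] unfolding borel_subalgebra_def by blast
    have "g eps <= h \<union> (\<Union>beta\<in>G eps. g beta)" using \<open>eps : G eps\<close> by blast
    also have "... <= b" unfolding bG by (rule span_superset)
    finally have "g eps <= b" .
    then show False using eps by (simp add: positive_roots_def)
  qed
  obtain M k where M: "M ~= {#}" "set_mset M <= ?S" "k > (0::nat)" "\<Sum>\<^sub># M + (%y. of_nat k * alpha y) = 0"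
    using key[OF alpha] n by blast
  obtain N l where N: "N ~= {#}" "set_mset N <= ?S" "l > (0::nat)" "\<Sum>\<^sub># N + (%y. of_nat l * (- alpha) y) = 0"
    using key[OF root_minus[OF alpha]] n by blast
  \<comment> \<open>The multiplicities cancel the contributions of \<open>alpha\<close> and
    \<open>- alpha\<close> and leave a vanishing sum of positive roots.\<close>
  let ?L = "repeat_mset l M + repeat_mset k N"
  have rep: "(\<Sum>\<^sub># (repeat_mset n X)) y = of_nat n * (\<Sum>\<^sub># X) y" for n y and X :: "('a => complex) multiset"
    by (induction n) (simp_all add: algebra_simps)
  have Ms: "(\<Sum>\<^sub># M) y = - (of_nat k * alpha y)" for y using fun_cong[OF M(4), of y] by (simp add: add_eq_0_iff2)
  have Ns: "(\<Sum>\<^sub># N) y = of_nat l * alpha y" for y using fun_cong[OF N(4), of y] by simp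
  have "\<Sum>\<^sub># ?L = 0" by (rule ext) (simp add: rep Ms Ns algebra_simps)
  moreover have "set_mset (repeat_mset n X) <= set_mset X" for n and X :: "('a => complex) multiset"
    by (induction n) auto
  then have "set_mset ?L <= ?S" using M(2) N(2) by (simp only: set_mset_union) blast
  moreover have "repeat_mset l M ~= {#}" using M(1) N(3) by (cases l) auto
  then have "?L ~= {#}" by simp
  ultimately show False using closed_roots_sum_nonzero[OF S] by blast
qed

text \<open>The difference of the two expansions is a vanishing sum of vectors of distinct
  weights.\<close>

lemma disjoint_weights_inter:
  assumes "A <= hdual" "C <= hdual" "A \<inter> C = {}" "x : span (\<Union>mu\<in>A. g mu)" "x : span (\<Union>mu\<in>C. g mu)"
  shows "x = 0"
proof -
  obtain M c where M: "finite M" "M <= A" "ALL mu:M. c mu : g mu" "x = (\<Sum>mu\<in>M. c mu)"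
    using span_subspaces_sum[OF assms(4) subspace_root_space] by blast
  obtain N d where N: "finite N" "N <= C" "ALL mu:N. d mu : g mu" "x = (\<Sum>mu\<in>N. d mu)"
    using span_subspaces_sum[OF assms(5) subspace_root_space] by blast
  define e where "e mu = (if mu : M then c mu else - d mu)" for mu
  have MN: "M \<inter> N = {}" using M N assms by blast
  have "(\<Sum>mu\<in>M \<union> N. e mu) = (\<Sum>mu\<in>M. e mu) + (\<Sum>mu\<in>N. e mu)" using M N MN by (intro sum.union_disjoint) auto
  also have "(\<Sum>mu\<in>M. e mu) = x" unfolding M(4) by (rule sum.cong) (auto simp: e_def)
  also have "(\<Sum>mu\<in>N. e mu) = (\<Sum>mu\<in>N. - d mu)" using MN by (intro sum.cong) (auto simp: e_def)
  also have "x + ... = 0" unfolding N(4) by (simp add: sum_negf)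
  finally have "ALL mu:M \<union> N. e mu : {0}"
  proof (intro weight_components_mem[where H = h and opr = lie and wt = "%mu. mu"])
    show "EX i:h. mu i ~= nu i" if "mu : M \<union> N" "nu : M \<union> N" "mu ~= nu" for mu nu
      using that M N assms by (intro hdual_separated) auto
    show "lie i (e mu) = scale (mu i) (e mu)" if "mu : M \<union> N" "i : h" for i mu
      using M(3) N(3) that by (auto simp: e_def root_space_def lie_neg_right)
  qed (use M N lin_lie in auto)
  then have "e mu = 0" if "mu : M" for mu using that by blast
  then have "ALL mu:M. c mu = 0" unfolding e_def by simp
  then show ?thesis unfolding M(4) by (intro sum.neutral)
qed

end

context complex_lie_algebra
begin

lemma subalgebra_hull: "subalgebra (subalgebra hull X)" by (rule hull_in) (auto simp: subalgebra_def subspace_Inter)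

end

sublocale standard_parabolic \<subseteq> cartan_lie_algebra scale lie h using semisimple cartan by unfold_locales

section \<open>The Levi subalgebra of K and the two nilradicals\<close>

context standard_parabolic
begin

abbreviation "pos \<equiv> positive_roots h b"

lemma closed_pos: "closed_roots pos"
  using solvable_subalgebra_positive_roots borel(1) by (auto simp: borel_subalgebra_def)

lemma pos_or_neg: "beta : roots h ==> beta : pos \<or> - beta : pos" using borel_all_roots borel by blast

lemma pos_root: "beta : pos ==> beta : roots h" using closed_pos by (auto simp: closed_roots_def)

lemma simple_root: "i : K t ==> \<alpha> i : simple_roots h b" using simple m_le_n bij_betwE by (fastforce simp: K_def)

lemma simple_pos: "i : K t ==> \<alpha> i : pos" using simple_root by (auto simp: simple_roots_def)

lemma simple_indecomposable:
  "i : K t ==> beta : pos ==> gamma : pos ==> \<alpha> i ~= beta + gamma"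
  using simple_root unfolding simple_roots_def plus_fun_def by blast

lemma subalgebra_l_K: "subalgebra (l_K t)" unfolding l_K_def by (rule subalgebra_hull)

lemma l_K_superset: "h <= l_K t" "i : K t ==> g (\<alpha> i) <= l_K t" "i : K t ==> g (- \<alpha> i) <= l_K t"
  unfolding l_K_def using hull_subset[of "h \<union> (\<Union>i\<in>K t. g (\<alpha> i) \<union> g (- \<alpha> i))" subalgebra] by blast+

lemma l_K_minimal:
  assumes "subalgebra T" "h <= T" "!!i. i : K t ==> g (\<alpha> i) <= T" "!!i. i : K t ==> g (- \<alpha> i) <= T"
  shows "l_K t <= T" unfolding l_K_def by (rule hull_minimal[where S = subalgebra]) (use assms in blast)+

lemma levi_subset_l_K: "levi_subalgebra h p <= l_K t" unfolding levi l_K_def by (rule hull_mono) (auto simp: K_def)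

lemma subalgebra_levi: "subalgebra (levi_subalgebra h p)" unfolding levi by (rule subalgebra_hull)

definition roots_K :: "(nat => complex) => ('a => complex) set" where
  "roots_K t = {beta : roots h. g beta <= l_K t}"

lemma l_K_span: "l_K t = span (h \<union> (\<Union>beta\<in>roots_K t. g beta))" unfolding roots_K_def by (rule h_stable_subspace)
    (use subalgebra_l_K[of t] l_K_superset(1)[of t] in \<open>auto simp: subalgebra_def\<close>)

lemma roots_K_add:
  assumes "beta : roots_K t" "gamma : roots_K t" "beta + gamma : roots h"
  shows "beta + gamma : roots_K t"
proof -
  have beta: "beta : roots h" "g beta <= l_K t" and gamma: "gamma : roots h" "g gamma <= l_K t"
    using assms by (auto simp: roots_K_def)
  obtain x where x: "x : g beta" "x ~= 0" using root_space_nonzero[OF beta(1)] by blast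
  obtain y where y: "y : g gamma" "y ~= 0" using root_space_nonzero[OF gamma(1)] by blast
  have "lie x y : l_K t" using x y beta gamma subalg_lie[OF subalgebra_l_K] by blast
  then have "g (beta + gamma) <= l_K t"
    using root_space_subset[OF assms(3) subalg_subspace[OF subalgebra_l_K] lie_root_space[OF x(1) y(1)]
        lie_roots_nonzero[OF beta(1) gamma(1) assms(3) x y]] by blast
  then show ?thesis using assms(3) by (simp add: roots_K_def)
qed

text \<open>The span of \<open>h\<close> and of the root spaces for which both signs occur is a
  subalgebra containing the generators, so by minimality it contains \<open>l_K\<close>;
  independence of weights does the rest.\<close>

lemma roots_K_minus:
  assumes "beta : roots_K t" shows "- beta : roots_K t"
proof -
  let ?R = "{beta : roots_K t. - beta : roots_K t}"
  let ?V = "span (h \<union> (\<Union>beta\<in>?R. g beta))"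
  have hV: "x : ?V" if "x : h" for x using that by (intro span_base) blast
  have gV: "x : ?V" if "beta : ?R" "x : g beta" for beta x using that by (intro span_base) blast
  have br: "lie x y : ?V" if x: "x : h \<union> (\<Union>beta\<in>?R. g beta)" and y: "y : h \<union> (\<Union>beta\<in>?R. g beta)" for x y
  proof -
    consider "x : h" "y : h" | beta where "beta : ?R" "x : g beta" "y : h" | beta where "beta : ?R" "y : g beta" "x : h"
      | beta gamma where "beta : ?R" "x : g beta" "gamma : ?R" "y : g gamma" using x y by blast
    then show ?thesis
    proof cases
      case 1
      then show ?thesis using h_abelian span_zero by simp
    next
      case (2 beta)
      then show ?thesis using gV lie_root_h by blast
    next
      case (3 beta)
      then show ?thesis using gV lie_h_root by blast
    next
      case (4 beta gamma)
      have r: "beta : roots h" "gamma : roots h" using 4 by (auto simp: roots_K_def)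
      show ?thesis
      proof (cases "beta + gamma = 0")
        case True
        then have "gamma = - beta" by (simp add: add_eq_0_iff)
        then have "lie x y = scale (killing x y) (dualv beta)" using lie_opposite_roots[OF r(1)] 4 by blast
        then show ?thesis using hV[OF dualv(1)[OF root_hlinear[OF r(1)]]] by (simp add: span_scale)
      next
        case False
        then consider "lie x y = 0" | "beta + gamma : roots h" "lie x y : g (beta + gamma)"
          using lie_root_spaces_cases[OF r] 4 by blast
        then show ?thesis
        proof cases
          case s: 2
          have "- (beta + gamma) = - beta + - gamma" by simp
          then have "- beta + - gamma : roots h" using root_minus[OF s(1)] by metis
          then have "- beta + - gamma : roots_K t" using 4 by (intro roots_K_add) auto
          then have "- (beta + gamma) : roots_K t" by simp
          moreover have "beta + gamma : roots_K t" using 4 s by (intro roots_K_add) auto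
          ultimately show ?thesis using gV s(2) by blast
        qed (simp add: span_zero)
      qed
    qed
  qed
  have sub: "subalgebra ?V" unfolding subalgebra_def
    by (intro conjI ballI subspace_span, rule lie_span_closed[OF br subspace_span])
  have sK: "\<alpha> i : ?R & - \<alpha> i : ?R" if "i : K t" for i
    using that l_K_superset root_minus[OF pos_root[OF simple_pos[OF that]]] pos_root[OF simple_pos[OF that]]
    by (simp add: roots_K_def)
  have "l_K t <= ?V" by (rule l_K_minimal[OF sub]) (use hV gV sK in blast)+
  have beta: "beta : roots h" "g beta <= l_K t" using assms by (auto simp: roots_K_def)
  obtain x where x: "x : g beta" "x ~= 0" using root_space_nonzero[OF beta(1)] by blast
  show ?thesis
  proof (rule ccontr)
    assume n: "- beta ~: roots_K t"
    have "x : ?V" using x beta \<open>l_K t <= ?V\<close> by blast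
    moreover have "h \<union> (\<Union>beta\<in>?R. g beta) = (\<Union>mu\<in>insert 0 ?R. g mu)" by (simp add: centralizer_h)
    ultimately have "x : span (\<Union>mu\<in>insert 0 ?R. g mu)" by simp
    moreover have "x : span (\<Union>mu\<in>{beta}. g mu)" using x by (intro span_base) blast
    ultimately have "x = 0"
      using disjoint_weights_inter[of "insert 0 ?R" "{beta}" x] n zero_not_root beta(1) roots_hdual hdual_zero
      by (auto simp: roots_K_def subset_iff)
    then show False using x by simp
  qed
qed

text \<open>What the positive and the negative roots have in common, so that \<open>u_K_plus\<close>
  and \<open>u_K_minus\<close> can be treated together.\<close>

definition stable_positive :: "(nat => complex) => ('a => complex) set => bool" where
  "stable_positive t P \<longleftrightarrow> closed_roots P &
    (ALL beta:P. ALL i:K t. ALL eps:{\<alpha> i, - \<alpha> i}. eps + beta : roots h --> eps + beta : P)"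

text \<open>If subtracting a simple root from \<open>beta\<close> gave a negative root, the simple
  root would be a sum of two positive roots.\<close>

lemma pos_add_simple:
  assumes "beta : pos" "i : K t" "eps : {\<alpha> i, - \<alpha> i}" "eps + beta : roots h"
  shows "eps + beta : pos"
proof (cases "eps = \<alpha> i")
  case True
  then show ?thesis using closed_pos assms simple_pos by (auto simp: closed_roots_def)
next
  case False
  then have eps: "eps = - \<alpha> i" using assms by simp
  show ?thesis
  proof (rule ccontr)
    assume "eps + beta ~: pos"
    then have "- (eps + beta) : pos" using pos_or_neg assms by blast
    moreover have "\<alpha> i = - (eps + beta) + beta" by (simp add: eps)
    ultimately show False using simple_indecomposable[OF assms(2)] assms(1) by blast
  qed
qed

lemma stable_positive_pos: "stable_positive t pos"
  unfolding stable_positive_def using closed_pos pos_add_simple by blast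

lemma stable_positive_neg: "stable_positive t (uminus ` pos)" unfolding stable_positive_def
proof (intro conjI ballI impI)
  show "closed_roots (uminus ` pos)" using closed_roots_uminus[OF closed_pos] .
  fix gamma i eps assume "gamma : uminus ` pos" and i: "i : K t" and eps: "eps : {\<alpha> i, - \<alpha> i}" and r: "eps + gamma : roots h"
  then obtain beta where beta: "beta : pos" "gamma = - beta" by blast
  have eq: "- (eps + gamma) = - eps + beta" unfolding beta(2) by simp
  have "- eps + beta : roots h" using root_minus[OF r] eq by metis
  moreover have "- eps : {\<alpha> i, - \<alpha> i}" using eps by auto
  ultimately have "- (eps + gamma) : pos" unfolding eq using pos_add_simple[OF beta(1) i] by blast
  then have "- (- (eps + gamma)) : uminus ` pos" by blast
  then show "eps + gamma : uminus ` pos" by (simp only: minus_minus)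
qed

definition nilradical :: "(nat => complex) => ('a => complex) set => 'a set" where
  "nilradical t P = span (\<Union>beta\<in>P - roots_K t. g beta)"

lemma subspace_nilradical: "subspace (nilradical t P)" unfolding nilradical_def by (rule subspace_span)

lemma u_K_plus_eq: "u_K_plus t = nilradical t pos"
proof -
  have "{beta : pos. ~ g beta <= l_K t} = pos - roots_K t" using pos_root by (auto simp: roots_K_def)
  then show ?thesis by (simp add: u_K_plus_def nilradical_def)
qed

lemma u_K_minus_eq: "u_K_minus t = nilradical t (uminus ` pos)"
proof -
  have "(\<Union>beta\<in>{beta : pos. ~ g (- beta) <= l_K t}. g (- beta)) = (\<Union>beta\<in>uminus ` pos - roots_K t. g beta)"
    using pos_root root_minus by (auto simp: roots_K_def)
  then show ?thesis by (simp add: u_K_minus_def nilradical_def)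
qed

text \<open>The elements that preserve the nilradical form a subalgebra, so it suffices to look at
  the generators of \<open>l_K\<close>.\<close>

lemma l_K_nilradical:
  assumes P: "stable_positive t P" and x: "x : l_K t" and u: "u : nilradical t P"
  shows "lie x u : nilradical t P"
proof -
  let ?U = "nilradical t P"
  let ?T = "{x. ALL u:?U. lie x u : ?U}"
  have PR: "P <= roots h" using P by (auto simp: stable_positive_def closed_roots_def)
  have T: "subalgebra ?T" unfolding subalgebra_def
  proof
    show "subspace ?T" by (rule subspaceI)
      (auto simp: lie_add_left lie_scale_left subspace_0 subspace_add subspace_scale subspace_nilradical)
    show "ALL x:?T. ALL y:?T. lie x y : ?T" by (auto simp: lie_lie_left intro!: subspace_diff[OF subspace_nilradical])
  qed
  have U: "z : ?U" if "beta : P - roots_K t" "z : g beta" for z beta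
    unfolding nilradical_def using that by (intro span_base) blast
  have gen: "y : ?T" if y: "!!beta v. beta : P - roots_K t ==> v : g beta ==> lie y v : ?U" for y
  proof -
    have "lie y u : ?U" if "u : ?U" for u by (rule lie_span_closed[of "{y}" "\<Union>beta\<in>P - roots_K t. g beta"])
        (use that y subspace_nilradical in \<open>auto simp: nilradical_def span_base\<close>)
    then show ?thesis by blast
  qed
  have sim: "g eps <= ?T" if i: "i : K t" and eps: "eps : {\<alpha> i, - \<alpha> i}" for i eps
  proof
    fix y assume y: "y : g eps"
    have "eps : roots h" "- eps : roots h" "g (- eps) <= l_K t" "g eps <= l_K t"
      using eps pos_root[OF simple_pos[OF i]] root_minus l_K_superset(2,3)[OF i] by auto
    then have e: "eps : roots_K t" "- eps : roots_K t" "eps : roots h" by (auto simp: roots_K_def)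
    show "y : ?T"
    proof (rule gen)
      fix beta v assume beta: "beta : P - roots_K t" and v: "v : g beta"
      have "eps + beta ~= 0"
      proof
        assume "eps + beta = 0"
        then have "beta = - eps" by (simp add: add_eq_0_iff)
        then show False using beta e by blast
      qed
      then consider "lie y v = 0" | "eps + beta : roots h" "lie y v : g (eps + beta)"
        using lie_root_spaces_cases[OF e(3), of beta y v] beta y v PR by blast
      then show "lie y v : ?U"
      proof cases
        case 2
        then have "eps + beta : P" using P beta i eps unfolding stable_positive_def by blast
        moreover have "eps + beta ~: roots_K t"
        proof
          assume "eps + beta : roots_K t"
          moreover have "- eps + (eps + beta) = beta" by simp
          ultimately have "beta : roots_K t" using roots_K_add[OF e(2)] beta PR by (metis DiffD1 subsetD)
          then show False using beta by blast
        qed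
        ultimately show ?thesis using U 2(2) by blast
      qed (simp add: subspace_0 subspace_nilradical)
    qed
  qed
  have "h <= ?T"
  proof
    fix y assume "y : h"
    then show "y : ?T" by (intro gen) (use U lie_h_root in blast)
  qed
  then have "l_K t <= ?T" by (intro l_K_minimal T) (use sim in blast)+
  then show ?thesis using x u by blast
qed

text \<open>The danger is that \<open>beta + gamma\<close> is a root of \<open>l_K\<close>. Pair
  \<open>[u,v]\<close> with an opposite root vector \<open>w\<close> of \<open>l_K\<close>: by
  invariance \<open>w\<close> acts on \<open>v\<close> instead, the result stays in the nilradical,
  and \<open>u\<close> is orthogonal to it since \<open>P\<close> has no opposite roots.\<close>

lemma nilradical_closed:
  assumes P: "stable_positive t P" and x: "x : nilradical t P" and y: "y : nilradical t P"
  shows "lie x y : nilradical t P" using x y unfolding nilradical_def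
proof (rule lie_span_closed[rotated 2])
  show "subspace (span (\<Union>beta\<in>P - roots_K t. g beta))" by (rule subspace_span)
  fix u v assume "u : (\<Union>beta\<in>P - roots_K t. g beta)" "v : (\<Union>beta\<in>P - roots_K t. g beta)"
  then obtain beta gamma where beta: "beta : P" "beta ~: roots_K t" "u : g beta" and gamma: "gamma : P" "gamma ~: roots_K t" "v : g gamma"
    by blast
  have cP: "closed_roots P" using P by (simp add: stable_positive_def)
  then have r: "beta : roots h" "gamma : roots h" using beta gamma by (auto simp: closed_roots_def)
  consider "lie u v = 0" | "lie u v ~= 0" "beta + gamma : roots h" "lie u v : g (beta + gamma)"
    using lie_root_spaces_cases[OF r closed_roots_no_opposite[OF cP beta(1) gamma(1)] beta(3) gamma(3)] by blast
  then show "lie u v : span (\<Union>beta\<in>P - roots_K t. g beta)"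
  proof cases
    case 2
    have "beta + gamma ~: roots_K t"
    proof
      assume d: "beta + gamma : roots_K t"
      obtain w where w: "w : g (- (beta + gamma))" "killing (lie u v) w = 1" using root_pairing[OF 2(2,3,1)] by blast
      have "w : l_K t" using roots_K_minus[OF d] w(1) by (auto simp: roots_K_def)
      moreover have "v : nilradical t P" unfolding nilradical_def using gamma by (intro span_base) blast
      ultimately have "lie w v : nilradical t P" using l_K_nilradical[OF P] by blast
      then have "killing u (lie w v) = 0" unfolding nilradical_def
      proof (rule killing_vanishes_on_span[rotated])
        fix z assume "z : (\<Union>beta\<in>P - roots_K t. g beta)"
        then obtain delta where delta: "delta : P" "z : g delta" by blast
        have "beta + delta ~= 0" using closed_roots_no_opposite[OF cP beta(1) delta(1)] .
        moreover have "beta + delta : hdual"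
          using cP beta(1) delta(1) roots_hdual by (intro hdual_plus) (auto simp: closed_roots_def)
        ultimately obtain y where "y : h" "(beta + delta) y ~= 0"
          using hdual_separated[OF _ hdual_zero, of "beta + delta"] by auto
        then show "killing u z = 0" using killing_root_space[OF beta(3) delta(2)] by simp
      qed
      then have "killing (lie u v) w = 0"
        unfolding killing_invariant by (simp add: lie_antisym[of v w] killing_neg_right)
      then show False using w(2) by simp
    qed
    moreover have "beta + gamma : P" using cP beta gamma 2(2) by (auto simp: closed_roots_def)
    ultimately show ?thesis using 2(3) by (intro span_base) blast
  qed (simp add: span_zero)
qed

lemma nilradicals_disjoint:
  assumes "x : nilradical t pos" "x : nilradical t (uminus ` pos)" shows "x = 0"
proof (rule disjoint_weights_inter[of "pos - roots_K t" "uminus ` pos - roots_K t"])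
  show "pos - roots_K t <= hdual" "uminus ` pos - roots_K t <= hdual" using pos_root root_minus roots_hdual by auto
  show "(pos - roots_K t) \<inter> (uminus ` pos - roots_K t) = {}" using closed_pos by (auto simp: closed_roots_def)
qed (use assms in \<open>simp_all add: nilradical_def\<close>)

end

section \<open>The Casimir operator and complete reducibility\<close>

context cartan_lie_algebra
begin

text \<open>The real subspace of weights on which the inner product is positive definite.\<close>

definition real_weights :: "('a => complex) set" where
  "real_weights = {mu : hdual. hlinear mu & (ALL beta:roots h. mu (dualv beta) : \<real>)}"

lemma real_weights_minus: "mu : real_weights ==> - mu : real_weights"
  by (auto simp: real_weights_def hdual_minus hlinear_minus)

lemma real_weights_plus: "mu : real_weights ==> nu : real_weights ==> mu + nu : real_weights"
  by (auto simp: real_weights_def hdual_plus hlinear_plus)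

lemma real_weights_diff: "mu : real_weights ==> nu : real_weights ==> mu - nu : real_weights"
  by (auto simp: real_weights_def hdual_diff hlinear_diff)

lemma real_weights_zero: "0 : real_weights" by (auto simp: real_weights_def hdual_zero hlinear_zero)

lemma root_real_weight: assumes "alpha : roots h" shows "alpha : real_weights"
proof -
  have "alpha (dualv beta) : \<real>" if beta: "beta : roots h" for beta
  proof -
    obtain v where "v : g alpha" "v ~= 0" using root_space_nonzero[OF assms] by blast
    then obtain m :: int where "alpha (dualv beta) = of_int m / 2 * beta (dualv beta)" using weight_dualv[OF beta] by blast
    moreover obtain r where "beta (dualv beta) = complex_of_real r" using root_norm_positive[OF beta] by blast
    ultimately have "alpha (dualv beta) = complex_of_real (of_int m / 2 * r)" by simp
    then show ?thesis by (metis Reals_of_real)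
  qed
  then show ?thesis using roots_hdual root_hlinear assms by (simp add: real_weights_def)
qed

text \<open>In a basis of weight vectors the length of \<open>mu\<close> is a sum of squares of the
  real numbers \<open>w b (dualv mu)\<close>. If they all vanish, \<open>dualv mu\<close> acts by
  zero and is zero.\<close>

lemma real_weight_norm:
  assumes "mu : real_weights"
  obtains r where "r >= 0" "mu (dualv mu) = complex_of_real r" "r = 0 ==> mu = 0"
proof -
  have lin: "hlinear mu" and re: "!!beta. beta : roots h ==> mu (dualv beta) : \<real>"
    using assms by (auto simp: real_weights_def)
  note t = dualv[OF lin]
  obtain B w where B: "finite B" "independent B" "span B = UNIV" "!!b. b : B ==> b : g (w b)"
    and w: "!!b. b : B ==> w b = 0 \<or> w b : roots h" using weight_basis by metis
  have "w b (dualv mu) : \<real>" if "b : B" for b using w[OF that] re dualv_symmetric[OF _ lin] root_hlinear by fastforce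
  then have f: "w b (dualv mu) = complex_of_real (Re (w b (dualv mu)))" if "b : B" for b using that by simp
  define f where "f b = Re (w b (dualv mu))" for b
  note f = f[folded f_def]
  have "mu (dualv mu) = killing (dualv mu) (dualv mu)" using t by simp
  also have "... = (\<Sum>b\<in>B. w b (dualv mu) * w b (dualv mu))" by (rule killing_h_sum[OF B t(1) t(1)])
  also have "... = complex_of_real (\<Sum>b\<in>B. (f b)\<^sup>2)" by (simp add: f power2_eq_square)
  finally have eq: "mu (dualv mu) = complex_of_real (\<Sum>b\<in>B. (f b)\<^sup>2)" .
  have "mu = 0" if 0: "(\<Sum>b\<in>B. (f b)\<^sup>2) = 0"
  proof -
    have "f b = 0" if "b : B" for b using 0 that B(1) by (simp add: sum_nonneg_eq_0_iff)
    then have "lie (dualv mu) b = 0" if "b : B" for b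
      using B(4)[OF that] t(1) f[OF that] that by (simp add: root_space_def)
    then have "lie (dualv mu) v = 0" for v using lin_eq_on_span[OF lin_lie endo.linear_zero, of v B] B(3) by auto
    then have "dualv mu = 0" by (rule lie_faithful)
    then have "mu y = 0" if "y : h" for y using t(2)[OF that] by simp
    then show ?thesis using hdual_eqI[OF _ hdual_zero] assms by (simp add: real_weights_def)
  qed
  then show ?thesis by (intro that[OF _ eq] sum_nonneg) auto
qed

lemma maximal_weight:
  assumes T: "closed_roots T" and X: "finite X" "X ~= {}"
  obtains m where "m : X" "!!beta. beta : T ==> beta + m ~: X"
proof -
  obtain m where m: "m : X"
    "!!y M. y : X ==> set_mset M <= uminus ` T ==> M ~= {#} ==> m ~= y + \<Sum>\<^sub># M"
    using minimal_weight[OF closed_roots_uminus[OF T] X] by metis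
  have "beta + m ~: X" if "beta : T" for beta using m(2)[of "beta + m" "{#- beta#}"] that by auto
  then show ?thesis using m(1) that by blast
qed

end

section \<open>Dual bases of a Levi subalgebra and its modules\<close>

locale levi_data = cartan_lie_algebra scale lie h for scale :: "complex => 'a::ab_group_add => 'a" and lie h +
  fixes R P :: "('a => complex) set"
  assumes R_roots: "R <= roots h" and R_minus: "!!beta. beta : R ==> - beta : R"
    and P_R: "R = P \<union> uminus ` P" and closed_P: "closed_roots P"
    and subalgebra_r: "subalgebra (span (h \<union> (\<Union>beta\<in>R. root_space h beta)))"
begin

definition r :: "'a set" where
  "r = span (h \<union> (\<Union>beta\<in>R. g beta))"

lemma h_r: "x : h ==> x : r" and g_r: "beta : R ==> x : g beta ==> x : r" unfolding r_def by (intro span_base; blast)+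

lemma subalgebra_r': "subalgebra r" unfolding r_def by (rule subalgebra_r)

lemma subspace_r: "subspace r" using subalgebra_r' subalg_subspace by blast

definition e_vec :: "('a => complex) => 'a" where
  "e_vec beta = (SOME x. x : g beta & x ~= 0)"

definition f_vec :: "('a => complex) => 'a" where
  "f_vec beta = (SOME y. y : g (- beta) & killing (e_vec beta) y = 1)"

lemma e_vec: assumes "beta : R" shows "e_vec beta : g beta" "e_vec beta ~= 0"
proof -
  have "EX x. x : g beta & x ~= 0" using root_space_nonzero assms R_roots by blast
  then have "e_vec beta : g beta & e_vec beta ~= 0" unfolding e_vec_def by (rule someI_ex)
  then show "e_vec beta : g beta" "e_vec beta ~= 0" by auto
qed

lemma f_vec: assumes "beta : R" shows "f_vec beta : g (- beta)" "killing (e_vec beta) (f_vec beta) = 1"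
proof -
  have "EX y. y : g (- beta) & killing (e_vec beta) y = 1" using root_pairing e_vec[OF assms] assms R_roots by blast
  then have "f_vec beta : g (- beta) & killing (e_vec beta) (f_vec beta) = 1" unfolding f_vec_def by (rule someI_ex)
  then show "f_vec beta : g (- beta)" "killing (e_vec beta) (f_vec beta) = 1" by auto
qed

definition h_basis :: "'a set" where
  "h_basis = (SOME B. B <= h & independent B & h <= span B)"

lemma h_basis: "h_basis <= h" "independent h_basis" "h <= span h_basis" "finite h_basis"
proof -
  have "EX B. B <= h & independent B & h <= span B" using basis_exists[of h] by metis
  then have "h_basis <= h & independent h_basis & h <= span h_basis" unfolding h_basis_def by (rule someI_ex)
  then show "h_basis <= h" "independent h_basis" "h <= span h_basis" "finite h_basis" using finite_independent by auto
qed

definition h_dual :: "'a => 'a" where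
  "h_dual b = dualv (%y. representation h_basis y b)"

lemma h_dual: assumes "b : h_basis" shows "h_dual b : h" "!!y. y : h ==> killing (h_dual b) y = representation h_basis y b"
proof -
  have "hlinear (%y. representation h_basis y b)"
    unfolding hlinear_def using h_basis by (auto simp: representation_add representation_scale subset_iff)
  from dualv[OF this] show "h_dual b : h" "!!y. y : h ==> killing (h_dual b) y = representation h_basis y b"
    by (auto simp: h_dual_def)
qed

text \<open>Indices for a basis of \<open>r\<close>: a basis of \<open>h\<close> and one vector for
  each root. The families \<open>bas\<close> and \<open>dbas\<close> are dual under the Killing
  form.\<close>

definition J :: "('a + ('a => complex)) set" where
  "J = h_basis <+> R"

definition bas :: "'a + ('a => complex) => 'a" where
  "bas = case_sum id e_vec"

definition dbas :: "'a + ('a => complex) => 'a" where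
  "dbas = case_sum h_dual f_vec"

lemma finite_R: "finite R" using finite_subset[OF R_roots finite_roots] .

lemma sum_J: "(\<Sum>j\<in>J. f (bas j) (dbas j)) = (\<Sum>b\<in>h_basis. f b (h_dual b)) + (\<Sum>beta\<in>R. f (e_vec beta) (f_vec beta))"
  unfolding J_def using sum.Plus[OF h_basis(4) finite_R, of "%j. f (bas j) (dbas j)"]
  by (simp add: bas_def dbas_def o_def)

lemma bas_r: "j : J ==> bas j : r" "j : J ==> dbas j : r" using h_basis h_dual(1) e_vec f_vec h_r g_r R_minus
  by (auto simp: J_def bas_def dbas_def) blast+

lemma killing_h_root: "x : h ==> y : g beta ==> beta : roots h ==> killing x y = 0"
  using killing_centralizer_weight[of x y beta] h_subset_centralizer roots_hdual zero_not_root by blast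

lemma killing_roots: "x : g beta ==> y : g gamma ==> beta : roots h ==> gamma : roots h ==> gamma ~= - beta ==> killing x y = 0"
proof -
  assume a: "x : g beta" "y : g gamma" "beta : roots h" "gamma : roots h" "gamma ~= - beta"
  then obtain z where "z : h" "gamma z ~= (- beta) z"
    using hdual_separated[OF roots_hdual hdual_minus[OF roots_hdual]] by blast
  then show "killing x y = 0" using killing_root_space[OF a(1,2)] by (auto simp: add_eq_0_iff)
qed

text \<open>The form pairs \<open>h\<close> with itself and each root space with the opposite one,
  so the coordinates can be checked separately on \<open>h\<close> and on each root space.\<close>

lemma expand_bas: "x : r ==> (\<Sum>j\<in>J. scale (killing x (dbas j)) (bas j)) = x"
proof -
  assume "x : r"
  moreover have "lin (%x. \<Sum>j\<in>J. scale (killing x (dbas j)) (bas j))"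
    by (rule linI) (simp_all add: killing_add_left killing_scale_left scale_left_distrib sum.distrib scale_sum_right)
  moreover have "(\<Sum>j\<in>J. scale (killing x (dbas j)) (bas j)) = x" if xin: "x : h \<union> (\<Union>beta\<in>R. g beta)" for x
  proof (cases "x : h")
    case True
    have z: "killing x (f_vec beta) = 0" if "beta : R" for beta
      using killing_h_root[OF True f_vec(1)] that R_minus R_roots by blast
    have "(\<Sum>j\<in>J. scale (killing x (dbas j)) (bas j)) = (\<Sum>b\<in>h_basis. scale (killing x (h_dual b)) b)"
      using sum_J[of "%b c. scale (killing x c) b"] by (simp add: z)
    also have "... = (\<Sum>b\<in>h_basis. scale (representation h_basis x b) b)"
      using h_dual(2)[OF _ True] by (intro sum.cong) (simp_all add: killing_commute[of x])
    also have "... = x" using h_basis True by (intro sum_representation_eq) auto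
    finally show ?thesis .
  next
    case False
    then obtain beta where beta: "beta : R" "x : g beta" using xin by blast
    then obtain c where c: "x = scale c (e_vec beta)" using root_space_one_dim e_vec R_roots by blast
    have z: "killing x (h_dual b) = 0" if "b : h_basis" for b
      using killing_h_root[OF h_dual(1)[OF that] beta(2)] beta(1) R_roots killing_commute by auto
    have w: "killing x (f_vec gamma) = (if gamma = beta then c else 0)" if "gamma : R" for gamma
    proof (cases "gamma = beta")
      case True
      then show ?thesis using f_vec(2)[OF beta(1)] by (simp add: c killing_scale_left)
    next
      case False
      then show ?thesis using killing_roots[OF beta(2) f_vec(1)[OF that]] beta(1) that R_roots R_minus
        by (metis neg_equal_iff_equal subsetD)
    qed
    have "(\<Sum>j\<in>J. scale (killing x (dbas j)) (bas j)) = (\<Sum>gamma\<in>R. scale (killing x (f_vec gamma)) (e_vec gamma))"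
      using sum_J[of "%b c. scale (killing x c) b"] by (simp add: z)
    also have "... = (\<Sum>gamma\<in>R. if gamma = beta then scale c (e_vec beta) else 0)" by (rule sum.cong) (auto simp: w)
    finally show ?thesis using beta(1) finite_R by (simp add: c)
  qed
  ultimately show ?thesis using lin_eq_on_span[of "%x. \<Sum>j\<in>J. scale (killing x (dbas j)) (bas j)" "%x. x"] linear_ident
    unfolding r_def by blast
qed

text \<open>The difference of the two sides is orthogonal to \<open>r\<close>, and by the expansion
  in \<open>bas\<close> an element of \<open>r\<close> orthogonal to \<open>r\<close> is
  zero.\<close>

lemma expand_dbas: assumes x: "x : r" shows "(\<Sum>j\<in>J. scale (killing x (bas j)) (dbas j)) = x"
proof -
  define y where "y = (\<Sum>j\<in>J. scale (killing x (bas j)) (dbas j))"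
  have y: "y : r" unfolding y_def using bas_r subspace_r by (intro subspace_sum subspace_scale) auto
  have k: "killing (x - y) u = 0" if u: "u : r" for u
  proof -
    have "killing y u = (\<Sum>j\<in>J. killing x (bas j) * killing (dbas j) u)"
      by (simp only: y_def killing_sum_left killing_scale_left)
    also have "... = killing x (\<Sum>j\<in>J. scale (killing u (dbas j)) (bas j))"
      by (simp add: killing_sum_right killing_scale_right killing_commute[of u] mult.commute)
    finally show ?thesis using expand_bas[OF u] by (simp add: killing_diff_left)
  qed
  have "x - y = (\<Sum>j\<in>J. scale (killing (x - y) (dbas j)) (bas j))"
    using expand_bas[of "x - y"] x y subspace_r by (simp add: subspace_diff)
  also have "... = 0" using k bas_r(2) by (intro sum.neutral) simp
  finally show ?thesis by (simp add: y_def)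
qed

text \<open>The dual bases belong to the Killing form of the ambient algebra; the Killing form of
  \<open>r\<close> itself would be degenerate on the centre.\<close>

definition casimir :: "('a => 'v::ab_group_add => 'v) => 'v => 'v" where
  "casimir rho v = (\<Sum>j\<in>J. rho (bas j) (rho (dbas j) v))"

end

text \<open>The module laws are demanded on \<open>V\<close> only, while \<open>rho x\<close> is
  linear on the ambient space. The weight vectors of the last axiom may lie outside
  \<open>V\<close>; stability of \<open>V\<close> under \<open>h\<close> then yields weight vectors
  inside.\<close>

locale weight_module = levi_data scale lie h R P + M: complex_space scaleM
  for scale :: "complex => 'a::ab_group_add => 'a" and lie h R P
    and scaleM :: "complex => 'v::ab_group_add => 'v" +
  fixes rho :: "'a => 'v => 'v" and V :: "'v set"
  assumes rho_lin: "!!x. M.lin (rho x)"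
    and V: "M.subspace V"
    and rho_V: "!!x v. x : r ==> v : V ==> rho x v : V"
    and rho_add: "!!x y v. x : r ==> y : r ==> v : V ==> rho (x + y) v = rho x v + rho y v"
    and rho_scale: "!!c x v. x : r ==> v : V ==> rho (scale c x) v = scaleM c (rho x v)"
    and rho_lie: "!!x y v. x : r ==> y : r ==> v : V ==> rho (lie x y) v = rho x (rho y v) - rho y (rho x v)"
    and weights: "EX S wt. finite S & V <= M.span S &
      (ALL s:S. wt s : real_weights & (ALL y:h. rho y s = scaleM (wt s y) s))"
begin

abbreviation "Omega \<equiv> casimir rho"

lemma rho_zero: "v : V ==> rho 0 v = 0" using rho_scale[of 0 v 0] subspace_0[OF subspace_r] by simp

lemma rho_sum: "(!!i. i : I ==> f i : r) ==> v : V ==> rho (\<Sum>i\<in>I. f i) v = (\<Sum>i\<in>I. rho (f i) v)"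
  by (induction I rule: infinite_finite_induct) (simp_all add: rho_zero rho_add subspace_sum[OF subspace_r])

lemma lin_casimir: "M.lin Omega" unfolding casimir_def
  by (rule M.linI) (simp_all add: M.lin_add[OF rho_lin] M.lin_scale[OF rho_lin] sum.distrib M.scale_sum_right)

lemma casimir_V: "v : V ==> Omega v : V" unfolding casimir_def using bas_r rho_V by (intro M.subspace_sum[OF V]) auto

text \<open>By invariance of the form, the matrices of \<open>ad y\<close> in the two dual bases are
  negative transposes of each other, so the two double sums cancel.\<close>

lemma casimir_commute:
  assumes y: "y : r" and v: "v : V" shows "rho y (Omega v) = Omega (rho y v)"
proof -
  have 1: "rho (lie y (bas j)) w = (\<Sum>i\<in>J. scaleM (killing (lie y (bas j)) (dbas i)) (rho (bas i) w))"
    if "j : J" "w : V" for j w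
  proof -
    have "lie y (bas j) : r" using y bas_r that subalg_lie[OF subalgebra_r'] by blast
    then have "rho (lie y (bas j)) w = rho (\<Sum>i\<in>J. scale (killing (lie y (bas j)) (dbas i)) (bas i)) w"
      by (simp add: expand_bas)
    also have "... = (\<Sum>i\<in>J. scaleM (killing (lie y (bas j)) (dbas i)) (rho (bas i) w))"
      using that bas_r by (subst rho_sum) (auto simp: rho_scale subspace_scale[OF subspace_r])
    finally show ?thesis .
  qed
  have 2: "rho (lie y (dbas j)) v = (\<Sum>i\<in>J. scaleM (killing (lie y (dbas j)) (bas i)) (rho (dbas i) v))" if "j : J" for j
  proof -
    have "lie y (dbas j) : r" using y bas_r that subalg_lie[OF subalgebra_r'] by blast
    then have "rho (lie y (dbas j)) v = rho (\<Sum>i\<in>J. scale (killing (lie y (dbas j)) (bas i)) (dbas i)) v"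
      by (simp add: expand_dbas)
    also have "... = (\<Sum>i\<in>J. scaleM (killing (lie y (dbas j)) (bas i)) (rho (dbas i) v))"
      using v bas_r by (subst rho_sum) (auto simp: rho_scale subspace_scale[OF subspace_r])
    finally show ?thesis .
  qed
  have "rho y (rho (bas j) (rho (dbas j) v)) - rho (bas j) (rho (dbas j) (rho y v)) =
    rho (lie y (bas j)) (rho (dbas j) v) + rho (bas j) (rho (lie y (dbas j)) v)" if "j : J" for j
    using bas_r[OF that] y v rho_V by (simp add: rho_lie M.lin_diff[OF rho_lin])
  then have "rho y (Omega v) - Omega (rho y v) =
    (\<Sum>j\<in>J. rho (lie y (bas j)) (rho (dbas j) v) + rho (bas j) (rho (lie y (dbas j)) v))"
    by (simp add: casimir_def M.lin_sum[OF rho_lin] sum_subtractf[symmetric])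
  also have "... = (\<Sum>j\<in>J. \<Sum>i\<in>J. scaleM (killing (lie y (bas j)) (dbas i)) (rho (bas i) (rho (dbas j) v))) +
    (\<Sum>j\<in>J. \<Sum>i\<in>J. scaleM (killing (lie y (dbas j)) (bas i)) (rho (bas j) (rho (dbas i) v)))" using bas_r v rho_V
    by (simp add: sum.distrib 1 2 M.lin_sum[OF rho_lin] M.lin_scale[OF rho_lin])
  also have "(\<Sum>j\<in>J. \<Sum>i\<in>J. scaleM (killing (lie y (dbas j)) (bas i)) (rho (bas j) (rho (dbas i) v))) =
    (\<Sum>j\<in>J. \<Sum>i\<in>J. scaleM (killing (lie y (dbas i)) (bas j)) (rho (bas i) (rho (dbas j) v)))" by (rule sum.swap)
  also have "(\<Sum>j\<in>J. \<Sum>i\<in>J. scaleM (killing (lie y (bas j)) (dbas i)) (rho (bas i) (rho (dbas j) v))) + ... =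
    (\<Sum>j\<in>J. \<Sum>i\<in>J. 0)" unfolding sum.distrib[symmetric] M.scale_left_distrib[symmetric]
  proof (intro sum.cong refl)
    fix i j
    have "killing (lie y (bas j)) (dbas i) = - killing (bas j) (lie y (dbas i))"
      using killing_invariant[of "bas j" y "dbas i"] by (simp add: lie_antisym[of y "bas j"] killing_neg_left)
    then show "scaleM (killing (lie y (bas j)) (dbas i) + killing (lie y (dbas i)) (bas j)) (rho (bas i) (rho (dbas j) v)) = 0"
      by (simp add: killing_commute[of "bas j"])
  qed
  finally show ?thesis by simp
qed

definition wspace :: "('a => complex) => 'v set" where
  "wspace mu = {v : V. ALL y:h. rho y v = scaleM (mu y) v}"

lemma rho_wspace:
  assumes "beta : R" "x : g beta" "v : wspace mu" shows "rho x v : wspace (beta + mu)" unfolding wspace_def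
proof (intro CollectI conjI ballI)
  have x: "x : r" and v: "v : V" using assms g_r by (auto simp: wspace_def)
  show "rho x v : V" using x v rho_V by blast
  fix y assume y: "y : h"
  have "rho y (rho x v) = rho (lie y x) v + rho x (rho y v)" using rho_lie[OF h_r[OF y] x v] by simp
  also have "lie y x = scale (beta y) x" using assms y by (simp add: root_space_def)
  finally show "rho y (rho x v) = scaleM ((beta + mu) y) (rho x v)"
    using assms(3) x v y by (simp add: wspace_def rho_scale M.lin_scale[OF rho_lin] M.scale_left_distrib)
qed

lemma V_weight_span:
  obtains X where "finite X" "X <= real_weights"
    "!!W. M.subspace W ==> W <= V ==> (!!y v. y : h ==> v : W ==> rho y v : W) ==> W <= M.span (\<Union>mu\<in>X. W \<inter> wspace mu)"
proof -
  obtain S wt where S: "finite S" "V <= M.span S" "!!s. s : S ==> wt s : real_weights"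
    "!!s y. s : S ==> y : h ==> rho y s = scaleM (wt s y) s" using weights by metis
  have "W <= M.span (\<Union>mu\<in>wt ` S. W \<inter> wspace mu)"
    if W: "M.subspace W" "W <= V" "!!y v. y : h ==> v : W ==> rho y v : W" for W
  proof -
    have "W <= M.span (\<Union>mu\<in>wt ` S. {v : W. ALL y:h. rho y v = scaleM (mu y) v})"
    proof (rule M.stable_subspace_weights[OF rho_lin W(1,3)])
      show "EX i:h. mu i ~= nu i" if "mu : wt ` S" "nu : wt ` S" "mu ~= nu" for mu nu
        using that S(3) by (intro hdual_separated) (auto simp: real_weights_def)
      have "S <= (\<Union>mu\<in>wt ` S. {v. ALL y:h. rho y v = scaleM (mu y) v})" using S(4) by auto
      then show "W <= M.span (\<Union>mu\<in>wt ` S. {v. ALL y:h. rho y v = scaleM (mu y) v})" using W(2) S(2) M.span_mono by blast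
    qed
    also have "... <= M.span (\<Union>mu\<in>wt ` S. W \<inter> wspace mu)" by (rule M.span_mono) (use W(2) in \<open>auto simp: wspace_def\<close>)
    finally show ?thesis .
  qed
  then show ?thesis using that[of "wt ` S"] S by blast
qed

text \<open>A weight space is itself \<open>h\<close>-stable, so it decomposes into its
  intersections with the weight spaces for \<open>X\<close>; these are zero if its own weight is not
  in \<open>X\<close>.\<close>

lemma weight_set:
  obtains X where "finite X" "X <= real_weights" "!!mu v. mu : hdual ==> v : wspace mu ==> v ~= 0 ==> mu : X"
proof -
  obtain X where X: "finite X" "X <= real_weights"
    "!!W. M.subspace W ==> W <= V ==> (!!y v. y : h ==> v : W ==> rho y v : W) ==> W <= M.span (\<Union>mu\<in>X. W \<inter> wspace mu)"
    using V_weight_span by metis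
  have sub: "M.subspace (wspace mu)" for mu unfolding wspace_def using V
    by (auto simp: M.subspace_def M.lin_add[OF rho_lin] M.lin_scale[OF rho_lin] M.lin_0[OF rho_lin]
        M.scale_right_distrib M.scale_left_commute)
  have "mu : X" if v: "mu : hdual" "v : wspace mu" "v ~= 0" for mu v
  proof (rule ccontr)
    assume n: "mu ~: X"
    have "wspace mu <= M.span (\<Union>nu\<in>X. wspace mu \<inter> wspace nu)"
      by (rule X(3)) (use sub V in \<open>auto simp: wspace_def M.subspace_scale rho_V h_r M.lin_scale[OF rho_lin] M.scale_left_commute\<close>)
    moreover have "wspace mu \<inter> wspace nu <= {0}" if nX: "nu : X" for nu
    proof
      fix w assume w: "w : wspace mu \<inter> wspace nu"
      obtain y where "y : h" "mu y ~= nu y"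
        using hdual_separated[OF v(1), of nu] X(2) nX n by (auto simp: real_weights_def)
      then show "w : {0}" using w M.scale_right_imp_eq by (auto simp: wspace_def)
    qed
    then have "(\<Union>nu\<in>X. wspace mu \<inter> wspace nu) <= {0}" by blast
    then have "M.span (\<Union>nu\<in>X. wspace mu \<inter> wspace nu) <= {0}" by (rule M.span_minimal) (auto simp: M.subspace_def)
    ultimately show False using v by blast
  qed
  then show ?thesis using that X by blast
qed

text \<open>The scalar is the inner product of \<open>mu\<close> with \<open>mu\<close> plus the sum
  of \<open>Q\<close>. Roots in \<open>Q\<close> contribute by commuting the raising past the
  lowering vector, the other roots give zero. Any half \<open>Q\<close> of \<open>R\<close> is
  allowed, which covers highest and lowest weights alike.\<close>

lemma casimir_highest:
  assumes Q: "closed_roots Q" "R = Q \<union> uminus ` Q" and v: "v : wspace mu" and mu: "hlinear mu"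
    and kill: "!!beta x. beta : Q ==> x : g beta ==> rho x v = 0"
  shows "Omega v = scaleM (mu (dualv mu) + (\<Sum>beta\<in>Q. mu (dualv beta))) v"
proof -
  have vV: "v : V" and wt: "!!y. y : h ==> rho y v = scaleM (mu y) v" using v by (auto simp: wspace_def)
  have QR: "Q <= R" "finite Q" using Q(2) finite_R by (auto intro: finite_subset)
  note t = dualv[OF mu]
  have "(\<Sum>b\<in>h_basis. rho b (rho (h_dual b) v)) = (\<Sum>b\<in>h_basis. scaleM (mu b * mu (h_dual b)) v)"
    using h_dual(1) h_basis(1) by (intro sum.cong) (auto simp: wt M.lin_scale[OF rho_lin] mult.commute)
  also have "... = scaleM (\<Sum>b\<in>h_basis. mu b * mu (h_dual b)) v" by (simp add: M.scale_sum_left)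
  also have "(\<Sum>b\<in>h_basis. mu b * mu (h_dual b)) = mu (dualv mu)"
  proof -
    have "dualv mu = (\<Sum>j\<in>J. scale (killing (dualv mu) (bas j)) (dbas j))" using expand_dbas[OF h_r[OF t(1)]] by simp
    also have "... = (\<Sum>b\<in>h_basis. scale (killing (dualv mu) b) (h_dual b))"
      using sum_J[of "%b c. scale (killing (dualv mu) b) c"] killing_h_root[OF t(1) e_vec(1)] R_roots
      by (simp add: subset_iff)
    finally have "mu (dualv mu) = mu (\<Sum>b\<in>h_basis. scale (killing (dualv mu) b) (h_dual b))" by simp
    also have "... = (\<Sum>b\<in>B. killing (dualv mu) b * mu (h_dual b))" if "B = h_basis" for B
    proof -
      have "finite B ==> B <= h_basis ==> (\<Sum>b\<in>B. scale (killing (dualv mu) b) (h_dual b)) : h &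
        mu (\<Sum>b\<in>B. scale (killing (dualv mu) b) (h_dual b)) = (\<Sum>b\<in>B. killing (dualv mu) b * mu (h_dual b))" for B
      proof (induction B rule: finite_induct)
        case empty
        have "mu (scale 0 0) = 0 * mu 0" using mu subspace_0[OF subspace_h] unfolding hlinear_def by blast
        then show ?case using subspace_0[OF subspace_h] by simp
      next
        case (insert b B)
        have "scale (killing (dualv mu) b) (h_dual b) : h"
          using insert.prems h_dual(1) subspace_h subspace_scale by blast
        then show ?case using insert mu subspace_h h_dual(1) by (simp add: hlinear_def subspace_add)
      qed
      then show ?thesis using h_basis(4) that by blast
    qed
    finally show ?thesis using t(2) h_basis(1) by (auto intro!: sum.cong)
  qed
  finally have 1: "(\<Sum>b\<in>h_basis. rho b (rho (h_dual b) v)) = scaleM (mu (dualv mu)) v" .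
  have pos: "rho (e_vec beta) (rho (f_vec beta) v) = scaleM (mu (dualv beta)) v" if "beta : Q" for beta
  proof -
    have beta: "beta : R" "beta : roots h" using that QR R_roots by auto
    note ef = e_vec[OF beta(1)] f_vec[OF beta(1)]
    have er: "e_vec beta : r" "f_vec beta : r" using ef g_r beta R_minus by blast+
    have "lie (e_vec beta) (f_vec beta) = dualv beta" using lie_opposite_roots[OF beta(2) ef(1,3)] ef(4) by simp
    moreover have "rho (e_vec beta) v = 0" using kill[OF that ef(1)] .
    ultimately have "rho (e_vec beta) (rho (f_vec beta) v) = rho (dualv beta) v"
      using rho_lie[OF er vV] by (simp add: M.lin_0[OF rho_lin])
    then show ?thesis using wt dualv(1)[OF root_hlinear[OF beta(2)]] by simp
  qed
  have neg: "rho (e_vec beta) (rho (f_vec beta) v) = 0" if "beta : R - Q" for beta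
  proof -
    have "- beta : Q" using that Q(2) by auto
    then have "rho (f_vec beta) v = 0" using kill f_vec(1) that by blast
    then show ?thesis by (simp add: M.lin_0[OF rho_lin])
  qed
  have "(\<Sum>beta\<in>R. rho (e_vec beta) (rho (f_vec beta) v)) = (\<Sum>beta\<in>Q. rho (e_vec beta) (rho (f_vec beta) v))"
    using QR finite_R neg by (intro sum.mono_neutral_right) auto
  also have "... = scaleM (\<Sum>beta\<in>Q. mu (dualv beta)) v" by (simp add: pos M.scale_sum_left)
  finally show ?thesis unfolding casimir_def sum_J[of "%b c. rho b (rho c v)"] 1 by (simp add: M.scale_left_distrib)
qed

text \<open>The downward string is finite, since its weights are distinct and only finitely many
  occur; the sl2 computation then gives a nonnegative multiple of the root length.\<close>

lemma highest_weight_dominant: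
  assumes beta: "beta : R" and v: "v : wspace mu" "v ~= 0" and mu: "mu : hdual"
    and kill: "!!x. x : g beta ==> rho x v = 0"
  shows "EX s>=0. mu (dualv beta) = complex_of_real s"
proof -
  have br: "beta : roots h" using beta R_roots by blast
  note ef = e_vec[OF beta] f_vec[OF beta]
  have er: "e_vec beta : r" "f_vec beta : r" using ef g_r beta R_minus by blast+
  let ?F = "rho (f_vec beta)"
  have mem: "(?F ^^ j) v : wspace (mu + (%y. of_nat j * (- beta) y))" for j
  proof (induction j)
    case 0
    have "mu + (%y. of_nat 0 * (- beta) y) = mu" by (rule ext) simp
    then show ?case using v by simp
  next
    case (Suc j)
    have eq: "- beta + (mu + (%y. of_nat j * (- beta) y)) = mu + (%y. of_nat (Suc j) * (- beta) y)"
      by (rule ext) (simp add: algebra_simps)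
    show ?case using rho_wspace[OF R_minus[OF beta] ef(3) Suc] by (simp only: eq funpow.simps(2) comp_apply)
  qed
  obtain X where X: "finite X" "!!mu v. mu : hdual ==> v : wspace mu ==> v ~= 0 ==> mu : X" using weight_set by metis
  have "EX k. (?F ^^ k) v = 0"
  proof (rule ccontr)
    assume n: "\<nexists>k. (?F ^^ k) v = 0"
    let ?s = "%j::nat. mu + (%y. of_nat j * (- beta) y)"
    obtain y where y: "y : h" "beta y ~= 0" using br by (auto simp: roots_def)
    have "inj ?s"
    proof (rule injI)
      fix k l assume "?s k = ?s l"
      then have "?s k y = ?s l y" by (rule fun_cong)
      then show "k = l" using y by simp
    qed
    moreover have "?s j : X" for j by (rule X(2)[OF _ mem]) (use mu roots_hdual[OF br] n in \<open>auto simp: hdual_def\<close>)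
    then have "range ?s <= X" by blast
    ultimately show False using X(1) finite_subset finite_imageD infinite_UNIV_nat by metis
  qed
  then obtain K where K: "(?F ^^ K) v = 0" by blast
  have "EX n::nat. mu (dualv beta) = of_nat n * beta (dualv beta) / 2"
  proof (rule M.string_weight[OF rho_lin rho_lin _ _ v(2) K])
    show "?F (rho (e_vec beta) v) = 0" using kill ef(1) by (simp add: M.lin_0[OF rho_lin])
    fix j
    have w: "(?F ^^ j) v : V" using mem by (auto simp: wspace_def)
    have "rho (dualv beta) ((?F ^^ j) v) = scaleM (mu (dualv beta) - of_nat j * beta (dualv beta)) ((?F ^^ j) v)"
      using mem[of j] dualv(1)[OF root_hlinear[OF br]] by (simp add: wspace_def)
    moreover have "lie (e_vec beta) (f_vec beta) = dualv beta" using lie_opposite_roots[OF br ef(1,3)] ef(4) by simp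
    ultimately show "rho (e_vec beta) (?F ((?F ^^ j) v)) = ?F (rho (e_vec beta) ((?F ^^ j) v)) +
        scaleM (mu (dualv beta) - of_nat j * beta (dualv beta)) ((?F ^^ j) v)" using rho_lie[OF er w] by simp
  qed
  then obtain n :: nat where n: "mu (dualv beta) = of_nat n * beta (dualv beta) / 2" by blast
  obtain s where s: "s > 0" "beta (dualv beta) = complex_of_real s" using root_norm_positive[OF br] by blast
  have "mu (dualv beta) = complex_of_real (real n * s / 2)" by (simp add: n s)
  then show ?thesis using s(1) by (intro exI[of _ "real n * s / 2"]) simp
qed

text \<open>Raise \<open>v\<close> by \<open>Q\<close> as long as possible inside the kernel of the
  squared Casimir operator. At the resulting highest weight \<open>nu\<close> the Casimir eigenvalue
  is zero, but it is a sum of nonnegative numbers that includes the length of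
  \<open>nu\<close>.\<close>

lemma extremal_weight_zero:
  assumes Q: "closed_roots Q" "R = Q \<union> uminus ` Q" and v: "v : wspace mu" "v ~= 0" "Omega (Omega v) = 0" and mu: "mu : hdual"
  shows "EX N. set_mset N <= Q & mu + \<Sum>\<^sub># N = 0"
proof -
  obtain X where X: "finite X" "X <= real_weights" "!!mu v. mu : hdual ==> v : wspace mu ==> v ~= 0 ==> mu : X"
    using weight_set by metis
  have QR: "Q <= R" "finite Q" using Q(2) finite_R by (auto intro: finite_subset)
  define Y where "Y = {nu : hdual. EX N u. set_mset N <= Q & nu = mu + \<Sum>\<^sub># N & u : wspace nu & u ~= 0 & Omega (Omega u) = 0}"
  have YX: "Y <= X" using X(3) by (auto simp: Y_def)
  have "mu = mu + \<Sum>\<^sub># {#}" "set_mset {#} <= Q" by auto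
  then have "mu : Y" unfolding Y_def using v mu by blast
  then have Y: "finite Y" "Y ~= {}" using YX X(1) finite_subset by auto
  obtain nu where nu: "nu : Y" "!!beta. beta : Q ==> beta + nu ~: Y" using maximal_weight[OF Q(1) Y] by blast
  obtain N u where N: "nu : hdual" "set_mset N <= Q" "nu = mu + \<Sum>\<^sub># N" "u : wspace nu" "u ~= 0" "Omega (Omega u) = 0"
    using nu(1) by (auto simp: Y_def)
  have uV: "u : V" using N by (simp add: wspace_def)
  have kill: "rho x u = 0" if beta: "beta : Q" "x : g beta" for beta x
  proof (rule ccontr)
    assume ne: "rho x u ~= 0"
    have bR: "beta : R" "beta : roots h" using beta QR R_roots by auto
    have "rho x u : wspace (beta + nu)" using rho_wspace[OF bR(1) beta(2) N(4)] .
    moreover have "Omega (Omega (rho x u)) = 0"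
      using casimir_commute[of x] g_r[OF bR(1) beta(2)] uV casimir_V N(6) by (metis M.lin_0 rho_lin)
    moreover have "beta + nu = mu + \<Sum>\<^sub># (add_mset beta N)" using N(3) by (simp add: ac_simps)
    moreover have "set_mset (add_mset beta N) <= Q" using N beta by simp
    moreover have "beta + nu : hdual" using hdual_plus roots_hdual bR N by blast
    ultimately have "beta + nu : Y" unfolding Y_def using ne by blast
    then show False using nu(2) beta by blast
  qed
  have rw: "nu : real_weights" using X(2) YX nu(1) by blast
  then have hl: "hlinear nu" by (simp add: real_weights_def)
  obtain s where s: "s >= 0" "nu (dualv nu) = complex_of_real s" "s = 0 ==> nu = 0"
    using real_weight_norm[OF rw] by blast
  have "EX f. ALL beta:Q. f beta >= 0 & nu (dualv beta) = complex_of_real (f beta)"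
  proof (intro bchoice ballI)
    fix beta assume beta: "beta : Q"
    then have "beta : R" using QR(1) by blast
    then show "EX s. s >= 0 & nu (dualv beta) = complex_of_real s"
      by (rule highest_weight_dominant[OF _ N(4,5,1) kill[OF beta]])
  qed
  then obtain f where f: "!!beta. beta : Q ==> f beta >= 0" "!!beta. beta : Q ==> nu (dualv beta) = complex_of_real (f beta)" by blast
  define c where "c = nu (dualv nu) + (\<Sum>beta\<in>Q. nu (dualv beta))"
  have c: "c = complex_of_real (s + (\<Sum>beta\<in>Q. f beta))" by (simp add: c_def s f(2))
  have "Omega u = scaleM c u" unfolding c_def by (rule casimir_highest[OF Q N(4) hl kill])
  then have "scaleM c (scaleM c u) = 0" using N(6) by (simp add: M.lin_scale[OF lin_casimir])
  then have "c = 0" using N(5) by simp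
  then have "s + (\<Sum>beta\<in>Q. f beta) = 0" unfolding c by (simp only: of_real_eq_0_iff)
  moreover have "(\<Sum>beta\<in>Q. f beta) >= 0" using f(1) by (rule sum_nonneg)
  ultimately have "s = 0" using s(1) by linarith
  then have "mu + \<Sum>\<^sub># N = 0" using s(3) N(3) by simp
  then show ?thesis using N(2) by blast
qed

text \<open>A weight of the kernel is minus a sum of positive roots and also minus a sum of negative
  ones; as positive roots have no vanishing nonempty sums, it is zero. So \<open>h\<close> acts by
  zero, and each root vector too, being a multiple of its bracket with \<open>h\<close>. The square
  of \<open>Omega\<close> appears here because \<open>ker_plus_image\<close> compares the kernels of
  an operator and of its square.\<close>

lemma casimir_kernel:
  assumes v: "v : V" "Omega (Omega v) = 0" and x: "x : r"
  shows "rho x v = 0"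
proof -
  define N where "N = {v : V. Omega (Omega v) = 0}"
  have sN: "M.subspace N" unfolding N_def using V
    by (auto simp: M.subspace_def M.lin_add[OF lin_casimir] M.lin_scale[OF lin_casimir] M.lin_0[OF lin_casimir])
  have NV: "N <= V" by (auto simp: N_def)
  have st: "rho y u : N" if "y : r" "u : N" for y u
    using that rho_V casimir_V casimir_commute unfolding N_def by (auto simp: casimir_commute[symmetric] M.lin_0[OF rho_lin])
  obtain X where X: "X <= real_weights"
    "!!W. M.subspace W ==> W <= V ==> (!!y v. y : h ==> v : W ==> rho y v : W) ==> W <= M.span (\<Union>mu\<in>X. W \<inter> wspace mu)"
    using V_weight_span by metis
  have cP: "closed_roots (uminus ` P)" using closed_roots_uminus[OF closed_P] .
  have "uminus ` uminus ` P = P" by (simp add: image_image)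
  then have RP: "R = uminus ` P \<union> uminus ` uminus ` P" using P_R by auto
  have wt0: "mu = 0" if u: "mu : X" "u : N" "u : wspace mu" "u ~= 0" for mu u
  proof -
    have mu: "mu : hdual" using X u by (auto simp: real_weights_def)
    have uu: "Omega (Omega u) = 0" using u by (simp add: N_def)
    obtain A where A: "set_mset A <= P" "mu + \<Sum>\<^sub># A = 0"
      using extremal_weight_zero[OF closed_P P_R u(3,4) uu mu] by blast
    obtain B where B: "set_mset B <= uminus ` P" "mu + \<Sum>\<^sub># B = 0"
      using extremal_weight_zero[OF cP RP u(3,4) uu mu] by blast
    have im: "\<Sum>\<^sub># (image_mset uminus B) = - \<Sum>\<^sub># B" by (induction B) simp_all
    have "\<Sum>\<^sub># A = - mu" "\<Sum>\<^sub># B = - mu" using A(2) B(2) by (simp_all add: add_eq_0_iff)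
    then have "\<Sum>\<^sub># (A + image_mset uminus B) = 0" using im by simp
    moreover have "set_mset (A + image_mset uminus B) <= P" using A(1) B(1) by auto
    ultimately have "A + image_mset uminus B = {#}" using closed_roots_sum_nonzero[OF closed_P] by blast
    then show ?thesis using A(2) by simp
  qed
  have h0: "rho y u = 0" if y: "y : h" and u: "u : N" for y u
  proof -
    have "N <= M.span (\<Union>mu\<in>X. N \<inter> wspace mu)" using X(2)[OF sN NV] st h_r by blast
    moreover have "(\<Union>mu\<in>X. N \<inter> wspace mu) <= {u. rho y u = 0}"
      using wt0 y by (auto simp: wspace_def) (metis M.lin_0 M.scale_zero_left rho_lin zero_fun_apply)
    then have "M.span (\<Union>mu\<in>X. N \<inter> wspace mu) <= {u. rho y u = 0}" by (rule M.span_minimal)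
        (auto simp: M.subspace_def M.lin_add[OF rho_lin] M.lin_scale[OF rho_lin] M.lin_0[OF rho_lin])
    ultimately show ?thesis using u by blast
  qed
  have vN: "v : N" using v by (simp add: N_def)
  have g0: "rho x v = 0" if x: "beta : R" "x : g beta" for beta x
  proof -
    obtain y where y: "y : h" "beta y ~= 0" using x R_roots by (auto simp: roots_def)
    have xr: "x : r" using g_r x by blast
    have "rho (lie y x) v = 0" using rho_lie[OF h_r[OF y(1)] xr v(1)] h0[OF y(1)] vN st[OF xr vN]
      by (simp add: M.lin_0[OF rho_lin])
    moreover have "lie y x = scale (beta y) x" using x y by (simp add: root_space_def)
    ultimately show ?thesis using rho_scale[OF xr v(1)] y by simp
  qed
  have "x : r & rho x v = 0" using x[unfolded r_def]
  proof (induction rule: span_induct_alt)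
    case base
    show ?case using rho_zero[OF v(1)] subspace_0[OF subspace_r] by simp
  next
    case (step c x y)
    then have "x : r" "rho x v = 0" using g0 h0[OF _ vN] h_r g_r by blast+
    then show ?case using step v(1) by (simp add: rho_add rho_scale subspace_scale[OF subspace_r] subspace_add[OF subspace_r])
  qed
  then show ?thesis ..
qed

text \<open>\<open>casimir_kernel\<close> shows that \<open>Omega\<close> and its square have the
  same kernel, made of invariants, so \<open>ker_plus_image\<close> applies.\<close>

lemma casimir_decomposition:
  assumes "v : V"
  obtains w where "w : V" "!!x. x : r ==> rho x (v - Omega w) = 0"
proof -
  obtain S where S: "finite S" "V <= M.span S" using weights by blast
  have z: "Omega u = 0" if "u : V" "Omega (Omega u) = 0" for u
  proof -
    have "rho (dbas j) u = 0" if "j : J" for j using casimir_kernel \<open>u : V\<close> \<open>Omega (Omega u) = 0\<close> bas_r(2)[OF that] by blast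
    then show ?thesis by (simp add: casimir_def M.lin_0[OF rho_lin])
  qed
  obtain w where w: "w : V" "Omega (v - Omega w) = 0"
    using M.ker_plus_image[OF lin_casimir V S(2,1) casimir_V z assms] by blast
  have "v - Omega w : V" using assms w casimir_V V by (simp add: M.subspace_diff)
  then have "rho x (v - Omega w) = 0" if "x : r" for x
    using casimir_kernel[OF _ _ that] w(2) by (simp add: M.lin_0[OF lin_casimir])
  then show ?thesis using w that by blast
qed

text \<open>\<open>Omega\<close> kills invariants, so \<open>w\<close> lies in the kernel of its
  square and is itself invariant. Together with the decomposition this makes the sum direct.\<close>

lemma invariant_casimir_image_zero:
  assumes "w : V" "!!x. x : r ==> rho x (Omega w) = 0" shows "Omega w = 0"
proof -
  have "Omega (Omega w) = 0" unfolding casimir_def[of rho "Omega w"] using assms(2)[OF bas_r(2)]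
    by (simp add: M.lin_0[OF rho_lin])
  then have "rho (dbas j) w = 0" if "j : J" for j using casimir_kernel[OF assms(1)] bas_r(2)[OF that] by blast
  then show ?thesis by (simp add: casimir_def M.lin_0[OF rho_lin])
qed

end

text \<open>Maps are extended by zero outside \<open>W\<close>, so that equality of functions is
  equality of linear maps.\<close>

definition hom_space :: "(complex => 'v => 'v) => 'v set => 'v set => ('v => 'v::ab_group_add) set" where
  "hom_space s W V = {sigma. (ALL w. w ~: W --> sigma w = 0) & (ALL w:W. sigma w : V) &
     (ALL u:W. ALL w:W. sigma (u + w) = sigma u + sigma w) & (ALL c. ALL w:W. sigma (s c w) = s c (sigma w))}"

definition hom_scale :: "(complex => 'v => 'v) => complex => ('v => 'v) => 'v => 'v" where
  "hom_scale s c sigma = (%w. s c (sigma w))"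

definition hom_act :: "('a => 'v => 'v) => 'v set => 'a => ('v => 'v) => 'v => 'v::ab_group_add" where
  "hom_act rho W x sigma = (%w. if w : W then rho x (sigma w) - sigma (rho x w) else 0)"

lemma (in complex_space) complex_space_hom: "complex_space (hom_scale scale)"
  by unfold_locales (auto simp: hom_scale_def fun_eq_iff algebra_simps)

lemma fun_sum_apply: "(\<Sum>i\<in>I. f i) x = (\<Sum>i\<in>I. f i x)" by (induction I rule: infinite_finite_induct) auto

text \<open>Matrix units of a Hom space require coordinates on the source, hence a basis of weight
  vectors inside \<open>V\<close>.\<close>

lemma (in weight_module) weight_vector_basis:
  obtains B wt where "finite B" "B <= V" "M.independent B" "V <= M.span B"
    "!!b. b : B ==> wt b : real_weights" "!!b y. b : B ==> y : h ==> rho y b = scaleM (wt b y) b"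
proof -
  obtain X where X: "X <= real_weights"
    "!!W. M.subspace W ==> W <= V ==> (!!y v. y : h ==> v : W ==> rho y v : W) ==> W <= M.span (\<Union>mu\<in>X. W \<inter> wspace mu)"
    using V_weight_span by metis
  have sp: "V <= M.span (\<Union>mu\<in>X. V \<inter> wspace mu)" using X(2)[OF V] rho_V h_r by blast
  obtain B where B: "B <= (\<Union>mu\<in>X. V \<inter> wspace mu)" "M.independent B" "(\<Union>mu\<in>X. V \<inter> wspace mu) <= M.span B"
    using M.maximal_independent_subset by metis
  have "V <= M.span B" using sp M.span_minimal[OF B(3) M.subspace_span] by blast
  moreover have "B <= V" using B by blast
  moreover obtain S where "finite S" "V <= M.span S" using weights by blast
  ultimately have "finite B" using M.independent_span_bound[OF _ B(2)] by blast
  have "ALL b:B. EX mu. mu : X & b : wspace mu" using B(1) by blast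
  then obtain wt where wt: "!!b. b : B ==> wt b : X" "!!b. b : B ==> b : wspace (wt b)" by metis
  have "rho y b = scaleM (wt b y) b" if "b : B" "y : h" for b y using wt(2)[OF that(1)] that by (simp add: wspace_def)
  then show ?thesis using that[of B wt] \<open>finite B\<close> \<open>B <= V\<close> B(2) \<open>V <= M.span B\<close> wt(1) X(1) by blast
qed

context levi_data
begin

lemma hom_module:
  assumes VM: "weight_module scale lie h R P sM rho V" and WM: "weight_module scale lie h R P sM rho W"
  shows "weight_module scale lie h R P (hom_scale sM) (hom_act rho W) (hom_space sM W V)"
proof -
  interpret V: weight_module scale lie h R P sM rho V by fact
  interpret W: weight_module scale lie h R P sM rho W by fact
  interpret E: complex_space "hom_scale sM" by (rule V.M.complex_space_hom)
  note rl = V.M.lin_add[OF V.rho_lin] V.M.lin_diff[OF V.rho_lin] V.M.lin_scale[OF V.rho_lin] V.M.lin_0[OF V.rho_lin]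
  note sub = V.M.subspace_add[OF V.V] V.M.subspace_scale[OF V.V] V.M.subspace_diff[OF V.V] V.M.subspace_0[OF V.V]
    V.M.subspace_add[OF W.V] V.M.subspace_scale[OF W.V] V.M.subspace_diff[OF W.V] V.M.subspace_0[OF W.V]
  have hom_diff: "sigma (u - w) = sigma u - sigma w" if s: "sigma : hom_space sM W V" "u : W" "w : W" for sigma u w
  proof -
    have "u - w : W" using s sub(7) by simp
    moreover have "ALL u:W. ALL w:W. sigma (u + w) = sigma u + sigma w" using s(1) by (simp add: hom_space_def)
    ultimately have "sigma (u - w + w) = sigma (u - w) + sigma w" using s(3) by blast
    then show ?thesis by simp
  qed
  show ?thesis
  proof (intro weight_module.intro weight_module_axioms.intro)
    show "levi_data scale lie h R P" by unfold_locales
    show "complex_space (hom_scale sM)" by (rule V.M.complex_space_hom)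
    show "E.lin (hom_act rho W x)" for x
      by (rule E.linI) (auto simp: hom_act_def hom_scale_def fun_eq_iff rl V.M.scale_right_diff_distrib)
    show "E.subspace (hom_space sM W V)"
      unfolding E.subspace_def by (auto simp: hom_space_def hom_scale_def sub V.M.scale_right_distrib V.M.scale_left_commute)
    show "hom_act rho W x sigma : hom_space sM W V" if "x : r" "sigma : hom_space sM W V" for x sigma
      using that W.rho_V V.rho_V by (auto simp: hom_space_def hom_act_def rl sub V.M.scale_right_diff_distrib)
    show "hom_act rho W (x + y) sigma = hom_act rho W x sigma + hom_act rho W y sigma"
      if "x : r" "y : r" "sigma : hom_space sM W V" for x y sigma
      using that W.rho_V V.rho_V by (auto simp: hom_space_def hom_act_def fun_eq_iff V.rho_add W.rho_add)
    show "hom_act rho W (scale c x) sigma = hom_scale sM c (hom_act rho W x sigma)"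
      if "x : r" "sigma : hom_space sM W V" for c x sigma using that W.rho_V V.rho_V
      by (auto simp: hom_space_def hom_act_def hom_scale_def fun_eq_iff V.rho_scale W.rho_scale V.M.scale_right_diff_distrib)
    show "hom_act rho W (lie x y) sigma = hom_act rho W x (hom_act rho W y sigma) - hom_act rho W y (hom_act rho W x sigma)"
      if xy: "x : r" "y : r" and s: "sigma : hom_space sM W V" for x y sigma
    proof
      fix w
      show "hom_act rho W (lie x y) sigma w = (hom_act rho W x (hom_act rho W y sigma) - hom_act rho W y (hom_act rho W x sigma)) w"
      proof (cases "w : W")
        case True
        have "sigma w : V" using s True by (simp add: hom_space_def)
        moreover have "sigma (rho x (rho y w) - rho y (rho x w)) = sigma (rho x (rho y w)) - sigma (rho y (rho x w))"
          using hom_diff[OF s] W.rho_V xy True by simp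
        ultimately show ?thesis using True xy W.rho_V by (simp add: hom_act_def V.rho_lie W.rho_lie rl)
      qed (simp add: hom_act_def)
    qed
    obtain B wb where B: "finite B" "B <= W" "V.M.independent B" "W <= V.M.span B"
      "!!b. b : B ==> wb b : real_weights" "!!b y. b : B ==> y : h ==> rho y b = sM (wb b y) b"
      using W.weight_vector_basis by metis
    obtain S ws where S: "finite S" "V <= V.M.span S" "!!s. s : S ==> ws s : real_weights"
      "!!s y. s : S ==> y : h ==> rho y s = sM (ws s y) s" using V.weights by metis
    let ?rep = "V.M.representation B"
    \<comment> \<open>Matrix units between weight vectors; their weights are the differences
      \<open>ws s - wb b\<close>. Their values may leave \<open>V\<close>, which the axiom on
      weights permits.\<close>
    define mat where "mat = (%(s, b) w. if w : W then sM (?rep w b) s else 0)"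
    have rep_rho: "?rep (rho y w) b = wb b y * ?rep w b" if w: "w : W" "b : B" "y : h" for w b y
    proof -
      have "rho y w = rho y (\<Sum>b\<in>B. sM (?rep w b) b)" using B w by (subst V.M.sum_representation_eq) auto
      also have "... = (\<Sum>b\<in>B. sM (wb b y * ?rep w b) b)"
        using B(6)[OF _ w(3)] by (simp add: V.M.lin_sum[OF V.rho_lin] rl mult.commute)
      finally have "?rep (rho y w) b = ?rep (\<Sum>b\<in>B. sM (wb b y * ?rep w b) b) b" by simp
      also have "... = (\<Sum>b'\<in>B. wb b' y * ?rep w b' * (if b = b' then 1 else 0))"
        using B(1,3) by (simp add: V.M.representation_sum V.M.representation_scale V.M.representation_basis V.M.span_base V.M.span_scale)
      also have "... = wb b y * ?rep w b" using w(2) B(1) by (simp add: if_distrib[of "%a. _ * a"] cong: if_cong)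
      finally show ?thesis .
    qed
    have "hom_space sM W V <= E.span (mat ` (S \<times> B))"
    proof
      fix sigma assume s: "sigma : hom_space sM W V"
      have "ALL b:B. EX c. sigma b = (\<Sum>s\<in>S. sM (c s) s)"
      proof
        fix b assume "b : B"
        then have "sigma b : V.M.span S" using s B(2) S(2) by (auto simp: hom_space_def)
        then show "EX c. sigma b = (\<Sum>s\<in>S. sM (c s) s)" using V.M.span_finite[OF S(1)] by auto
      qed
      then obtain c where c: "!!b. b : B ==> sigma b = (\<Sum>s\<in>S. sM (c b s) s)" by metis
      have sigma_sum: "(\<Sum>b\<in>A. sM (a b) b) : W & sigma (\<Sum>b\<in>A. sM (a b) b) = (\<Sum>b\<in>A. sM (a b) (sigma b))"
        if "A <= B" for A a using finite_subset[OF that B(1)] that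
      proof (induction A rule: finite_induct)
        case empty
        have "sigma 0 = 0" using hom_diff[OF s sub(8) sub(8)] by simp
        then show ?case using sub(8) by simp
      next
        case (insert b A)
        then have "b : W" using B(2) by blast
        then show ?case using insert s sub by (simp add: hom_space_def)
      qed
      have "sigma = (\<Sum>(s, b)\<in>S \<times> B. hom_scale sM (c b s) (mat (s, b)))"
      proof
        fix w
        show "sigma w = (\<Sum>(s, b)\<in>S \<times> B. hom_scale sM (c b s) (mat (s, b))) w"
        proof (cases "w : W")
          case True
          have "sigma w = sigma (\<Sum>b\<in>B. sM (?rep w b) b)" using B True by (subst V.M.sum_representation_eq) auto
          also have "... = (\<Sum>b\<in>B. sM (?rep w b) (sigma b))" using sigma_sum[of B] by simp
          also have "... = (\<Sum>b\<in>B. \<Sum>s\<in>S. sM (c b s) (sM (?rep w b) s))"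
            by (rule sum.cong) (simp_all add: c V.M.scale_sum_right mult.commute)
          also have "... = (\<Sum>(s, b)\<in>S \<times> B. sM (c b s) (sM (?rep w b) s))"
            by (subst sum.swap) (rule sum.cartesian_product)
          finally show ?thesis using True by (simp add: fun_sum_apply mat_def hom_scale_def case_prod_unfold)
        next
          case False
          then have "sigma w = 0" using s by (simp add: hom_space_def)
          then show ?thesis using False by (simp add: fun_sum_apply mat_def hom_scale_def case_prod_unfold)
        qed
      qed
      also have "... : E.span (mat ` (S \<times> B))"
      proof (rule E.span_sum)
        show "(case p of (s, b) => hom_scale sM (c b s) (mat (s, b))) : E.span (mat ` (S \<times> B))" if "p : S \<times> B" for p
          using that by (cases p) (simp, rule E.span_scale, rule E.span_base, blast)
      qed
      finally show "sigma : E.span (mat ` (S \<times> B))" .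
    qed
    moreover have "EX mu. mu : real_weights & (ALL y:h. hom_act rho W y m = hom_scale sM (mu y) m)"
      if m: "m : mat ` (S \<times> B)" for m
    proof -
      obtain s b where sb: "m = mat (s, b)" "s : S" "b : B" using m by auto
      have "hom_act rho W y (mat (s, b)) = hom_scale sM ((ws s - wb b) y) (mat (s, b))" if y: "y : h" for y
      proof
        fix w
        show "hom_act rho W y (mat (s, b)) w = hom_scale sM ((ws s - wb b) y) (mat (s, b)) w"
        proof (cases "w : W")
          case True
          have "hom_act rho W y (mat (s, b)) w = sM (?rep w b) (sM (ws s y) s) - sM (wb b y * ?rep w b) s"
            using W.rho_V[OF h_r[OF y] True] True
            by (simp add: hom_act_def mat_def rl S(4)[OF sb(2) y] rep_rho[OF True sb(3) y])
          also have "... = sM ((ws s y - wb b y) * ?rep w b) s"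
            by (simp add: V.M.scale_left_diff_distrib[symmetric] left_diff_distrib right_diff_distrib mult.commute[of _ "?rep w b"])
          finally show ?thesis using True by (simp add: hom_scale_def mat_def)
        qed (simp add: hom_act_def hom_scale_def mat_def)
      qed
      moreover have "ws s - wb b : real_weights" using sb S(3) B(5) by (intro real_weights_diff)
      ultimately show ?thesis unfolding sb(1) by blast
    qed
    then obtain wt where "!!m. m : mat ` (S \<times> B) ==> wt m : real_weights & (ALL y:h. hom_act rho W y m = hom_scale sM (wt m y) m)"
      by metis
    moreover have "finite (mat ` (S \<times> B))" using S(1) B(1) by simp
    ultimately show "EX S wt. finite S & hom_space sM W V <= E.span S &
      (ALL s:S. wt s : real_weights & (ALL y:h. hom_act rho W y s = hom_scale sM (wt s y) s))" by blast
  qed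
qed

text \<open>Averaging a generalized inverse with the Casimir operator makes it equivariant.\<close>

lemma equivariant_generalized_inverse:
  assumes VM: "weight_module scale lie h R P sM rho V" and WM: "weight_module scale lie h R P sM rho W"
    and d: "Vector_Spaces.linear sM sM d" "!!v. v : V ==> d v : W"
    and eq: "!!x v. x : r ==> v : V ==> d (rho x v) = rho x (d v)"
  obtains sigma where "sigma : hom_space sM W V" "!!x w. x : r ==> w : W ==> sigma (rho x w) = rho x (sigma w)"
    "!!v. v : V ==> d (sigma (d v)) = d v"
proof -
  interpret V: weight_module scale lie h R P sM rho V by fact
  interpret W: weight_module scale lie h R P sM rho W by fact
  interpret E: weight_module scale lie h R P "hom_scale sM" "hom_act rho W" "hom_space sM W V"
    by (rule hom_module[OF VM WM])
  interpret F: weight_module scale lie h R P "hom_scale sM" "hom_act rho V" "hom_space sM V W"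
    by (rule hom_module[OF WM VM])
  define dd where "dd = (%v. if v : V then d v else 0)"
  \<comment> \<open>A generalized inverse of \<open>d\<close> is a solution of
    \<open>Phi sigma = dd\<close>, and \<open>Phi\<close> is equivariant because \<open>d\<close>
    is.\<close>
  define Phi where "Phi sigma = (%v. if v : V then d (sigma (d v)) else 0)" for sigma
  note dl = V.M.lin_add[OF d(1)] V.M.lin_scale[OF d(1)] V.M.lin_diff[OF d(1)] V.M.lin_0[OF d(1)] V.M.lin_sum[OF d(1)]
  have ddF: "dd : hom_space sM V W" using d(2) V.V
    by (auto simp: hom_space_def dd_def dl V.M.subspace_add V.M.subspace_scale)
  have dd_inv: "hom_act rho V x dd = 0" if "x : r" for x
    using that eq V.rho_V by (auto simp: hom_act_def dd_def fun_eq_iff)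
  have PhiF: "Phi sigma : hom_space sM V W" if "sigma : hom_space sM W V" for sigma
    using that d(2) V.V by (auto simp: hom_space_def Phi_def dl V.M.subspace_add V.M.subspace_scale)
  have Phiact: "Phi (hom_act rho W x sigma) = hom_act rho V x (Phi sigma)" if "x : r" "sigma : hom_space sM W V" for x sigma
    using that eq d(2) V.rho_V by (auto simp: hom_space_def Phi_def hom_act_def fun_eq_iff dl)
  have Phisum: "Phi (\<Sum>i\<in>I. f i) = (\<Sum>i\<in>I. Phi (f i))" for f and I :: "('a + ('a => complex)) set"
    by (rule ext) (simp add: Phi_def fun_sum_apply dl)
  have PhiOmega: "Phi (E.Omega tau) = F.Omega (Phi tau)" if t: "tau : hom_space sM W V" for tau
    unfolding casimir_def Phisum
  proof (rule sum.cong[OF refl])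
    fix j assume "j : J"
    note j = bas_r[OF this]
    show "Phi (hom_act rho W (bas j) (hom_act rho W (dbas j) tau)) = hom_act rho V (bas j) (hom_act rho V (dbas j) (Phi tau))"
      using Phiact[OF j(1) E.rho_V[OF j(2) t]] Phiact[OF j(2) t] by simp
  qed
  \<comment> \<open>A linear right inverse of \<open>d\<close> on its image solves the equation, but
    without equivariance.\<close>
  obtain g0 where g0: "range g0 <= V" "Vector_Spaces.linear sM sM g0" "!!v. v : d ` V ==> d (g0 v) = v"
    using V.M.endo.linear_exists_right_inverse_on[OF d(1) V.V] by blast
  define sigma0 where "sigma0 = (%w. if w : W then g0 w else 0)"
  have sigma0E: "sigma0 : hom_space sM W V"
    using g0(1) W.V by (auto simp: hom_space_def sigma0_def V.M.lin_add[OF g0(2)] V.M.lin_scale[OF g0(2)]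
        V.M.subspace_add V.M.subspace_scale)
  have Phi0: "Phi sigma0 = dd" using d(2) g0(3) by (auto simp: Phi_def sigma0_def dd_def fun_eq_iff)
  obtain tau where tau: "tau : hom_space sM W V" "!!x. x : r ==> hom_act rho W x (sigma0 - E.Omega tau) = 0"
    using E.casimir_decomposition[OF sigma0E] by blast
  define sigma where "sigma = sigma0 - E.Omega tau"
  have sigmaE: "sigma : hom_space sM W V"
    unfolding sigma_def using sigma0E E.casimir_V[OF tau(1)] E.V by (simp add: E.M.subspace_diff)
  have "Phi sigma = dd - F.Omega (Phi tau)"
    unfolding Phi0[symmetric] PhiOmega[OF tau(1), symmetric] by (rule ext) (simp add: sigma_def Phi_def dl)
  then have eq2: "F.Omega (Phi tau) = dd - Phi sigma" by simp
  \<comment> \<open>The error is invariant, as a difference of two invariant maps, and it lies in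
    the image of the Casimir operator; such an element is zero.\<close>
  have "hom_act rho V x (F.Omega (Phi tau)) = 0" if "x : r" for x
  proof -
    have "hom_act rho V x (Phi sigma) = Phi 0" using Phiact[OF that sigmaE] tau(2)[OF that] by (simp add: sigma_def)
    also have "Phi 0 = 0" by (rule ext) (simp add: Phi_def dl)
    finally show ?thesis unfolding eq2 E.M.lin_diff[OF F.rho_lin] using dd_inv[OF that] by simp
  qed
  then have "F.Omega (Phi tau) = 0" using F.invariant_casimir_image_zero[OF PhiF[OF tau(1)]] by blast
  then have eq3: "dd = Phi sigma" using eq2 by simp
  have "d (sigma (d v)) = d v" if "v : V" for v using that fun_cong[OF eq3, of v] by (simp add: dd_def Phi_def)
  moreover have "sigma (rho x w) = rho x (sigma w)" if "x : r" "w : W" for x w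
    using fun_cong[OF tau(2)[OF that(1)], of w] that(2) by (simp add: hom_act_def sigma_def[symmetric])
  ultimately show ?thesis using that sigmaE by blast
qed

end

section \<open>Cochains and Cartan calculus by recursion on the argument list\<close>

text \<open>Signs for an arbitrary abelian group: the same recursions are used for numbers and for
  functions as values.\<close>

definition sg :: "nat => 'm::ab_group_add => 'm" where
  "sg n v = (if even n then v else - v)"

lemma sg_simps [simp]: "sg 0 v = v" "sg (Suc n) v = - sg n v" "sg n 0 = 0" by (auto simp: sg_def)

lemma sg_add: "sg n (u + v) = sg n u + sg n v" and sg_minus: "sg n (- v) = - sg n v"
  and sg_sg: "sg n (sg m v) = sg (n + m) v" by (auto simp: sg_def)

lemma sg_apply: "sg n f x = sg n (f x)" by (simp add: sg_def)

lemma sg_complex: "sg n (c::complex) = (- 1) ^ n * c" by (simp add: sg_def)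

lemma sg_mult: "sg n (c * d :: complex) = c * sg n d" by (simp add: sg_def)

text \<open>With \<open>lie x\<close> for \<open>D\<close>, minus this sum is the Lie derivative for
  trivial coefficients.\<close>

primrec ins_all :: "('a => 'a) => 'a list => ('a list => 'm::ab_group_add) => 'm" where
  "ins_all D [] = (%f. 0)"
| "ins_all D (y # ys) = (%f. f (D y # ys) + ins_all D ys (%zs. f (y # zs)))"

lemma ins_all_eq: "ins_all D ws f = (\<Sum>i<length ws. f (ws[i := D (ws ! i)]))"
proof (induction ws arbitrary: f)
  case (Cons w ws)
  then show ?case by (simp add: sum.lessThan_Suc_shift del: sum.lessThan_Suc)
qed simp

lemma ins_all_append: "ins_all D (us @ ws) f = ins_all D us (%vs. f (vs @ ws)) + ins_all D ws (%vs. f (us @ vs))"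
  by (induction us arbitrary: f) (simp_all add: add.assoc)

lemma ins_all_add: "ins_all D ws (%vs. f vs + g vs) = ins_all D ws f + ins_all D ws g"
  by (simp add: ins_all_eq sum.distrib)

lemma ins_all_diff: "ins_all D ws (%vs. f vs - g vs) = ins_all D ws f - ins_all D ws g"
  by (simp add: ins_all_eq sum_subtractf)

lemma ins_all_minus: "ins_all D ws (%vs. - f vs) = - ins_all D ws f" by (simp add: ins_all_eq sum_negf)

lemma ins_all_zero: "ins_all D ws (%vs. 0) = 0" by (simp add: ins_all_eq)

lemma ins_all_scale: "ins_all D ws (%vs. c * f vs) = (c::complex) * ins_all D ws f"
  by (simp add: ins_all_eq sum_distrib_left)

lemma ins_all_apply: "ins_all D ws f z = ins_all D ws (%vs. f vs z)" by (induction ws arbitrary: f) auto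

lemma ins_all_cong:
  assumes "!!x. x : S ==> D x : S" "set ws <= S"
    "!!vs. set vs <= S ==> length vs = length ws ==> f vs = g vs"
  shows "ins_all D ws f = ins_all D ws g" unfolding ins_all_eq
proof (rule sum.cong[OF refl])
  fix i assume "i : {..<length ws}"
  then have "set (ws[i := D (ws ! i)]) <= S" using assms(1,2) by (intro set_update_subsetI) (auto simp: subset_iff)
  then show "f (ws[i := D (ws ! i)]) = g (ws[i := D (ws ! i)])" using assms(3) by simp
qed

text \<open>Cartan's formula read as a recursion: contracting the differential with the first
  argument gives the Lie derivative minus the differential of the contraction. The formula contains
  no degree, and the values may themselves be functions.\<close>

primrec ce :: "('a => 'a => 'a) => ('a => 'm => 'm) => 'a list => ('a list => 'm::ab_group_add) => 'm" where
  "ce lie rho [] = (%f. 0)"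
| "ce lie rho (x # ws) = (%f. rho x (f ws) - ins_all (lie x) ws f - ce lie rho ws (%vs. f (x # vs)))"

lemma ce_cong:
  assumes "!!x y. x : S ==> y : S ==> lie x y : S" "set ws <= S"
    "!!vs. set vs <= S ==> Suc (length vs) = length ws ==> f vs = g vs"
  shows "ce lie rho ws f = ce lie rho ws g" using assms(2,3)
proof (induction ws arbitrary: f g)
  case (Cons w ws)
  have "ins_all (lie w) ws f = ins_all (lie w) ws g"
    by (rule ins_all_cong[where S = S]) (use Cons.prems assms(1) in auto)
  moreover have "ce lie rho ws (%vs. f (w # vs)) = ce lie rho ws (%vs. g (w # vs))"
    by (rule Cons.IH) (use Cons.prems in auto)
  ultimately show ?case using Cons.prems by simp
qed simp

lemma ce_zero: "(!!x. rho x 0 = 0) ==> ce lie rho ws (%vs. 0) = 0" by (induction ws) (simp_all add: ins_all_zero)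

abbreviation "ce0 lie \<equiv> ce lie (%_ _. 0)"

lemma ce0_add: "ce0 lie ws (%vs. f vs + g vs) = ce0 lie ws f + ce0 lie ws g"
  by (induction ws arbitrary: f g) (simp_all add: ins_all_add)

lemma ce0_minus: "ce0 lie ws (%vs. - f vs) = - ce0 lie ws f"
  by (induction ws arbitrary: f) (simp_all add: ins_all_minus)

lemma ce0_diff: "ce0 lie ws (%vs. f vs - g vs) = ce0 lie ws f - ce0 lie ws g"
  by (induction ws arbitrary: f g) (simp_all add: ins_all_diff)

lemma ce0_scale: "ce0 lie ws (%vs. c * f vs) = (c::complex) * ce0 lie ws f"
  by (induction ws arbitrary: f) (simp_all add: ins_all_scale algebra_simps)

lemma nths_Compl: "nths (x # xs) (- {0}) = xs" "nths (x # xs) (- {Suc i}) = x # nths xs (- {i})"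
  "nths (x # xs) (- {0, Suc j}) = nths xs (- {j})" "nths (x # xs) (- {Suc i, Suc j}) = x # nths xs (- {i, j})"
proof -
  have "{j. Suc j : - {0::nat}} = UNIV" "!!i. {j. Suc j : - {Suc i}} = - {i}"
    "!!i. {j. Suc j : - {0, Suc i}} = - {i}" "!!i l. {j. Suc j : - {Suc i, Suc l}} = - {i, l}" by auto
  then show "nths (x # xs) (- {0}) = xs" "nths (x # xs) (- {Suc i}) = x # nths xs (- {i})"
    "nths (x # xs) (- {0, Suc j}) = nths xs (- {j})" "nths (x # xs) (- {Suc i, Suc j}) = x # nths xs (- {i, j})"
    by (simp_all add: nths_Cons nths_all)
qed

definition antisym_on :: "'a set => ('a list => 'm::ab_group_add) => bool" where
  "antisym_on S f \<longleftrightarrow> (ALL us x y vs. set (us @ x # y # vs) <= S --> f (us @ x # y # vs) = - f (us @ y # x # vs))"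

lemma antisym_on_Cons: "antisym_on S f ==> w : S ==> antisym_on S (%vs. f (w # vs))" unfolding antisym_on_def
proof (intro allI impI)
  fix us x y vs
  assume "ALL us x y vs. set (us @ x # y # vs) <= S --> f (us @ x # y # vs) = - f (us @ y # x # vs)"
    and "w : S" "set (us @ x # y # vs) <= S"
  then show "f (w # us @ x # y # vs) = - f (w # us @ y # x # vs)"
    using append_Cons[of w us] by (metis insert_subset list.simps(15))
qed

text \<open>Moving the changed entry to the front costs one sign for every entry it passes.\<close>

lemma ins_all_antisym:
  assumes "!!x. x : S ==> D x : S"
  shows "antisym_on S f ==> set ws <= S ==>
    ins_all D ws f = (\<Sum>j<length ws. sg j (f (D (ws ! j) # nths ws (- {j}))))"
proof (induction ws arbitrary: f)
  case (Cons w ws)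
  have "f (w # D (ws ! j) # nths ws (- {j})) = - f (D (ws ! j) # w # nths ws (- {j}))" if "j < length ws" for j
  proof -
    have "set ([] @ w # D (ws ! j) # nths ws (- {j})) <= S"
      using Cons.prems(2) assms that set_nths_subset[of ws "- {j}"] by (auto simp: subset_iff)
    then show ?thesis using Cons.prems(1) unfolding antisym_on_def by (metis append_Nil)
  qed
  then show ?case using Cons.IH[OF antisym_on_Cons[OF Cons.prems(1)]] Cons.prems(2)
    by (simp add: sum.lessThan_Suc_shift nths_Compl sg_minus del: sum.lessThan_Suc)
qed simp

text \<open>The terms in which the first entry acts or is bracketed make up the Lie derivative; in
  all others it is carried along as a fixed argument, at the price of one sign.\<close>

lemma ce_explicit:
  assumes S: "!!x y. x : S ==> y : S ==> lie x y : S" and rho: "!!x v. x : S ==> rho x (- v) = - rho x v"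
  shows "antisym_on S f ==> set xs <= S ==>
    (\<Sum>i<length xs. sg i (rho (xs ! i) (f (nths xs (- {i}))))) +
    (\<Sum>j<length xs. \<Sum>i<j. sg (i + j) (f (lie (xs ! i) (xs ! j) # nths xs (- {i, j})))) = ce lie rho xs f"
proof (induction xs arbitrary: f)
  case (Cons x xs)
  let ?n = "length xs"
  let ?f = "%vs. f (x # vs)"
  have x: "x : S" and xs: "set xs <= S" using Cons.prems by auto
  have mem: "xs ! i : S" if "i < ?n" for i using xs that by auto
  have sw: "f (lie (xs ! i) (xs ! j) # x # nths xs (- {i, j})) = - ?f (lie (xs ! i) (xs ! j) # nths xs (- {i, j}))"
    if "i < ?n" "j < ?n" for i j
  proof -
    have "set ([] @ lie (xs ! i) (xs ! j) # x # nths xs (- {i, j})) <= S"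
      using x S mem that xs set_nths_subset[of xs "- {i, j}"] by (auto simp: subset_iff)
    then show ?thesis using Cons.prems(1) unfolding antisym_on_def by (metis append_Nil)
  qed
  have 1: "(\<Sum>i<length (x # xs). sg i (rho ((x # xs) ! i) (f (nths (x # xs) (- {i}))))) =
    rho x (f xs) - (\<Sum>i<?n. sg i (rho (xs ! i) (?f (nths xs (- {i})))))"
    by (simp add: sum.lessThan_Suc_shift nths_Compl sum_negf del: sum.lessThan_Suc)
  have "(\<Sum>j<length (x # xs). \<Sum>i<j. sg (i + j) (f (lie ((x # xs) ! i) ((x # xs) ! j) # nths (x # xs) (- {i, j})))) =
    (\<Sum>j<?n. \<Sum>i<Suc j. sg (i + Suc j) (f (lie ((x # xs) ! i) (xs ! j) # nths (x # xs) (- {i, Suc j}))))"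
    by (simp add: sum.lessThan_Suc_shift[of _ ?n] del: sum.lessThan_Suc)
  also have "... = (\<Sum>j<?n. - sg j (f (lie x (xs ! j) # nths xs (- {j}))) +
      (\<Sum>i<j. sg (i + j) (f (lie (xs ! i) (xs ! j) # x # nths xs (- {i, j})))))"
    by (simp add: sum.lessThan_Suc_shift nths_Compl del: sum.lessThan_Suc)
  also have "... = - (\<Sum>j<?n. sg j (f (lie x (xs ! j) # nths xs (- {j})))) -
      (\<Sum>j<?n. \<Sum>i<j. sg (i + j) (?f (lie (xs ! i) (xs ! j) # nths xs (- {i, j}))))"
  proof -
    have "(\<Sum>j<?n. \<Sum>i<j. sg (i + j) (f (lie (xs ! i) (xs ! j) # x # nths xs (- {i, j})))) =
      (\<Sum>j<?n. \<Sum>i<j. - sg (i + j) (?f (lie (xs ! i) (xs ! j) # nths xs (- {i, j}))))"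
      by (intro sum.cong refl) (simp add: sw sg_minus)
    then show ?thesis by (simp add: sum.distrib sum_negf sum_subtractf)
  qed
  also have "(\<Sum>j<?n. sg j (f (lie x (xs ! j) # nths xs (- {j})))) = ins_all (lie x) xs f"
    by (rule ins_all_antisym[symmetric, OF S[OF x] Cons.prems(1) xs])
  finally have 2: "(\<Sum>j<length (x # xs). \<Sum>i<j. sg (i + j) (f (lie ((x # xs) ! i) ((x # xs) ! j) # nths (x # xs) (- {i, j})))) =
    - ins_all (lie x) xs f - (\<Sum>j<?n. \<Sum>i<j. sg (i + j) (?f (lie (xs ! i) (xs ! j) # nths xs (- {i, j}))))" .
  show ?case unfolding 1 2 ce.simps Cons.IH[OF antisym_on_Cons[OF Cons.prems(1) x] xs, symmetric]
    by (simp add: algebra_simps)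
qed simp

section \<open>Alternating functions on lists and the identities of Cartan calculus\<close>

context complex_lie_algebra
begin

text \<open>One condition for lists of all lengths. Adjacent repetitions suffice: antisymmetry and
  vanishing on all repetitions follow.\<close>

definition alt_on :: "'a set => ('a list => complex) => bool" where
  "alt_on S f \<longleftrightarrow> (ALL us vs. set us <= S --> set vs <= S -->
     (ALL x:S. ALL y:S. f (us @ (x + y) # vs) = f (us @ x # vs) + f (us @ y # vs)) &
     (ALL c. ALL x:S. f (us @ scale c x # vs) = c * f (us @ x # vs)) &
     (ALL x:S. f (us @ x # x # vs) = 0))"

lemma alt_onI:
  assumes "!!us vs x y. set us <= S ==> set vs <= S ==> x : S ==> y : S ==>
      f (us @ (x + y) # vs) = f (us @ x # vs) + f (us @ y # vs)"
    "!!us vs c x. set us <= S ==> set vs <= S ==> x : S ==> f (us @ scale c x # vs) = c * f (us @ x # vs)"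
    "!!us vs x. set us <= S ==> set vs <= S ==> x : S ==> f (us @ x # x # vs) = 0"
  shows "alt_on S f" using assms unfolding alt_on_def by simp

lemma alt_onD:
  assumes "alt_on S f" "set us <= S" "set vs <= S" "x : S"
  shows alt_on_add: "y : S ==> f (us @ (x + y) # vs) = f (us @ x # vs) + f (us @ y # vs)"
    and alt_on_scale: "f (us @ scale c x # vs) = c * f (us @ x # vs)"
    and alt_on_same: "f (us @ x # x # vs) = 0" using assms unfolding alt_on_def by blast+

lemma alt_on_zero: "alt_on S f ==> set us <= S ==> set vs <= S ==> 0 : S ==> f (us @ 0 # vs) = 0"
  using alt_on_scale[of S f us vs 0 0] by simp

lemma alt_on_append: "alt_on S f ==> set ws <= S ==> alt_on S (%vs. f (ws @ vs))"
proof (rule alt_onI)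
  assume a: "alt_on S f" "set ws <= S"
  show "f (ws @ us @ (x + y) # vs) = f (ws @ us @ x # vs) + f (ws @ us @ y # vs)"
    if "set us <= S" "set vs <= S" "x : S" "y : S" for us vs x y
    using alt_on_add[OF a(1), of "ws @ us" vs x y] that a(2) by simp
  show "f (ws @ us @ scale c x # vs) = c * f (ws @ us @ x # vs)" if "set us <= S" "set vs <= S" "x : S" for us vs c x
    using alt_on_scale[OF a(1), of "ws @ us" vs x c] that a(2) by simp
  show "f (ws @ us @ x # x # vs) = 0" if "set us <= S" "set vs <= S" "x : S" for us vs x
    using alt_on_same[OF a(1), of "ws @ us" vs x] that a(2) by simp
qed

lemma alt_on_Cons: "alt_on S f ==> w : S ==> alt_on S (%vs. f (w # vs))" using alt_on_append[of S f "[w]"] by simp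

lemma alt_on_append_right: "alt_on S f ==> set ws <= S ==> alt_on S (%vs. f (vs @ ws))"
proof (rule alt_onI)
  assume a: "alt_on S f" "set ws <= S"
  show "f ((us @ (x + y) # vs) @ ws) = f ((us @ x # vs) @ ws) + f ((us @ y # vs) @ ws)"
    if "set us <= S" "set vs <= S" "x : S" "y : S" for us vs x y
    using alt_on_add[OF a(1), of us "vs @ ws" x y] that a(2) by simp
  show "f ((us @ scale c x # vs) @ ws) = c * f ((us @ x # vs) @ ws)"
    if "set us <= S" "set vs <= S" "x : S" for us vs c x
    using alt_on_scale[OF a(1), of us "vs @ ws" x c] that a(2) by simp
  show "f ((us @ x # x # vs) @ ws) = 0" if "set us <= S" "set vs <= S" "x : S" for us vs x
    using alt_on_same[OF a(1), of us "vs @ ws" x] that a(2) by simp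
qed

lemma alt_on_subset: "alt_on S f ==> T <= S ==> alt_on T f"
  by (rule alt_onI) (simp_all add: alt_on_add[of S f] alt_on_scale[of S f] alt_on_same[of S f] subset_iff)

lemma alt_on_cong:
  assumes "alt_on S f" "subspace S" "!!ws. set ws <= S ==> f ws = g ws"
  shows "alt_on S g"
proof (rule alt_onI)
  show "g (us @ (x + y) # vs) = g (us @ x # vs) + g (us @ y # vs)"
    if "set us <= S" "set vs <= S" "x : S" "y : S" for us vs x y
    using alt_on_add[OF assms(1) that] assms(3)[of "us @ (x + y) # vs"] assms(3)[of "us @ x # vs"]
      assms(3)[of "us @ y # vs"] that subspace_add[OF assms(2)] by simp
  show "g (us @ scale c x # vs) = c * g (us @ x # vs)" if "set us <= S" "set vs <= S" "x : S" for us vs c x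
    using alt_on_scale[OF assms(1) that, of c] assms(3)[of "us @ scale c x # vs"] assms(3)[of "us @ x # vs"]
      that subspace_scale[OF assms(2)] by simp
  show "g (us @ x # x # vs) = 0" if "set us <= S" "set vs <= S" "x : S" for us vs x
    using alt_on_same[OF assms(1) that] assms(3)[of "us @ x # x # vs"] that by simp
qed

lemma alt_on_lin:
  assumes "alt_on S f" "alt_on S g"
  shows alt_on_plus: "alt_on S (%ws. f ws + g ws)" and alt_on_smult: "alt_on S (%ws. c * f ws)"
    and alt_on_minus: "alt_on S (%ws. - f ws)"
  by (rule alt_onI; simp add: alt_onD[OF assms(1)] alt_onD[OF assms(2)] algebra_simps)+

lemma alt_on_zero_fun: "alt_on S (%ws. 0)" by (rule alt_onI) auto

lemma alt_on_sg: "alt_on S f ==> alt_on S (%ws. sg n (f ws))" by (cases "even n") (simp_all add: sg_def alt_on_minus)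

lemma alt_on_swap:
  assumes f: "alt_on S f" and S: "subspace S" and m: "set us <= S" "set vs <= S" "x : S" "y : S"
  shows "f (us @ x # y # vs) = - f (us @ y # x # vs)"
proof -
  have xy: "x + y : S" using m S by (simp add: subspace_add)
  have "0 = f (us @ (x + y) # (x + y) # vs)" using alt_on_same[OF f m(1,2) xy] by simp
  also have "... = f (us @ x # (x + y) # vs) + f (us @ y # (x + y) # vs)" by (rule alt_on_add[OF f]) (use m xy in auto)
  also have "f (us @ x # (x + y) # vs) = f (us @ x # x # vs) + f (us @ x # y # vs)"
    using alt_on_add[OF f, of "us @ [x]" vs x y] m by simp
  also have "f (us @ y # (x + y) # vs) = f (us @ y # x # vs) + f (us @ y # y # vs)"
    using alt_on_add[OF f, of "us @ [y]" vs x y] m by simp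
  finally show ?thesis using alt_on_same[OF f m(1,2)] m by (simp add: add_eq_0_iff2)
qed

lemma alt_on_antisym: "alt_on S f ==> subspace S ==> antisym_on S f"
  unfolding antisym_on_def by (intro allI impI, rule alt_on_swap[of S f]) auto

lemma alt_on_move:
  assumes f: "alt_on S f" and S: "subspace S"
  shows "set us <= S ==> set vs <= S ==> set ws <= S ==> x : S ==>
    f (us @ x # ws @ vs) = sg (length ws) (f (us @ ws @ x # vs))"
proof (induction ws arbitrary: us)
  case (Cons w ws)
  have "f (us @ x # w # ws @ vs) = - f ((us @ [w]) @ x # ws @ vs)"
    using alt_on_swap[OF f S, of us "ws @ vs" x w] Cons.prems by simp
  also have "... = - sg (length ws) (f ((us @ [w]) @ ws @ x # vs))" using Cons.IH[of "us @ [w]"] Cons.prems by simp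
  finally show ?case by simp
qed simp

lemma alt_on_repeated:
  assumes f: "alt_on S f" and S: "subspace S" and xs: "set xs <= S" "i < length xs" "j < length xs" "i ~= j" "xs ! i = xs ! j"
  shows "f xs = 0"
proof -
  have main: "f xs = 0" if ij: "i < j" "j < length xs" "xs ! i = xs ! j" for i j
  proof -
    define us ws vs where "us = take i xs" "ws = take (j - Suc i) (drop (Suc i) xs)" "vs = drop (Suc j) xs"
    have 1: "xs = us @ xs ! i # drop (Suc i) xs" unfolding us_ws_vs_def by (rule id_take_nth_drop) (use ij in simp)
    have "drop (Suc i) xs = ws @ drop (Suc i) xs ! (j - Suc i) # drop (Suc (j - Suc i)) (drop (Suc i) xs)"
      unfolding us_ws_vs_def using ij by (intro id_take_nth_drop) auto
    also have "drop (Suc i) xs ! (j - Suc i) = xs ! i" using ij by simp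
    also have "drop (Suc (j - Suc i)) (drop (Suc i) xs) = vs" using ij by (simp add: us_ws_vs_def)
    finally have eq: "xs = us @ xs ! i # ws @ xs ! i # vs" using 1 by simp
    then have m: "set us <= S" "set ws <= S" "set vs <= S" "xs ! i : S"
      using xs(1) ij by (auto simp: us_ws_vs_def dest!: in_set_takeD in_set_dropD)
    have "f xs = f (us @ xs ! i # ws @ xs ! i # vs)" using eq by simp
    also have "... = sg (length ws) (f (us @ ws @ xs ! i # xs ! i # vs))"
      using alt_on_move[OF f S, of us "xs ! i # vs" ws "xs ! i"] m by simp
    also have "f (us @ ws @ xs ! i # xs ! i # vs) = 0" using alt_on_same[OF f, of "us @ ws" vs "xs ! i"] m by simp
    finally show ?thesis by simp
  qed
  show ?thesis using main[of i j] main[of j i] xs by (cases "i < j") auto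
qed

lemma alt_on_ins_all:
  assumes D: "!!x. x : S ==> D x : S" "lin D"
  shows "alt_on S f ==> subspace S ==> alt_on S (%ws. ins_all D ws f)"
proof (rule alt_onI)
  assume S: "subspace S"
  note sub = subspace_add[OF S] subspace_scale[OF S]
  show "ins_all D (us @ (x + y) # vs) f = ins_all D (us @ x # vs) f + ins_all D (us @ y # vs) f"
    if "alt_on S f" "set us <= S" "set vs <= S" "x : S" "y : S" for us vs x y using that
  proof (induction us arbitrary: f)
    case Nil
    have "ins_all D vs (%zs. f ((x + y) # zs)) = ins_all D vs (%zs. f (x # zs) + f (y # zs))"
      by (rule ins_all_cong[where S = S]) (use Nil D alt_on_add[of S f "[]"] in auto)
    moreover have "f (D (x + y) # vs) = f (D x # vs) + f (D y # vs)"
      using alt_on_add[of S f "[]" vs "D x" "D y"] Nil D by (simp add: lin_add)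
    ultimately show ?case by (simp add: ins_all_add)
  next
    case (Cons u us)
    then show ?case using alt_on_add[of S f "D u # us" vs x y] alt_on_Cons[of S f u] D by simp
  qed
  show "ins_all D (us @ scale c x # vs) f = c * ins_all D (us @ x # vs) f"
    if "alt_on S f" "set us <= S" "set vs <= S" "x : S" for us vs c x using that
  proof (induction us arbitrary: f)
    case Nil
    have "ins_all D vs (%zs. f (scale c x # zs)) = ins_all D vs (%zs. c * f (x # zs))"
      by (rule ins_all_cong[where S = S]) (use Nil D alt_on_scale[of S f "[]"] in auto)
    moreover have "f (D (scale c x) # vs) = c * f (D x # vs)"
      using alt_on_scale[of S f "[]" vs "D x" c] Nil D by (simp add: lin_scale)
    ultimately show ?case by (simp add: ins_all_scale algebra_simps)
  next
    case (Cons u us)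
    then show ?case using alt_on_scale[of S f "D u # us" vs x c] alt_on_Cons[of S f u] D by (simp add: algebra_simps)
  qed
  show "ins_all D (us @ x # x # vs) f = 0" if "alt_on S f" "set us <= S" "set vs <= S" "x : S" for us vs x using that
  proof (induction us arbitrary: f)
    case Nil
    have "ins_all D vs (%zs. f (x # x # zs)) = ins_all D vs (%zs. 0)"
      by (rule ins_all_cong[where S = S]) (use Nil D alt_on_same[of S f "[]"] in auto)
    moreover have "f (D x # x # vs) = - f (x # D x # vs)" using alt_on_swap[of S f "[]" vs "D x" x] Nil D S by simp
    ultimately show ?case by (simp add: ins_all_zero)
  next
    case (Cons u us)
    then show ?case using alt_on_same[of S f "D u # us" vs x] alt_on_Cons[of S f u] D by simp
  qed
qed

text \<open>The operators \<open>- ins_all (lie x)\<close> form a representation; without their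
  minus signs one sign remains on the right.\<close>

lemma ins_all_commutator:
  assumes S: "subspace S" and x: "!!v. v : S ==> lie x v : S" and y: "!!v. v : S ==> lie y v : S"
  shows "alt_on S f ==> set ws <= S ==>
    ins_all (lie x) ws (%vs. ins_all (lie y) vs f) - ins_all (lie y) ws (%vs. ins_all (lie x) vs f) =
    - ins_all (lie (lie x y)) ws f"
proof (induction ws arbitrary: f)
  case (Cons w ws)
  have w: "w : S" "set ws <= S" using Cons.prems by auto
  have "lie (lie x y) w : S"
    using subspace_diff[OF S x[OF y[OF w(1)]] y[OF x[OF w(1)]]] by (simp add: lie_lie_right[of x y w])
  then have "f (lie (lie x y) w # ws) + f (lie y (lie x w) # ws) = f (lie x (lie y w) # ws)"
    using alt_on_add[OF Cons.prems(1), of "[]" ws "lie (lie x y) w" "lie y (lie x w)"] w x y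
    by (simp add: lie_lie_right[of x y w])
  moreover have "ins_all (lie x) ws (%vs. ins_all (lie y) vs (%zs. f (w # zs))) -
      ins_all (lie y) ws (%vs. ins_all (lie x) vs (%zs. f (w # zs))) = - ins_all (lie (lie x y)) ws (%zs. f (w # zs))"
    by (rule Cons.IH[OF alt_on_Cons[OF Cons.prems(1) w(1)] w(2)])
  ultimately show ?case by (simp add: ins_all_add algebra_simps)
qed simp

lemma ins_all_lie_add:
  assumes S: "subalgebra S" and "x : S" "y : S"
  shows "alt_on S f ==> set ws <= S ==> ins_all (lie (x + y)) ws f = ins_all (lie x) ws f + ins_all (lie y) ws f"
proof (induction ws arbitrary: f)
  case (Cons w ws)
  then show ?case using alt_on_add[of S f "[]" ws "lie x w" "lie y w"] alt_on_Cons[of S f w] subalg_lie[OF S] assms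
    by (simp add: lie_add_left)
qed simp

lemma ins_all_lie_scale:
  assumes S: "subalgebra S" and "x : S"
  shows "alt_on S f ==> set ws <= S ==> ins_all (lie (scale c x)) ws f = c * ins_all (lie x) ws f"
proof (induction ws arbitrary: f)
  case (Cons w ws)
  then show ?case using alt_on_scale[of S f "[]" ws "lie x w" c] alt_on_Cons[of S f w] subalg_lie[OF S] assms
    by (simp add: lie_scale_left algebra_simps)
qed simp

text \<open>The differential commutes with Lie derivatives. In the recursion, the commutator of two
  Lie derivatives is compensated by the term in which \<open>x\<close> acts on the first
  entry.\<close>

lemma ce0_ins_all:
  assumes S: "subalgebra S" and x: "!!v. v : S ==> lie x v : S"
  shows "alt_on S f ==> set ws <= S ==>
    ins_all (lie x) ws (%vs. ce0 lie vs f) = ce0 lie ws (%vs. ins_all (lie x) vs f)"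
proof (induction ws arbitrary: f)
  case (Cons w ws)
  have w: "w : S" "set ws <= S" using Cons.prems by auto
  have "ins_all (lie x) ws (%vs. ins_all (lie w) vs f) - ins_all (lie w) ws (%vs. ins_all (lie x) vs f) =
    - ins_all (lie (lie x w)) ws f"
    by (rule ins_all_commutator[OF subalg_subspace[OF S] x subalg_lie[OF S w(1)] Cons.prems(1) w(2)])
  moreover have "ins_all (lie x) ws (%vs. ce0 lie vs (%zs. f (w # zs))) =
      ce0 lie ws (%vs. ins_all (lie x) vs (%zs. f (w # zs)))"
    by (rule Cons.IH[OF alt_on_Cons[OF Cons.prems(1) w(1)] w(2)])
  ultimately show ?case by (simp add: ins_all_diff ins_all_minus ce0_add algebra_simps)
qed simp

text \<open>By Cartan's formula, twice the differential with first entry \<open>w\<close> is a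
  commutator of the differential with a Lie derivative plus twice the differential of the
  contraction; induction handles the latter.\<close>

lemma ce0_ce0:
  assumes S: "subalgebra S"
  shows "alt_on S f ==> set ws <= S ==> ce0 lie ws (%vs. ce0 lie vs f) = 0"
proof (induction ws arbitrary: f)
  case (Cons w ws)
  have w: "w : S" "set ws <= S" using Cons.prems by auto
  have "ce0 lie ws (%vs. ce0 lie (w # vs) f) =
    - ce0 lie ws (%vs. ins_all (lie w) vs f) - ce0 lie ws (%vs. ce0 lie vs (%zs. f (w # zs)))"
    by (simp add: ce0_diff ce0_minus)
  then show ?case
    using Cons.IH[OF alt_on_Cons[OF Cons.prems(1) w(1)] w(2)] ce0_ins_all[OF S subalg_lie[OF S w(1)] Cons.prems(1) w(2)] by simp
qed simp

lemma alt_on_ce0: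
  assumes S: "subalgebra S"
  shows "alt_on S f ==> alt_on S (%ws. ce0 lie ws f)"
proof (rule alt_onI)
  have sS: "subspace S" using S subalg_subspace by blast
  have ia: "alt_on S (%ws. ins_all (lie u) ws f)" if "alt_on S f" "u : S" for f u
    by (rule alt_on_ins_all[OF _ lin_lie that(1) sS]) (use subalg_lie[OF S] that in auto)
  note cl = subalg_lie[OF S]
  show "ce0 lie (us @ (x + y) # vs) f = ce0 lie (us @ x # vs) f + ce0 lie (us @ y # vs) f"
    if "alt_on S f" "set us <= S" "set vs <= S" "x : S" "y : S" for us vs x y using that
  proof (induction us arbitrary: f)
    case Nil
    have "ce0 lie vs (%zs. f ((x + y) # zs)) = ce0 lie vs (%zs. f (x # zs) + f (y # zs))"
      by (rule ce_cong[where S = S]) (use Nil cl alt_on_add[of S f "[]"] in auto)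
    then show ?case using ins_all_lie_add[OF S Nil(4,5,1,3)] by (simp add: ce0_add)
  next
    case (Cons u us)
    then show ?case using alt_on_add[OF ia[of f u], of us vs x y] alt_on_Cons[of S f u] by simp
  qed
  show "ce0 lie (us @ scale c x # vs) f = c * ce0 lie (us @ x # vs) f"
    if "alt_on S f" "set us <= S" "set vs <= S" "x : S" for us vs c x using that
  proof (induction us arbitrary: f)
    case Nil
    have "ce0 lie vs (%zs. f (scale c x # zs)) = ce0 lie vs (%zs. c * f (x # zs))"
      by (rule ce_cong[where S = S]) (use Nil cl alt_on_scale[of S f "[]"] in auto)
    then show ?case using ins_all_lie_scale[OF S Nil(4,1,3)] by (simp add: ce0_scale algebra_simps)
  next
    case (Cons u us)
    then show ?case using alt_on_scale[OF ia[of f u], of us vs x c] alt_on_Cons[of S f u] by (simp add: algebra_simps)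
  qed
  show "ce0 lie (us @ x # x # vs) f = 0" if "alt_on S f" "set us <= S" "set vs <= S" "x : S" for us vs x using that
  proof (induction us arbitrary: f)
    case Nil
    have "ce0 lie vs (%zs. f (x # x # zs)) = ce0 lie vs (%zs. 0)"
      by (rule ce_cong[where S = S]) (use Nil cl alt_on_same[of S f "[]"] in auto)
    moreover have "f (0 # vs) = 0" using alt_on_zero[of S f "[]" vs] Nil subspace_0[OF sS] by simp
    ultimately show ?case by (simp add: lie_self ce_zero)
  next
    case (Cons u us)
    then show ?case using alt_on_same[OF ia[of f u], of us vs x] alt_on_Cons[of S f u] by simp
  qed
qed

text \<open>Restricting the differential to lists \<open>xs @ zs\<close> splits it into a double complex.\<close>

lemma ce0_append:
  assumes rho: "!!x F. rho x F zs = - ins_all (lie x) zs F"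
  shows "ce0 lie (xs @ zs) f = ce lie rho xs (%us vs. f (us @ vs)) zs + sg (length xs) (ce0 lie zs (%vs. f (xs @ vs)))"
proof (induction xs arbitrary: f)
  case (Cons x xs)
  have eq: "(%vsa. f (x # xs @ vsa)) = (%vs. (%us. f (x # us)) (xs @ vs))" by simp
  show ?case using Cons.IH[of "%us. f (x # us)"] by (simp add: ins_all_append ins_all_apply rho)
qed simp

end

section \<open>Relative cochains of a semidirect product\<close>

text \<open>The complement \<open>L\<close> is a subalgebra, not only a vector space complement of
  the ideal: this excludes a component of the differential that raises the filtration by
  two.\<close>

locale semidirect = complex_lie_algebra scale lie for scale :: "complex => 'a::ab_group_add => 'a" and lie +
  fixes L I k :: "'a set"
  assumes L: "subalgebra L" and I: "subspace I"
    and LI: "!!x z. x : L ==> z : I ==> lie x z : I" and II: "!!x z. x : I ==> z : I ==> lie x z : I"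
    and L_I: "L \<inter> I = {0}" and kL: "k <= L" and k: "subalgebra k"
begin

definition A :: "'a set" where
  "A = L + I"

definition PL :: "'a => 'a" where
  "PL x = (SOME l. l : L & x - l : I)"

definition PI :: "'a => 'a" where
  "PI x = x - PL x"

lemma subspace_L: "subspace L" using L subalg_subspace by blast

lemma PL_eqI: assumes "l : L" "x - l : I" shows "PL x = l"
proof -
  have "PL x : L & x - PL x : I" unfolding PL_def by (rule someI[of _ l]) (use assms in simp)
  then have "PL x - l : L" "(x - l) - (x - PL x) : I"
    using assms subspace_diff[OF subspace_L] subspace_diff[OF I] by blast+
  then have "PL x - l : L \<inter> I" by simp
  then show ?thesis using L_I by simp
qed

lemma P_mem: assumes "x : A" shows "PL x : L" "PI x : I" "x = PL x + PI x"
proof -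
  obtain l z where lz: "l : L" "z : I" "x = l + z" using assms unfolding A_def by (rule set_plus_elim)
  then have "PL x = l" by (intro PL_eqI) auto
  then show "PL x : L" "PI x : I" "x = PL x + PI x" using lz by (auto simp: PI_def)
qed

lemma L_A: "x : L ==> x : A" and I_A: "x : I ==> x : A"
  using set_plus_intro[of x L 0 I] set_plus_intro[of 0 L x I] subspace_0[OF subspace_L] subspace_0[OF I]
  by (auto simp: A_def)

lemma P_L: "x : L ==> PL x = x" "x : L ==> PI x = 0" and P_I: "x : I ==> PL x = 0" "x : I ==> PI x = x"
  using PL_eqI[of x x] PL_eqI[of 0 x] subspace_0[OF subspace_L] subspace_0[OF I] by (auto simp: PI_def)

lemma P_add: assumes "x : A" "y : A" shows "PL (x + y) = PL x + PL y" "PI (x + y) = PI x + PI y"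
proof -
  show "PL (x + y) = PL x + PL y"
  proof (rule PL_eqI)
    show "PL x + PL y : L" using P_mem assms subspace_add[OF subspace_L] by blast
    have "x + y - (PL x + PL y) = PI x + PI y" by (simp add: PI_def)
    then show "x + y - (PL x + PL y) : I" using P_mem assms subspace_add[OF I] by metis
  qed
  then show "PI (x + y) = PI x + PI y" by (simp add: PI_def)
qed

lemma P_scale: assumes "x : A" shows "PL (scale c x) = scale c (PL x)" "PI (scale c x) = scale c (PI x)"
proof -
  show "PL (scale c x) = scale c (PL x)"
  proof (rule PL_eqI)
    show "scale c (PL x) : L" using P_mem assms subspace_scale[OF subspace_L] by blast
    have "scale c x - scale c (PL x) = scale c (PI x)" by (simp add: PI_def scale_right_diff_distrib)
    then show "scale c x - scale c (PL x) : I" using P_mem assms subspace_scale[OF I] by metis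
  qed
  then show "PI (scale c x) = scale c (PI x)" by (simp add: PI_def scale_right_diff_distrib)
qed

lemma subspace_A: "subspace A"
proof (rule subspaceI)
  show "0 : A" using L_A subspace_0[OF subspace_L] by blast
  show "x + y : A" if "x : A" "y : A" for x y
  proof -
    have "x + y = (PL x + PL y) + (PI x + PI y)" using P_mem(3) that by (metis add.assoc add.left_commute)
    then show ?thesis unfolding A_def
      using set_plus_intro P_mem that subspace_add[OF I] subspace_add[OF subspace_L] by metis
  qed
  show "scale c x : A" if "x : A" for c x
  proof -
    have "scale c x = scale c (PL x) + scale c (PI x)" using P_mem(3)[OF that] by (metis scale_right_distrib)
    then show ?thesis unfolding A_def
      using set_plus_intro P_mem that subspace_scale[OF I] subspace_scale[OF subspace_L] by metis
  qed
qed

lemma lie_I_A: assumes "x : A" "z : I" shows "lie x z : I"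
proof -
  have "lie x z = lie (PL x) z + lie (PI x) z" using P_mem(3)[OF assms(1)] by (metis lie_add_left)
  then show ?thesis using P_mem[OF assms(1)] LI II assms subspace_add[OF I] by metis
qed

lemma A: "subalgebra A" unfolding subalgebra_def
proof (intro conjI ballI)
  fix x y assume x: "x : A" and y: "y : A"
  have eq: "lie x y = lie (PL x) (PL y) + (lie (PI x) (PL y) + lie x (PI y))"
    using P_mem(3)[OF x] P_mem(3)[OF y] by (metis add.assoc lie_add_left lie_add_right)
  have "lie (PI x) (PL y) : I"
    using LI[of "PL y" "PI x"] P_mem x y lie_antisym[of "PI x" "PL y"] subspace_neg[OF I] by metis
  then have "lie (PI x) (PL y) + lie x (PI y) : I" using lie_I_A x P_mem y subspace_add[OF I] by blast
  moreover have "lie (PL x) (PL y) : L" using P_mem x y subalg_lie[OF L] by blast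
  ultimately show "lie x y : A" unfolding A_def eq by (intro set_plus_intro)
qed (rule subspace_A)

lemma I_subalgebra: "subalgebra I" using I II by (simp add: subalgebra_def)

lemma lists_A: "set xs <= L ==> set xs <= A" "set zs <= I ==> set zs <= A" using L_A I_A by auto

text \<open>Split every entry by the projections, move parts in \<open>I\<close> to the far right
  and let parts in \<open>L\<close> join the left group. An entry that already lies in
  \<open>I\<close> is moved without splitting, so the count of such entries, bounded below by
  \<open>m\<close>, is preserved.\<close>

lemma alt_on_LI_vanish:
  assumes f: "alt_on A f"
    and z: "!!us vs. set us <= L ==> set vs <= I ==> length us + length vs = N ==> m <= length vs ==> f (us @ vs) = 0"
  shows "set us <= L ==> set vs <= I ==> set ws <= A ==> length us + length ws + length vs = N ==>
    m <= length vs + length (filter (%x. x : I) ws) ==> f (us @ ws @ vs) = 0"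
proof (induction ws arbitrary: us vs)
  case Nil
  then show ?case using z by simp
next
  case (Cons w ws)
  have w: "w : A" "set ws <= A" and uv: "set us <= A" "set vs <= A" using Cons.prems lists_A by auto
  have mv: "f (us @ x # ws @ vs) = 0" if "x : I" "m <= Suc (length vs + length (filter (%x. x : I) ws))" for x
  proof -
    have "f (us @ x # ws @ vs) = sg (length ws) (f (us @ ws @ x # vs))"
      using alt_on_move[OF f subspace_A uv w(2) I_A[OF that(1)]] .
    also have "f (us @ ws @ x # vs) = 0" using Cons.IH[of us "x # vs"] Cons.prems w that by simp
    finally show ?thesis by simp
  qed
  show ?case
  proof (cases "w : I")
    case True
    then show ?thesis using mv[of w] Cons.prems by simp
  next
    case False
    have "f (us @ (PL w + PI w) # ws @ vs) = f (us @ PL w # ws @ vs) + f (us @ PI w # ws @ vs)"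
      by (rule alt_on_add[OF f]) (use uv w P_mem[OF w(1)] L_A I_A in auto)
    moreover have "f (us @ PI w # ws @ vs) = 0" using mv P_mem[OF w(1)] Cons.prems False by simp
    moreover have "f (us @ PL w # ws @ vs) = 0"
      using Cons.IH[of "us @ [PL w]" vs] Cons.prems w P_mem[OF w(1)] False by simp
    ultimately show ?thesis using P_mem(3)[OF w(1)] by simp
  qed
qed

lemma alt_on_determined:
  assumes f: "alt_on A f" and z: "!!us vs. set us <= L ==> set vs <= I ==> length us + length vs = length ws ==> f (us @ vs) = 0"
    and "set ws <= A"
  shows "f ws = 0"
  using alt_on_LI_vanish[OF f, where N = "length ws" and m = 0 and us = "[]" and vs = "[]" and ws = ws] z assms(3)
  by simp

end

subsection \<open>Extending a family on \<open>L\<close>-lists and \<open>I\<close>-lists\<close>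

text \<open>Each entry goes to the first or to the second list; an entry sent to the second has to
  pass all later entries sent to the first, whence the sign.\<close>

primrec shuffle_sum :: "('a => 'a) => ('a => 'a) => 'a list => ('a list => 'a list => complex) => complex" where
  "shuffle_sum a b [] = (%f. f [] [])"
| "shuffle_sum a b (w # ws) = (%f. shuffle_sum a b ws (%xs zs. f (a w # xs) zs) +
     shuffle_sum a b ws (%xs zs. sg (length xs) (f xs (b w # zs))))"

lemma shuffle_sum_add:
  "shuffle_sum a b ws (%xs zs. f xs zs + g xs zs) = shuffle_sum a b ws f + shuffle_sum a b ws g"
  by (induction ws arbitrary: f g) (simp_all add: sg_add)

lemma shuffle_sum_scale:
  "shuffle_sum a b ws (%xs zs. c * f xs zs) = c * shuffle_sum a b ws f"
  by (induction ws arbitrary: f) (simp_all add: sg_mult algebra_simps)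

lemma shuffle_sum_minus: "shuffle_sum a b ws (%xs zs. - f xs zs) = - shuffle_sum a b ws f"
  using shuffle_sum_scale[of a b ws "-1" f] by simp

lemma shuffle_sum_zero: "shuffle_sum a b ws (%xs zs. 0) = 0" by (induction ws) simp_all

context semidirect
begin

abbreviation "shuf \<equiv> shuffle_sum PL PI"

lemma shuf_cong:
  "set ws <= A ==> (!!xs zs. set xs <= L ==> set zs <= I ==> length xs + length zs = length ws ==> f xs zs = g xs zs) ==>
    shuf ws f = shuf ws g"
proof (induction ws arbitrary: f g)
  case (Cons w ws)
  have w: "PL w : L" "PI w : I" using P_mem Cons.prems(1) by auto
  have "shuf ws (%xs zs. f (PL w # xs) zs) = shuf ws (%xs zs. g (PL w # xs) zs)"
    by (rule Cons.IH) (use Cons.prems w in auto)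
  moreover have "shuf ws (%xs zs. sg (length xs) (f xs (PI w # zs))) = shuf ws (%xs zs. sg (length xs) (g xs (PI w # zs)))"
    by (rule Cons.IH) (use Cons.prems w in auto)
  ultimately show ?case by simp
qed simp

definition bialt :: "('a list => 'a list => complex) => bool" where
  "bialt f \<longleftrightarrow> (ALL zs. set zs <= I --> alt_on L (%xs. f xs zs)) & (ALL xs. set xs <= L --> alt_on I (f xs))"

lemma bialt_L: "bialt f ==> x : L ==> bialt (%xs zs. f (x # xs) zs)" unfolding bialt_def by (auto intro: alt_on_Cons)

lemma bialt_I: assumes "bialt f" "z : I" shows "bialt (%xs zs. sg (length xs) (f xs (z # zs)))" unfolding bialt_def
proof (intro conjI allI impI)
  fix zs assume "set zs <= I"
  then have "alt_on L (%xs. f xs (z # zs))" using assms by (auto simp: bialt_def)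
  then show "alt_on L (%xs. sg (length xs) (f xs (z # zs)))"
    by (intro alt_onI) (simp_all add: alt_onD[of L "%xs. f xs (z # zs)"] sg_add sg_mult sg_minus)
next
  fix xs assume "set xs <= L"
  then have "alt_on I (f xs)" using assms(1) by (auto simp: bialt_def)
  then show "alt_on I (%zs. sg (length xs) (f xs (z # zs)))"
    using assms(2) by (intro alt_on_sg alt_on_Cons[of I "f xs"])
qed

lemma bialtD:
  assumes "bialt f" "set zs <= I" "set xs <= L"
  shows "alt_on L (%xs. f xs zs)" "alt_on I (f xs)" using assms by (auto simp: bialt_def)

lemma bialt_L_rules:
  assumes "bialt f" "set zs <= I" "set vs <= L"
  shows "x : L ==> y : L ==> f ((x + y) # vs) zs = f (x # vs) zs + f (y # vs) zs"
    and "x : L ==> f (scale c x # vs) zs = c * f (x # vs) zs"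
    and "x : L ==> f (x # x # vs) zs = 0" and "f (0 # vs) zs = 0"
proof -
  have a: "alt_on L (%xs. f xs zs)" using bialtD(1)[OF assms(1,2), of "[]"] by simp
  have e: "set [] <= L" by simp
  show "x : L ==> y : L ==> f ((x + y) # vs) zs = f (x # vs) zs + f (y # vs) zs"
    and "x : L ==> f (scale c x # vs) zs = c * f (x # vs) zs"
    and "x : L ==> f (x # x # vs) zs = 0" and "f (0 # vs) zs = 0"
    using alt_on_add[OF a e assms(3), of x y] alt_on_scale[OF a e assms(3), of x c]
      alt_on_same[OF a e assms(3), of x] alt_on_zero[OF a e assms(3) subspace_0[OF subspace_L]]
    unfolding append_Nil by blast+
qed

lemma bialt_I_rules:
  assumes "bialt f" "set xs <= L" "set vs <= I"
  shows "x : I ==> y : I ==> f xs ((x + y) # vs) = f xs (x # vs) + f xs (y # vs)"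
    and "x : I ==> f xs (scale c x # vs) = c * f xs (x # vs)"
    and "x : I ==> f xs (x # x # vs) = 0" and "f xs (0 # vs) = 0"
proof -
  have a: "alt_on I (f xs)" using bialtD(2)[OF assms(1) _ assms(2), of "[]"] by simp
  have e: "set [] <= I" by simp
  show "x : I ==> y : I ==> f xs ((x + y) # vs) = f xs (x # vs) + f xs (y # vs)"
    and "x : I ==> f xs (scale c x # vs) = c * f xs (x # vs)"
    and "x : I ==> f xs (x # x # vs) = 0" and "f xs (0 # vs) = 0"
    using alt_on_add[OF a e assms(3), of x y] alt_on_scale[OF a e assms(3), of x c]
      alt_on_same[OF a e assms(3), of x] alt_on_zero[OF a e assms(3) subspace_0[OF I]] unfolding append_Nil by blast+
qed

lemma alt_on_shuf: "bialt f ==> alt_on A (%ws. shuf ws f)"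
proof (rule alt_onI)
  show "shuf (us @ (x + y) # vs) f = shuf (us @ x # vs) f + shuf (us @ y # vs) f"
    if "bialt f" "set us <= A" "set vs <= A" "x : A" "y : A" for us vs x y using that
  proof (induction us arbitrary: f)
    case Nil
    note m = P_mem(1,2)[OF Nil(4)] P_mem(1,2)[OF Nil(5)]
    have "shuf vs (%xs zs. f (PL (x + y) # xs) zs) = shuf vs (%xs zs. f (PL x # xs) zs + f (PL y # xs) zs)"
      by (rule shuf_cong[OF Nil(3)])
        (simp add: P_add[OF Nil(4,5)] bialt_L_rules[OF Nil(1)] m)
    moreover have "shuf vs (%xs zs. sg (length xs) (f xs (PI (x + y) # zs))) =
        shuf vs (%xs zs. sg (length xs) (f xs (PI x # zs)) + sg (length xs) (f xs (PI y # zs)))"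
      by (rule shuf_cong[OF Nil(3)])
        (simp add: P_add[OF Nil(4,5)] bialt_I_rules[OF Nil(1)] m sg_add)
    ultimately show ?case by (simp add: shuffle_sum_add)
  next
    case (Cons u us)
    then show ?case using bialt_L bialt_I P_mem(1,2)[of u] by simp
  qed
  show "shuf (us @ scale c x # vs) f = c * shuf (us @ x # vs) f"
    if "bialt f" "set us <= A" "set vs <= A" "x : A" for us vs c x using that
  proof (induction us arbitrary: f)
    case Nil
    note m = P_mem(1,2)[OF Nil(4)]
    have "shuf vs (%xs zs. f (PL (scale c x) # xs) zs) = shuf vs (%xs zs. c * f (PL x # xs) zs)"
      by (rule shuf_cong[OF Nil(3)])
        (simp add: P_scale[OF Nil(4)] bialt_L_rules[OF Nil(1)] m)
    moreover have "shuf vs (%xs zs. sg (length xs) (f xs (PI (scale c x) # zs))) =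
        shuf vs (%xs zs. c * sg (length xs) (f xs (PI x # zs)))" by (rule shuf_cong[OF Nil(3)])
        (simp add: P_scale[OF Nil(4)] bialt_I_rules[OF Nil(1)] m sg_mult)
    ultimately show ?case by (simp add: shuffle_sum_scale algebra_simps)
  next
    case (Cons u us)
    then show ?case using bialt_L bialt_I P_mem(1,2)[of u] by (simp add: algebra_simps)
  qed
  show "shuf (us @ x # x # vs) f = 0" if "bialt f" "set us <= A" "set vs <= A" "x : A" for us vs x using that
  proof (induction us arbitrary: f)
    case Nil
    note m = P_mem(1,2)[OF Nil(4)]
    have "shuf vs (%xs zs. f (PL x # PL x # xs) zs) = shuf vs (%xs zs. 0)"
      by (rule shuf_cong[OF Nil(3)]) (simp add: bialt_L_rules[OF Nil(1)] m)
    moreover have "shuf vs (%xs zs. sg (length xs) (sg (length xs) (f xs (PI x # PI x # zs)))) = shuf vs (%xs zs. 0)"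
      by (rule shuf_cong[OF Nil(3)]) (simp add: bialt_I_rules[OF Nil(1)] m)
    \<comment> \<open>The two mixed terms cancel, since in one of them the entry of \<open>I\<close>
      passes one more entry of \<open>L\<close>.\<close>
    ultimately show ?case by (simp add: shuffle_sum_zero shuffle_sum_minus)
  next
    case (Cons u us)
    then show ?case using bialt_L bialt_I P_mem(1,2)[of u] by simp
  qed
qed

text \<open>For a list with \<open>L\<close> in front the projections annihilate all distributions
  but one, in which nothing is passed.\<close>

lemma shuf_split: "bialt f ==> set xs <= L ==> set zs <= I ==> shuf (xs @ zs) f = f xs zs"
proof (induction xs arbitrary: f)
  case Nil
  show ?case using Nil(1,3)
  proof (induction zs arbitrary: f)
    case (Cons z zs)
    have z: "z : I" "set zs <= I" using Cons.prems by auto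
    have "shuf zs (%xs zs. f (PL z # xs) zs) = shuf zs (%xs zs. 0)"
      by (rule shuf_cong[OF lists_A(2)[OF z(2)]]) (simp add: P_I[OF z(1)] bialt_L_rules[OF Cons.prems(1)])
    moreover have "shuf zs (%xs zs. sg (length xs) (f xs (z # zs))) = f [] (z # zs)"
      using Cons.IH[OF bialt_I[OF Cons.prems(1) z(1)] z(2)] by simp
    ultimately show ?case by (simp add: P_I[OF z(1)] shuffle_sum_zero)
  qed simp
next
  case (Cons x xs)
  have x: "x : L" "set xs <= L" using Cons.prems by auto
  have "shuf (xs @ zs) (%xs zs. sg (length xs) (f xs (PI x # zs))) = shuf (xs @ zs) (%xs zs. 0)"
    by (rule shuf_cong) (use x(2) Cons.prems(3) lists_A in \<open>auto simp: P_L[OF x(1)] bialt_I_rules[OF Cons.prems(1)]\<close>)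
  moreover have "shuf (xs @ zs) (%xs zs. f (x # xs) zs) = f (x # xs) zs"
    using Cons.IH[OF bialt_L[OF Cons.prems(1) x(1)] x(2) Cons.prems(3)] by simp
  ultimately show ?case by (simp add: P_L[OF x(1)] shuffle_sum_zero)
qed

subsection \<open>The filtered complex\<close>

definition altn :: "'a set => nat => ('a list => complex) => bool" where
  "altn S n f \<longleftrightarrow> alt_on S f & (ALL xs. xs ~: args S n --> f xs = 0)"

lemma altn_0: "altn S n f ==> ~ set xs <= S \<or> length xs ~= n ==> f xs = 0" by (auto simp: altn_def args_def)

definition diff_on :: "'a set => ('a list => complex) => 'a list => complex" where
  "diff_on S f = (%ys. if set ys <= S then ce0 lie ys f else 0)"

lemma altn_diff_on:
  assumes S: "subalgebra S" and f: "altn S n f" shows "altn S (Suc n) (diff_on S f)" unfolding altn_def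
proof (intro conjI allI impI)
  have "alt_on S (%ws. ce0 lie ws f)" using alt_on_ce0[OF S] f by (simp add: altn_def)
  then show "alt_on S (diff_on S f)" by (rule alt_on_cong) (use S subalg_subspace in \<open>auto simp: diff_on_def\<close>)
  fix xs assume xs: "xs ~: args S (Suc n)"
  show "diff_on S f xs = 0"
  proof (cases "set xs <= S")
    case True
    then have len: "length xs ~= Suc n" using xs by (simp add: args_def)
    have "ce0 lie xs f = ce0 lie xs (%_. 0)"
      by (rule ce_cong[where S = S]) (use subalg_lie[OF S] True altn_0[OF f] len in auto)
    then show ?thesis by (simp add: diff_on_def ce_zero)
  qed (simp add: diff_on_def)
qed

lemma diff_on_diff_on:
  assumes S: "subalgebra S" and f: "altn S n f" shows "diff_on S (diff_on S f) = (%_. 0)"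
proof
  fix xs
  show "diff_on S (diff_on S f) xs = 0"
  proof (cases "set xs <= S")
    case True
    have "ce0 lie xs (diff_on S f) = ce0 lie xs (%vs. ce0 lie vs f)"
      by (rule ce_cong[where S = S]) (use subalg_lie[OF S] True in \<open>auto simp: diff_on_def\<close>)
    also have "... = 0" by (rule ce0_ce0[OF S _ True]) (use f in \<open>simp add: altn_def\<close>)
    finally show ?thesis by (simp add: diff_on_def)
  qed (simp add: diff_on_def)
qed

lemma diff_on_add: "diff_on S (%xs. f xs + g xs) = (%xs. diff_on S f xs + diff_on S g xs)"
  and diff_on_scale: "diff_on S (%xs. c * f xs) = (%xs. c * diff_on S f xs)"
  and diff_on_minus: "diff_on S (%xs. - f xs) = (%xs. - diff_on S f xs)"
  and diff_on_diff: "diff_on S (%xs. f xs - g xs) = (%xs. diff_on S f xs - diff_on S g xs)"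
  and diff_on_zero: "diff_on S (%xs. 0) = (%xs. 0)"
  by (auto simp: diff_on_def ce0_add ce0_scale ce0_minus ce0_diff ce_zero fun_eq_iff)

lemma altn_plus: "altn S n f ==> altn S n g ==> altn S n (%xs. f xs + g xs)"
  and altn_smult: "altn S n f ==> altn S n (%xs. c * f xs)"
  and altn_minus: "altn S n f ==> altn S n (%xs. - f xs)"
  and altn_zero: "altn S n (%xs. 0)" by (auto simp: altn_def alt_on_plus alt_on_smult alt_on_minus alt_on_zero_fun)

lemma altn_diff: "altn S n f ==> altn S n g ==> altn S n (%xs. f xs - g xs)"
  using altn_plus[OF _ altn_minus, of S n f g] by simp

text \<open>For trivial coefficients the action on values is zero, so equivariance under
  \<open>k\<close> means that the insertion sums vanish.\<close>

definition Cn :: "nat => ('a list => complex) set" where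
  "Cn n = {f. altn A n f & (ALL xs. set xs <= A --> set xs \<inter> k ~= {} --> f xs = 0) &
     (ALL x:k. ALL xs. set xs <= A --> ins_all (lie x) xs f = 0)}"

abbreviation "D \<equiv> diff_on A"

lemma Cn_altn: "f : Cn n ==> altn A n f" by (simp add: Cn_def)

lemma Cn_alt_on: "f : Cn n ==> alt_on A f" by (simp add: Cn_def altn_def)

lemma Cn_plus: "f : Cn n ==> g : Cn n ==> (%xs. f xs + g xs) : Cn n"
  and Cn_smult: "f : Cn n ==> (%xs. c * f xs) : Cn n"
  and Cn_zero: "(%xs. 0) : Cn n"
  by (auto simp: Cn_def altn_plus altn_smult altn_zero ins_all_add ins_all_scale ins_all_zero)

lemma kA: "x : k ==> x : A" using kL L_A by blast

lemma Cn_D: assumes f: "f : Cn n" shows "D f : Cn (Suc n)" unfolding Cn_def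
proof (intro CollectI conjI ballI allI impI)
  note fa = Cn_alt_on[OF f]
  show alt: "altn A (Suc n) (D f)" by (rule altn_diff_on[OF A Cn_altn[OF f]])
  have inv: "ins_all (lie x) xs f = 0" if "x : k" "set xs <= A" for x xs using f that by (simp add: Cn_def)
  fix xs assume xs: "set xs <= A"
  {
    assume "set xs \<inter> k ~= {}"
    then obtain x us vs where x: "x : k" "xs = us @ x # vs" by (meson disjoint_iff split_list)
    \<comment> \<open>With an element of \<open>k\<close> in front, the recursion leaves an
      insertion sum, zero by invariance, and the differential of a contraction that is itself
      zero.\<close>
    have hd: "D f (x # ws) = 0" if ws: "set ws <= A" for ws
    proof -
      have "ce0 lie ws (%vs. f (x # vs)) = ce0 lie ws (%vs. 0)"
        by (rule ce_cong[where S = A]) (use subalg_lie[OF A] ws f x kA in \<open>auto simp: Cn_def\<close>)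
      then show ?thesis using inv[OF x(1) ws] ws kA[OF x(1)] by (simp add: diff_on_def ce_zero)
    qed
    have "D f (x # us @ vs) = sg (length us) (D f (us @ x # vs))"
      using alt_on_move[of A "D f" "[]" vs us x] alt subspace_A xs x kA by (simp add: altn_def)
    then show "D f xs = 0" using hd[of "us @ vs"] xs x by (auto simp: sg_def split: if_splits)
  }
  fix x assume x: "x : k"
  have "ins_all (lie x) xs (D f) = ins_all (lie x) xs (%vs. ce0 lie vs f)"
    by (rule ins_all_cong[where S = A]) (use subalg_lie[OF A] xs x kA in \<open>auto simp: diff_on_def\<close>)
  also have "... = ce0 lie xs (%vs. ins_all (lie x) vs f)" by (rule ce0_ins_all[OF A subalg_lie[OF A kA[OF x]] fa xs])
  also have "... = ce0 lie xs (%vs. 0)" by (rule ce_cong[where S = A]) (use subalg_lie[OF A] xs inv[OF x] in auto)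
  finally show "ins_all (lie x) xs (D f) = 0" by (simp add: ce_zero)
qed

lemma D_D: "f : Cn n ==> D (D f) = (%_. 0)" by (rule diff_on_diff_on[OF A Cn_altn])

text \<open>Only lists with the entries of \<open>L\<close> in front are tested; fewer than
  \<open>p\<close> of them means at least \<open>n - p + 1\<close> entries from
  \<open>I\<close>.\<close>

definition Fil :: "int => nat => ('a list => complex) set" where
  "Fil p n = {f : Cn n. ALL xs zs. set xs <= L --> set zs <= I --> length xs + length zs = n -->
     int (length xs) < p --> f (xs @ zs) = 0}"

lemma FilI:
  "f : Cn n ==> (!!xs zs. set xs <= L ==> set zs <= I ==> length xs + length zs = n ==> int (length xs) < p ==> f (xs @ zs) = 0)
    ==> f : Fil p n" by (simp add: Fil_def)

lemma Fil_Cn: "f : Fil p n ==> f : Cn n" by (simp add: Fil_def)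

lemma Fil_0: "f : Fil p n ==> set xs <= L ==> set zs <= I ==> int (length xs) < p ==> f (xs @ zs) = 0"
  using altn_0[OF Cn_altn[OF Fil_Cn], of f p n "xs @ zs"] by (cases "length xs + length zs = n") (auto simp: Fil_def)

lemma Fil_plus: "f : Fil p n ==> g : Fil p n ==> (%xs. f xs + g xs) : Fil p n"
  and Fil_smult: "f : Fil p n ==> (%xs. c * f xs) : Fil p n"
  and Fil_zero: "(%xs. 0) : Fil p n" by (auto simp: Fil_def Cn_plus Cn_smult Cn_zero)

lemma Fil_minus: "f : Fil p n ==> (%xs. - f xs) : Fil p n" using Fil_smult[of f p n "-1"] by simp

lemma Fil_diff: "f : Fil p n ==> g : Fil p n ==> (%xs. f xs - g xs) : Fil p n"
  using Fil_plus[OF _ Fil_minus, of f p n g] by simp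

lemma Fil_antimono: "p <= q ==> Fil q n <= Fil p n" by (auto simp: Fil_def)

lemma Fil_nonpos: "p <= 0 ==> Fil p n = Cn n" by (auto simp: Fil_def)

lemma Fil_large: assumes "int n < p" shows "Fil p n = {%_. 0}"
proof -
  have "f = (%_. 0)" if f: "f : Fil p n" for f
  proof
    fix xs
    show "f xs = 0"
    proof (cases "set xs <= A & length xs = n")
      case True
      show ?thesis
      proof (rule alt_on_determined[OF Cn_alt_on[OF Fil_Cn[OF f]]])
        show "f (us @ vs) = 0" if "set us <= L" "set vs <= I" "length us + length vs = length xs" for us vs
          by (rule Fil_0[OF f that(1,2)]) (use that(3) True assms in linarith)
      qed (use True in simp)
    qed (use altn_0[OF Cn_altn[OF Fil_Cn[OF f]]] in auto)
  qed
  then show ?thesis using Fil_zero by blast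
qed

text \<open>A cochain seen as a function of its arguments in \<open>L\<close>, with values in the
  cochains of \<open>I\<close>.\<close>

definition slot :: "('a list => complex) => 'a list => 'a list => complex" where
  "slot f xs = (%zs. if set zs <= I then f (xs @ zs) else 0)"

definition th :: "'a => ('a list => complex) => 'a list => complex" where
  "th x F = (%zs. if set zs <= I then - ins_all (lie x) zs F else 0)"

abbreviation "dI \<equiv> diff_on I"

lemma slot_altn:
  assumes "f : Cn n" "set xs <= L" "n = length xs + q" shows "altn I q (slot f xs)" unfolding altn_def
proof (intro conjI allI impI)
  have "alt_on A (%zs. f (xs @ zs))" by (rule alt_on_append[OF Cn_alt_on]) (use assms lists_A in auto)
  then have "alt_on I (%zs. f (xs @ zs))" by (rule alt_on_subset) (use I_A in blast)
  then show "alt_on I (slot f xs)" by (rule alt_on_cong[OF _ I]) (simp add: slot_def)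
  show "slot f xs zs = 0" if "zs ~: args I q" for zs
    using that altn_0[OF Cn_altn[OF assms(1)], of "xs @ zs"] assms(3) by (auto simp: slot_def args_def)
qed

lemma slot_short: "f : Cn n ==> n < length xs ==> slot f xs = (%_. 0)"
  using altn_0[OF Cn_altn] by (auto simp: slot_def fun_eq_iff)

text \<open>The differential has two components: the one along \<open>L\<close> with the cochains of
  \<open>I\<close> as coefficients, and up to sign that of \<open>I\<close>. A further one could
  only come from brackets of \<open>L\<close> leaving \<open>L\<close>.\<close>

lemma slot_D:
  assumes "f : Cn n" "set xs <= L"
  shows "slot (D f) xs = (%zs. ce lie th xs (slot f) zs + sg (length xs) (dI (slot f xs) zs))"
proof
  fix zs
  show "slot (D f) xs zs = ce lie th xs (slot f) zs + sg (length xs) (dI (slot f xs) zs)"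
  proof (cases "set zs <= I")
    case True
    define rho where "rho = (%x F zs. - ins_all (lie x) zs F :: complex)"
    have ce_eq: "ce lie rho ys (%us vs. h (us @ vs)) zs = ce lie th ys (%us vs. if set vs <= I then h (us @ vs) else 0) zs"
      if "set ys <= L" for ys h using that
    proof (induction ys arbitrary: h)
      case (Cons y ys)
      have "ins_all (lie y) zs (%vs. h (ys @ vs)) = ins_all (lie y) zs (%vs. if set vs <= I then h (ys @ vs) else 0)"
        by (rule ins_all_cong[where S = I]) (use LI Cons.prems True in auto)
      then show ?case using Cons.IH[of "%us. h (y # us)"] Cons.prems True
        by (simp add: rho_def th_def ins_all_apply cong: if_cong)
    qed simp
    have "slot (D f) xs zs = ce0 lie (xs @ zs) f" using True assms(2) lists_A by (simp add: slot_def diff_on_def)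
    also have "... = ce lie rho xs (%us vs. f (us @ vs)) zs + sg (length xs) (ce0 lie zs (%vs. f (xs @ vs)))"
      by (rule ce0_append) (simp add: rho_def)
    also have "ce lie rho xs (%us vs. f (us @ vs)) zs = ce lie th xs (slot f) zs"
      using ce_eq[OF assms(2)] by (simp add: slot_def[abs_def])
    also have "ce0 lie zs (%vs. f (xs @ vs)) = ce0 lie zs (slot f xs)"
      by (rule ce_cong[where S = I]) (use II True in \<open>auto simp: slot_def\<close>)
    finally show ?thesis using True by (simp add: diff_on_def)
  next
    case False
    have "ce lie th ys h zs = 0" if "!!us. h us zs = 0" for ys h using that
    proof (induction ys arbitrary: h)
      case (Cons y ys)
      have "ins_all (lie y) ys h zs = 0" by (simp add: ins_all_apply Cons.prems ins_all_zero)
      then show ?case using Cons.IH[of "%us. h (y # us)"] Cons.prems False by (simp add: th_def)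
    qed simp
    then have "ce lie th xs (slot f) zs = 0" using False by (simp add: slot_def)
    then show ?thesis using False by (simp add: slot_def diff_on_def)
  qed
qed

end

section \<open>Leading terms of cochains and equivariant operations on them\<close>

context semidirect
begin

lemma th_zero: "th x (%_. 0) = (%_. 0)" "th x 0 = 0" by (auto simp: th_def ins_all_zero fun_eq_iff ins_all_eq)

lemma altn_th: assumes "x : L" "altn I q f" shows "altn I q (th x f)" unfolding altn_def
proof (intro conjI allI impI)
  have "alt_on I (%zs. ins_all (lie x) zs f)"
    by (rule alt_on_ins_all[OF _ lin_lie _ I]) (use assms LI in \<open>auto simp: altn_def\<close>)
  then have m: "alt_on I (%zs. - ins_all (lie x) zs f)" using alt_on_minus by blast
  show "alt_on I (th x f)" by (rule alt_on_cong[OF m I]) (simp add: th_def)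
  show "th x f zs = 0" if zs: "zs ~: args I q" for zs
  proof (cases "set zs <= I")
    case True
    then have "ins_all (lie x) zs f = ins_all (lie x) zs (%_. 0)"
      using zs altn_0[OF assms(2)] LI[OF assms(1)] by (intro ins_all_cong[where S = I]) (auto simp: args_def)
    then show ?thesis by (simp add: th_def ins_all_zero)
  qed (simp add: th_def)
qed

lemma dI_th: assumes "x : L" "altn I q f" shows "dI (th x f) = th x (dI f)"
proof
  fix zs
  show "dI (th x f) zs = th x (dI f) zs"
  proof (cases "set zs <= I")
    case True
    have fA: "alt_on I f" using assms by (simp add: altn_def)
    have "dI (th x f) zs = ce0 lie zs (%vs. - ins_all (lie x) vs f)"
      using True II by (auto simp: diff_on_def th_def intro!: ce_cong[where S = I])
    also have "... = - ins_all (lie x) zs (%vs. ce0 lie vs f)" by (simp add: ce0_minus ce0_ins_all[OF I_subalgebra LI[OF assms(1)] fA True])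
    also have "ins_all (lie x) zs (%vs. ce0 lie vs f) = ins_all (lie x) zs (dI f)"
      by (rule ins_all_cong[where S = I]) (use LI assms True in \<open>auto simp: diff_on_def\<close>)
    finally show ?thesis using True by (simp add: th_def)
  qed (simp add: diff_on_def th_def)
qed

lemma th_plus: "th x (f + g) = th x f + th x g" and th_smult: "th x (%zs. c * f zs) = (%zs. c * th x f zs)"
  and th_minus: "th x (- f) = - th x f"
proof -
  have "ins_all D zs (f + g) = ins_all D zs f + ins_all D zs g" for D zs
    using ins_all_add[of D zs f g] by (simp add: plus_fun_def)
  then show "th x (f + g) = th x f + th x g" by (auto simp: th_def fun_eq_iff)
  show "th x (%zs. c * f zs) = (%zs. c * th x f zs)" by (auto simp: th_def fun_eq_iff ins_all_scale)
  have "ins_all D zs (- f) = - ins_all D zs f" for D zs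
    using ins_all_minus[of D zs f] by (simp add: fun_Compl_def)
  then show "th x (- f) = - th x f" by (auto simp: th_def fun_eq_iff)
qed

lemma dI_plus: "dI (f + g) = dI f + dI g" and dI_minus: "dI (- f) = - dI f" and dI_diff: "dI (f - g) = dI f - dI g"
  and dI_zero: "dI 0 = 0" using diff_on_add[of I f g] diff_on_minus[of I f] diff_on_diff[of I f g] diff_on_zero[of I]
  by (simp_all add: plus_fun_def fun_Compl_def fun_diff_def zero_fun_def)

lemma altn_fplus: "altn I q f ==> altn I q g ==> altn I q (f + g)" and altn_fminus: "altn I q f ==> altn I q (- f)"
  and altn_fdiff: "altn I q f ==> altn I q g ==> altn I q (f - g)" and altn_fzero: "altn I q 0"
  using altn_plus[of I q f g] altn_minus[of I q f] altn_diff[of I q f g] altn_zero[of I q]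
  by (simp_all add: plus_fun_def fun_Compl_def fun_diff_def zero_fun_def)

lemma altn_fsum: "(!!i. i : J ==> altn I q (f i)) ==> altn I q (\<Sum>i\<in>J. f i)"
  by (induction J rule: infinite_finite_induct) (simp_all add: altn_fplus altn_fzero)

text \<open>These are the possible leading parts, in filtration degree \<open>p\<close>, of relative cochains.\<close>

definition family :: "nat => nat => ('a list => 'a list => complex) => bool" where
  "family p q G \<longleftrightarrow> (ALL xs. set xs <= L --> length xs = p --> altn I q (G xs)) &
     (ALL xs. ~ (set xs <= L & length xs = p) --> G xs = 0) &
     (ALL zs. set zs <= I --> alt_on L (%xs. G xs zs)) &
     (ALL xs. set xs <= L --> set xs \<inter> k ~= {} --> G xs = 0) &
     (ALL x:k. ALL xs. set xs <= L --> ins_all (lie x) xs G = th x (G xs))"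

lemma family_altn: "family p q G ==> altn I q (G xs)" unfolding family_def using altn_fzero by (metis (full_types))

lemma family_0: "family p q G ==> ~ (set xs <= L & length xs = p) ==> G xs = 0" by (simp add: family_def)

text \<open>The shuffle sum provides the extension. Both relative conditions are alternating in the
  remaining arguments, so they may be tested on lists with \<open>L\<close> in front, where they are
  the conditions of \<open>family\<close> concerning \<open>k\<close>.\<close>

lemma lift_family:
  assumes G: "family p q G"
  obtains f where "f : Fil (int p) (p + q)" "!!xs. set xs <= L ==> slot f xs = G xs"
proof -
  have bi: "bialt G" unfolding bialt_def using G family_altn[OF G] by (auto simp: family_def altn_def)
  define f where "f = (%ws. if set ws <= A then shuf ws G else 0)"
  have fa: "alt_on A f" unfolding f_def by (rule alt_on_cong[OF alt_on_shuf[OF bi] subspace_A]) simp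
  have fsp: "f (xs @ zs) = G xs zs" if "set xs <= L" "set zs <= I" for xs zs
    using shuf_split[OF bi that] lists_A that by (simp add: f_def)
  have alt: "altn A (p + q) f" unfolding altn_def
  proof (intro conjI fa allI impI)
    fix xs assume xs: "xs ~: args A (p + q)"
    show "f xs = 0"
    proof (cases "set xs <= A")
      case True
      then have len: "length xs ~= p + q" using xs by (simp add: args_def)
      have "shuf xs G = shuf xs (%_ _. 0)"
      proof (rule shuf_cong[OF True])
        fix us vs assume uv: "set us <= L" "set vs <= I" "length us + length vs = length xs"
        show "G us vs = 0"
        proof (cases "length us = p")
          case True
          then show ?thesis using altn_0[OF family_altn[OF G]] uv len by auto
        qed (use family_0[OF G, of us] in simp)
      qed
      then show ?thesis by (simp add: f_def shuffle_sum_zero)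
    qed (simp add: f_def)
  qed
  have fC: "f : Cn (p + q)" unfolding Cn_def
  proof (intro CollectI conjI ballI allI impI)
    show "altn A (p + q) f" by (fact alt)
    fix xs assume xs: "set xs <= A"
    {
      assume "set xs \<inter> k ~= {}"
      then obtain x us vs where x: "x : k" "xs = us @ x # vs" by (meson disjoint_iff split_list)
      have xL: "x : L" using x kL by blast
      have "f (x # ws) = 0" if ws: "set ws <= A" for ws
      proof (rule alt_on_determined[OF alt_on_Cons[OF fa kA[OF x(1)]] _ ws])
        fix us vs assume "set us <= L" "set vs <= I"
        then have "f ((x # us) @ vs) = G (x # us) vs" using fsp[of "x # us" vs] xL by simp
        moreover have "G (x # us) = 0" using G x(1) xL \<open>set us <= L\<close> by (simp add: family_def)
        ultimately show "f (x # us @ vs) = 0" by simp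
      qed
      moreover have "f (x # us @ vs) = sg (length us) (f (us @ x # vs))"
        using alt_on_move[OF fa subspace_A, of "[]" vs us x] xs x kA by simp
      ultimately show "f xs = 0" using xs x(2) by (auto simp: sg_def split: if_splits)
    }
    fix x assume x: "x : k"
    have xL: "x : L" using x kL by blast
    have ia: "alt_on A (%ws. ins_all (lie x) ws f)"
      by (rule alt_on_ins_all[OF _ lin_lie fa subspace_A]) (use subalg_lie[OF A kA[OF x]] in blast)
    show "ins_all (lie x) xs f = 0"
    proof (rule alt_on_determined[OF ia _ xs])
      fix us vs assume uv: "set us <= L" "set vs <= I"
      have "ins_all (lie x) us (%us. f (us @ vs)) = ins_all (lie x) us (%us. G us vs)"
        by (rule ins_all_cong[where S = L]) (use subalg_lie[OF L xL] uv fsp in auto)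
      moreover have "ins_all (lie x) vs (%vs. f (us @ vs)) = ins_all (lie x) vs (G us)"
        by (rule ins_all_cong[where S = I]) (use LI[OF xL] uv fsp in auto)
      moreover have "ins_all (lie x) us (%us. G us vs) = th x (G us) vs"
        using G x uv by (simp add: family_def ins_all_apply[symmetric])
      ultimately show "ins_all (lie x) (us @ vs) f = 0" using uv by (simp add: ins_all_append th_def)
    qed
  qed
  have "f : Fil (int p) (p + q)" by (rule FilI[OF fC]) (use fsp family_0[OF G] in auto)
  moreover have "slot f xs = G xs" if "set xs <= L" for xs
  proof
    fix zs
    show "slot f xs zs = G xs zs"
      using fsp[OF that, of zs] altn_0[OF family_altn[OF G], of zs xs] by (auto simp: slot_def)
  qed
  ultimately show ?thesis using that by blast
qed

lemma slot_ins_all: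
  assumes f: "f : Cn n" and x: "x : k" and xs: "set xs <= L"
  shows "ins_all (lie x) xs (slot f) = th x (slot f xs)"
proof
  fix zs
  have xL: "x : L" using x kL by blast
  show "ins_all (lie x) xs (slot f) zs = th x (slot f xs) zs"
  proof (cases "set zs <= I")
    case True
    have "0 = ins_all (lie x) (xs @ zs) f" using f x xs True lists_A by (simp add: Cn_def)
    also have "... = ins_all (lie x) xs (%us. slot f us zs) + ins_all (lie x) zs (%vs. f (xs @ vs))"
      using True by (simp add: ins_all_append slot_def)
    also have "ins_all (lie x) zs (%vs. f (xs @ vs)) = ins_all (lie x) zs (slot f xs)"
      by (rule ins_all_cong[where S = I]) (use LI[OF xL] True in \<open>auto simp: slot_def\<close>)
    finally show ?thesis using True by (simp add: th_def ins_all_apply eq_neg_iff_add_eq_0)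
  qed (simp add: th_def ins_all_apply slot_def ins_all_zero)
qed

lemma slot_alt_on: assumes f: "f : Cn n" shows "alt_on L (%xs. slot f xs zs)"
proof (cases "set zs <= I")
  case True
  have "alt_on L (%xs. f (xs @ zs))"
    by (rule alt_on_subset[OF alt_on_append_right[OF Cn_alt_on[OF f]]]) (use True lists_A L_A in auto)
  then show ?thesis using True by (simp add: slot_def)
qed (simp add: slot_def alt_on_zero_fun)

lemma slot_k: "f : Cn n ==> set xs <= L ==> set xs \<inter> k ~= {} ==> slot f xs = 0" unfolding slot_def
proof
  fix zs assume a: "f : Cn n" "set xs <= L" "set xs \<inter> k ~= {}"
  show "(if set zs <= I then f (xs @ zs) else 0) = 0 zs"
  proof (cases "set zs <= I")
    case True
    then have "set (xs @ zs) <= A" "set (xs @ zs) \<inter> k ~= {}" using a lists_A by auto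
    then show ?thesis using a(1) unfolding Cn_def by simp
  qed simp
qed

text \<open>The other lengths are set to zero, so that the lifted cochain has no components besides
  its leading one.\<close>

definition restrict_len :: "nat => ('a list => 'a list => complex) => 'a list => 'a list => complex" where
  "restrict_len p F = (%xs. if set xs <= L & length xs = p then F xs else 0)"

lemma ins_all_restrict_len:
  assumes "x : L" "set xs <= L"
  shows "ins_all (lie x) xs (restrict_len p F) = (if length xs = p then ins_all (lie x) xs F else 0)"
proof (cases "length xs = p")
  case True
  have "ins_all (lie x) xs (restrict_len p F) = ins_all (lie x) xs F"
    by (rule ins_all_cong[where S = L]) (use assms subalg_lie[OF L] True in \<open>auto simp: restrict_len_def\<close>)
  then show ?thesis using True by simp
next
  case False
  have "ins_all (lie x) xs (restrict_len p F) = ins_all (lie x) xs (%_. 0)"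
    by (rule ins_all_cong[where S = L]) (use assms subalg_lie[OF L] False in \<open>auto simp: restrict_len_def\<close>)
  also have "... = 0" by (rule ins_all_zero)
  finally show ?thesis using False by (simp only: if_False)
qed

text \<open>The relative conditions on a leading term involve only linear combinations and the
  action of \<open>k\<close>, which lies in \<open>L\<close>; a linear map commuting with
  \<open>L\<close> preserves them.\<close>

lemma family_map:
  assumes f: "f : Cn (p + q)"
    and tau: "!!F. altn I q F ==> altn I q' (tau F)"
      "!!F G. altn I q F ==> altn I q G ==> tau (F + G) = tau F + tau G"
      "!!c F. altn I q F ==> tau (%zs. c * F zs) = (%zs. c * tau F zs)"
      "!!x F. x : L ==> altn I q F ==> tau (th x F) = th x (tau F)"
  shows "family p q' (restrict_len p (%xs. tau (slot f xs)))"
proof -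
  have sa: "altn I q (slot f xs)" if "set xs <= L" "length xs = p" for xs using slot_altn[OF f that(1)] that(2) by simp
  have tau0: "tau 0 = 0" using tau(2)[OF altn_fzero altn_fzero] by simp
  have tausum: "tau (\<Sum>i\<in>J. F i) = (\<Sum>i\<in>J. tau (F i))" if "!!i. i : J ==> altn I q (F i)" for F and J :: "nat set"
    using that by (induction J rule: infinite_finite_induct) (simp_all add: tau0 tau(2) altn_fsum)
  show ?thesis unfolding family_def
  proof (intro conjI allI impI ballI)
    show "altn I q' (restrict_len p (%xs. tau (slot f xs)) xs)" if "set xs <= L" "length xs = p" for xs
      using tau(1) sa that by (simp add: restrict_len_def)
    show "restrict_len p (%xs. tau (slot f xs)) xs = 0" if "~ (set xs <= L & length xs = p)" for xs
      unfolding restrict_len_def by (rule if_not_P[OF that])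
    show "restrict_len p (%xs. tau (slot f xs)) xs = 0" if "set xs <= L" "set xs \<inter> k ~= {}" for xs
      unfolding restrict_len_def slot_k[OF f that] tau0 by simp
    fix x xs assume x: "x : k" and xs: "set xs <= L"
    have xL: "x : L" using x kL by blast
    show "ins_all (lie x) xs (restrict_len p (%xs. tau (slot f xs))) = th x (restrict_len p (%xs. tau (slot f xs)) xs)"
    proof (cases "length xs = p")
      case True
      have up: "set (xs[i := lie x (xs ! i)]) <= L" if "i < length xs" for i
        using xs that subalg_lie[OF L xL] by (intro set_update_subsetI) (auto simp: subset_iff)
      have "ins_all (lie x) xs (%xs. tau (slot f xs)) = tau (ins_all (lie x) xs (slot f))"
        unfolding ins_all_eq by (rule tausum[symmetric]) (use sa up True in simp)
      also have "... = th x (tau (slot f xs))" using slot_ins_all[OF f x xs] tau(4)[OF xL sa[OF xs True]] by simp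
      finally show ?thesis using True xs by (simp add: ins_all_restrict_len[OF xL xs]) (simp add: restrict_len_def)
    next
      case False
      then have "restrict_len p (%xs. tau (slot f xs)) xs = 0" unfolding restrict_len_def by simp
      then show ?thesis using False ins_all_restrict_len[OF xL xs, of p "%xs. tau (slot f xs)"] by (metis th_zero(2))
    qed
  next
    fix zs assume zs: "set zs <= I"
    let ?g = "%xs. restrict_len p (%xs. tau (slot f xs)) xs zs"
    have pl: "slot f (us @ (x + y) # vs) = slot f (us @ x # vs) + slot f (us @ y # vs)"
      if "set us <= L" "set vs <= L" "x : L" "y : L" for us vs x y
      using alt_on_add[OF slot_alt_on[OF f] that] by (simp add: fun_eq_iff)
    have sc: "slot f (us @ scale c x # vs) = (%zs. c * slot f (us @ x # vs) zs)"
      if "set us <= L" "set vs <= L" "x : L" for us vs c x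
      using alt_on_scale[OF slot_alt_on[OF f] that] by (simp add: fun_eq_iff)
    have sm: "slot f (us @ x # x # vs) = 0" if "set us <= L" "set vs <= L" "x : L" for us vs x
      using alt_on_same[OF slot_alt_on[OF f] that] by (simp add: fun_eq_iff)
    show "alt_on L ?g"
    proof (rule alt_onI)
      show "?g (us @ (x + y) # vs) = ?g (us @ x # vs) + ?g (us @ y # vs)"
        if "set us <= L" "set vs <= L" "x : L" "y : L" for us vs x y
        using that subspace_add[OF subspace_L that(3,4)] pl[OF that] tau(2) sa by (simp add: restrict_len_def)
      show "?g (us @ scale c x # vs) = c * ?g (us @ x # vs)" if "set us <= L" "set vs <= L" "x : L" for us vs c x
        using that subspace_scale[OF subspace_L that(3)] sc[OF that] tau(3) sa by (simp add: restrict_len_def)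
      show "?g (us @ x # x # vs) = 0" if "set us <= L" "set vs <= L" "x : L" for us vs x
        using sm[OF that] tau0 by (simp add: restrict_len_def)
    qed
  qed
qed

text \<open>The component of the differential along \<open>L\<close> is built from sums and the
  action of \<open>L\<close>, and \<open>tau\<close> respects both.\<close>

lemma ce_equivariant_map:
  assumes tau: "!!F. altn I q F ==> altn I q' (tau F)"
      "!!F G. altn I q F ==> altn I q G ==> tau (F + G) = tau F + tau G"
      "!!x F. x : L ==> altn I q F ==> tau (th x F) = th x (tau F)"
  shows "set xs <= L ==> (!!us. set us <= L ==> Suc (length us) = length xs ==> altn I q (F us)) ==>
    altn I q (ce lie th xs F) & ce lie th xs (%us. tau (F us)) = tau (ce lie th xs F)"
proof (induction xs arbitrary: F)
  case Nil
  have "tau 0 = 0" using tau(2)[OF altn_fzero altn_fzero] by simp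
  then show ?case unfolding ce.simps using altn_fzero by metis
next
  case (Cons x xs)
  have tau0: "tau 0 = 0" using tau(2)[OF altn_fzero altn_fzero] by simp
  have taud: "tau (F - G) = tau F - tau G" if "altn I q F" "altn I q G" for F G
    using tau(2)[OF altn_fdiff[OF that] that(2)] by simp
  have tausum: "tau (\<Sum>i\<in>J. F i) = (\<Sum>i\<in>J. tau (F i))" if "!!i. i : J ==> altn I q (F i)" for F and J :: "nat set"
    using that by (induction J rule: infinite_finite_induct) (simp_all add: tau0 tau(2) altn_fsum)
  have x: "x : L" "set xs <= L" using Cons.prems by auto
  have up: "altn I q (F (xs[i := lie x (xs ! i)]))" if "i < length xs" for i using x that subalg_lie[OF L x(1)]
    by (intro Cons.prems(2) set_update_subsetI) (auto simp: subset_iff)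
  have ih: "altn I q (ce lie th xs (%us. F (x # us))) &
      ce lie th xs (%us. tau (F (x # us))) = tau (ce lie th xs (%us. F (x # us)))"
    by (rule Cons.IH) (use Cons.prems in auto)
  have a: "altn I q (F xs)" using Cons.prems by simp
  have b: "altn I q (ins_all (lie x) xs F)" unfolding ins_all_eq by (rule altn_fsum) (use up in simp)
  have c: "ins_all (lie x) xs (%us. tau (F us)) = tau (ins_all (lie x) xs F)"
    unfolding ins_all_eq by (rule tausum[symmetric]) (use up in simp)
  note t = altn_th[OF x(1) a]
  note tb = altn_fdiff[OF t b]
  show ?case unfolding ce.simps c conjunct2[OF ih] taud[OF tb conjunct1[OF ih]] taud[OF t b] tau(3)[OF x(1) a]
    using altn_fdiff[OF tb conjunct1[OF ih]] by blast
qed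

lemma ce_th_zero:
  assumes "set xs <= L" "!!us. set us <= L ==> Suc (length us) = length xs ==> F us = 0"
  shows "ce lie th xs F = 0"
proof -
  have "ce lie th xs F = ce lie th xs (%_. 0)" by (rule ce_cong[where S = L]) (use assms subalg_lie[OF L] in auto)
  then show ?thesis by (simp add: ce_zero th_zero)
qed

lemma ce_th_cong:
  assumes "set xs <= L" "!!us. set us <= L ==> Suc (length us) = length xs ==> F us = G us"
  shows "ce lie th xs F = ce lie th xs G" by (rule ce_cong[where S = L]) (use assms subalg_lie[OF L] in auto)

lemma sg_dI: "sg n (dI f) = dI (sg n f)" by (simp add: sg_def dI_minus)

lemma slot_D': "f : Cn n ==> set xs <= L ==> slot (D f) xs = ce lie th xs (slot f) + sg (length xs) (dI (slot f xs))"
  using slot_D[of f n xs] by (simp add: fun_eq_iff sg_apply)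

lemma FilI_slot:
  assumes "f : Cn n" "!!xs. set xs <= L ==> int (length xs) < p ==> slot f xs = 0"
  shows "f : Fil p n"
proof (rule FilI[OF assms(1)])
  fix xs zs assume "set xs <= L" "set zs <= I" "int (length xs) < p"
  then show "f (xs @ zs) = 0" using fun_cong[OF assms(2), of xs zs] by (simp add: slot_def)
qed

lemma Fil_slot: "f : Fil p n ==> set xs <= L ==> int (length xs) < p ==> slot f xs = 0"
  using Fil_0 by (auto simp: slot_def fun_eq_iff)

lemma Fil_D: assumes f: "f : Fil p n" shows "D f : Fil p (Suc n)"
proof (rule FilI_slot[OF Cn_D[OF Fil_Cn[OF f]]])
  fix xs assume xs: "set xs <= L" "int (length xs) < p"
  have "ce lie th xs (slot f) = 0" by (rule ce_th_zero[OF xs(1)]) (use Fil_slot[OF f] xs in auto)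
  then show "slot (D f) xs = 0" using slot_D'[OF Fil_Cn[OF f] xs(1)] Fil_slot[OF f xs] by (simp add: dI_zero)
qed

lemma Fil_D_slot:
  assumes f: "f : Fil (int p) n" and xs: "set xs <= L" "length xs = p"
  shows "slot (D f) xs = sg p (dI (slot f xs))"
proof -
  have "ce lie th xs (slot f) = 0" by (rule ce_th_zero[OF xs(1)]) (use Fil_slot[OF f] xs in auto)
  then show ?thesis using slot_D'[OF Fil_Cn[OF f] xs(1)] xs(2) by simp
qed

lemma Fil_Suc_iff:
  assumes "f : Fil (int p) n"
  shows "f : Fil (int p + 1) n \<longleftrightarrow> (ALL xs. set xs <= L --> length xs = p --> slot f xs = 0)"
proof
  show "ALL xs. set xs <= L --> length xs = p --> slot f xs = 0" if "f : Fil (int p + 1) n"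
    using Fil_slot[OF that] by simp
  assume z: "ALL xs. set xs <= L --> length xs = p --> slot f xs = 0"
  show "f : Fil (int p + 1) n"
  proof (rule FilI_slot[OF Fil_Cn[OF assms]])
    fix xs assume "set xs <= L" "int (length xs) < int p + 1"
    then show "slot f xs = 0" using z Fil_slot[OF assms, of xs] by (cases "length xs = p") auto
  qed
qed

text \<open>The lift is concentrated in slots of length \<open>p\<close>, so its differential has
  only two components: \<open>dI\<close> of the family in length \<open>p\<close> and the
  differential along \<open>L\<close> in length \<open>p + 1\<close>.\<close>

lemma lift_closed:
  assumes G: "family p q G" and f: "f : Fil (int p) (p + q)" "!!xs. set xs <= L ==> slot f xs = G xs"
    and co: "!!xs. set xs <= L ==> length xs = p ==> dI (G xs) = 0"
  shows "D f : Fil (int p + 1) (Suc (p + q))"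
    and "(!!xs. set xs <= L ==> length xs = Suc p ==> ce lie th xs G = 0) ==> D f = (%_. 0)"
proof -
  show 1: "D f : Fil (int p + 1) (Suc (p + q))"
    unfolding Fil_Suc_iff[OF Fil_D[OF f(1)]] using Fil_D_slot[OF f(1)] f(2) co by simp
  assume z: "!!xs. set xs <= L ==> length xs = Suc p ==> ce lie th xs G = 0"
  have sl: "slot (D f) xs = 0" if xs: "set xs <= L" for xs
  proof -
    have eq: "slot (D f) xs = ce lie th xs G + sg (length xs) (dI (G xs))"
      using slot_D'[OF Fil_Cn[OF f(1)] xs] f(2) xs ce_th_cong[OF xs, of "slot f" G] by simp
    have "ce lie th xs G = 0" using z[OF xs] family_0[OF G] by (cases "length xs = Suc p") (auto intro!: ce_th_zero xs)
    moreover have "dI (G xs) = 0" using co[OF xs] family_0[OF G, of xs] by (cases "length xs = p") (auto simp: dI_zero)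
    ultimately show ?thesis using eq by simp
  qed
  then have "D f : Fil (int (Suc (p + q)) + 1) (Suc (p + q))" by (intro FilI_slot[OF Cn_D[OF Fil_Cn[OF f(1)]]])
  then show "D f = (%_. 0)" using Fil_large[of "Suc (p + q)" "int (Suc (p + q)) + 1"] by simp
qed

definition cobd :: "nat => ('a list => complex) set" where
  "cobd q = (case q of 0 => {0} | Suc q' => dI ` {f. altn I q' f})"

end

section \<open>Degeneration from an equivariant generalized inverse\<close>

locale semidirect_split = semidirect scale lie L I k for scale :: "complex => 'a::ab_group_add => 'a" and lie L I k +
  fixes sigma :: "nat => ('a list => complex) => 'a list => complex"
  assumes sigma_altn: "!!q F. altn I (Suc q) F ==> altn I q (sigma q F)"
    and sigma_plus: "!!q F G. altn I (Suc q) F ==> altn I (Suc q) G ==> sigma q (F + G) = sigma q F + sigma q G"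
    and sigma_smult: "!!q c F. altn I (Suc q) F ==> sigma q (%zs. c * F zs) = (%zs. c * sigma q F zs)"
    and sigma_th: "!!q x F. x : L ==> altn I (Suc q) F ==> sigma q (th x F) = th x (sigma q F)"
    and sigma_inverse: "!!q F. altn I q F ==> dI (sigma q (dI F)) = dI F"
begin

text \<open>\<open>proj\<close> kills coboundaries and moves a cocycle only by a coboundary.\<close>

definition proj :: "nat => ('a list => complex) => 'a list => complex" where
  "proj q F = (case q of 0 => F | Suc q' => F - dI (sigma q' F))"

lemma dI_altn: "altn I q F ==> altn I (Suc q) (dI F)" by (rule altn_diff_on[OF I_subalgebra])

lemma dI_dI: "altn I q F ==> dI (dI F) = 0" using diff_on_diff_on[OF I_subalgebra] by (simp add: zero_fun_def)

lemma proj_altn: "altn I q F ==> altn I q (proj q F)"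
  by (cases q) (auto simp: proj_def intro!: altn_fdiff dI_altn sigma_altn)

lemma proj_plus: "altn I q F ==> altn I q G ==> proj q (F + G) = proj q F + proj q G"
  by (cases q) (auto simp: proj_def sigma_plus dI_plus)

lemma proj_smult: "altn I q F ==> proj q (%zs. c * F zs) = (%zs. c * proj q F zs)"
  by (cases q) (auto simp: proj_def sigma_smult diff_on_scale fun_eq_iff algebra_simps)

lemma proj_th: "x : L ==> altn I q F ==> proj q (th x F) = th x (proj q F)"
proof (cases q)
  case (Suc q')
  assume a: "x : L" "altn I q F"
  have "th x (F - dI (sigma q' F)) = th x F - th x (dI (sigma q' F))"
    using th_plus[of x F "- dI (sigma q' F)"] th_minus[of x "dI (sigma q' F)"] by simp
  moreover have "sigma q' (th x F) = th x (sigma q' F)" "dI (th x (sigma q' F)) = th x (dI (sigma q' F))"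
    using a Suc sigma_th dI_th[OF a(1) sigma_altn] by blast+
  ultimately show ?thesis by (simp only: proj_def Suc nat.case)
qed (simp add: proj_def)

lemma dI_proj: "altn I q F ==> dI (proj q F) = dI F" by (cases q) (auto simp: proj_def dI_diff dI_dI[OF sigma_altn])

lemma proj_cobd: "F : cobd q ==> proj q F = 0" by (cases q) (auto simp: proj_def cobd_def sigma_inverse)

lemma proj_minus_cobd: "altn I q F ==> F - proj q F : cobd q"
  by (cases q) (auto simp: proj_def cobd_def intro: sigma_altn)

lemma cobd_altn: "F : cobd q ==> altn I q F" by (cases q) (auto simp: cobd_def altn_fzero dI_altn)

text \<open>Apply \<open>sigma\<close> to the leading coboundaries and lift the result to
  \<open>e'\<close>; by \<open>sigma_inverse\<close> the cochain \<open>D e'\<close> has the same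
  leading term as \<open>e\<close>. For \<open>q = 0\<close> the only coboundary is zero.\<close>

lemma slot_cobd_imp:
  assumes e: "e : Fil (int p) (p + q)" and co: "!!xs. set xs <= L ==> length xs = p ==> slot e xs : cobd q"
  shows "e : Fil (int p + 1) (p + q) \<or>
    (EX q' e'. q = Suc q' & e' : Fil (int p) (p + q') & (%ws. e ws - D e' ws) : Fil (int p + 1) (p + q))"
proof (cases q)
  case 0
  then show ?thesis using co Fil_Suc_iff[OF e] by (simp add: cobd_def)
next
  case (Suc q')
  have eC: "e : Cn (p + Suc q')" using Fil_Cn[OF e] Suc by simp
  \<comment> \<open>The factor \<open>sg p\<close> cancels the sign with which \<open>dI\<close>
    enters a slot of length \<open>p\<close>.\<close>
  have fam: "family p q' (restrict_len p (%xs. sg p (sigma q' (slot e xs))))"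
  proof (rule family_map[OF eC])
    show "altn I q' (sg p (sigma q' F))" if "altn I (Suc q') F" for F
      using sigma_altn[OF that] by (simp add: sg_def altn_fminus)
    show "sg p (sigma q' (%zs. c * F zs)) = (%zs. c * sg p (sigma q' F) zs)" if "altn I (Suc q') F" for c F
      by (simp add: sigma_smult[OF that] sg_apply fun_eq_iff sg_mult)
    show "sg p (sigma q' (F + G)) = sg p (sigma q' F) + sg p (sigma q' G)" if "altn I (Suc q') F" "altn I (Suc q') G" for F G
      unfolding sigma_plus[OF that] sg_add ..
    show "sg p (sigma q' (th x F)) = th x (sg p (sigma q' F))" if "x : L" "altn I (Suc q') F" for x F
      by (simp add: sigma_th[OF that] sg_def th_minus)
  qed
  obtain e' where e': "e' : Fil (int p) (p + q')" "!!xs. set xs <= L ==> slot e' xs = restrict_len p (%xs. sg p (sigma q' (slot e xs))) xs"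
    using lift_family[OF fam] by blast
  have De': "D e' : Fil (int p) (p + q)" using Fil_D[OF e'(1)] Suc by simp
  have "slot (%ws. e ws - D e' ws) xs = 0" if xs: "set xs <= L" "length xs = p" for xs
  proof -
    obtain m where m: "altn I q' m" "slot e xs = dI m" using co[OF xs] Suc by (auto simp: cobd_def)
    have "slot (D e') xs = sg p (dI (sg p (sigma q' (slot e xs))))"
      using Fil_D_slot[OF e'(1) xs] e'(2)[OF xs(1)] xs by (simp add: restrict_len_def)
    also have "... = dI (sigma q' (dI m))" by (simp add: m sg_dI sg_sg) (simp add: sg_def)
    also have "... = slot e xs" using sigma_inverse[OF m(1)] m(2) by simp
    finally show ?thesis by (auto simp: slot_def fun_eq_iff split: if_splits)
  qed
  then have "(%ws. e ws - D e' ws) : Fil (int p + 1) (p + q)" using Fil_Suc_iff[OF Fil_diff[OF e De']] by blast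
  then show ?thesis using e' Suc by blast
qed

lemma family_proj: "f : Cn (p + q) ==> family p q (restrict_len p (%xs. proj q (slot f xs)))"
  by (rule family_map[OF _ proj_altn proj_plus proj_smult proj_th])

text \<open>This is the degeneration: classes on the second page are represented by cocycles.\<close>

lemma second_page_cycle:
  assumes f: "f : Fil p n" "D f : Fil (p + 2) (Suc n)"
  shows "EX g:Fil (p + 1) n. D f = D g"
proof -
  consider "p < 0" | "int n < p" | i j where "p = int i" "n = i + j"
    by (metis le_add_diff_inverse not_le_imp_less of_nat_le_iff zero_le_imp_eq_int)
  then show ?thesis
  proof cases
    case 1
    then show ?thesis using f Fil_Cn Fil_nonpos[of "p + 1" n] by auto
  next
    case 2
    then have "f = (%_. 0)" using Fil_large f by blast
    then show ?thesis using Fil_zero by blast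
  next
    case (3 i j)
    note f = f[unfolded 3]
    have fC: "f : Cn (i + j)" using Fil_Cn[OF f(1)] .
    have sa: "altn I j (slot f xs)" if "set xs <= L" "length xs = i" for xs
      using slot_altn[OF fC that(1)] that(2) by simp
    have sc: "dI (slot f xs) = 0" if "set xs <= L" "length xs = i" for xs
    proof -
      have "sg i (dI (slot f xs)) = 0" using Fil_D_slot[OF f(1) that] Fil_slot[OF f(2) that(1)] that(2) by simp
      then show ?thesis by (simp add: sg_def split: if_splits)
    qed
    \<comment> \<open>Projecting replaces each leading value by a cocycle in the same class.\<close>
    let ?G = "restrict_len i (%xs. proj j (slot f xs))"
    have G: "family i j ?G" by (rule family_proj[OF fC])
    obtain c where c: "c : Fil (int i) (i + j)" "!!xs. set xs <= L ==> slot c xs = ?G xs"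
      using lift_family[OF G] by blast
    have "ce lie th xs ?G = 0" if xs: "set xs <= L" "length xs = Suc i" for xs
    proof -
      have "ce lie th xs ?G = ce lie th xs (%us. proj j (slot f us))"
        by (rule ce_th_cong[OF xs(1)]) (use xs in \<open>simp add: restrict_len_def\<close>)
      also have "... = proj j (ce lie th xs (slot f))"
      proof (rule conjunct2[OF ce_equivariant_map[OF proj_altn proj_plus proj_th xs(1)]])
        show "altn I j (slot f us)" if "set us <= L" "Suc (length us) = length xs" for us
          using sa[OF that(1)] that(2) xs(2) by linarith
      qed
      \<comment> \<open>As \<open>D f\<close> has no component of length \<open>i + 1\<close>, the
        differential along \<open>L\<close> of the leading term is, up to sign, \<open>dI\<close> of
        the next slot, and \<open>proj\<close> will kill it.\<close>
      also have "ce lie th xs (slot f) : cobd j"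
      proof -
        have z: "ce lie th xs (slot f) + sg (Suc i) (dI (slot f xs)) = 0"
          using slot_D'[OF fC xs(1)] Fil_slot[OF f(2) xs(1)] xs(2) by simp
        show ?thesis
        proof (cases j)
          case 0
          then have "slot f xs = 0" using slot_short[OF fC] xs by (simp add: zero_fun_def)
          then show ?thesis using z 0 by (simp add: cobd_def dI_zero)
        next
          case (Suc j')
          have "altn I j' (slot f xs)" using slot_altn[OF fC xs(1)] xs(2) Suc by simp
          then have "altn I j' (sg i (slot f xs))" by (simp add: sg_def altn_fminus)
          moreover have "ce lie th xs (slot f) = dI (sg i (slot f xs))"
            using z[folded eq_neg_iff_add_eq_0] unfolding sg_simps dI_minus minus_minus sg_dI .
          ultimately show ?thesis using Suc by (auto simp: cobd_def)
        qed
      qed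
      then have "proj j (ce lie th xs (slot f)) = 0" by (rule proj_cobd)
      finally show ?thesis .
    qed
    moreover have "dI (?G xs) = 0" if "set xs <= L" "length xs = i" for xs
      using dI_proj[OF sa[OF that]] sc[OF that] that by (simp add: restrict_len_def)
    ultimately have Dc: "D c = (%_. 0)" using lift_closed(2)[OF G c] by blast
    \<comment> \<open>The cochain \<open>c\<close> is a cocycle, so \<open>e\<close> has the same
      differential as \<open>f\<close>; its leading term now consists of coboundaries and can be
      removed.\<close>
    define e where "e = (%ws. f ws - c ws)"
    have e: "e : Fil (int i) (i + j)" unfolding e_def by (rule Fil_diff[OF f(1) c(1)])
    have De: "D e = D f" unfolding e_def diff_on_diff Dc by simp
    have "slot e xs : cobd j" if "set xs <= L" "length xs = i" for xs
    proof -
      have "slot e xs = slot f xs - slot c xs" by (auto simp: e_def slot_def fun_eq_iff)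
      then show ?thesis using proj_minus_cobd[OF sa[OF that]] c(2)[OF that(1)] that by (simp add: restrict_len_def)
    qed
    from slot_cobd_imp[OF e this]
    consider "e : Fil (int i + 1) (i + j)"
      | q' e' where "j = Suc q'" "e' : Fil (int i) (i + q')" "(%ws. e ws - D e' ws) : Fil (int i + 1) (i + j)" by blast
    then show ?thesis
    proof cases
      case 1
      then show ?thesis unfolding 3 using De by metis
    next
      case (2 q' e')
      have "D (%ws. e ws - D e' ws) = D f" unfolding diff_on_diff D_D[OF Fil_Cn[OF 2(2)]] using De by simp
      then show ?thesis unfolding 3 using 2(3) by metis
    qed
  qed
qed

end

section \<open>Quotients of function spaces and filtered complexes\<close>

definition fun_module :: "('b => complex) set => (complex, 'b => complex) module" where
  "fun_module Z = \<lparr>carrier = Z, monoid.mult = undefined, one = undefined,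
     zero = (%_. 0), add = (%f g x. f x + g x), module.smult = (%c f x. c * f x)\<rparr>"

lemma fun_module_simps [simp]:
  "carrier (fun_module Z) = Z" "zero (fun_module Z) = (%_. 0)"
  "add (fun_module Z) = (%f g x. f x + g x)" "module.smult (fun_module Z) = (%c f x. c * f x)"
  "(fun_module Z)\<lparr>carrier := Y\<rparr> = fun_module Y" by (simp_all add: fun_module_def)

definition fsub :: "('b => complex) set => bool" where
  "fsub Z \<longleftrightarrow> (%_. 0) : Z & (ALL f:Z. ALL g:Z. (%x. f x + g x) : Z) & (ALL c. ALL f:Z. (%x. c * f x) : Z)"

lemma fsubD:
  assumes "fsub Z"
  shows fsub_0: "(%_. 0) : Z"
    and fsub_add: "f : Z ==> g : Z ==> (%x. f x + g x) : Z"
    and fsub_scale: "f : Z ==> (%x. c * f x) : Z"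
    and fsub_diff: "f : Z ==> g : Z ==> (%x. f x - g x) : Z"
proof -
  show 0: "(%_. 0) : Z" and a: "f : Z ==> g : Z ==> (%x. f x + g x) : Z"
    and s: "f : Z ==> (%x. c * f x) : Z" for f g c using assms by (auto simp: fsub_def)
  show "f : Z ==> g : Z ==> (%x. f x - g x) : Z" using a[of f "%x. (- 1) * g x"] s[of g "- 1"] by simp
qed

definition cls :: "('b => complex) set => ('b => complex) => ('b => complex) set" where
  "cls B f = {%x. b x + f x | b. b : B}"

lemma coset_fun_module: "B +>\<^bsub>fun_module Z\<^esub> f = cls B f" by (auto simp: a_r_coset_def r_coset_def cls_def)

lemma set_add_fun_module: "X <+>\<^bsub>fun_module Z\<^esub> Y = {%x. f x + g x | f g. f : X & g : Y}"
  by (auto simp: set_add_def set_mult_def)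

lemma cls_iff: "h : cls B f \<longleftrightarrow> (%x. h x - f x) : B"
proof
  assume "(%x. h x - f x) : B"
  then show "h : cls B f" unfolding cls_def by (intro CollectI exI[of _ "%x. h x - f x"]) simp
qed (auto simp: cls_def)

lemma cls_self: "fsub B ==> f : cls B f" by (simp add: cls_iff fsub_0)

lemma cls_eq_iff:
  assumes B: "fsub B" shows "cls B f = cls B g \<longleftrightarrow> (%x. f x - g x) : B"
proof
  show "cls B f = cls B g ==> (%x. f x - g x) : B" using cls_self[OF B, of f] by (simp add: cls_iff)
  assume fg: "(%x. f x - g x) : B"
  have "(%x. h x - f x) : B \<longleftrightarrow> (%x. h x - g x) : B" for h
    using fsub_add[OF B fg, of "%x. h x - f x"] fsub_diff[OF B _ fg, of "%x. h x - g x"] by auto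
  then show "cls B f = cls B g" by (auto simp: cls_iff)
qed

lemma cls_eqI: "fsub B ==> h : cls B f ==> cls B h = cls B f" by (simp add: cls_iff cls_eq_iff)

lemma cls_zero: "cls B (%_. 0) = B" by (auto simp: cls_iff)

lemma cls_eq_self: "fsub B ==> cls B f = B \<longleftrightarrow> f : B" using cls_eq_iff[of B f "%_. 0"] by (simp add: cls_zero)

lemma cls_add:
  assumes B: "fsub B"
  shows "cls B f <+>\<^bsub>fun_module Z\<^esub> cls B g = cls B (%x. f x + g x)" unfolding set_add_fun_module
proof (intro Set.set_eqI iffI)
  fix h assume "h : {%x. f' x + g' x | f' g'. f' : cls B f & g' : cls B g}"
  then obtain f' g' where "h = (%x. f' x + g' x)" "(%x. f' x - f x) : B" "(%x. g' x - g x) : B" by (auto simp: cls_iff)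
  then show "h : cls B (%x. f x + g x)"
    using fsub_add[OF B, of "%x. f' x - f x" "%x. g' x - g x"] by (simp add: cls_iff algebra_simps)
next
  fix h assume "h : cls B (%x. f x + g x)"
  then have "(%x. h x - g x) : cls B f" by (simp add: cls_iff algebra_simps)
  then show "h : {%x. f' x + g' x | f' g'. f' : cls B f & g' : cls B g}"
    using cls_self[OF B, of g] by (intro CollectI exI[of _ "%x. h x - g x"] exI[of _ g]) simp
qed

lemma cls_scale:
  assumes B: "fsub B" shows "(\<Union>h\<in>cls B f. cls B (%x. c * h x)) = cls B (%x. c * f x)"
proof -
  have "cls B (%x. c * h x) = cls B (%x. c * f x)" if "h : cls B f" for h
    using fsub_scale[OF B, of "%x. h x - f x" c] that by (simp add: cls_iff cls_eq_iff[OF B] algebra_simps)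
  then show ?thesis using cls_self[OF B] by blast
qed

lemma carrier_quot_space: "carrier (quot_space V W) = (%v. W +>\<^bsub>V\<^esub> v) ` carrier V"
  by (auto simp: quot_space_def A_RCOSETS_def RCOSETS_def a_r_coset_def)

lemma quot_fun:
  "carrier (quot_space (fun_module Z) B) = cls B ` Z" "zero (quot_space (fun_module Z) B) = B"
  "add (quot_space (fun_module Z) B) = set_add (fun_module Z)"
  "fsub B ==> cls B f \<oplus>\<^bsub>quot_space (fun_module Z) B\<^esub> cls B g = cls B (%x. f x + g x)"
  "fsub B ==> c \<odot>\<^bsub>quot_space (fun_module Z) B\<^esub> cls B f = cls B (%x. c * f x)"
  by (simp_all add: carrier_quot_space coset_fun_module) (simp_all add: quot_space_def cls_add cls_scale coset_fun_module)

text \<open>The cochain conditions for coefficients in cohomology contain \<open>finsum\<close> over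
  the quotient record, whose rules live in this locale.\<close>

lemma abelian_monoid_quot:
  assumes Z: "fsub Z" and B: "fsub B"
  shows "abelian_monoid (quot_space (fun_module Z) B)"
proof -
  let ?Q = "quot_space (fun_module Z) B"
  show ?thesis
  proof (rule abelian_monoidI)
    have zero: "\<zero>\<^bsub>?Q\<^esub> = cls B (%_. 0)" by (simp add: quot_fun cls_zero)
    show "\<zero>\<^bsub>?Q\<^esub> : carrier (?Q)" unfolding zero using fsub_0[OF Z] by (auto simp: quot_fun(1))
    fix X Y W
    assume "X : carrier (?Q)" "Y : carrier (?Q)"
    then obtain f g where fg: "f : Z" "g : Z" "X = cls B f" "Y = cls B g" by (auto simp: quot_fun(1))
    show "X \<oplus>\<^bsub>?Q\<^esub> Y : carrier (?Q)"
      using fg fsub_add[OF Z] by (auto simp: quot_fun(1) quot_fun(4)[OF B])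
    show "X \<oplus>\<^bsub>?Q\<^esub> Y = Y \<oplus>\<^bsub>?Q\<^esub> X" using fg by (simp add: quot_fun(4)[OF B] add.commute)
    show "\<zero>\<^bsub>?Q\<^esub> \<oplus>\<^bsub>?Q\<^esub> X = X" unfolding zero using fg by (simp add: quot_fun(4)[OF B])
    assume "W : carrier (?Q)"
    then obtain h where "W = cls B h" by (auto simp: quot_fun(1))
    then show "X \<oplus>\<^bsub>?Q\<^esub> Y \<oplus>\<^bsub>?Q\<^esub> W =
        X \<oplus>\<^bsub>?Q\<^esub> (Y \<oplus>\<^bsub>?Q\<^esub> W)" using fg by (simp add: quot_fun(4)[OF B] add.assoc)
  qed
qed

lemma finsum_cls:
  assumes Z: "fsub Z" and B: "fsub B" and J: "finite J"
  shows "(!!i. i : J ==> F i : Z) ==>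
    (\<Oplus>\<^bsub>quot_space (fun_module Z) B\<^esub>i\<in>J. cls B (F i)) = cls B (%x. \<Sum>i\<in>J. F i x) & (%x. \<Sum>i\<in>J. F i x) : Z" using J
proof (induction J)
  interpret abelian_monoid "quot_space (fun_module Z) B" by (rule abelian_monoid_quot[OF Z B])
  case empty
  then show ?case using fsub_0[OF Z] by (simp add: quot_fun cls_zero)
next
  interpret abelian_monoid "quot_space (fun_module Z) B" by (rule abelian_monoid_quot[OF Z B])
  case (insert j J)
  have "(\<Oplus>\<^bsub>quot_space (fun_module Z) B\<^esub>i\<in>insert j J. cls B (F i)) =
      cls B (F j) \<oplus>\<^bsub>quot_space (fun_module Z) B\<^esub> (\<Oplus>\<^bsub>quot_space (fun_module Z) B\<^esub>i\<in>J. cls B (F i))"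
    by (rule finsum_insert) (use insert in \<open>auto simp: quot_fun(1)\<close>)
  then show ?case
    using insert fsub_add[OF Z, of "F j" "%x. \<Sum>i\<in>J. F i x"] by (simp add: quot_fun(4)[OF B])
qed

lemma finsum_trivial_module: "finite J ==> (\<Oplus>\<^bsub>trivial_module\<^esub>i\<in>J. F i) = (\<Sum>i\<in>J. F i)"
proof (induction J rule: finite_induct)
  have am: "abelian_monoid trivial_module" by (rule abelian_monoidI) (auto simp: trivial_module_def)
  interpret abelian_monoid trivial_module by (rule am)
  {
    case empty
    have "\<zero>\<^bsub>trivial_module\<^esub> = 0" by (simp add: trivial_module_def)
    then show ?case using finsum_empty by simp
  next
    case (insert j J)
    have "(\<Oplus>\<^bsub>trivial_module\<^esub>i\<in>insert j J. F i) = F j \<oplus>\<^bsub>trivial_module\<^esub> (\<Oplus>\<^bsub>trivial_module\<^esub>i\<in>J. F i)"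
      by (rule finsum_insert) (use insert in \<open>auto simp: trivial_module_def\<close>)
    then show ?case using insert by (simp add: trivial_module_def)
  }
qed

lemma minus_trivial_module: "c \<ominus>\<^bsub>trivial_module\<^esub> d = c - d"
proof -
  have "m_inv (add_monoid trivial_module) d = - d" unfolding m_inv_def trivial_module_def
    by (rule the_equality) (simp_all, metis add_eq_0_iff)
  then show ?thesis by (simp add: a_minus_def a_inv_def) (simp add: trivial_module_def)
qed

text \<open>\<open>W\<close> is necessarily the image of \<open>B\<close>, so that \<open>g\<close> maps cosets onto cosets.\<close>

lemma quot_space_isomorphic:
  assumes Z: "fsub Z" and B: "fsub B" "B <= Z"
    and onto: "g ` Z = carrier V" and W: "W <= carrier V"
    and add: "!!f f'. f : Z ==> f' : Z ==> g (%x. f x + f' x) = g f \<oplus>\<^bsub>V\<^esub> g f'"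
    and scale: "!!c f. f : Z ==> g (%x. c * f x) = c \<odot>\<^bsub>V\<^esub> g f"
    and ker: "!!f. f : Z ==> g f : W \<longleftrightarrow> f : B"
  shows "vs_isomorphic (quot_space (fun_module Z) B) (quot_space V W)"
proof -
  let ?Q = "quot_space (fun_module Z) B" and ?P = "quot_space V W"
  have gB: "g ` B = W"
  proof
    show "g ` B <= W" using ker subsetD[OF B(2)] by (intro image_subsetI) simp
    show "W <= g ` B"
    proof
      fix w assume w: "w : W"
      then obtain f where "f : Z" "w = g f" using subsetD[OF W w] onto by (metis imageE)
      then show "w : g ` B" using ker[of f] w by simp
    qed
  qed
  have clsZ: "cls B f <= Z" if f: "f : Z" for f
  proof
    fix h assume "h : cls B f"
    then have "(%x. h x - f x) : B" by (simp only: cls_iff)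
    then have "(%x. h x - f x) : Z" by (rule subsetD[OF B(2)])
    then show "h : Z" using fsub_add[OF Z _ f, of "%x. h x - f x"] by simp
  qed
  have coset: "W +>\<^bsub>V\<^esub> g f = g ` cls B f" if f: "f : Z" for f
  proof -
    have "W +>\<^bsub>V\<^esub> g f = (%b. g b \<oplus>\<^bsub>V\<^esub> g f) ` B" unfolding gB[symmetric] by (auto simp: a_r_coset_def r_coset_def)
    also have "... = (%b. g (%x. b x + f x)) ` B" using add f B(2) by (intro image_cong) auto
    finally show ?thesis by (auto simp: cls_def)
  qed
  have car: "carrier (?P) = (%f. g ` cls B f) ` Z"
  proof -
    show ?thesis unfolding carrier_quot_space onto[symmetric] image_image using coset by (intro image_cong) auto
  qed
  have inj: "f : cls B f'" if f: "f : Z" "f' : Z" and eq: "g ` cls B f = g ` cls B f'" for f f'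
  proof -
    have "g f : g ` cls B f'" using cls_self[OF B(1), of f] eq by blast
    then obtain h where h: "h : cls B f'" "g f = g h" by blast
    have hZ: "h : Z" using h(1) clsZ f(2) by blast
    \<comment> \<open>Differences are written with the scalar -1, since \<open>g\<close> is known to
      respect sums and scalar multiples.\<close>
    have mh: "(%x. (- 1) * h x) : Z" by (rule fsub_scale[OF Z hZ])
    have "g (%x. f x + (- 1) * h x) = g (%x. h x + (- 1) * h x)" unfolding add[OF f(1) mh] add[OF hZ mh] h(2) ..
    also have "... = g (%_. 0)" by simp
    also have "... : W" using ker[OF fsub_0[OF Z]] fsub_0[OF B(1)] by blast
    finally have "(%x. f x + (- 1) * h x) : B" using ker fsub_add[OF Z f(1) mh] by blast
    then have "f : cls B h" by (simp add: cls_iff)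
    then show ?thesis using cls_eqI[OF B(1) h(1)] by simp
  qed
  let ?phi = "%X. g ` X"
  have "?phi : iso (add_monoid (?Q)) (add_monoid (?P))" unfolding iso_def hom_def
  proof (intro CollectI conjI funcsetI ballI)
    show "bij_betw ?phi (carrier (add_monoid (?Q))) (carrier (add_monoid (?P)))" unfolding bij_betw_def
    proof
      show "inj_on ?phi (carrier (add_monoid (?Q)))"
      proof (rule inj_onI)
        fix X Y assume X: "X : carrier (add_monoid (?Q))"
          and Y: "Y : carrier (add_monoid (?Q))" and eq: "g ` X = g ` Y"
        obtain f f' where f: "f : Z" "X = cls B f" and f': "f' : Z" "Y = cls B f'"
          using X Y by (auto simp: quot_fun(1))
        show "X = Y" using cls_eqI[OF B(1) inj[OF f(1) f'(1)]] eq f(2) f'(2) by simp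
      qed
      show "?phi ` carrier (add_monoid (?Q)) = carrier (add_monoid (?P))"
        by (simp add: quot_fun(1) car image_image)
    qed
    fix X assume X: "X : carrier (add_monoid (?Q))"
    then obtain f where f: "f : Z" "X = cls B f" by (auto simp: quot_fun(1))
    show "?phi X : carrier (add_monoid (?P))" using f by (auto simp: car)
    fix Y assume "Y : carrier (add_monoid (?Q))"
    then obtain f' where f': "f' : Z" "Y = cls B f'" by (auto simp: quot_fun(1))
    have "g ` {%x. u x + v x | u v. u : X & v : Y} = {u \<oplus>\<^bsub>V\<^esub> v | u v. u : g ` X & v : g ` Y}"
    proof (intro Set.set_eqI iffI)
      fix w assume "w : g ` {%x. u x + v x | u v. u : X & v : Y}"
      then obtain u v where uv: "u : X" "v : Y" "w = g (%x. u x + v x)" by blast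
      moreover from this have "g (%x. u x + v x) = g u \<oplus>\<^bsub>V\<^esub> g v"
        using clsZ[OF f(1)] clsZ[OF f'(1)] f(2) f'(2) by (intro add) auto
      ultimately show "w : {u \<oplus>\<^bsub>V\<^esub> v | u v. u : g ` X & v : g ` Y}"
        by (intro CollectI exI[of _ "g u"] exI[of _ "g v"]) simp
    next
      fix w assume "w : {u \<oplus>\<^bsub>V\<^esub> v | u v. u : g ` X & v : g ` Y}"
      then obtain u v where uv: "u : X" "v : Y" "w = g u \<oplus>\<^bsub>V\<^esub> g v" by blast
      have "g (%x. u x + v x) = g u \<oplus>\<^bsub>V\<^esub> g v" using clsZ[OF f(1)] clsZ[OF f'(1)] f(2) f'(2) uv by (intro add) auto
      then show "w : g ` {%x. u x + v x | u v. u : X & v : Y}"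
        using uv by (intro image_eqI[of _ _ "%x. u x + v x"] CollectI exI[of _ u] exI[of _ v]) simp_all
    qed
    then show "?phi (X \<otimes>\<^bsub>add_monoid (?Q)\<^esub> Y) =
        ?phi X \<otimes>\<^bsub>add_monoid (?P)\<^esub> ?phi Y"
      by (simp add: quot_fun(3) set_add_fun_module) (auto simp: quot_space_def set_add_def set_mult_def)
  qed
  moreover have "?phi (c \<odot>\<^bsub>?Q\<^esub> X) = c \<odot>\<^bsub>?P\<^esub> ?phi X" if X: "X : carrier (?Q)" for c X
  proof -
    obtain f where f: "f : Z" "X = cls B f" using X by (auto simp: quot_fun(1))
    have "c \<odot>\<^bsub>?P\<^esub> ?phi X = (\<Union>u\<in>X. W +>\<^bsub>V\<^esub> (c \<odot>\<^bsub>V\<^esub> g u))" by (simp add: quot_space_def)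
    also have "... = (\<Union>u\<in>X. g ` cls B (%x. c * u x))"
    proof (rule SUP_cong[OF refl])
      fix u assume "u : X"
      then have u: "u : Z" using clsZ f by blast
      show "W +>\<^bsub>V\<^esub> (c \<odot>\<^bsub>V\<^esub> g u) = g ` cls B (%x. c * u x)"
        using coset[OF fsub_scale[OF Z u, of c]] scale[OF u, of c] by simp
    qed
    also have "... = g ` (\<Union>u\<in>X. cls B (%x. c * u x))" by blast
    finally show ?thesis by (simp add: quot_space_def coset_fun_module)
  qed
  ultimately show ?thesis unfolding vs_isomorphic_def by blast
qed

section \<open>Pages of a bounded filtered complex\<close>

locale filtered_complex =
  fixes C :: "nat => ('b => complex) set" and d :: "nat => ('b => complex) => 'b => complex"
    and F :: "int => nat => ('b => complex) set"
  assumes d_add: "!!n f g. f : C n ==> g : C n ==> d n (%x. f x + g x) = (%x. d n f x + d n g x)"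
    and d_scale: "!!n c f. f : C n ==> d n (%x. c * f x) = (%x. c * d n f x)"
    and F_sub: "!!p n. fsub (F p n)" and F_C: "!!p n. F p n <= C n"
    and F_antimono: "!!p q n. p <= q ==> F q n <= F p n"
    and F_nonpos: "!!p n. p <= 0 ==> F p n = C n" and F_large: "!!p n. int n < p ==> F p n = {%_. 0}"
    and d_F: "!!p n f. f : F p n ==> d n f : F p (Suc n)"
    and d_d: "!!n f. f : C n ==> d (Suc n) (d n f) = (%_. 0)"
begin

abbreviation "Cm \<equiv> %n. fun_module (C n)"

lemma C_sub: "fsub (C n)" using F_sub[of 0 n] F_nonpos[of 0 n] by simp

lemma d_C: "f : C n ==> d n f : C (Suc n)" using d_F[of f 0 n] F_nonpos[of 0] by simp

lemma d_0: "d n (%_. 0) = (%_. 0)" using d_scale[OF fsub_0[OF C_sub], of n 0] by simp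

abbreviation "Zr \<equiv> ss_cycles d F"
abbreviation "Br \<equiv> ss_bounds Cm d F"

lemma Zr_sub: "fsub (Zr r p n)" unfolding fsub_def ss_cycles_def
  using fsub_0[OF F_sub] fsub_add[OF F_sub] fsub_scale[OF F_sub] F_C d_0 d_add d_scale
  by (auto simp: subset_iff)

definition Rr :: "int => int => nat => ('b => complex) set" where
  "Rr r p n = (case n of 0 => {%_. 0} | Suc m => d m ` Zr (r - 1) (p - r + 1) m)"

lemma Zr_C: "f : Zr r p n ==> f : C n" using F_C by (auto simp: ss_cycles_def)

lemma Rr_sub: "fsub (Rr r p n)"
proof (cases n)
  case (Suc m)
  note Z = Zr_sub[of "r - 1" "p - r + 1" m]
  have "(%x. d m f x + d m g x) : d m ` Zr (r - 1) (p - r + 1) m"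
    if "f : Zr (r - 1) (p - r + 1) m" "g : Zr (r - 1) (p - r + 1) m" for f g
    using d_add[OF Zr_C[OF that(1)] Zr_C[OF that(2)]] fsub_add[OF Z that] by (metis imageI)
  moreover have "(%x. c * d m f x) : d m ` Zr (r - 1) (p - r + 1) m" if "f : Zr (r - 1) (p - r + 1) m" for f c
    using d_scale[OF Zr_C[OF that], of c] fsub_scale[OF Z that, of c] by (metis imageI)
  moreover have "(%_. 0) : d m ` Zr (r - 1) (p - r + 1) m" using d_0[of m] fsub_0[OF Z] by (metis imageI)
  ultimately show ?thesis using Suc by (simp add: Rr_def fsub_def)
qed (simp add: Rr_def fsub_def)

lemma Br_iff: "f : Br r p n \<longleftrightarrow> (EX a:Zr (r - 1) (p + 1) n. EX b:Rr r p n. f = (%x. a x + b x))"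
  by (cases n) (auto simp: ss_bounds_def set_add_fun_module Rr_def)

lemma Br_I: "a : Zr (r - 1) (p + 1) n ==> b : Rr r p n ==> (%x. a x + b x) : Br r p n" unfolding Br_iff by blast

lemma Br_sub: "fsub (Br r p n)" unfolding fsub_def
proof (intro conjI ballI allI)
  note Z = Zr_sub[of "r - 1" "p + 1" n] and R = Rr_sub[of r p n]
  show "(%_. 0) : Br r p n" using Br_I[OF fsub_0[OF Z] fsub_0[OF R]] by simp
  fix f assume "f : Br r p n"
  then obtain a b where f: "a : Zr (r - 1) (p + 1) n" "b : Rr r p n" "f = (%x. a x + b x)" unfolding Br_iff by blast
  show "(%x. c * f x) : Br r p n" for c
    using Br_I[OF fsub_scale[OF Z f(1), of c] fsub_scale[OF R f(2), of c]] by (simp add: f(3) algebra_simps)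
  fix g assume "g : Br r p n"
  then obtain a' b' where g: "a' : Zr (r - 1) (p + 1) n" "b' : Rr r p n" "g = (%x. a' x + b' x)" unfolding Br_iff by blast
  show "(%x. f x + g x) : Br r p n"
    using Br_I[OF fsub_add[OF Z f(1) g(1)] fsub_add[OF R f(2) g(2)]] by (simp add: f(3) g(3) algebra_simps)
qed

lemma Br_Zr: "Br r p n <= Zr r p n"
proof
  fix f assume "f : Br r p n"
  then obtain a b where f: "a : Zr (r - 1) (p + 1) n" "b : Rr r p n" "f = (%x. a x + b x)" unfolding Br_iff by blast
  have "a : Zr r p n" using f(1) F_antimono[of p "p + 1" n] by (auto simp: ss_cycles_def)
  moreover have "b : Zr r p n"
  proof (cases n)
    case 0
    then show ?thesis using f(2) fsub_0[OF Zr_sub] by (simp add: Rr_def)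
  next
    case (Suc m)
    then obtain e where e: "e : Zr (r - 1) (p - r + 1) m" "b = d m e" using f(2) by (auto simp: Rr_def)
    then show ?thesis using d_d[OF Zr_C[OF e(1)]] fsub_0[OF F_sub] Suc by (simp add: ss_cycles_def)
  qed
  ultimately show "f : Zr r p n" using fsub_add[OF Zr_sub] f(3) by blast
qed

lemma ss_page_eq: "ss_page Cm d F r p n = quot_space (fun_module (Zr r p n)) (Br r p n)" by (simp add: ss_page_def)

text \<open>Cycles of a later page are in particular cycles of the second, so the exchange of
  \<open>f\<close> for a \<open>g\<close> one step deeper with the same differential serves for all
  \<open>r\<close>; then \<open>d g\<close> lies in the image part of the denominator of the
  target.\<close>

lemma degenerates_at_two:
  assumes "!!p n f. f : F p n ==> d n f : F (p + 2) (Suc n) ==> EX g:F (p + 1) n. d n f = d n g"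
  shows "ss_degenerates_at Cm d F 2" unfolding ss_degenerates_at_def
proof (intro allI impI ballI)
  fix r p :: int and n X assume r: "2 <= r" and X: "X : carrier (ss_page Cm d F r p n)"
  obtain f where f: "f : Zr r p n" "X = cls (Br r p n) f" using X by (auto simp: ss_page_eq quot_fun(1))
  have "cls (Br r (p + r) (Suc n)) (d n h) = Br r (p + r) (Suc n)" if "h : X" for h
  proof -
    have "(%x. h x - f x) : Zr r p n" using that f(2) Br_Zr by (auto simp: cls_iff)
    then have h: "h : Zr r p n" using fsub_add[OF Zr_sub _ f(1)] by fastforce
    then have "h : F p n" "d n h : F (p + 2) (Suc n)"
      using F_antimono[of "p + 2" "p + r" "Suc n"] r by (auto simp: ss_cycles_def)
    then obtain g where g: "g : F (p + 1) n" "d n h = d n g" using assms by blast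
    \<comment> \<open>The target has filtration degree \<open>p + r\<close>, so its incoming
      differentials start in degree \<open>p + r - r + 1 = p + 1\<close>.\<close>
    then have "g : Zr (r - 1) (p + r - r + 1) n" using h by (simp add: ss_cycles_def)
    then have "d n h : Rr r (p + r) (Suc n)" using g(2) by (simp add: Rr_def)
    then have "d n h : Br r (p + r) (Suc n)" using Br_I[OF fsub_0[OF Zr_sub]] by fastforce
    then show ?thesis by (simp add: cls_eq_self[OF Br_sub])
  qed
  moreover have "X ~= {}" using cls_self[OF Br_sub] f(2) by blast
  ultimately show "ss_diff Cm d F r p n X = \<zero>\<^bsub>ss_page Cm d F r (p + r) (Suc n)\<^esub>"
    by (simp add: ss_diff_def ss_page_eq quot_fun(2) coset_fun_module)
qed

abbreviation "Zc \<equiv> cocycles Cm d"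
abbreviation "Bc \<equiv> coboundaries Cm d"

lemma Zc_iff: "f : Zc n \<longleftrightarrow> f : C n & d n f = (%_. 0)" by (simp add: cocycles_def)

lemma Zc_sub: "fsub (Zc n)" unfolding fsub_def
  using fsub_0[OF C_sub] fsub_add[OF C_sub] fsub_scale[OF C_sub] d_0 d_add d_scale
  by (simp add: Zc_iff)

lemma Bc_sub: "fsub (Bc n)"
proof (cases n)
  case (Suc m)
  have "(%x. d m f x + d m g x) : d m ` C m" if "f : C m" "g : C m" for f g
    using d_add[OF that] fsub_add[OF C_sub that] by (metis imageI)
  moreover have "(%x. c * d m f x) : d m ` C m" if "f : C m" for f c
    using d_scale[OF that, of c] fsub_scale[OF C_sub that, of c] by (metis imageI)
  moreover have "(%_. 0) : d m ` C m" using d_0[of m] fsub_0[OF C_sub] by (metis imageI)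
  ultimately show ?thesis using Suc by (simp add: coboundaries_def fsub_def)
qed (simp add: coboundaries_def fsub_def)

lemma Bc_Zc: "Bc n <= Zc n" using d_d d_C fsub_0[OF C_sub] d_0 by (cases n) (auto simp: coboundaries_def Zc_iff)

lemma cohomology_eq: "cohomology Cm d n = quot_space (fun_module (Zc n)) (Bc n)" by (simp add: cohomology_def)

lemma cohomology_filtration_eq: "cohomology_filtration Cm d F p n = cls (Bc n) ` (Zc n \<inter> F p n)"
proof (intro Set.set_eqI iffI)
  fix X assume "X : cohomology_filtration Cm d F p n"
  then obtain f h where f: "f : Zc n" "X = cls (Bc n) f" "h : X" "h : F p n"
    by (auto simp: cohomology_filtration_def cohomology_eq quot_fun(1))
  have "(%x. h x - f x) : Zc n" using f Bc_Zc by (auto simp: cls_iff)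
  then have "h : Zc n" using fsub_add[OF Zc_sub _ f(1)] by fastforce
  then show "X : cls (Bc n) ` (Zc n \<inter> F p n)" using f cls_eqI[OF Bc_sub] by blast
next
  fix X assume "X : cls (Bc n) ` (Zc n \<inter> F p n)"
  then show "X : cohomology_filtration Cm d F p n"
    using cls_self[OF Bc_sub] by (auto simp: cohomology_filtration_def cohomology_eq quot_fun(1))
qed

lemma converges_to_cohomology: "ss_converges_to_cohomology Cm d F" unfolding ss_converges_to_cohomology_def
proof (intro conjI allI)
  fix n
  have "cohomology_filtration Cm d F 0 n = carrier (cohomology Cm d n)"
    using F_nonpos[of 0 n] by (auto simp: cohomology_filtration_eq cohomology_eq quot_fun(1) Zc_iff)
  then show "EX p. cohomology_filtration Cm d F p n = carrier (cohomology Cm d n)" by blast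
  have "Zc n \<inter> {%_. 0} = {%_. 0}" using fsub_0[OF Zc_sub] by blast
  then have "cohomology_filtration Cm d F (int n + 1) n = {\<zero>\<^bsub>cohomology Cm d n\<^esub>}" using F_large[of n "int n + 1"]
    by (simp add: cohomology_filtration_eq cohomology_eq quot_fun(2) cls_zero)
  then show "EX p. cohomology_filtration Cm d F p n = {\<zero>\<^bsub>cohomology Cm d n\<^esub>}" by blast
next
  fix p :: int and n
  show "EX r0. ALL r>=r0. vs_isomorphic (ss_page Cm d F r p n)
        (quot_space ((cohomology Cm d n)\<lparr>carrier := cohomology_filtration Cm d F p n\<rparr>)
           (cohomology_filtration Cm d F (p + 1) n))"
  proof (intro exI allI impI)
    \<comment> \<open>The first bound makes the source of the incoming differential the whole
      cochain space, the second makes the target filtration zero; from then on cycles are cocycles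
      and the image terms are coboundaries.\<close>
    fix r assume r: "max (p + 1) (int n + 2 - p) <= r"
    have large: "F (p + r) (Suc n) = {%_. 0}" by (rule F_large) (use r in auto)
    have Z: "Zr r p n = Zc n \<inter> F p n" using large F_C[THEN subsetD] by (auto simp: ss_cycles_def Zc_iff)
    have Z1: "Zr (r - 1) (p + 1) n = Zc n \<inter> F (p + 1) n" using large F_C[THEN subsetD] by (auto simp: ss_cycles_def Zc_iff)
    have R: "Rr r p n = Bc n \<inter> F p n"
    proof (cases n)
      case (Suc m)
      have "F (p - r + 1) m = C m" by (rule F_nonpos) (use r in auto)
      then show ?thesis using Suc by (auto simp: Rr_def ss_cycles_def coboundaries_def)
    qed (use fsub_0[OF F_sub] in \<open>auto simp: Rr_def coboundaries_def\<close>)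
    let ?V = "(cohomology Cm d n)\<lparr>carrier := cohomology_filtration Cm d F p n\<rparr>"
    show "vs_isomorphic (ss_page Cm d F r p n)
        (quot_space ?V
           (cohomology_filtration Cm d F (p + 1) n))" unfolding ss_page_eq
    proof (rule quot_space_isomorphic[OF Zr_sub Br_sub Br_Zr, where g = "cls (Bc n)"])
      show "cls (Bc n) ` Zr r p n = carrier ?V" by (simp add: Z cohomology_filtration_eq)
      show "cohomology_filtration Cm d F (p + 1) n <=
          carrier ?V" using F_antimono[of p "p + 1" n] by (auto simp: cohomology_filtration_eq)
      fix f assume f: "f : Zr r p n"
      show "cls (Bc n) (%x. f x + f' x) = cls (Bc n) f
          \<oplus>\<^bsub>?V\<^esub> cls (Bc n) f'" for f' by (simp add: cohomology_eq quot_fun(4)[OF Bc_sub])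
      show "cls (Bc n) (%x. c * f x) =
          c \<odot>\<^bsub>?V\<^esub> cls (Bc n) f" for c by (simp add: cohomology_eq quot_fun(5)[OF Bc_sub])
      show "cls (Bc n) f : cohomology_filtration Cm d F (p + 1) n \<longleftrightarrow> f : Br r p n"
      proof
        assume "cls (Bc n) f : cohomology_filtration Cm d F (p + 1) n"
        then obtain a where a: "a : Zc n" "a : F (p + 1) n" "(%x. f x - a x) : Bc n"
          by (auto simp: cohomology_filtration_eq cls_eq_iff[OF Bc_sub])
        have "(%x. f x - a x) : F p n"
          by (rule fsub_diff[OF F_sub]) (use a f Z F_antimono[of p "p + 1" n] in auto)
        then have "(%x. f x - a x) : Rr r p n" "a : Zr (r - 1) (p + 1) n" using a R Z1 by auto
        then show "f : Br r p n" using Br_I[of a r p n "%x. f x - a x"] by simp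
      next
        assume "f : Br r p n"
        then obtain a b where "a : Zc n \<inter> F (p + 1) n" "b : Bc n" "f = (%x. a x + b x)" unfolding Br_iff R Z1 by blast
        then show "cls (Bc n) f : cohomology_filtration Cm d F (p + 1) n"
          unfolding cohomology_filtration_eq by (intro image_eqI[of _ _ a]) (auto simp: cls_eq_iff[OF Bc_sub])
      qed
    qed
  qed
qed

end

lemma finsum_cls_cong:
  assumes Z: "fsub Z" and B: "fsub B" and J: "finite J"
    and X: "!!i. i : J ==> X i = cls B (F i)" and F: "!!i. i : J ==> F i : Z"
  shows "(\<Oplus>\<^bsub>quot_space (fun_module Z) B\<^esub>i\<in>J. X i) = cls B (%x. \<Sum>i\<in>J. F i x)" "(%x. \<Sum>i\<in>J. F i x) : Z"
proof -
  interpret abelian_monoid "quot_space (fun_module Z) B" by (rule abelian_monoid_quot[OF Z B])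
  have "(\<Oplus>\<^bsub>quot_space (fun_module Z) B\<^esub>i\<in>J. X i) = (\<Oplus>\<^bsub>quot_space (fun_module Z) B\<^esub>i\<in>J. cls B (F i))"
    by (rule finsum_cong') (use X F in \<open>auto simp: quot_fun(1)\<close>)
  then show "(\<Oplus>\<^bsub>quot_space (fun_module Z) B\<^esub>i\<in>J. X i) = cls B (%x. \<Sum>i\<in>J. F i x)" "(%x. \<Sum>i\<in>J. F i x) : Z"
    using finsum_cls[OF Z B J, of F] F by simp_all
qed

section \<open>The records of the statement as concrete cochain spaces\<close>

context complex_lie_algebra
begin

lemma alt_on_update:
  assumes f: "alt_on S f" and xs: "set xs <= S" "i < length xs" and x: "x : S"
  shows "y : S ==> f (xs[i := x + y]) = f (xs[i := x]) + f (xs[i := y])" "f (xs[i := scale c x]) = c * f (xs[i := x])"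
proof -
  have "set (take i xs) <= S" "set (drop (Suc i) xs) <= S"
    using xs(1) set_take_subset[of i xs] set_drop_subset[of "Suc i" xs] by auto
  then show "y : S ==> f (xs[i := x + y]) = f (xs[i := x]) + f (xs[i := y])" "f (xs[i := scale c x]) = c * f (xs[i := x])"
    using alt_on_add[OF f _ _ x] alt_on_scale[OF f _ _ x] by (simp_all add: upd_conv_take_nth_drop[OF xs(2)])
qed

lemma ins_all_sum:
  assumes f: "alt_on S f" and ws: "set ws <= S" and D: "!!v. v : S ==> D v : S" "!!v. v : S ==> D' v : S"
  shows "ins_all (%v. D v + D' v) ws f = ins_all D ws f + ins_all D' ws f"
    and "ins_all (%v. scale c (D v)) ws f = c * ins_all D ws f"
proof -
  have m: "D (ws ! i) : S" "D' (ws ! i) : S" if "i < length ws" for i using D ws that by (auto simp: subset_iff)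
  show "ins_all (%v. D v + D' v) ws f = ins_all D ws f + ins_all D' ws f"
    unfolding ins_all_eq sum.distrib[symmetric] by (rule sum.cong) (simp_all add: alt_on_update[OF f ws] m)
  show "ins_all (%v. scale c (D v)) ws f = c * ins_all D ws f"
    unfolding ins_all_eq sum_distrib_left by (rule sum.cong) (simp_all add: alt_on_update[OF f ws] m)
qed

definition lie_rec :: "'a set => 'a lie_algebra" where
  "lie_rec S = \<lparr>carrier = S, monoid.mult = undefined, one = undefined,
     zero = 0, add = (+), module.smult = scale, bracket = lie\<rparr>"

lemma lie_rec_simps [simp]:
  "carrier (lie_rec S) = S" "zero (lie_rec S) = 0" "add (lie_rec S) = (+)" "module.smult (lie_rec S) = scale"
  "bracket (lie_rec S) = lie" "(lie_rec S)\<lparr>carrier := T\<rparr> = lie_rec T" by (simp_all add: lie_rec_def)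

end

lemma trivial_module_simps [simp]:
  "carrier trivial_module = UNIV" "zero trivial_module = 0" "add trivial_module = (+)" "module.smult trivial_module = (*)"
  by (simp_all add: trivial_module_def)

context semidirect
begin

lemma alternating_maps_trivial:
  assumes S: "subspace S" shows "alternating_maps (lie_rec S) trivial_module n = {f. altn S n f}"
proof (intro Set.set_eqI iffI)
  fix f assume f: "f : alternating_maps (lie_rec S) trivial_module n"
  have z: "f xs = 0" if "xs ~: args S n" for xs using f that by (simp add: alternating_maps_def)
  have add: "f (xs[i := x + y]) = f (xs[i := x]) + f (xs[i := y])"
    if "xs : args S n" "i < n" "x : S" "y : S" for xs i x y using f that by (simp add: alternating_maps_def)
  have sc: "f (xs[i := scale c x]) = c * f (xs[i := x])" if "xs : args S n" "i < n" "x : S" for xs i c x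
    using f that by (simp add: alternating_maps_def)
  have rp: "f xs = 0" if "xs : args S n" "i < n" "j < n" "i ~= j" "xs ! i = xs ! j" for xs i j
  proof -
    have "ALL xs:args S n. ALL i<n. ALL j<n. i ~= j & xs ! i = xs ! j --> f xs = 0"
      using f by (simp add: alternating_maps_def)
    then show ?thesis using that by blast
  qed
  have "alt_on S f"
  proof (rule alt_onI)
    fix us vs x y assume m: "set us <= S" "set vs <= S" "x : S" "y : S"
    show "f (us @ (x + y) # vs) = f (us @ x # vs) + f (us @ y # vs)"
    proof (cases "Suc (length us + length vs) = n")
      case True
      then have "us @ x # vs : args S n" "length us < n" using m by (auto simp: args_def)
      then show ?thesis using add[of "us @ x # vs" "length us" x y] m by simp
    qed (simp add: z args_def)
  next
    fix us vs c x assume m: "set us <= S" "set vs <= S" "x : S"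
    show "f (us @ scale c x # vs) = c * f (us @ x # vs)"
    proof (cases "Suc (length us + length vs) = n")
      case True
      then have "us @ x # vs : args S n" "length us < n" using m by (auto simp: args_def)
      then show ?thesis using sc[of "us @ x # vs" "length us" x c] m by simp
    qed (simp add: z args_def)
  next
    fix us vs x assume m: "set us <= S" "set vs <= S" "x : S"
    show "f (us @ x # x # vs) = 0"
    proof (cases "us @ x # x # vs : args S n")
      case True
      then have "length us < n" "Suc (length us) < n" by (auto simp: args_def)
      then show ?thesis by (rule rp[OF True]) (simp_all add: nth_append)
    qed (rule z)
  qed
  then show "f : {f. altn S n f}" using z by (simp add: altn_def)
next
  fix f assume "f : {f. altn S n f}"
  then have f: "altn S n f" and fa: "alt_on S f" by (auto simp: altn_def)
  show "f : alternating_maps (lie_rec S) trivial_module n" unfolding alternating_maps_def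
  proof (intro CollectI conjI allI ballI impI)
    show "f xs = \<zero>\<^bsub>trivial_module\<^esub>" if "xs ~: args (carrier (lie_rec S)) n" for xs
      using f that by (simp add: altn_def)
    show "f xs : carrier trivial_module" for xs by simp
    show "f (xs[i := x \<oplus>\<^bsub>lie_rec S\<^esub> y]) = f (xs[i := x]) \<oplus>\<^bsub>trivial_module\<^esub> f (xs[i := y])"
      if "xs : args (carrier (lie_rec S)) n" "i < n" "x : carrier (lie_rec S)" "y : carrier (lie_rec S)" for xs i x y
      using alt_on_update(1)[OF fa, of xs i x y] that by (simp add: args_def)
    show "f (xs[i := c \<odot>\<^bsub>lie_rec S\<^esub> x]) = c \<odot>\<^bsub>trivial_module\<^esub> f (xs[i := x])"
      if "xs : args (carrier (lie_rec S)) n" "i < n" "x : carrier (lie_rec S)" for xs i c x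
      using alt_on_update(2)[OF fa, of xs i x c] that by (simp add: args_def)
    show "f xs = \<zero>\<^bsub>trivial_module\<^esub>"
      if "xs : args (carrier (lie_rec S)) n" "i < n" "j < n" "i ~= j & xs ! i = xs ! j" for xs i j
      using alt_on_repeated[OF fa S, of xs i j] that by (simp add: args_def)
  qed
qed

lemma rel_cochains_A: "rel_cochains (lie_rec A) k trivial_module trivial_action n = fun_module (Cn n)"
proof -
  have "{f : {f. altn A n f}. (ALL xs:args A n. set xs \<inter> k ~= {} --> f xs = 0) &
      (ALL x:k. ALL xs:args A n. 0 = (\<Sum>i<n. f (xs[i := lie x (xs ! i)])))} = Cn n" (is "?X = _")
  proof (intro Set.set_eqI iffI)
    fix f assume f: "f : ?X"
    then have a: "altn A n f" by simp
    show "f : Cn n" unfolding Cn_def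
    proof (intro CollectI conjI allI impI ballI)
      fix xs assume xs: "set xs <= A"
      show "f xs = 0" if "set xs \<inter> k ~= {}"
        using f xs that altn_0[OF a, of xs] by (cases "length xs = n") (auto simp: args_def)
      fix x assume x: "x : k"
      show "ins_all (lie x) xs f = 0"
      proof (cases "length xs = n")
        case True
        then have "xs : args A n" using xs by (simp add: args_def)
        then have "0 = (\<Sum>i<n. f (xs[i := lie x (xs ! i)]))" using f x by blast
        then show ?thesis using True by (simp add: ins_all_eq)
      next
        case False
        then show ?thesis unfolding ins_all_eq by (intro sum.neutral ballI altn_0[OF a]) simp
      qed
    qed (rule a)
  qed (auto simp: Cn_def ins_all_eq args_def)
  then show ?thesis
    by (simp add: rel_cochains_def fun_module_def alternating_maps_trivial[OF subspace_A] finsum_trivial_module trivial_action_def)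
qed

text \<open>Relative to the zero subalgebra, multilinearity gives both relative conditions.\<close>

lemma rel_cochains_I: "rel_cochains (lie_rec I) {0} trivial_module trivial_action q = fun_module {f. altn I q f}"
proof -
  have "f xs = 0" if f: "altn I q f" and xs: "xs : args I q" "0 : set xs" for f xs
  proof -
    obtain us vs where "xs = us @ 0 # vs" using split_list[OF xs(2)] by blast
    then show ?thesis using f xs(1) alt_on_zero[of I f us vs] subspace_0[OF I] by (simp add: args_def altn_def)
  qed
  moreover have "f (xs[i := lie 0 (xs ! i)]) = 0" if f: "altn I q f" and xs: "xs : args I q" "i < q" for f xs i
  proof -
    have "lie 0 (xs ! i) = scale 0 (lie 0 (xs ! i))" using lie_scale_left[of 0 0 "xs ! i"] by simp
    then have "lie 0 (xs ! i) = 0" by simp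
    then show ?thesis using f xs alt_on_update(2)[of I f xs i 0 0] subspace_0[OF I] by (simp add: args_def altn_def)
  qed
  ultimately show ?thesis
    by (auto simp: rel_cochains_def fun_module_def alternating_maps_trivial[OF I] finsum_trivial_module trivial_action_def
        intro!: sum.neutral)
qed

lemma ce_diff_trivial:
  assumes S: "subalgebra S" and f: "altn S n f"
  shows "ce_diff (lie_rec S) trivial_module trivial_action n f = diff_on S f"
proof
  fix xs
  show "ce_diff (lie_rec S) trivial_module trivial_action n f xs = diff_on S f xs"
  proof (cases "xs : args S (Suc n)")
    case True
    then have xs: "set xs <= S" "length xs = Suc n" by (auto simp: args_def)
    have "antisym_on S f" using alt_on_antisym f S subalg_subspace by (simp add: altn_def)
    then have "ce0 lie xs f = (\<Sum>j<Suc n. \<Sum>i<j. (- 1) ^ (i + j) * f (lie (xs ! i) (xs ! j) # nths xs (- {i, j})))"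
      using ce_explicit[of S lie "%_ _. 0" f xs] subalg_lie[OF S] xs by (simp add: sg_complex)
    then show ?thesis using True xs
      by (simp add: ce_diff_def diff_on_def finsum_trivial_module trivial_action_def lessThan_Suc_atMost)
  next
    case False
    have "altn S (Suc n) (diff_on S f)" by (rule altn_diff_on[OF S f])
    then show ?thesis using False by (simp add: ce_diff_def altn_def)
  qed
qed

lemma hs_filtration_eq: "hs_filtration (lie_rec A) I k trivial_module trivial_action p n = Fil p n"
proof (intro Set.set_eqI iffI)
  fix f assume f: "f : hs_filtration (lie_rec A) I k trivial_module trivial_action p n"
  show "f : Fil p n"
  proof (rule FilI)
    show "f : Cn n" using f by (simp add: hs_filtration_def rel_cochains_A)
    fix xs zs assume m: "set xs <= L" "set zs <= I" "length xs + length zs = n" "int (length xs) < p"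
    \<comment> \<open>Only an inclusion holds, because zero entries of \<open>xs\<close> also lie in
      \<open>I\<close>.\<close>
    have "{length xs..<n} <= {i. i < n & (xs @ zs) ! i : I}" using m(2,3) by (auto simp: nth_append subset_iff)
    then have "length zs <= card {i. i < n & (xs @ zs) ! i : I}"
      using card_mono[of "{i. i < n & (xs @ zs) ! i : I}" "{length xs..<n}"] m(3) by simp
    then have "int n - p + 1 <= int (card {i. i < n & (xs @ zs) ! i : I})" using m(3,4) by linarith
    moreover have "xs @ zs : args A n" using m lists_A by (simp add: args_def)
    ultimately show "f (xs @ zs) = 0" using f by (simp add: hs_filtration_def)
  qed
next
  fix f assume f: "f : Fil p n"
  have "f xs = 0" if xs: "xs : args A n" "int n - p + 1 <= int (card {i. i < n & xs ! i : I})" for xs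
  proof -
    have len: "length xs = n" "set xs <= A" using xs(1) by (auto simp: args_def)
    have "f ([] @ xs @ []) = 0"
    proof (rule alt_on_LI_vanish[where N = n and m = "nat (int n - p + 1)"])
      show "alt_on A f" by (rule Cn_alt_on[OF Fil_Cn[OF f]])
      show "f (us @ vs) = 0"
        if "set us <= L" "set vs <= I" "length us + length vs = n" "nat (int n - p + 1) <= length vs" for us vs
        by (rule Fil_0[OF f that(1,2)]) (use that in linarith)
      show "nat (int n - p + 1) <= length [] + length (filter (%x. x : I) xs)"
        using xs(2) len by (simp add: length_filter_conv_card)
    qed (use len in auto)
    then show ?thesis by simp
  qed
  then show "f : hs_filtration (lie_rec A) I k trivial_module trivial_action p n"
    using Fil_Cn[OF f] by (simp add: hs_filtration_def rel_cochains_A)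
qed

lemma fsub_Fil: "fsub (Fil p n)" by (simp add: fsub_def Fil_plus Fil_smult Fil_zero)

abbreviation "dA \<equiv> ce_diff (lie_rec A) trivial_module trivial_action"

lemma dA_eq: "f : Cn n ==> dA n f = D f" by (rule ce_diff_trivial[OF A Cn_altn])

sublocale hs: filtered_complex Cn dA Fil
proof
  show "dA n (%x. f x + g x) = (%x. dA n f x + dA n g x)" if "f : Cn n" "g : Cn n" for n f g
    by (simp add: dA_eq Cn_plus that diff_on_add)
  show "dA n (%x. c * f x) = (%x. c * dA n f x)" if "f : Cn n" for n c f
    by (simp add: dA_eq Cn_smult that diff_on_scale)
  show "dA (Suc n) (dA n f) = (%_. 0)" if "f : Cn n" for n f by (simp add: dA_eq Cn_D that D_D[OF that])
  show "dA n f : Fil p (Suc n)" if "f : Fil p n" for p n f using Fil_D[OF that] by (simp add: dA_eq Fil_Cn[OF that])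
qed (use fsub_Fil Fil_Cn Fil_antimono Fil_nonpos Fil_large in auto)

lemma hs_converges_semidirect: "hs_converges (lie_rec A) I k trivial_module trivial_action"
  using hs.converges_to_cohomology by (simp add: hs_converges_def rel_cochains_A[abs_def] hs_filtration_eq[abs_def])

definition Zq :: "nat => ('a list => complex) set" where
  "Zq q = {f. altn I q f & dI f = (%_. 0)}"

lemma fsub_Zq: "fsub (Zq q)"
  by (simp add: fsub_def Zq_def altn_plus altn_smult altn_zero diff_on_add diff_on_scale diff_on_zero)

lemma fsub_cobd: "fsub (cobd q)"
proof (cases q)
  case (Suc m)
  show ?thesis unfolding fsub_def
  proof (intro conjI ballI allI)
    show "(%_. 0) : cobd q" using Suc altn_zero diff_on_zero[of I] by (force simp: cobd_def)
    fix f assume "f : cobd q"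
    then obtain a where a: "altn I m a" "f = dI a" using Suc by (auto simp: cobd_def)
    have "(%x. c * f x) = dI (%x. c * a x)" for c using a(2) by (simp add: diff_on_scale)
    then show "(%x. c * f x) : cobd q" for c using altn_smult[OF a(1), of c] Suc by (simp add: cobd_def)
    fix g assume "g : cobd q"
    then obtain b where b: "altn I m b" "g = dI b" using Suc by (auto simp: cobd_def)
    have "(%x. f x + g x) = dI (%x. a x + b x)" using a(2) b(2) by (simp add: diff_on_add)
    then show "(%x. f x + g x) : cobd q" using altn_plus[OF a(1) b(1)] Suc by (simp add: cobd_def)
  qed
qed (simp add: cobd_def fsub_def zero_fun_def)

lemma cobd_Zq: "cobd q <= Zq q"
proof (cases q)
  case (Suc m)
  have "altn I q (dI a)" "dI (dI a) = (%_. 0)" if "altn I m a" for a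
    using altn_diff_on[OF I_subalgebra that] diff_on_diff_on[OF I_subalgebra that] Suc by auto
  then show ?thesis using Suc by (auto simp: cobd_def Zq_def)
qed (auto simp: cobd_def Zq_def zero_fun_def altn_zero diff_on_zero)

abbreviation "Hq q \<equiv> ideal_cohomology (lie_rec A) I trivial_module trivial_action q"

lemma Hq_eq: "Hq q = quot_space (fun_module (Zq q)) (cobd q)"
proof -
  have 1: "cocycles (%q. fun_module {f. altn I q f}) (ce_diff (lie_rec I) trivial_module trivial_action) q = Zq q"
    using ce_diff_trivial[OF I_subalgebra] by (auto simp: cocycles_def Zq_def)
  have 2: "coboundaries (%q. fun_module {f. altn I q f}) (ce_diff (lie_rec I) trivial_module trivial_action) q = cobd q"
  proof (cases q)
    case (Suc m)
    then show ?thesis using ce_diff_trivial[OF I_subalgebra, of m]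
      by (auto simp: coboundaries_def cobd_def intro!: image_cong)
  qed (simp add: coboundaries_def cobd_def zero_fun_def)
  show ?thesis by (simp add: ideal_cohomology_def rel_cohomology_def rel_cochains_I[abs_def] cohomology_def 1 2)
qed

end

section \<open>The second page\<close>

context semidirect
begin

lemma th_add_left: "alt_on I f ==> x : A ==> y : A ==> th (x + y) f = th x f + th y f"
  and th_scale_left: "alt_on I f ==> x : A ==> th (scale c x) f = (%zs. c * th x f zs)"
proof -
  assume f: "alt_on I f" and x: "x : A"
  have "ins_all (lie (scale c x)) zs f = c * ins_all (lie x) zs f" if "set zs <= I" for zs
    using ins_all_sum(2)[OF f that, of "lie x" "lie x" c] lie_I_A[OF x] by (simp add: lie_scale_left[abs_def])
  then show "th (scale c x) f = (%zs. c * th x f zs)" by (auto simp: th_def fun_eq_iff)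
  assume y: "y : A"
  have "ins_all (lie (x + y)) zs f = ins_all (lie x) zs f + ins_all (lie y) zs f" if "set zs <= I" for zs
    using ins_all_sum(1)[OF f that, of "lie x" "lie y"] lie_I_A x y by (simp add: lie_add_left[abs_def])
  then show "th (x + y) f = th x f + th y f" by (auto simp: th_def fun_eq_iff)
qed

lemma altn_th_A: "altn I q f ==> ~ (set zs <= I & length zs = q) ==> th x f zs = 0" if "x : A" for x
proof -
  assume f: "altn I q f" and zs: "~ (set zs <= I & length zs = q)"
  show ?thesis
  proof (cases "set zs <= I")
    case True
    then have "f (zs[i := lie x (zs ! i)]) = 0" for i using zs by (intro altn_0[OF f]) simp
    then show ?thesis using True by (simp add: th_def ins_all_eq)
  qed (simp add: th_def)
qed

text \<open>Cartan's formula: \<open>I\<close> acts trivially on its own cohomology.\<close>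

lemma th_I_cobd:
  assumes i: "i : I" and f: "f : Zq q" shows "th i f : cobd q"
proof -
  have fa: "altn I q f" and df: "dI f = (%_. 0)" using f by (auto simp: Zq_def)
  show ?thesis
  proof (cases q)
    case 0
    have "th i f zs = 0" for zs using altn_th_A[OF I_A[OF i] fa, of zs] 0 by (cases zs) (auto simp: th_def)
    then show ?thesis using 0 by (simp add: cobd_def fun_eq_iff)
  next
    case (Suc m)
    define g where "g = (%zs. f (i # zs))"
    have g: "altn I m g" using alt_on_Cons[of I f i] fa i Suc by (auto simp: altn_def g_def args_def)
    have "th i f zs = dI g zs" for zs
    proof (cases "set zs <= I")
      case True
      then have "dI f (i # zs) = - ins_all (lie i) zs f - ce0 lie zs g" using i by (simp add: diff_on_def g_def)
      then have "- ins_all (lie i) zs f = ce0 lie zs g" by (simp add: df)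
      then show ?thesis using True by (simp add: th_def diff_on_def)
    qed (simp add: th_def diff_on_def)
    then have "th i f = dI g" by blast
    then show ?thesis using g Suc by (simp add: cobd_def)
  qed
qed

lemma th_Zq: assumes "x : L" "f : Zq q" shows "th x f : Zq q"
  using altn_th[OF assms(1), of q f] dI_th[OF assms(1), of q f] assms(2) th_zero(1)[of x] by (simp add: Zq_def)

lemma th_cobd: assumes "x : L" "c : cobd q" shows "th x c : cobd q"
proof (cases q)
  case (Suc m)
  then obtain a where a: "altn I m a" "c = dI a" using assms(2) by (auto simp: cobd_def)
  then have "th x c = dI (th x a)" using dI_th[OF assms(1) a(1)] by simp
  then show ?thesis using altn_th[OF assms(1) a(1)] Suc by (simp add: cobd_def)
qed (use assms th_zero in \<open>simp add: cobd_def zero_fun_def\<close>)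

text \<open>Changing \<open>x\<close> within its coset is harmless by Cartan's formula, changing the
  cocycle within its class because \<open>th\<close> commutes with \<open>dI\<close>.\<close>

lemma th_class:
  assumes x: "x : L" "x' - x : I" and f: "f : Zq q" "g : cls (cobd q) f"
  shows "cls (cobd q) (th x' g) = cls (cobd q) (th x f)"
proof -
  have "(%zs. g zs - f zs) : cobd q" using f(2) by (simp only: cls_iff)
  then have c: "g - f : cobd q" by (simp add: fun_diff_def)
  have gZ: "g : Zq q" using fsub_add[OF fsub_Zq subsetD[OF cobd_Zq c] f(1)] by simp
  have ga: "alt_on I g" using gZ by (simp add: Zq_def altn_def)
  have "th x' g = th x g + th (x' - x) g" using th_add_left[OF ga L_A[OF x(1)] I_A[OF x(2)]] by simp
  moreover have "th x g = th x f + th x (g - f)" using th_plus[of x f "g - f"] by simp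
  ultimately have "th x' g - th x f = (%zs. th x (g - f) zs + th (x' - x) g zs)" by (simp add: fun_eq_iff)
  also have "... : cobd q" by (rule fsub_add[OF fsub_cobd th_cobd[OF x(1) c] th_I_cobd[OF x(2) gZ]])
  finally show ?thesis by (simp add: cls_eq_iff[OF fsub_cobd] fun_diff_def)
qed

section \<open>The quotient algebra and its action on the cohomology of the ideal\<close>

abbreviation "act q \<equiv> quot_action (lie_rec A) I trivial_module trivial_action q"
abbreviation "Q \<equiv> lie_quot (lie_rec A) I"

definition coset :: "'a => 'a set" where
  "coset x = I +>\<^bsub>lie_rec A\<^esub> x"

lemma coset_iff: "y : coset x \<longleftrightarrow> y - x : I"
proof -
  have "y = z + x \<longleftrightarrow> z = y - x" for z by auto
  then show ?thesis by (simp add: coset_def a_r_coset_def r_coset_def)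
qed

lemma coset_self: "x : coset x" using subspace_0[OF I] by (simp add: coset_iff)

lemma coset_eq: "coset x = coset y \<longleftrightarrow> x - y : I"
proof
  show "coset x = coset y ==> x - y : I" using coset_self[of x] by (simp add: coset_iff)
  assume xy: "x - y : I"
  have "z - x : I \<longleftrightarrow> z - y : I" for z
    using subspace_add[OF I xy, of "z - x"] subspace_diff[OF I _ xy, of "z - y"] by auto
  then show "coset x = coset y" by (auto simp: coset_iff)
qed

lemma carrier_Q: "carrier Q = coset ` L"
proof -
  have "carrier Q = coset ` A" by (auto simp: lie_quot_def A_RCOSETS_def RCOSETS_def coset_def a_r_coset_def)
  also have "... = coset ` L"
  proof (intro equalityI image_subsetI)
    fix x assume x: "x : A"
    have "coset x = coset (PL x)" using P_mem(2)[OF x] by (simp add: coset_eq PI_def)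
    then show "coset x : coset ` L" using P_mem(1)[OF x] by blast
  qed (use L_A in blast)
  finally show ?thesis .
qed

lemma Q_add: "coset x \<oplus>\<^bsub>Q\<^esub> coset y = coset (x + y)"
proof -
  have "coset x \<oplus>\<^bsub>Q\<^esub> coset y = {u + v | u v. u : coset x & v : coset y}"
    by (auto simp: lie_quot_def set_add_def set_mult_def)
  also have "... = coset (x + y)"
  proof (intro Set.set_eqI iffI)
    fix w assume "w : {u + v | u v. u : coset x & v : coset y}"
    then obtain u v where "w = u + v" "u - x : I" "v - y : I" by (auto simp: coset_iff)
    then show "w : coset (x + y)" using subspace_add[OF I, of "u - x" "v - y"] by (simp add: coset_iff algebra_simps)
  next
    fix w assume "w : coset (x + y)"
    then have "w - y : coset x" by (simp add: coset_iff algebra_simps)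
    then show "w : {u + v | u v. u : coset x & v : coset y}"
      using coset_self[of y] by (intro CollectI exI[of _ "w - y"] exI[of _ y]) simp
  qed
  finally show ?thesis .
qed

lemma Q_scale: "c \<odot>\<^bsub>Q\<^esub> coset x = coset (scale c x)"
proof -
  have eq: "coset (scale c u) = coset (scale c x)" if "u : coset x" for u
    using that subspace_scale[OF I, of "u - x" c] by (simp add: coset_iff coset_eq scale_right_diff_distrib)
  have "c \<odot>\<^bsub>Q\<^esub> coset x = (\<Union>u\<in>coset x. coset (scale c u))" by (simp add: lie_quot_def coset_def[symmetric])
  also have "... = (\<Union>u\<in>coset x. coset (scale c x))" by (rule SUP_cong[OF refl eq])
  finally show ?thesis using coset_self[of x] by blast
qed

lemma Q_bracket: assumes "x : L" "y : L" shows "bracket Q (coset x) (coset y) = coset (lie x y)"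
proof -
  have eq: "coset (lie u v) = coset (lie x y)" if uv: "u : coset x" "v : coset y" for u v
  proof -
    have 1: "u - x : I" "v - y : I" using uv by (simp_all add: coset_iff)
    have "y + (v - y) : A" unfolding A_def by (rule set_plus_intro[OF assms(2) 1(2)])
    then have vA: "v : A" by simp
    have "lie (u - x) v = - lie v (u - x)" by (rule lie_antisym)
    then have "lie (u - x) v : I" using subspace_neg[OF I lie_I_A[OF vA 1(1)]] by simp
    moreover have "lie x (v - y) : I" by (rule LI[OF assms(1) 1(2)])
    moreover have "lie u v - lie x y = lie (u - x) v + lie x (v - y)"
      using lie_add_left[of "u - x" x v] lie_add_right[of x "v - y" y] by (simp add: algebra_simps)
    ultimately show ?thesis using subspace_add[OF I] by (simp add: coset_eq)
  qed
  have "bracket Q (coset x) (coset y) = (\<Union>u\<in>coset x. \<Union>v\<in>coset y. coset (lie u v))"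
    by (simp add: lie_quot_def coset_def[symmetric])
  also have "... = (\<Union>u\<in>coset x. \<Union>v\<in>coset y. coset (lie x y))" by (intro SUP_cong refl eq)
  finally show ?thesis using coset_self[of x] coset_self[of y] by blast
qed

text \<open>Cosets in the carrier of \<open>Q\<close> meet \<open>L\<close> exactly once, so
  argument lists over the quotient are argument lists over \<open>L\<close>.\<close>

definition rep :: "'a set => 'a" where
  "rep X = (THE x. x : L & x : X)"

lemma rep_coset: assumes "x : L" shows "rep (coset x) = x" unfolding rep_def
proof (rule the_equality)
  fix y assume y: "y : L & y : coset x"
  then have "y - x : L \<inter> I" using subspace_diff[OF subspace_L _ assms] by (simp add: coset_iff)
  then show "y = x" using L_I by simp
qed (use assms coset_self in blast)

lemma map_rep: "set xs <= L ==> map rep (map coset xs) = xs" by (induction xs) (auto simp: rep_coset)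

lemma args_Q_E:
  assumes "Xs : args (carrier Q) n"
  obtains xs where "set xs <= L" "length xs = n" "Xs = map coset xs"
proof (rule that[of "map rep Xs"])
  have X: "X : coset ` L" if "X : set Xs" for X using assms that by (auto simp: args_def carrier_Q)
  show "set (map rep Xs) <= L" using X rep_coset by fastforce
  show "length (map rep Xs) = n" using assms by (simp add: args_def)
  show "Xs = map coset (map rep Xs)" unfolding map_map by (rule map_idI[symmetric]) (use X rep_coset in fastforce)
qed

lemma args_Q: "set xs <= L ==> length xs = n ==> map coset xs : args (carrier Q) n" by (auto simp: args_def carrier_Q)

lemma lie_derivative_th:
  assumes "x : A" "altn I q f" shows "lie_derivative (lie_rec A) I trivial_module trivial_action q x f = th x f"
proof
  fix zs
  show "lie_derivative (lie_rec A) I trivial_module trivial_action q x f zs = th x f zs"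
    using altn_th_A[OF assms, of zs]
    by (auto simp: lie_derivative_def args_def finsum_trivial_module minus_trivial_module trivial_action_def th_def ins_all_eq)
qed

text \<open>The action is defined as a union over all representatives of both classes, and by
  \<open>th_class\<close> all these cosets coincide.\<close>

lemma act_class:
  assumes x: "x : L" and f: "f : Zq q" shows "act q (coset x) (cls (cobd q) f) = cls (cobd q) (th x f)"
proof -
  have *: "cobd q +>\<^bsub>fun_module {f. altn I q f}\<^esub> lie_derivative (lie_rec A) I trivial_module trivial_action q u g =
      cls (cobd q) (th x f)" if "u : coset x" "g : cls (cobd q) f" for u g
  proof -
    have ux: "u - x : I" using that(1) by (simp add: coset_iff)
    have "x + (u - x) : A" unfolding A_def by (rule set_plus_intro[OF x ux])
    then have uA: "u : A" by simp
    have "(%zs. g zs - f zs) : cobd q" using that(2) by (simp only: cls_iff)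
    then have "g : Zq q" using fsub_add[OF fsub_Zq subsetD[OF cobd_Zq] f, of "%zs. g zs - f zs"] by simp
    then have "altn I q g" by (simp add: Zq_def)
    then show ?thesis using th_class[OF x ux f that(2)] lie_derivative_th[OF uA, of q g] by (simp add: coset_fun_module)
  qed
  have "(\<Union>u\<in>coset x. \<Union>g\<in>cls (cobd q) f. cls (cobd q) (th x f)) = cls (cobd q) (th x f)"
    using coset_self[of x] cls_self[OF fsub_cobd, of f q] by blast
  moreover have "act q (coset x) (cls (cobd q) f) =
      (\<Union>u\<in>coset x. \<Union>g\<in>cls (cobd q) f. cls (cobd q) (th x f))"
    unfolding quot_action_def lie_rec_simps rel_cochains_I Hq_eq quot_fun(2) by (intro SUP_cong refl *)
  ultimately show ?thesis by simp
qed

text \<open>Off the argument lists the value is \<open>cobd q\<close>, the zero of the cohomology,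
  as the normalization of cochains demands.\<close>

definition cls_coch :: "nat => nat => ('a list => 'a list => complex) => 'a set list => ('a list => complex) set" where
  "cls_coch p q F = (%Xs. if Xs : args (carrier Q) p then cls (cobd q) (F (map rep Xs)) else cobd q)"

lemma cls_coch_coset:
  "set xs <= L ==> length xs = p ==> cls_coch p q F (map coset xs) = cls (cobd q) (F xs)"
  using args_Q[of xs p] map_rep[of xs] by (simp add: cls_coch_def del: map_map)

lemma cls_coch_cong:
  "(!!xs. set xs <= L ==> length xs = p ==> cls (cobd q) (F xs) = cls (cobd q) (G xs)) ==>
    cls_coch p q F = cls_coch p q G"
proof
  fix Xs
  assume eq: "!!xs. set xs <= L ==> length xs = p ==> cls (cobd q) (F xs) = cls (cobd q) (G xs)"
  show "cls_coch p q F Xs = cls_coch p q G Xs"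
  proof (cases "Xs : args (carrier Q) p")
    case True
    then obtain xs where "set xs <= L" "length xs = p" "Xs = map coset xs" by (rule args_Q_E)
    then show ?thesis using eq by (simp add: cls_coch_coset)
  qed (simp add: cls_coch_def)
qed

text \<open>Unlike in \<open>family\<close>, other lengths are left free, so that the slots of a
  cochain qualify directly.\<close>

definition cocycle_family :: "nat => nat => ('a list => 'a list => complex) => bool" where
  "cocycle_family p q F \<longleftrightarrow> (ALL xs. set xs <= L --> length xs = p --> F xs : Zq q) & (ALL zs. alt_on L (%xs. F xs zs)) &
     (ALL xs. set xs <= L --> set xs \<inter> k ~= {} --> F xs = 0) &
     (ALL x:k. ALL xs. set xs <= L --> ins_all (lie x) xs F = th x (F xs))"

abbreviation "HC q \<equiv> rel_cochains Q (coset ` k) (Hq q) (act q)"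
abbreviation "dH q \<equiv> ce_diff Q (Hq q) (act q)"

lemma Hq_simps: "carrier (Hq q) = cls (cobd q) ` Zq q" "\<zero>\<^bsub>Hq q\<^esub> = cobd q"
  "cls (cobd q) f \<oplus>\<^bsub>Hq q\<^esub> cls (cobd q) g = cls (cobd q) (%x. f x + g x)"
  "c \<odot>\<^bsub>Hq q\<^esub> cls (cobd q) f = cls (cobd q) (%x. c * f x)"
  by (simp_all only: Hq_eq quot_fun(1,2) quot_fun(4,5)[OF fsub_cobd])

lemma cls_coch_in:
  assumes F: "cocycle_family p q F" shows "cls_coch p q F : carrier (HC q p)"
proof -
  let ?c = "cls_coch p q F"
  have FZ: "F xs : Zq q" if "set xs <= L" "length xs = p" for xs using F that by (simp add: cocycle_family_def)
  have Fa: "alt_on L (%xs. F xs zs)" for zs using F by (simp add: cocycle_family_def)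
  have up: "set (xs[i := x]) <= L" if "set xs <= L" "x : L" for xs i x using that by (rule set_update_subsetI)
  have "?c : alternating_maps Q (Hq q) p" unfolding alternating_maps_def
  proof (intro CollectI conjI allI ballI impI)
    show "?c Xs = \<zero>\<^bsub>Hq q\<^esub>" if "Xs ~: args (carrier Q) p" for Xs using that by (simp add: cls_coch_def Hq_simps)
    fix Xs assume "Xs : args (carrier Q) p"
    then obtain xs where xs: "set xs <= L" "length xs = p" "Xs = map coset xs" by (rule args_Q_E)
    show "?c Xs : carrier (Hq q)" using xs FZ by (simp add: cls_coch_coset Hq_simps)
    show "?c (Xs[i := X \<oplus>\<^bsub>Q\<^esub> Y]) = ?c (Xs[i := X]) \<oplus>\<^bsub>Hq q\<^esub> ?c (Xs[i := Y])"
      if i: "i < p" and XY: "X : carrier Q" "Y : carrier Q" for i X Y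
    proof -
      obtain x y where x: "x : L" "X = coset x" and y: "y : L" "Y = coset y" using XY by (auto simp: carrier_Q)
      have "F (xs[i := x + y]) = (%zs. F (xs[i := x]) zs + F (xs[i := y]) zs)"
        using alt_on_update(1)[OF Fa xs(1) _ x(1) y(1)] i xs(2) by blast
      then show ?thesis using up[OF xs(1)] x y xs subspace_add[OF subspace_L]
        by (simp add: Q_add map_update[symmetric] cls_coch_coset Hq_simps)
    qed
    show "?c (Xs[i := c \<odot>\<^bsub>Q\<^esub> X]) = c \<odot>\<^bsub>Hq q\<^esub> ?c (Xs[i := X])" if i: "i < p" and X: "X : carrier Q" for i c X
    proof -
      obtain x where x: "x : L" "X = coset x" using X by (auto simp: carrier_Q)
      have "F (xs[i := scale c x]) = (%zs. c * F (xs[i := x]) zs)"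
        using alt_on_update(2)[OF Fa xs(1) _ x(1)] i xs(2) by blast
      then show ?thesis using up[OF xs(1)] x xs subspace_scale[OF subspace_L]
        by (simp add: Q_scale map_update[symmetric] cls_coch_coset Hq_simps)
    qed
    show "?c Xs = \<zero>\<^bsub>Hq q\<^esub>" if ij: "i < p" "j < p" "i ~= j & Xs ! i = Xs ! j" for i j
    proof -
      have "rep (coset (xs ! i)) = rep (coset (xs ! j))" using ij xs by simp
      then have "xs ! i = xs ! j" using rep_coset xs ij by (metis nth_mem subsetD)
      then have "F xs zs = 0" for zs using alt_on_repeated[OF Fa subspace_L xs(1), of i j] ij xs(2) by simp
      then have "F xs = (%_. 0)" by blast
      then show ?thesis using xs by (simp add: cls_coch_coset Hq_simps cls_zero)
    qed
  qed
  moreover have "?c Xs = \<zero>\<^bsub>Hq q\<^esub>" if Xs: "Xs : args (carrier Q) p" and ne: "set Xs \<inter> coset ` k ~= {}" for Xs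
  proof -
    obtain xs where xs: "set xs <= L" "length xs = p" "Xs = map coset xs" using Xs by (rule args_Q_E)
    obtain x y where xy: "x : set xs" "y : k" "coset x = coset y" using ne xs(3) by auto
    then have "x = y" using rep_coset kL xs(1) by (metis subsetD)
    then have "F xs = (%_. 0)" using F xs(1) xy by (auto simp: cocycle_family_def zero_fun_def)
    then show ?thesis using xs by (simp add: cls_coch_coset Hq_simps cls_zero)
  qed
  moreover have "act q X (?c Xs) = (\<Oplus>\<^bsub>Hq q\<^esub>i\<in>{..<p}. ?c (Xs[i := bracket Q X (Xs ! i)]))"
    if X: "X : coset ` k" and Xs: "Xs : args (carrier Q) p" for X Xs
  proof -
    obtain xs where xs: "set xs <= L" "length xs = p" "Xs = map coset xs" using Xs by (rule args_Q_E)
    obtain x where x: "x : k" "X = coset x" using X by blast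
    have xL: "x : L" using x kL by blast
    have up': "set (xs[i := lie x (xs ! i)]) <= L" if "i < p" for i
      by (rule up[OF xs(1) subalg_lie[OF L xL]]) (use xs that nth_mem in blast)
    have "(\<Oplus>\<^bsub>Hq q\<^esub>i\<in>{..<p}. ?c (Xs[i := bracket Q X (Xs ! i)])) =
        cls (cobd q) (%zs. \<Sum>i\<in>{..<p}. F (xs[i := lie x (xs ! i)]) zs)" unfolding Hq_eq
    proof (rule finsum_cls_cong(1)[OF fsub_Zq fsub_cobd])
      fix i assume i: "i : {..<p}"
      have m: "xs ! i : L" using xs i by auto
      have "Xs[i := bracket Q X (Xs ! i)] = map coset (xs[i := lie x (xs ! i)])"
        using Q_bracket[OF xL m] xs i x by (simp add: map_update)
      then show "?c (Xs[i := bracket Q X (Xs ! i)]) = cls (cobd q) (F (xs[i := lie x (xs ! i)]))"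
        using cls_coch_coset[OF up'] i xs(2) by simp
      show "F (xs[i := lie x (xs ! i)]) : Zq q" using FZ[OF up'] i xs(2) by simp
    qed simp
    also have "(%zs. \<Sum>i\<in>{..<p}. F (xs[i := lie x (xs ! i)]) zs) = ins_all (lie x) xs F"
      by (simp add: fun_eq_iff ins_all_apply) (simp add: ins_all_eq xs(2))
    also have "ins_all (lie x) xs F = th x (F xs)" using F x xs(1) by (simp add: cocycle_family_def)
    finally show ?thesis using act_class[OF xL FZ[OF xs(1,2)]] xs x by (simp add: cls_coch_coset)
  qed
  ultimately show ?thesis by (simp add: rel_cochains_def)
qed

text \<open>Every summand of the explicit differential has a cocycle as representative, so the sum
  can be taken before passing to classes and is then identified by
  \<open>ce_explicit\<close>.\<close>

lemma dH_cls_coch: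
  assumes FZ: "!!xs. set xs <= L ==> length xs = p ==> F xs : Zq q" and Fa: "!!zs. alt_on L (%xs. F xs zs)"
    and xs: "set xs <= L" "length xs = Suc p"
  shows "dH q p (cls_coch p q F) (map coset xs) = cls (cobd q) (ce lie th xs F)" "ce lie th xs F : Zq q"
proof -
  let ?c = "cls_coch p q F"
  have m: "xs ! i : L" if "i <= p" for i using xs that by auto
  have n1: "set (nths xs (- {i})) <= L" for i using set_nths_subset[of xs "- {i}"] xs(1) by blast
  have n2: "set (nths xs (- {i, j})) <= L" for i j using set_nths_subset[of xs "- {i, j}"] xs(1) by blast
  have l1: "length (nths xs (- {i})) = p" if "i <= p" for i
  proof -
    have "{j. j < length xs & j : - {i}} = {..<Suc p} - {i}" using xs(2) by auto
    then show ?thesis using that by (simp add: length_nths card_Diff_subset)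
  qed
  have l2: "Suc (length (nths xs (- {i, j}))) = p" if "i < j" "j <= p" for i j
  proof -
    have "{l. l < length xs & l : - {i, j}} = {..<Suc p} - {i, j}" using xs(2) by auto
    then show ?thesis using that by (simp add: length_nths card_Diff_subset)
  qed
  let ?f1 = "%i zs. (- 1) ^ i * th (xs ! i) (F (nths xs (- {i}))) zs"
  let ?f2 = "%j i zs. (- 1) ^ (i + j) * F (lie (xs ! i) (xs ! j) # nths xs (- {i, j})) zs"
  have z1: "?f1 i : Zq q" if "i : {..p}" for i
    by (rule fsub_scale[OF fsub_Zq th_Zq]) (use that m FZ[OF n1 l1] in auto)
  have z2: "?f2 j i : Zq q" if "j : {..p}" "i : {..<j}" for i j
    by (rule fsub_scale[OF fsub_Zq FZ]) (use that m n2 l2 subalg_lie[OF L] in auto)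
  have e1: "((- 1) ^ i) \<odot>\<^bsub>Hq q\<^esub> act q (map coset xs ! i) (?c (nths (map coset xs) (- {i}))) = cls (cobd q) (?f1 i)"
    if "i : {..p}" for i
  proof -
    have i: "i <= p" using that by simp
    have "?c (nths (map coset xs) (- {i})) = cls (cobd q) (F (nths xs (- {i})))"
      using cls_coch_coset[OF n1 l1[OF i]] by (simp add: nths_map)
    then show ?thesis using act_class[OF m[OF i] FZ[OF n1 l1[OF i]]] i xs(2) by (simp add: Hq_simps)
  qed
  have e2: "((- 1) ^ (i + j)) \<odot>\<^bsub>Hq q\<^esub> ?c (bracket Q (map coset xs ! i) (map coset xs ! j) # nths (map coset xs) (- {i, j})) =
      cls (cobd q) (?f2 j i)" if "j : {..p}" "i : {..<j}" for i j
  proof -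
    have ij: "i < j" "j <= p" using that by auto
    have "bracket Q (map coset xs ! i) (map coset xs ! j) # nths (map coset xs) (- {i, j}) =
        map coset (lie (xs ! i) (xs ! j) # nths xs (- {i, j}))"
      using Q_bracket[OF m m, of i j] ij xs(2) by (simp add: nths_map)
    moreover have "?c (map coset (lie (xs ! i) (xs ! j) # nths xs (- {i, j}))) =
        cls (cobd q) (F (lie (xs ! i) (xs ! j) # nths xs (- {i, j})))"
      by (rule cls_coch_coset) (use ij m n2 l2 subalg_lie[OF L] in auto)
    ultimately show ?thesis by (simp add: Hq_simps del: list.map)
  qed
  have s1: "(\<Oplus>\<^bsub>Hq q\<^esub>i\<in>{..p}. ((- 1) ^ i) \<odot>\<^bsub>Hq q\<^esub> act q (map coset xs ! i) (?c (nths (map coset xs) (- {i})))) =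
      cls (cobd q) (%zs. \<Sum>i\<in>{..p}. ?f1 i zs)" "(%zs. \<Sum>i\<in>{..p}. ?f1 i zs) : Zq q" unfolding Hq_eq
    by (rule finsum_cls_cong[OF fsub_Zq fsub_cobd finite_atMost], (erule e1[unfolded Hq_eq] z1)+)+
  have s2: "(\<Oplus>\<^bsub>Hq q\<^esub>i\<in>{..<j}. ((- 1) ^ (i + j)) \<odot>\<^bsub>Hq q\<^esub>
        ?c (bracket Q (map coset xs ! i) (map coset xs ! j) # nths (map coset xs) (- {i, j}))) =
      cls (cobd q) (%zs. \<Sum>i\<in>{..<j}. ?f2 j i zs)" "(%zs. \<Sum>i\<in>{..<j}. ?f2 j i zs) : Zq q" if "j : {..p}" for j
    unfolding Hq_eq by (rule finsum_cls_cong[OF fsub_Zq fsub_cobd finite_lessThan],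
        (erule e2[OF that, unfolded Hq_eq] z2[OF that])+)+
  have s3: "(\<Oplus>\<^bsub>Hq q\<^esub>j\<in>{..p}. \<Oplus>\<^bsub>Hq q\<^esub>i\<in>{..<j}. ((- 1) ^ (i + j)) \<odot>\<^bsub>Hq q\<^esub>
        ?c (bracket Q (map coset xs ! i) (map coset xs ! j) # nths (map coset xs) (- {i, j}))) =
      cls (cobd q) (%zs. \<Sum>j\<in>{..p}. \<Sum>i\<in>{..<j}. ?f2 j i zs)" "(%zs. \<Sum>j\<in>{..p}. \<Sum>i\<in>{..<j}. ?f2 j i zs) : Zq q"
    unfolding Hq_eq
    by (rule finsum_cls_cong[OF fsub_Zq fsub_cobd finite_atMost], (erule s2[unfolded Hq_eq])+)+
  have sum: "(%zs. (\<Sum>i\<in>{..p}. ?f1 i zs) + (\<Sum>j\<in>{..p}. \<Sum>i\<in>{..<j}. ?f2 j i zs)) = ce lie th xs F"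
  proof -
    have "antisym_on L F" unfolding antisym_on_def
    proof (intro allI impI ext)
      fix us x y vs zs assume "set (us @ x # y # vs) <= L"
      then show "F (us @ x # y # vs) zs = (- F (us @ y # x # vs)) zs"
        using alt_on_swap[OF Fa subspace_L, of us vs x y zs] by simp
    qed
    then have "ce lie th xs F = (\<Sum>i<length xs. sg i (th (xs ! i) (F (nths xs (- {i}))))) +
      (\<Sum>j<length xs. \<Sum>i<j. sg (i + j) (F (lie (xs ! i) (xs ! j) # nths xs (- {i, j}))))"
      using ce_explicit[of L lie th F xs] subalg_lie[OF L] th_minus xs(1) by simp
    then show ?thesis by (simp add: fun_eq_iff fun_sum_apply sg_apply sg_complex xs(2) lessThan_Suc_atMost)
  qed
  show "ce lie th xs F : Zq q" using fsub_add[OF fsub_Zq s1(2) s3(2)] unfolding sum .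
  show "dH q p ?c (map coset xs) = cls (cobd q) (ce lie th xs F)"
    using args_Q[OF xs] s1(1) s3(1) sum by (simp add: ce_diff_def Hq_simps)
qed

end

context semidirect
begin

lemma slot_cocycle_family:
  assumes f: "f : Cn (p + q)" and d: "!!xs. set xs <= L ==> length xs = p ==> dI (slot f xs) = 0"
  shows "cocycle_family p q (slot f)" unfolding cocycle_family_def
proof (intro conjI allI impI ballI)
  show "slot f xs : Zq q" if "set xs <= L" "length xs = p" for xs
    using slot_altn[OF f that(1), of q] that(2) d[OF that] by (simp add: Zq_def zero_fun_def)
qed (fact slot_alt_on[OF f] slot_k[OF f] slot_ins_all[OF f])+

text \<open>The difference is, up to sign, \<open>dI\<close> of the slot of length
  \<open>p + 1\<close>, which is zero for degree reasons when \<open>q = 0\<close>.\<close>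

lemma slot_D_cobd:
  assumes f: "f : Cn (p + q)" and xs: "set xs <= L" "length xs = Suc p"
  shows "slot (D f) xs - ce lie th xs (slot f) : cobd q"
proof -
  have eq: "slot (D f) xs - ce lie th xs (slot f) = sg (Suc p) (dI (slot f xs))"
    unfolding slot_D'[OF f xs(1)] xs(2) by (rule add_diff_cancel_left')
  show ?thesis
  proof (cases q)
    case 0
    have "slot f xs = 0" using slot_short[OF f, of xs] xs 0 by (simp add: zero_fun_def)
    then show ?thesis unfolding eq 0 by (simp only: cobd_def nat.case dI_zero sg_simps) simp
  next
    case (Suc m)
    have "altn I m (slot f xs)" by (rule slot_altn[OF f xs(1)]) (use xs(2) Suc in simp)
    then have "altn I m (sg (Suc p) (slot f xs))" unfolding sg_def using altn_fminus by simp
    then show ?thesis unfolding eq sg_dI Suc cobd_def by simp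
  qed
qed

text \<open>On leading terms that are cocycles, \<open>D\<close> induces the first differential: the
  one of the quotient algebra with coefficients in cohomology.\<close>

lemma dH_slot:
  assumes f: "f : Cn (p + q)" and d: "!!xs. set xs <= L ==> length xs = p ==> dI (slot f xs) = 0"
  shows "dH q p (cls_coch p q (slot f)) = cls_coch (Suc p) q (slot (D f))"
proof
  note F = slot_cocycle_family[OF f d]
  fix Xs
  show "dH q p (cls_coch p q (slot f)) Xs = cls_coch (Suc p) q (slot (D f)) Xs"
  proof (cases "Xs : args (carrier Q) (Suc p)")
    case True
    then obtain xs where xs: "set xs <= L" "length xs = Suc p" "Xs = map coset xs" by (rule args_Q_E)
    have "cls (cobd q) (slot (D f) xs) = cls (cobd q) (ce lie th xs (slot f))"
      using slot_D_cobd[OF f xs(1,2)] by (simp add: cls_eq_iff[OF fsub_cobd] fun_diff_def)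
    moreover have "dH q p (cls_coch p q (slot f)) (map coset xs) = cls (cobd q) (ce lie th xs (slot f))"
      by (rule dH_cls_coch(1)[OF _ _ xs(1,2)]) (use F in \<open>auto simp: cocycle_family_def\<close>)
    ultimately show ?thesis using cls_coch_coset[OF xs(1,2)] xs(3) by simp
  next
    case False
    then show ?thesis by (simp add: ce_diff_def cls_coch_def Hq_simps)
  qed
qed

lemma cls_coch_cobd:
  assumes "!!xs. set xs <= L ==> length xs = p ==> F xs : cobd q"
  shows "cls_coch p q F = (%_. cobd q)"
proof
  fix Xs
  show "cls_coch p q F Xs = cobd q"
  proof (cases "Xs : args (carrier Q) p")
    case True
    then obtain xs where xs: "set xs <= L" "length xs = p" "Xs = map coset xs" by (rule args_Q_E)
    then show ?thesis using assms by (simp add: cls_coch_coset cls_eq_self fsub_cobd)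
  qed (simp add: cls_coch_def)
qed

lemma cls_coch_cobd_iff:
  "cls_coch p q F = cls_coch p q G ==> set xs <= L ==> length xs = p ==> F xs - G xs : cobd q"
proof -
  assume a: "cls_coch p q F = cls_coch p q G" "set xs <= L" "length xs = p"
  have "cls (cobd q) (F xs) = cls (cobd q) (G xs)"
    using cls_coch_coset[OF a(2,3), of q F] cls_coch_coset[OF a(2,3), of q G] a(1) by simp
  then show ?thesis unfolding cls_eq_iff[OF fsub_cobd] fun_diff_def .
qed

lemma cls_coch_cobdD:
  "cls_coch p q F = (%_. cobd q) ==> set xs <= L ==> length xs = p ==> F xs : cobd q"
proof -
  assume a: "cls_coch p q F = (%_. cobd q)" "set xs <= L" "length xs = p"
  have "cls (cobd q) (F xs) = cobd q" using cls_coch_coset[OF a(2,3), of q F] a(1) by simp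
  then show ?thesis unfolding cls_eq_self[OF fsub_cobd] .
qed

lemma HC_simps: "\<zero>\<^bsub>HC q p\<^esub> = (%_. cobd q)" "c \<oplus>\<^bsub>HC q p\<^esub> c' = (%Xs. c Xs \<oplus>\<^bsub>Hq q\<^esub> c' Xs)"
  "a \<odot>\<^bsub>HC q p\<^esub> c = (%Xs. a \<odot>\<^bsub>Hq q\<^esub> c Xs)" by (simp_all add: rel_cochains_def Hq_simps)

lemma slot_plus: "slot (%ws. f ws + g ws) xs = (%zs. slot f xs zs + slot g xs zs)"
  and slot_smult: "slot (%ws. c * f ws) xs = (%zs. c * slot f xs zs)" by (auto simp: slot_def)

lemma cls_coch_plus:
  "cls_coch p q (%xs zs. F xs zs + G xs zs) = (%Xs. cls_coch p q F Xs \<oplus>\<^bsub>Hq q\<^esub> cls_coch p q G Xs)"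
  "cls_coch p q (%xs zs. c * F xs zs) = (%Xs. c \<odot>\<^bsub>Hq q\<^esub> cls_coch p q F Xs)"
  using Hq_simps(3)[of q "%_. 0" "%_. 0"] Hq_simps(4)[of q c "%_. 0"]
  by (auto simp: cls_coch_def Hq_simps cls_zero fun_eq_iff)

end

section \<open>Equivariant representatives and the identification of the second page\<close>

context semidirect_split
begin

lemma proj_proj: assumes "altn I q F" shows "proj q (proj q F) = proj q F"
proof -
  have c: "F - proj q F : cobd q" by (rule proj_minus_cobd[OF assms])
  have "proj q F = proj q (proj q F + (F - proj q F))" by simp
  also have "... = proj q (proj q F) + proj q (F - proj q F)"
    by (rule proj_plus[OF proj_altn[OF assms] cobd_altn[OF c]])
  finally show ?thesis unfolding proj_cobd[OF c] by simp
qed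

text \<open>Representatives of the classes fixed by \<open>proj\<close>; being unique, they depend linearly and equivariantly on the class.\<close>

definition harm :: "nat => ('a list => complex) set" where
  "harm q = {F : Zq q. proj q F = F}"

lemma harm_Zq: "F : harm q ==> F : Zq q" and harm_altn: "F : harm q ==> altn I q F" and harm_proj: "F : harm q ==> proj q F = F"
  by (auto simp: harm_def Zq_def)

lemma fsub_harm: "fsub (harm q)" unfolding fsub_def
proof (intro conjI ballI allI)
  have z: "(%_. 0) : cobd q" by (rule fsub_0[OF fsub_cobd])
  show "(%_. 0) : harm q" using proj_cobd[OF z] subsetD[OF cobd_Zq z] by (simp add: harm_def zero_fun_def)
  fix F assume F: "F : harm q"
  show "(%x. c * F x) : harm q" for c
    using fsub_scale[OF fsub_Zq harm_Zq[OF F]] proj_smult[OF harm_altn[OF F]] harm_proj[OF F] by (simp add: harm_def)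
  fix G assume G: "G : harm q"
  show "(%x. F x + G x) : harm q" using fsub_add[OF fsub_Zq harm_Zq[OF F] harm_Zq[OF G]]
      proj_plus[OF harm_altn[OF F] harm_altn[OF G]] harm_proj[OF F] harm_proj[OF G] by (simp add: harm_def plus_fun_def)
qed

lemma harm_unique: assumes "F : harm q" "G : harm q" "cls (cobd q) F = cls (cobd q) G" shows "F = G"
proof -
  have c: "(%x. F x - G x) : cobd q" using assms(3) by (simp only: cls_eq_iff[OF fsub_cobd])
  have "(%x. F x - G x) = 0"
    using proj_cobd[OF c] harm_proj[OF fsub_diff[OF fsub_harm assms(1,2)]] by simp
  then show ?thesis by (simp add: fun_eq_iff)
qed

lemma harm_th: "x : L ==> F : harm q ==> th x F : harm q"
  using th_Zq[of x F q] proj_th[of x q F] harm_altn[of F q] by (simp add: harm_def)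

lemma harm_representative: assumes "X : carrier (Hq q)" obtains F where "F : harm q" "cls (cobd q) F = X"
proof -
  obtain z where z: "z : Zq q" "X = cls (cobd q) z" using assms by (auto simp: Hq_simps)
  have a: "altn I q z" using z(1) by (simp add: Zq_def)
  have "proj q z : harm q" using proj_altn[OF a] dI_proj[OF a] proj_proj[OF a] z(1) by (simp add: harm_def Zq_def)
  moreover have "cls (cobd q) (proj q z) = X"
    using proj_minus_cobd[OF a] cls_eq_iff[OF fsub_cobd, of q z "proj q z"] z(2) by (simp add: fun_diff_def)
  ultimately show ?thesis by (rule that)
qed

text \<open>Every law satisfied by \<open>c\<close> is an equality of classes whose two sides have
  representatives in \<open>harm\<close>; there the class determines the representative, so the law
  lifts to \<open>G\<close>.\<close>

lemma cls_coch_family: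
  assumes c: "c : carrier (HC q p)"
  obtains G where "family p q G" "!!xs. G xs : harm q" "c = cls_coch p q G"
proof -
  define sec where "sec X = (SOME F. F : harm q & cls (cobd q) F = X)" for X
  define G where "G = restrict_len p (%xs. sec (c (map coset xs)))"
  have ca: "c : alternating_maps Q (Hq q) p" using c by (simp add: rel_cochains_def)
  have Gv: "G xs : harm q & cls (cobd q) (G xs) = c (map coset xs)" if xs: "set xs <= L" "length xs = p" for xs
  proof -
    have "c (map coset xs) : carrier (Hq q)" using ca args_Q[OF xs] by (simp add: alternating_maps_def)
    then obtain F where "F : harm q & cls (cobd q) F = c (map coset xs)" using harm_representative by blast
    then show ?thesis using someI[of "%F. F : harm q & cls (cobd q) F = c (map coset xs)" F] xs
      by (simp add: G_def restrict_len_def sec_def)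
  qed
  have Gu: "G xs = F" if "set xs <= L" "length xs = p" "F : harm q" "cls (cobd q) F = c (map coset xs)" for xs F
    using Gv[OF that(1,2)] harm_unique[of "G xs" q F] that(3,4) by simp
  have G0: "G xs = 0" if "~ (set xs <= L & length xs = p)" for xs
    unfolding G_def restrict_len_def by (rule if_not_P[OF that])
  have h0: "0 : harm q" "cls (cobd q) 0 = cobd q" using fsub_0[OF fsub_harm] by (simp_all add: zero_fun_def cls_zero)
  have Gh: "G xs : harm q" for xs using Gv[of xs] G0[of xs] h0(1) by metis
  have up: "set (xs[i := u]) <= L" if "set xs <= L" "u : L" for xs i u using that by (rule set_update_subsetI)
  have alt: "alt_on L (%xs. G xs zs)" for zs
  proof -
    \<comment> \<open>Alternation is proved in its positional form, because \<open>c\<close>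
      satisfies it in that form on lists of cosets.\<close>
    have "(%xs. G xs zs) : alternating_maps (lie_rec L) trivial_module p" unfolding alternating_maps_def
    proof (intro CollectI conjI allI ballI impI)
      show "G xs zs = \<zero>\<^bsub>trivial_module\<^esub>" if xs: "xs ~: args (carrier (lie_rec L)) p" for xs
      proof -
        have "G xs = 0" by (rule G0) (use xs in \<open>auto simp: args_def\<close>)
        then show ?thesis by simp
      qed
      show "G xs zs : carrier trivial_module" for xs by simp
      fix xs assume "xs : args (carrier (lie_rec L)) p"
      then have xs: "set xs <= L" "length xs = p" by (auto simp: args_def)
      note X = args_Q[OF xs]
      {
        fix i x y assume i: "i < p" and xy: "x : carrier (lie_rec L)" "y : carrier (lie_rec L)"
        then have L: "x : L" "y : L" "x + y : L" using subspace_add[OF subspace_L] by auto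
        have Q: "coset x : carrier Q" "coset y : carrier Q" using L by (auto simp: carrier_Q)
        have "ALL Xs:args (carrier Q) p. ALL i<p. ALL X:carrier Q. ALL Y:carrier Q.
            c (Xs[i := X \<oplus>\<^bsub>Q\<^esub> Y]) = c (Xs[i := X]) \<oplus>\<^bsub>Hq q\<^esub> c (Xs[i := Y])"
          using ca unfolding alternating_maps_def by blast
        then have "c (map coset (xs[i := x + y])) = c (map coset (xs[i := x])) \<oplus>\<^bsub>Hq q\<^esub> c (map coset (xs[i := y]))"
          unfolding map_update Q_add[symmetric] using X i Q by blast
        then have "G (xs[i := x + y]) = G (xs[i := x]) + G (xs[i := y])"
          using Gv[OF up[OF xs(1) L(1)], of i] Gv[OF up[OF xs(1) L(2)], of i] xs(2)
            fsub_add[OF fsub_harm Gh Gh, of "xs[i := x]" "xs[i := y]"] Hq_simps(3)[of q "G (xs[i := x])" "G (xs[i := y])"]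
          by (intro Gu up xs L) (simp_all add: plus_fun_def)
        then show "G (xs[i := x \<oplus>\<^bsub>lie_rec L\<^esub> y]) zs = G (xs[i := x]) zs \<oplus>\<^bsub>trivial_module\<^esub> G (xs[i := y]) zs" by simp
      next
        fix i a x assume i: "i < p" and x: "x : carrier (lie_rec L)"
        then have L: "x : L" "scale a x : L" using subspace_scale[OF subspace_L] by auto
        have Q: "coset x : carrier Q" using L by (auto simp: carrier_Q)
        have "ALL Xs:args (carrier Q) p. ALL i<p. ALL a. ALL X:carrier Q. c (Xs[i := a \<odot>\<^bsub>Q\<^esub> X]) = a \<odot>\<^bsub>Hq q\<^esub> c (Xs[i := X])"
          using ca unfolding alternating_maps_def by blast
        then have "c (map coset (xs[i := scale a x])) = a \<odot>\<^bsub>Hq q\<^esub> c (map coset (xs[i := x]))"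
          unfolding map_update Q_scale[symmetric] using X i Q by blast
        then have "G (xs[i := scale a x]) = (%zs. a * G (xs[i := x]) zs)"
          using Gv[OF up[OF xs(1) L(1)], of i] xs(2) fsub_scale[OF fsub_harm Gh, of a "xs[i := x]"]
            Hq_simps(4)[of q a "G (xs[i := x])"] by (intro Gu up xs L) simp_all
        then show "G (xs[i := a \<odot>\<^bsub>lie_rec L\<^esub> x]) zs = a \<odot>\<^bsub>trivial_module\<^esub> G (xs[i := x]) zs" by simp
      next
        fix i j assume ij: "i < p" "j < p" "i ~= j & xs ! i = xs ! j"
        have "ALL Xs:args (carrier Q) p. ALL i<p. ALL j<p. i ~= j & Xs ! i = Xs ! j --> c Xs = \<zero>\<^bsub>Hq q\<^esub>"
          using ca unfolding alternating_maps_def by blast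
        moreover have "map coset xs ! i = map coset xs ! j" using ij xs(2) by simp
        ultimately have "c (map coset xs) = cobd q" using X ij unfolding Hq_simps(2) by blast
        then have "G xs = 0" using h0 by (intro Gu xs) simp_all
        then show "G xs zs = \<zero>\<^bsub>trivial_module\<^esub>" by simp
      }
    qed
    then show ?thesis unfolding alternating_maps_trivial[OF subspace_L] by (simp add: altn_def)
  qed
  have "family p q G" unfolding family_def
  proof (intro conjI allI impI ballI)
    show "altn I q (G xs)" for xs by (rule harm_altn[OF Gh])
    show "G xs = 0" if "~ (set xs <= L & length xs = p)" for xs using that by (rule G0)
    show "alt_on L (%xs. G xs zs)" for zs by (rule alt)
    show "G xs = 0" if xs: "set xs <= L" "set xs \<inter> k ~= {}" for xs
    proof (cases "length xs = p")
      case True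
      have "set (map coset xs) \<inter> coset ` k ~= {}" using xs(2) by auto
      then have "c (map coset xs) = cobd q" using c args_Q[OF xs(1) True] by (simp add: rel_cochains_def Hq_simps)
      then show ?thesis using h0 by (intro Gu xs True) simp_all
    qed (intro G0, simp)
    fix x xs assume x: "x : k" and xs: "set xs <= L"
    have xL: "x : L" using x kL by blast
    show "ins_all (lie x) xs G = th x (G xs)"
    proof (cases "length xs = p")
      case False
      have "ins_all (lie x) xs G = 0" unfolding ins_all_eq by (rule sum.neutral) (use False in \<open>auto intro!: G0\<close>)
      moreover have "G xs = 0" by (rule G0) (use False in simp)
      ultimately show ?thesis using th_zero(2) by metis
    next
      case True
      have m: "xs ! i : L" if "i < p" for i using xs True that nth_mem by blast
      define w where "w = (%i. G (xs[i := lie x (xs ! i)]))"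
      have cw: "c ((map coset xs)[i := bracket Q (coset x) (map coset xs ! i)]) = cls (cobd q) (w i)" if "i : {..<p}" for i
        using Gv[OF up[OF xs subalg_lie[OF L xL m]], of i i] Q_bracket[OF xL m, of i] that True
        by (simp add: map_update w_def)
      have wh: "w i : harm q" for i unfolding w_def by (rule Gh)
      have ws: "(%zs. \<Sum>i\<in>{..<p}. w i zs) = (\<Sum>i\<in>{..<p}. w i)" by (simp add: fun_eq_iff fun_sum_apply)
      have "th x (G xs) = (\<Sum>i\<in>{..<p}. w i)"
      proof (rule harm_unique[OF harm_th[OF xL Gh]])
        show "(\<Sum>i\<in>{..<p}. w i) : harm q"
          unfolding ws[symmetric] by (rule finsum_cls_cong(2)[OF fsub_harm fsub_cobd _ refl wh]) simp
        have "cls (cobd q) (th x (G xs)) = act q (coset x) (c (map coset xs))"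
          using act_class[OF xL harm_Zq[OF Gh[of xs]]] conjunct2[OF Gv[OF xs True]] by (simp only:)
        also have "... = (\<Oplus>\<^bsub>Hq q\<^esub>i\<in>{..<p}. c ((map coset xs)[i := bracket Q (coset x) (map coset xs ! i)]))"
          using c args_Q[OF xs True] x by (simp add: rel_cochains_def)
        also have "... = cls (cobd q) (%zs. \<Sum>i\<in>{..<p}. w i zs)"
          unfolding Hq_eq by (rule finsum_cls_cong(1)[OF fsub_Zq fsub_cobd _ cw harm_Zq[OF wh]]) simp_all
        finally show "cls (cobd q) (th x (G xs)) = cls (cobd q) (\<Sum>i\<in>{..<p}. w i)" unfolding ws .
      qed
      then show ?thesis by (simp add: ins_all_eq True w_def)
    qed
  qed
  moreover have "c = cls_coch p q G"
  proof
    fix Xs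
    show "c Xs = cls_coch p q G Xs"
    proof (cases "Xs : args (carrier Q) p")
      case True
      then obtain xs where xs: "set xs <= L" "length xs = p" "Xs = map coset xs" by (rule args_Q_E)
      then show ?thesis using Gv[OF xs(1,2)] cls_coch_coset[OF xs(1,2), of q G] by simp
    next
      case False
      then show ?thesis using ca by (simp add: alternating_maps_def Hq_simps cls_coch_def)
    qed
  qed
  ultimately show ?thesis using Gh that by blast
qed

text \<open>If \<open>c\<close> is closed, the differential of \<open>G\<close> along
  \<open>L\<close> takes values in coboundaries. It commutes with \<open>proj\<close>, which fixes
  \<open>G\<close> and kills coboundaries, so it vanishes and the lift is a cocycle.\<close>

lemma cls_coch_lift:
  assumes c: "c : carrier (HC q p)"
  obtains f where "f : Fil (int p) (p + q)" "D f : Fil (int p + 1) (Suc (p + q))" "c = cls_coch p q (slot f)"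
    "dH q p c = (%_. cobd q) ==> D f = (%_. 0)"
proof -
  obtain G where G0: "family p q G" "!!xs. G xs : harm q" "c = cls_coch p q G"
    using cls_coch_family[OF c] by blast
  note G = G0(1) harm_Zq[OF G0(2)] harm_proj[OF G0(2)] G0(3)
  obtain f where f: "f : Fil (int p) (p + q)" "!!xs. set xs <= L ==> slot f xs = G xs"
    using lift_family[OF G(1)] by blast
  have co: "dI (G xs) = 0" for xs using G(2)[of xs] by (simp add: Zq_def zero_fun_def)
  note cl = lift_closed[OF G(1) f co]
  have cf: "c = cls_coch p q (slot f)" unfolding G(4) by (rule cls_coch_cong) (simp add: f(2))
  have "D f = (%_. 0)" if d: "dH q p c = (%_. cobd q)"
  proof (rule cl(2))
    fix xs assume xs: "set xs <= L" "length xs = Suc p"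
    have GL: "alt_on L (%xs. G xs zs)" for zs
    proof (rule alt_on_cong[OF slot_alt_on[OF Fil_Cn[OF f(1)], of zs] subspace_L])
      show "slot f ws zs = G ws zs" if "set ws <= L" for ws using f(2)[OF that] by simp
    qed
    have "cls (cobd q) (ce lie th xs G) = cobd q" using dH_cls_coch(1)[OF G(2) GL xs] d G(4) by simp
    then have "ce lie th xs G : cobd q" by (simp add: cls_eq_self fsub_cobd)
    then have z: "proj q (ce lie th xs G) = 0" by (rule proj_cobd)
    have e: "ce lie th xs (%us. proj q (G us)) = proj q (ce lie th xs G)"
      by (rule conjunct2[OF ce_equivariant_map[OF proj_altn proj_plus proj_th xs(1)]]) (use G(2) in \<open>auto simp: Zq_def\<close>)
    show "ce lie th xs G = 0" using trans[OF e z] unfolding G(3) .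
  qed
  then show ?thesis using that[OF f(1) cl(1) cf] by blast
qed

lemma Zr_one: "e : Fil p n ==> D e : Fil (p + 1) (Suc n) ==> e : hs.Zr 1 p n"
  by (simp add: ss_cycles_def dA_eq[OF Fil_Cn])

lemma D_in_Br: "e : Fil (p - 1) n ==> D e : Fil p (Suc n) ==> D e : hs.Br 2 p (Suc n)"
proof -
  assume e: "e : Fil (p - 1) n" "D e : Fil p (Suc n)"
  then have "e : hs.Zr 1 (p - 1) n" using Zr_one[of e "p - 1" n] by simp
  then have "D e : hs.Rr 2 p (Suc n)" using dA_eq[OF Fil_Cn[OF e(1)]] by (force simp: hs.Rr_def)
  then have "(%x. 0 + D e x) : hs.Br 2 p (Suc n)" by (intro hs.Br_I fsub_0[OF hs.Zr_sub])
  then show ?thesis by simp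
qed

text \<open>Removing the leading coboundaries costs \<open>D e'\<close>, which belongs to the image
  part of the denominator, and leaves a cycle one step deeper, which belongs to the other
  part.\<close>

lemma slot_cobd_Br:
  assumes e: "e : Fil (int p) (p + q)" "D e : Fil (int p + 2) (Suc (p + q))"
    and co: "!!xs. set xs <= L ==> length xs = p ==> slot e xs : cobd q"
  shows "e : hs.Br 2 (int p) (p + q)"
proof -
  have 1: "a : hs.Br 2 (int p) (p + q)" if a: "a : Fil (int p + 1) (p + q)" "D a = D e" for a
  proof -
    have "a : hs.Zr 1 (int p + 1) (p + q)" using Zr_one[OF a(1)] a(2) e(2) by (simp add: add.assoc)
    then have "(%x. a x + 0) : hs.Br 2 (int p) (p + q)" by (intro hs.Br_I fsub_0[OF hs.Rr_sub]) simp
    then show ?thesis by simp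
  qed
  from slot_cobd_imp[OF e(1) co]
  consider "e : Fil (int p + 1) (p + q)"
    | q' e' where "q = Suc q'" "e' : Fil (int p) (p + q')" "(%ws. e ws - D e' ws) : Fil (int p + 1) (p + q)" by blast
  then show ?thesis
  proof cases
    case 1
    then show ?thesis using \<open>!!a. a : Fil (int p + 1) (p + q) ==> D a = D e ==> a : hs.Br 2 (int p) (p + q)\<close> by blast
  next
    case (2 q' e')
    have "D (%ws. e ws - D e' ws) = D e" unfolding diff_on_diff D_D[OF Fil_Cn[OF 2(2)]] by simp
    then have a: "(%ws. e ws - D e' ws) : hs.Br 2 (int p) (p + q)" by (rule 1[OF 2(3)])
    have "e' : Fil (int p - 1) (p + q')" using 2(2) Fil_antimono[of "int p - 1" "int p"] by auto
    then have "D e' : hs.Br 2 (int p) (p + q)" using D_in_Br[OF _ Fil_D[OF 2(2)]] 2(1) by simp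
    then show ?thesis using fsub_add[OF hs.Br_sub a] by fastforce
  qed
qed

lemma cocycle_page:
  assumes "f : Fil (int p) (p + q)" "D f : Fil (int p + 1) (Suc (p + q))" "set xs <= L" "length xs = p"
  shows "dI (slot f xs) = 0"
proof -
  have "sg p (dI (slot f xs)) = 0" using Fil_D_slot[OF assms(1,3,4)] Fil_slot[OF assms(2,3)] assms(4) by simp
  then show ?thesis by (simp add: sg_def split: if_splits)
qed

text \<open>The isomorphism sends a cycle to the classes of its leading term. It is onto because
  closed class-valued cochains lift to cocycles.\<close>

lemma second_page_isomorphic:
  "vs_isomorphic (hs_page (lie_rec A) I k trivial_module trivial_action 2 (int p) (p + q))
     (hs_E2_term (lie_rec A) I k trivial_module trivial_action p q)"
proof -
  let ?n = "p + q"
  let ?g = "%f. cls_coch p q (slot f)"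
  let ?V = "(HC q p)\<lparr>carrier := cocycles (HC q) (dH q) p\<rparr>"
  let ?W = "coboundaries (HC q) (dH q) p"
  have page: "hs_page (lie_rec A) I k trivial_module trivial_action 2 (int p) ?n =
      quot_space (fun_module (hs.Zr 2 (int p) ?n)) (hs.Br 2 (int p) ?n)"
    using hs.ss_page_eq by (simp add: hs_page_def rel_cochains_A[abs_def] hs_filtration_eq[abs_def])
  have E2: "hs_E2_term (lie_rec A) I k trivial_module trivial_action p q = quot_space ?V ?W"
    by (simp add: hs_E2_term_def rel_cohomology_def cohomology_def coset_def[abs_def])
  have Zr: "f : Fil (int p) ?n" "D f : Fil (int p + 2) (Suc ?n)" "D f : Fil (int p + 1) (Suc ?n)"
    if "f : hs.Zr 2 (int p) ?n" for f
    using that Fil_antimono[of "int p + 1" "int p + 2" "Suc ?n"] by (auto simp: ss_cycles_def dA_eq[OF Fil_Cn])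
  have lower: "dH q p' (cls_coch p' q (slot b)) = cls_coch p q (slot (D b))"
      "cls_coch p' q (slot b) : carrier (HC q p')"
    if "p = Suc p'" "b : Fil (int p') (p' + q)" "D b : Fil (int p) ?n" for p' b
  proof -
    have co: "dI (slot b xs) = 0" if "set xs <= L" "length xs = p'" for xs
      using cocycle_page[OF \<open>b : Fil (int p') (p' + q)\<close> _ that] \<open>p = Suc p'\<close> \<open>D b : Fil (int p) ?n\<close>
      by (simp add: add.commute)
    show "dH q p' (cls_coch p' q (slot b)) = cls_coch p q (slot (D b))"
      unfolding that(1) by (rule dH_slot[OF Fil_Cn[OF that(2)] co])
    show "cls_coch p' q (slot b) : carrier (HC q p')"
      by (rule cls_coch_in[OF slot_cocycle_family[OF Fil_Cn[OF that(2)] co]])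
  qed
  have W0: "?W = {%_. cobd q}" if "p = 0" using that by (simp add: coboundaries_def HC_simps)
  have WSuc: "EX b. b : Fil (int p') (p' + q) & D b : Fil (int p) ?n & c = ?g (D b)"
    if p': "p = Suc p'" and c: "c : ?W" for p' c
  proof -
    obtain c' where c': "c' : carrier (HC q p')" "c = dH q p' c'" using c p' by (auto simp: coboundaries_def)
    obtain b where b: "b : Fil (int p') (p' + q)" "D b : Fil (int p' + 1) (Suc (p' + q))" "c' = cls_coch p' q (slot b)"
      using cls_coch_lift[OF c'(1)] by blast
    have "D b : Fil (int p) ?n" using b(2) p' by (simp add: add.commute)
    then show ?thesis using lower(1)[OF p' b(1)] b c'(2) by blast
  qed
  have in_Zr: "f : hs.Zr 2 (int p) ?n" if "f : Fil (int p) ?n" "D f = (%_. 0)" for f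
    using that Fil_zero by (simp add: ss_cycles_def dA_eq[OF Fil_Cn])
  have onto: "?g ` hs.Zr 2 (int p) ?n = cocycles (HC q) (dH q) p"
  proof (intro equalityI subsetI)
    fix c assume "c : ?g ` hs.Zr 2 (int p) ?n"
    then obtain f where f: "f : hs.Zr 2 (int p) ?n" "c = ?g f" by blast
    note fp = Zr[OF f(1)]
    note co = cocycle_page[OF fp(1,3)]
    have "dH q p c = cls_coch (Suc p) q (slot (D f))" unfolding f(2) by (rule dH_slot[OF Fil_Cn[OF fp(1)] co])
    also have "... = (%_. cobd q)"
    proof (rule cls_coch_cobd)
      fix xs assume "set xs <= L" "length xs = Suc p"
      then have "slot (D f) xs = 0" using Fil_slot[OF fp(2)] by simp
      then show "slot (D f) xs : cobd q" using fsub_0[OF fsub_cobd] by (simp add: zero_fun_def)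
    qed
    finally show "c : cocycles (HC q) (dH q) p"
      using cls_coch_in[OF slot_cocycle_family[OF Fil_Cn[OF fp(1)] co]] f(2) by (simp add: cocycles_def HC_simps)
  next
    fix c assume "c : cocycles (HC q) (dH q) p"
    then have c: "c : carrier (HC q p)" "dH q p c = (%_. cobd q)" by (auto simp: cocycles_def HC_simps)
    obtain f where "f : Fil (int p) ?n" "c = ?g f" "D f = (%_. 0)" using cls_coch_lift[OF c(1)] c(2) by blast
    then show "c : ?g ` hs.Zr 2 (int p) ?n" using in_Zr by blast
  qed
  \<comment> \<open>If the classes of the leading term form a coboundary, lift a preimage to
    \<open>b\<close>; after subtracting \<open>D b\<close> the leading term takes values in the
    coboundaries of \<open>I\<close>.\<close>
  have g_iff: "f : hs.Br 2 (int p) ?n" if f: "f : hs.Zr 2 (int p) ?n" and gf: "?g f : ?W" for f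
  proof (cases p)
    case 0
    then have "slot f xs : cobd q" if "set xs <= L" "length xs = p" for xs
      using gf W0 cls_coch_cobdD[OF _ that] by blast
    then show ?thesis by (rule slot_cobd_Br[OF Zr(1,2)[OF f]])
  next
    case (Suc p')
    obtain b where b: "b : Fil (int p') (p' + q)" "D b : Fil (int p) ?n" "?g f = ?g (D b)" using WSuc[OF Suc gf] by blast
    have n: "?n = Suc (p' + q)" using Suc by simp
    have e: "(%ws. f ws - D b ws) : hs.Br 2 (int p) ?n"
    proof (rule slot_cobd_Br)
      show "(%ws. f ws - D b ws) : Fil (int p) ?n" by (rule Fil_diff[OF Zr(1)[OF f] b(2)])
      have "D (%ws. f ws - D b ws) = D f" unfolding diff_on_diff D_D[OF Fil_Cn[OF b(1)]] by simp
      then show "D (%ws. f ws - D b ws) : Fil (int p + 2) (Suc ?n)" using Zr(2)[OF f] by simp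
      fix xs assume "set xs <= L" "length xs = p"
      then have "slot f xs - slot (D b) xs : cobd q" by (rule cls_coch_cobd_iff[OF b(3)])
      moreover have "slot (%ws. f ws - D b ws) xs = slot f xs - slot (D b) xs" by (auto simp: slot_def fun_eq_iff)
      ultimately show "slot (%ws. f ws - D b ws) xs : cobd q" by simp
    qed
    have "D b : hs.Br 2 (int p) ?n" unfolding n by (rule D_in_Br) (use b Suc n in auto)
    then show ?thesis using fsub_add[OF hs.Br_sub e] by fastforce
  qed
  have iff_g: "?g f : ?W" if f: "f : hs.Br 2 (int p) ?n" for f
  proof -
    obtain a b where ab: "a : hs.Zr (2 - 1) (int p + 1) ?n" "b : hs.Rr 2 (int p) ?n" "f = (%x. a x + b x)"
      using f unfolding hs.Br_iff by blast
    have a: "a : Fil (int p + 1) ?n" using ab(1) by (simp add: ss_cycles_def)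
    have sf: "slot f xs = slot b xs" if "set xs <= L" "length xs = p" for xs
      using Fil_slot[OF a that(1)] that(2) unfolding ab(3) slot_plus by simp
    show ?thesis
    \<comment> \<open>For \<open>p = 0\<close> the incoming differential starts in filtration degree
      -1, where it contributes only coboundaries of \<open>I\<close>.\<close>
    proof (cases p)
      case 0
      have "slot b xs : cobd q" if xs: "set xs <= L" "length xs = p" for xs
      proof (cases q)
        case q: 0
        then have "b = (%_. 0)" using ab(2) 0 by (simp add: hs.Rr_def)
        then have "slot b xs = (%_. 0)" by (auto simp: slot_def)
        then show ?thesis using fsub_0[OF fsub_cobd] by simp
      next
        case (Suc m)
        then obtain e where e: "e : Fil (int p - 1) m" "b = D e"
          using ab(2) 0 by (auto simp: hs.Rr_def ss_cycles_def dA_eq[OF Fil_Cn])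
        have eC: "e : Cn (0 + m)" using Fil_Cn[OF e(1)] by simp
        have "xs = []" using xs 0 by simp
        then have "slot b xs = dI (slot e [])" using slot_D'[OF eC, of "[]"] e(2) by simp
        moreover have "altn I m (slot e [])" by (rule slot_altn[OF eC]) simp_all
        ultimately show ?thesis using Suc by (simp add: cobd_def)
      qed
      then show ?thesis using W0[OF 0] cls_coch_cobd[of p "slot f" q] sf by simp
    next
      case (Suc p')
      then have n: "?n = Suc (p' + q)" by simp
      obtain e where e: "e : hs.Zr (2 - 1) (int p - 2 + 1) (p' + q)" "b = dA (p' + q) e"
        using ab(2) unfolding n hs.Rr_def by auto
      have eF: "e : Fil (int p') (p' + q)" using e(1) Suc by (simp add: ss_cycles_def)
      have b: "b = D e" using e(2) dA_eq[OF Fil_Cn[OF eF]] by simp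
      have "D e : Fil (int p) ?n" using e(1) Suc n dA_eq[OF Fil_Cn[OF eF]] by (simp add: ss_cycles_def add.commute)
      note lo = lower[OF Suc eF this]
      have "?g f = ?g (D e)" by (rule cls_coch_cong) (simp add: sf b)
      then have "?g f = dH q p' (cls_coch p' q (slot e))" using lo(1) by simp
      then show ?thesis using lo(2) Suc unfolding coboundaries_def by (simp only: nat.case image_eqI)
    qed
  qed
  show ?thesis unfolding page E2
  proof (rule quot_space_isomorphic[OF hs.Zr_sub hs.Br_sub hs.Br_Zr, where g = ?g])
    show "?g ` hs.Zr 2 (int p) ?n = carrier ?V" using onto by simp
    show "?W <= carrier ?V"
    proof
      fix c assume c: "c : ?W"
      have "c : ?g ` hs.Zr 2 (int p) ?n"
      proof (cases p)
        case 0
        have "slot (%_. 0) xs = (%_. 0)" for xs by (auto simp: slot_def)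
        then have "?g (%_. 0) = (%_. cobd q)" using cls_coch_cobd fsub_0[OF fsub_cobd] by simp
        then have "c = ?g (%_. 0)" using W0[OF 0] c by simp
        then show ?thesis using fsub_0[OF hs.Zr_sub] by (rule image_eqI)
      next
        case (Suc p')
        obtain b where b: "b : Fil (int p') (p' + q)" "D b : Fil (int p) ?n" "c = ?g (D b)" using WSuc[OF Suc c] by blast
        then show ?thesis using in_Zr[OF b(2) D_D[OF Fil_Cn[OF b(1)]]] by blast
      qed
      then show "c : carrier ?V" using onto by simp
    qed
    fix f assume "f : hs.Zr 2 (int p) ?n"
    then show "?g f : ?W \<longleftrightarrow> f : hs.Br 2 (int p) ?n" using g_iff iff_g by blast
    show "?g (%x. f x + f' x) = ?g f \<oplus>\<^bsub>?V\<^esub> ?g f'" for f'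
    proof -
      have "slot (%x. f x + f' x) = (%xs zs. slot f xs zs + slot f' xs zs)" by (rule ext) (rule slot_plus)
      then show ?thesis by (simp add: cls_coch_plus HC_simps)
    qed
    show "?g (%x. c * f x) = c \<odot>\<^bsub>?V\<^esub> ?g f" for c
    proof -
      have "slot (%x. c * f x) = (%xs zs. c * slot f xs zs)" by (rule ext) (rule slot_smult)
      then show ?thesis by (simp add: cls_coch_plus HC_simps)
    qed
  qed
qed

lemma hs_degenerates_semidirect: "hs_degenerates_at (lie_rec A) I k trivial_module trivial_action 2"
proof -
  have "EX g:Fil (p + 1) n. dA n f = dA n g" if "f : Fil p n" "dA n f : Fil (p + 2) (Suc n)" for p n f
    using second_page_cycle[of f p n] that by (metis Fil_Cn dA_eq)
  then have "ss_degenerates_at hs.Cm dA Fil 2" by (rule hs.degenerates_at_two)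
  then show ?thesis by (simp add: hs_degenerates_at_def rel_cochains_A[abs_def] hs_filtration_eq[abs_def])
qed

end

section \<open>Weights of the cochains\<close>

interpretation fun_space: complex_space "%c (f :: 'b => complex) x. c * f x"
  by unfold_locales (auto simp: fun_eq_iff algebra_simps)

context complex_lie_algebra
begin

text \<open>Products of dual basis vectors as multilinear functions. They are not alternating, but a
  weight module only asks for weight vectors spanning a larger space, so bases of exterior powers
  are avoided.\<close>

primrec tensor :: "'a set => 'a list => 'a list => complex" where
  "tensor B [] = (%zs. if zs = [] then 1 else 0)"
| "tensor B (b # bs) = (%zs. case zs of [] => 0 | z # us => representation B z b * tensor B bs us)"

lemma tensor_outside: "~ set zs <= span B ==> tensor B bs zs = 0"
proof (induction bs arbitrary: zs)
  case (Cons b bs)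
  then obtain z us where zs: "zs = z # us" by (cases zs) auto
  show ?case
  proof (cases "z : span B")
    case True
    then show ?thesis using Cons zs by simp
  next
    case False
    then show ?thesis using zs by (simp add: representation_def)
  qed
qed auto

lemma representation_weight:
  assumes B: "independent B" and wt: "!!b. b : B ==> lie x b = scale (wt b) b" and b: "b : B" and z: "z : span B"
  shows "representation B (lie x z) b = wt b * representation B z b & lie x z : span B"
proof -
  have "z : span B & representation B (lie x z) b = wt b * representation B z b & lie x z : span B" using z
  proof (induction rule: span_induct_alt)
    case base
    have "lie x 0 = 0" using lie_scale_right[of x 0 0] by simp
    then show ?case by (simp add: span_zero representation_zero)
  next
    case (step c b' y)
    have b': "b' : span B" using step by (simp add: span_base)
    have eq: "lie x (scale c b' + y) = scale c (scale (wt b') b') + lie x y"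
      using step(1) by (simp add: lie_add_right lie_scale_right wt)
    have m: "scale c b' : span B" "scale (wt b') b' : span B" "scale c (scale (wt b') b') : span B"
      using b' by (simp_all add: span_scale)
    have y: "y : span B" "lie x y : span B" "representation B (lie x y) b = wt b * representation B y b"
      using step(2) by blast+
    have "representation B (lie x (scale c b' + y)) b = wt b * representation B (scale c b' + y) b"
      unfolding eq representation_add[OF B y(2) m(3)] representation_add[OF B y(1) m(1)]
        representation_scale[OF B m(2)] representation_scale[OF B b'] representation_basis[OF B step(1)] y(3)
      by (simp add: distrib_left)
    then show ?case using span_add[OF m(1) y(1)] span_add[OF m(3) y(2)] eq by simp
  qed
  then show ?thesis by blast
qed

text \<open>The insertion sum acts on one tensor factor at a time, so the weights add up.\<close>

lemma ins_all_tensor: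
  assumes B: "independent B" and wt: "!!b. b : B ==> lie x b = scale (wt b) b"
  shows "set bs <= B ==> set zs <= span B ==> ins_all (lie x) zs (tensor B bs) = sum_list (map wt bs) * tensor B bs zs"
proof (induction bs arbitrary: zs)
  case Nil
  have "ins_all (lie x) zs (tensor B []) = 0" unfolding ins_all_eq by (rule sum.neutral) auto
  then show ?case by simp
next
  case (Cons b bs)
  show ?case
  proof (cases zs)
    case (Cons z us)
    have m: "b : B" "z : span B" "set bs <= B" "set us <= span B" using Cons.prems Cons by auto
    have "ins_all (lie x) us (%vs. representation B z b * tensor B bs vs) =
        representation B z b * (sum_list (map wt bs) * tensor B bs us)" unfolding ins_all_scale Cons.IH[OF m(3,4)] ..
    moreover have "representation B (lie x z) b = wt b * representation B z b"
      using representation_weight[OF B wt m(1,2)] by blast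
    ultimately have "ins_all (lie x) (z # us) (tensor B (b # bs)) =
        wt b * representation B z b * tensor B bs us + representation B z b * (sum_list (map wt bs) * tensor B bs us)"
      by simp
    then show ?thesis using Cons by (simp add: distrib_left distrib_right mult_ac)
  qed simp
qed

lemma alt_on_expand:
  assumes f: "alt_on (span B) f" and B: "finite B" "independent B" and m: "z : span B" "set zs <= span B"
  shows "f (z # zs) = (\<Sum>b\<in>B. representation B z b * f (b # zs))"
proof -
  have e: "set [] <= span B" by simp
  have "f ((\<Sum>b\<in>T. scale (representation B z b) b) # zs) = (\<Sum>b\<in>T. representation B z b * f (b # zs))"
    if "finite T" "T <= B" for T using that
  proof (induction T rule: finite_induct)
    case empty
    show ?case using alt_on_zero[OF f e m(2) span_zero] by simp
  next
    case (insert b T)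
    have b: "b : span B" and s: "(\<Sum>b\<in>T. scale (representation B z b) b) : span B"
      using insert.prems span_base[of _ B] by (auto intro: span_sum span_scale)
    have "f ((scale (representation B z b) b + (\<Sum>b\<in>T. scale (representation B z b) b)) # zs) =
        f (scale (representation B z b) b # zs) + f ((\<Sum>b\<in>T. scale (representation B z b) b) # zs)"
      using alt_on_add[OF f e m(2) span_scale[OF b] s] by simp
    then show ?case using insert alt_on_scale[OF f e m(2) b] by simp
  qed
  from this[OF B(1) subset_refl] show ?thesis using sum_representation_eq[OF B(2) m(1) B(1) subset_refl] by simp
qed

end

context semidirect
begin

text \<open>Expand the first argument in the basis and apply the induction hypothesis to the
  coefficients. Outside the span both sides vanish, as \<open>representation\<close> is zero
  there.\<close>

lemma altn_tensor_span:
  assumes B: "finite B" "independent B"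
  shows "altn (span B) q f ==> f : fun_space.span (tensor B ` {bs. set bs <= B & length bs = q})"
proof (induction q arbitrary: f)
  case 0
  have "f = (%zs. f [] * tensor B [] zs)" using altn_0[OF 0] by (auto simp: fun_eq_iff)
  moreover have "(%zs. f [] * tensor B [] zs) : fun_space.span (tensor B ` {bs. set bs <= B & length bs = 0})"
    by (rule fun_space.span_scale[OF fun_space.span_base]) force
  ultimately show ?case by simp
next
  case (Suc q)
  let ?T = "tensor B ` {bs. set bs <= B & length bs = Suc q}"
  let ?c = "%b g zs. case zs of [] => 0 | z # us => representation B z b * g us"
  have fa: "alt_on (span B) f" using Suc.prems by (simp add: altn_def)
  have step: "?c b g : fun_space.span ?T"
    if b: "b : B" and g: "g : fun_space.span (tensor B ` {bs. set bs <= B & length bs = q})" for b g using g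
  proof (induction rule: fun_space.span_induct_alt)
    case base
    have "?c b 0 = 0" by (rule ext) (simp split: list.split)
    then show ?case using fun_space.span_zero by metis
  next
    case (step a t g)
    obtain bs where bs: "set bs <= B" "length bs = q" "t = tensor B bs" using step(1) by blast
    have eq: "?c b ((%x. a * t x) + g) = (%x. a * tensor B (b # bs) x) + ?c b g"
      by (auto simp: fun_eq_iff bs(3) algebra_simps split: list.split)
    have "tensor B (b # bs) : fun_space.span ?T" using bs b by (intro fun_space.span_base imageI) simp
    then show ?case unfolding eq by (intro fun_space.span_add fun_space.span_scale step(2))
  qed
  have "f = (\<Sum>b\<in>B. ?c b (%zs. f (b # zs)))"
  proof
    fix zs
    show "f zs = (\<Sum>b\<in>B. ?c b (%zs. f (b # zs))) zs"
    proof (cases zs)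
      case Nil
      then show ?thesis using altn_0[OF Suc.prems, of zs] by (simp add: fun_sum_apply)
    next
      case (Cons z us)
      show ?thesis
      proof (cases "z : span B & set us <= span B")
        case True
        then show ?thesis using alt_on_expand[OF fa B, of z us] Cons by (simp add: fun_sum_apply)
      next
        case False
        have "representation B z b * f (b # us) = 0" for b
          using False altn_0[OF Suc.prems, of "b # us"] by (auto simp: representation_def)
        then have "(\<Sum>b\<in>B. representation B z b * f (b # us)) = 0" by (intro sum.neutral ballI)
        moreover have "f zs = 0" using altn_0[OF Suc.prems, of zs] False Cons by auto
        ultimately show ?thesis using Cons by (simp add: fun_sum_apply)
      qed
    qed
  qed
  moreover have "?c b (%zs. f (b # zs)) : fun_space.span ?T" if b: "b : B" for b
  proof (rule step[OF b Suc.IH])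
    show "altn (span B) q (%zs. f (b # zs))"
      using alt_on_Cons[OF fa span_base[OF b]] Suc.prems span_base[OF b] by (auto simp: altn_def args_def)
  qed
  ultimately show ?case using fun_space.span_sum[of B "%b. ?c b (%zs. f (b # zs))" ?T] by simp
qed

lemma th_tensor:
  assumes B: "independent B" "span B = I" and wt: "!!b. b : B ==> lie x b = scale (wt b) b" and bs: "set bs <= B"
  shows "th x (tensor B bs) = (%zs. - sum_list (map wt bs) * tensor B bs zs)"
  using ins_all_tensor[OF B(1) wt bs] tensor_outside[of _ B bs] B(2) by (auto simp: th_def fun_eq_iff)

text \<open>The minus sign in \<open>th\<close> turns the commutator rule for insertion sums into
  the law of a representation.\<close>

lemma th_lie:
  assumes x: "x : L" and y: "y : L" and f: "altn I q f"
  shows "th (lie x y) f = th x (th y f) - th y (th x f)"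
proof
  fix zs
  have th2: "th u (th v f) zs = ins_all (lie u) zs (%vs. ins_all (lie v) vs f)" if "u : L" "set zs <= I" for u v
  proof -
    have "ins_all (lie u) zs (th v f) = ins_all (lie u) zs (%vs. - ins_all (lie v) vs f)"
      by (rule ins_all_cong[where S = I]) (use LI[OF that(1)] that(2) in \<open>auto simp: th_def\<close>)
    then show ?thesis using that(2) by (simp add: th_def ins_all_minus)
  qed
  show "th (lie x y) f zs = (th x (th y f) - th y (th x f)) zs"
  proof (cases "set zs <= I")
    case True
    then show ?thesis using ins_all_commutator[OF I LI[OF x] LI[OF y], of f zs] f th2[OF x True] th2[OF y True]
      by (simp add: altn_def) (simp add: th_def)
  qed (simp add: th_def)
qed

end

section \<open>The Lie algebra attached to a standard parabolic\<close>

context standard_parabolic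
begin

abbreviation "pscale \<equiv> module_prod.scale scale scale"
abbreviation "plie \<equiv> %x y. (lie (fst x) (fst y), lie (snd x) (snd y))"

sublocale product: vector_space_prod scale scale ..

lemma pscale_eq: "pscale c v = (scale c (fst v), scale c (snd v))" by (rule product.scale_def)

lemma product_lie_algebra: "complex_lie_algebra pscale plie" by unfold_locales
    (simp_all add: pscale_eq lie_add_left lie_add_right lie_scale_left lie_scale_right lie_self jacobi zero_prod_def)

lemma tilde_u_K_eq: "tilde_u_K t = u_K_minus t \<times> u_K_plus t"
proof -
  have "x : (u_K_minus t \<times> {0}) + ({0} \<times> u_K_plus t) \<longleftrightarrow> x : u_K_minus t \<times> u_K_plus t" for x
  proof
    assume "x : u_K_minus t \<times> u_K_plus t"
    then have "(fst x, 0) + (0, snd x) : (u_K_minus t \<times> {0}) + ({0} \<times> u_K_plus t)" by (intro set_plus_intro) auto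
    then show "x : (u_K_minus t \<times> {0}) + ({0} \<times> u_K_plus t)" by simp
  qed (auto elim!: set_plus_elim)
  then show ?thesis unfolding tilde_u_K_def by blast
qed

lemma diagonal_iff: "x : diagonal V \<longleftrightarrow> fst x : V & snd x = fst x" by (cases x) (auto simp: diagonal_def)

text \<open>The factors of the ideal are the nilradicals of the negative and of the positive roots.
  They meet only in zero, and therefore the diagonal meets their product only in zero.\<close>

lemma semidirect_product: "semidirect pscale plie (diagonal (l_K t)) (tilde_u_K t) l_diagonal"
proof -
  interpret P: complex_lie_algebra pscale plie by (rule product_lie_algebra)
  have diag: "P.subalgebra (diagonal S)" if "subalgebra S" for S
    using that unfolding P.subalgebra_def subalgebra_def product.p.subspace_def subspace_def
    by (auto simp: diagonal_iff pscale_eq)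
  note np = stable_positive_pos[of t] and nn = stable_positive_neg[of t]
  show ?thesis
  proof
    show "P.subalgebra (diagonal (l_K t))" by (rule diag[OF subalgebra_l_K])
    show "P.subalgebra l_diagonal" unfolding l_diagonal_def by (rule diag[OF subalgebra_levi])
    show "l_diagonal <= diagonal (l_K t)" using levi_subset_l_K by (auto simp: l_diagonal_def diagonal_def)
    show "product.p.subspace (tilde_u_K t)"
      unfolding tilde_u_K_eq u_K_plus_eq u_K_minus_eq by (intro product.subspace_Times subspace_nilradical)
    show "plie x z : tilde_u_K t" if "x : diagonal (l_K t)" "z : tilde_u_K t" for x z
      using that l_K_nilradical[OF np] l_K_nilradical[OF nn]
      by (auto simp: tilde_u_K_eq u_K_plus_eq u_K_minus_eq diagonal_iff)
    show "plie x z : tilde_u_K t" if "x : tilde_u_K t" "z : tilde_u_K t" for x z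
      using that nilradical_closed[OF np] nilradical_closed[OF nn] by (auto simp: tilde_u_K_eq u_K_plus_eq u_K_minus_eq)
    show "diagonal (l_K t) \<inter> tilde_u_K t = {0}"
    proof (intro equalityI subsetI)
      fix x assume "x : diagonal (l_K t) \<inter> tilde_u_K t"
      then have "snd x = fst x" "fst x : nilradical t pos" "fst x : nilradical t (uminus ` pos)"
        by (auto simp: tilde_u_K_eq u_K_plus_eq u_K_minus_eq diagonal_iff)
      then show "x : {0}" using nilradicals_disjoint[of "fst x" t] by (simp add: prod_eq_iff)
    next
      fix x :: "'a \<times> 'a" assume "x : {0}"
      then show "x : diagonal (l_K t) \<inter> tilde_u_K t"
        using subspace_0[OF subalg_subspace[OF subalgebra_l_K[of t]]] subspace_0[OF subspace_nilradical]
        by (simp add: tilde_u_K_eq u_K_plus_eq u_K_minus_eq diagonal_iff mem_Times_iff)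
    qed
  qed
qed

lemma levi_data_l_K: "levi_data scale lie h (roots_K t) (roots_K t \<inter> pos)"
proof
  show "roots_K t <= roots h" by (auto simp: roots_K_def)
  show "- beta : roots_K t" if "beta : roots_K t" for beta by (rule roots_K_minus[OF that])
  show "roots_K t = roots_K t \<inter> pos \<union> uminus ` (roots_K t \<inter> pos)"
  proof (intro equalityI subsetI)
    fix beta assume b: "beta : roots_K t"
    then consider "beta : pos" | "- beta : pos" using pos_or_neg by (auto simp: roots_K_def)
    then show "beta : roots_K t \<inter> pos \<union> uminus ` (roots_K t \<inter> pos)"
    proof cases
      case 2
      have "- beta : roots_K t \<inter> pos" using 2 roots_K_minus[OF b] by blast
      from imageI[OF this, of uminus] show ?thesis unfolding minus_minus by (rule UnI2)
    qed (use b in simp)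
  qed (use roots_K_minus in auto)
  show "closed_roots (roots_K t \<inter> pos)" using closed_pos roots_K_add[of _ t] by (auto simp: closed_roots_def)
  show "subalgebra (span (h \<union> (\<Union>beta\<in>roots_K t. g beta)))" using subalgebra_l_K[of t] unfolding l_K_span .
qed

text \<open>The basis is selected from root vectors placed in a single factor, so each member is a
  weight vector for the diagonal copy of \<open>h\<close>.\<close>

lemma tilde_u_K_basis:
  obtains B wt where "finite B" "module.independent pscale B" "module.span pscale B = tilde_u_K t"
    "!!b. b : B ==> wt b : real_weights" "!!b x. b : B ==> x : h ==> plie (x, x) b = pscale (wt b x) b"
proof -
  interpret P: complex_lie_algebra pscale plie by (rule product_lie_algebra)
  have ex: "EX B. finite B & span B = nilradical t R & B <= (\<Union>beta\<in>R - roots_K t. g beta)" for R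
  proof -
    obtain B where B: "B <= (\<Union>beta\<in>R - roots_K t. g beta)" "independent B" "(\<Union>beta\<in>R - roots_K t. g beta) <= span B"
      using maximal_independent_subset[of "\<Union>beta\<in>R - roots_K t. g beta"] by blast
    have "span B = nilradical t R"
      unfolding nilradical_def using span_mono[OF B(1)] span_minimal[OF B(3) subspace_span] by blast
    then show ?thesis using B finite_dimensional_vector_space.finiteI_independent[OF finite_dimensional B(2)] by blast
  qed
  obtain B1 where B1: "finite B1" "span B1 = u_K_minus t" "B1 <= (\<Union>beta\<in>uminus ` pos - roots_K t. g beta)"
    using ex[of "uminus ` pos"] unfolding u_K_minus_eq by blast
  obtain B2 where B2: "finite B2" "span B2 = u_K_plus t" "B2 <= (\<Union>beta\<in>pos - roots_K t. g beta)"
    using ex[of pos] unfolding u_K_plus_eq by blast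
  let ?F = "B1 \<times> {0} \<union> {0} \<times> B2"
  have spF: "product.p.span ?F = tilde_u_K t"
  proof -
    have "product.p.span ?F = {x + y | x y. x : product.p.span (B1 \<times> {0}) & y : product.p.span ({0} \<times> B2)}"
      by (rule product.p.span_Un)
    also have "... = {x + y | x y. x : u_K_minus t \<times> {0} & y : {0} \<times> u_K_plus t}"
      by (simp only: product.span_Times_sing1 product.span_Times_sing2 B1(2) B2(2))
    also have "... = tilde_u_K t" by (auto simp: tilde_u_K_def set_plus_def)
    finally show ?thesis .
  qed
  obtain B where B: "B <= ?F" "product.p.independent B" "?F <= product.p.span B"
    using product.p.maximal_independent_subset[of ?F] by blast
  have spB: "product.p.span B = tilde_u_K t"
    using product.p.span_mono[OF B(1)] product.p.span_minimal[OF B(3) product.p.subspace_span] spF by blast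
  have finB: "finite B" using B(1) B1(1) B2(1) by (meson finite_SigmaI finite_UnI finite.intros finite_subset)
  have "EX mu. mu : real_weights & (ALL x:h. plie (x, x) b = pscale (mu x) b)" if b: "b : B" for b
  proof -
    have "b : B1 \<times> {0} \<or> b : {0} \<times> B2" using b B(1) by blast
    then have "EX beta:roots h. (fst b : g beta & snd b = 0) \<or> (fst b = 0 & snd b : g beta)"
      using B1(3) B2(3) pos_root root_minus by (cases b) fastforce
    then obtain beta where beta: "beta : roots h" "(fst b : g beta & snd b = 0) \<or> (fst b = 0 & snd b : g beta)" by blast
    have z: "lie x 0 = 0" for x using lie_scale_right[of x 0 0] by simp
    have "plie (x, x) b = pscale (beta x) b" if "x : h" for x
      using beta(2) that z by (auto simp: pscale_eq root_space_def)
    then show ?thesis using root_real_weight[OF beta(1)] by blast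
  qed
  then obtain wt where "!!b. b : B ==> wt b : real_weights" "!!b x. b : B ==> x : h ==> plie (x, x) b = pscale (wt b x) b"
    by metis
  then show ?thesis using that finB B(2) spB by blast
qed

lemma sum_real_weights: "(!!b. b : set bs ==> wt b : real_weights) ==> (%x. sum_list (map (%b. wt b x) bs)) : real_weights"
proof (induction bs)
  case Nil
  then show ?case using real_weights_zero by (simp add: zero_fun_def)
next
  case (Cons b bs)
  then show ?case using real_weights_plus[of "wt b" "%x. sum_list (map (%b. wt b x) bs)"] by (simp add: plus_fun_def)
qed

lemma weight_module_cochains:
  "weight_module scale lie h (roots_K t) (roots_K t \<inter> pos) (%c (f :: ('a \<times> 'a) list => complex) zs. c * f zs)
     (%x. semidirect.th plie (tilde_u_K t) (x, x)) {f. semidirect.altn pscale (tilde_u_K t) q f}"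
proof -
  interpret S: semidirect pscale plie "diagonal (l_K t)" "tilde_u_K t" l_diagonal by (rule semidirect_product)
  interpret R: levi_data scale lie h "roots_K t" "roots_K t \<inter> pos" by (rule levi_data_l_K)
  have r: "R.r = l_K t" by (simp add: R.r_def l_K_span)
  have dL: "(x, x) : diagonal (l_K t)" if "x : R.r" for x using that by (simp add: r diagonal_iff)
  obtain B wt where B: "finite B" "product.p.independent B" "product.p.span B = tilde_u_K t"
    "!!b. b : B ==> wt b : real_weights" "!!b x. b : B ==> x : h ==> plie (x, x) b = pscale (wt b x) b"
    using tilde_u_K_basis[of t] by blast
  show ?thesis
  proof (intro weight_module.intro weight_module_axioms.intro)
    show "levi_data scale lie h (roots_K t) (roots_K t \<inter> pos)" by (rule levi_data_l_K)
    show "complex_space (%c (f :: ('a \<times> 'a) list => complex) zs. c * f zs)" by unfold_locales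
    show "fun_space.lin (S.th (x, x))" for x by (rule fun_space.linI) (rule S.th_plus, rule S.th_smult)
    show "fun_space.subspace {f. S.altn (tilde_u_K t) q f}"
      by (rule fun_space.subspaceI) (simp_all add: S.altn_fzero S.altn_fplus S.altn_smult)
    show "S.th (x, x) f : {f. S.altn (tilde_u_K t) q f}" if "x : R.r" "f : {f. S.altn (tilde_u_K t) q f}" for x f
      using S.altn_th[OF dL[OF that(1)]] that(2) by simp
    show "S.th (x + y, x + y) f = S.th (x, x) f + S.th (y, y) f"
      if "x : R.r" "y : R.r" "f : {f. S.altn (tilde_u_K t) q f}" for x y f
      using S.th_add_left[OF _ S.L_A[OF dL[OF that(1)]] S.L_A[OF dL[OF that(2)]], of f] that(3) by (simp add: S.altn_def)
    show "S.th (scale c x, scale c x) f = (%zs. c * S.th (x, x) f zs)"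
      if "x : R.r" "f : {f. S.altn (tilde_u_K t) q f}" for c x f
      using S.th_scale_left[OF _ S.L_A[OF dL[OF that(1)]], of f c] that(2) by (simp add: S.altn_def pscale_eq)
    show "S.th (lie x y, lie x y) f = S.th (x, x) (S.th (y, y) f) - S.th (y, y) (S.th (x, x) f)"
      if "x : R.r" "y : R.r" "f : {f. S.altn (tilde_u_K t) q f}" for x y f
      using S.th_lie[OF dL[OF that(1)] dL[OF that(2)], of q f] that(3) by simp
    let ?X = "{bs. set bs <= B & length bs = q}"
    \<comment> \<open>Functions on the ideal carry the negatives of the weights of the basis
      vectors.\<close>
    let ?mu = "%bs x. - sum_list (map (%b. wt b x) bs)"
    \<comment> \<open>The weight has to depend on the function alone, so a word representing it is
      chosen.\<close>
    let ?wt = "%s. ?mu (inv_into ?X (S.tensor B) s)"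
    have fin: "finite (S.tensor B ` ?X)" using finite_lists_length_eq[OF B(1)] by simp
    have span: "{f. S.altn (tilde_u_K t) q f} <= fun_space.span (S.tensor B ` ?X)"
      using S.altn_tensor_span[OF B(1,2), of q] unfolding B(3) by blast
    have "?wt s : real_weights & (ALL y:h. S.th (y, y) s = (%zs. ?wt s y * s zs))" if s: "s : S.tensor B ` ?X" for s
    proof -
      define bs where "bs = inv_into ?X (S.tensor B) s"
      have bs: "set bs <= B" "S.tensor B bs = s" using inv_into_into[OF s] f_inv_into_f[OF s] unfolding bs_def by blast+
      have "- (%x. sum_list (map (%b. wt b x) bs)) : real_weights"
        by (intro real_weights_minus sum_real_weights) (use bs(1) B(4) in blast)
      then have "?mu bs : real_weights" by (simp add: fun_Compl_def)
      moreover have "S.th (y, y) s = (%zs. ?mu bs y * s zs)" if "y : h" for y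
        using S.th_tensor[OF B(2,3) B(5)[OF _ that] bs(1)] bs(2) by simp
      ultimately show ?thesis unfolding bs_def by blast
    qed
    then show "EX S' wt. finite S' & {f. S.altn (tilde_u_K t) q f} <= fun_space.span S' &
        (ALL s:S'. wt s : real_weights & (ALL y:h. S.th (y, y) s = (%zs. wt s y * s zs)))"
      using fin span by (intro exI[of _ "S.tensor B ` ?X"] exI[of _ ?wt]) blast
  qed
qed

text \<open>The conditions on \<open>sigma\<close> do not link different degrees, so one equivariant
  generalized inverse is chosen for each degree.\<close>

lemma ex_semidirect_split:
  "EX sigma. semidirect_split pscale plie (diagonal (l_K t)) (tilde_u_K t) l_diagonal sigma"
proof -
  interpret S: semidirect pscale plie "diagonal (l_K t)" "tilde_u_K t" l_diagonal by (rule semidirect_product)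
  interpret R: levi_data scale lie h "roots_K t" "roots_K t \<inter> pos" by (rule levi_data_l_K)
  have r: "R.r = l_K t" by (simp add: R.r_def l_K_span)
  let ?V = "%q. {f. S.altn (tilde_u_K t) q f}"
  let ?s = "%c (f :: ('a \<times> 'a) list => complex) zs. c * f zs"
  let ?P = "%q sigma. sigma : hom_space ?s (?V (Suc q)) (?V q) &
      (ALL x:l_K t. ALL f:?V (Suc q). sigma (S.th (x, x) f) = S.th (x, x) (sigma f)) &
      (ALL f:?V q. S.dI (sigma (S.dI f)) = S.dI f)"
  have "EX sigma. ?P q sigma" for q
  proof (rule R.equivariant_generalized_inverse[OF weight_module_cochains[of t q] weight_module_cochains[of t "Suc q"]])
    show "fun_space.lin S.dI" by (rule fun_space.linI) (rule S.dI_plus, rule S.diff_on_scale)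
    show "S.dI f : ?V (Suc q)" if "f : ?V q" for f using that S.altn_diff_on[OF S.I_subalgebra] by simp
    show "S.dI (S.th (x, x) f) = S.th (x, x) (S.dI f)" if "x : R.r" "f : ?V q" for x f
      using S.dI_th[of "(x, x)" q f] that by (simp add: r diagonal_iff)
    fix sigma assume "sigma : hom_space ?s (?V (Suc q)) (?V q)"
      "!!x f. x : R.r ==> f : ?V (Suc q) ==> sigma (S.th (x, x) f) = S.th (x, x) (sigma f)"
      "!!f. f : ?V q ==> S.dI (sigma (S.dI f)) = S.dI f"
    then show ?thesis unfolding r by blast
  qed
  then have "ALL q. EX sigma. ?P q sigma" by (intro allI)
  then obtain sigma where P: "ALL q. ?P q (sigma q)" by (rule choice[THEN exE])
  have s: "sigma q : hom_space ?s (?V (Suc q)) (?V q)"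
    "x : l_K t ==> f : ?V (Suc q) ==> sigma q (S.th (x, x) f) = S.th (x, x) (sigma q f)"
    "g : ?V q ==> S.dI (sigma q (S.dI g)) = S.dI g" for q x f g using spec[OF P, of q] by blast+
  have "semidirect_split pscale plie (diagonal (l_K t)) (tilde_u_K t) l_diagonal sigma"
  proof
    show "S.altn (tilde_u_K t) q (sigma q F)" if "S.altn (tilde_u_K t) (Suc q) F" for q F
      using s(1)[of q] that by (simp add: hom_space_def)
    show "sigma q (F + G) = sigma q F + sigma q G" if "S.altn (tilde_u_K t) (Suc q) F" "S.altn (tilde_u_K t) (Suc q) G" for q F G
      using s(1)[of q] that unfolding hom_space_def by blast
    show "sigma q (%zs. c * F zs) = (%zs. c * sigma q F zs)" if "S.altn (tilde_u_K t) (Suc q) F" for q c F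
      using s(1)[of q] that unfolding hom_space_def by blast
    show "sigma q (S.th x F) = S.th x (sigma q F)" if "x : diagonal (l_K t)" "S.altn (tilde_u_K t) (Suc q) F" for q x F
      using s(2)[of "fst x" F q] that by (cases x) (simp add: diagonal_iff)
    show "S.dI (sigma q (S.dI F)) = S.dI F" if "S.altn (tilde_u_K t) q F" for q F using s(3)[of F q] that by simp
  qed
  then show ?thesis by blast
qed

lemma g_K_spectral_sequence:
  "hs_converges (g_K t) (tilde_u_K t) l_diagonal trivial_module trivial_action"
  "vs_isomorphic (hs_page (g_K t) (tilde_u_K t) l_diagonal trivial_module trivial_action 2 (int i) (i + j))
     (hs_E2_term (g_K t) (tilde_u_K t) l_diagonal trivial_module trivial_action i j)"
  "hs_degenerates_at (g_K t) (tilde_u_K t) l_diagonal trivial_module trivial_action 2"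
proof -
  obtain sigma where "semidirect_split pscale plie (diagonal (l_K t)) (tilde_u_K t) l_diagonal sigma"
    using ex_semidirect_split by blast
  then interpret S: semidirect_split pscale plie "diagonal (l_K t)" "tilde_u_K t" l_diagonal sigma .
  have "g_K t = S.lie_rec S.A" by (simp add: g_K_def S.lie_rec_def S.A_def)
  then show "hs_converges (g_K t) (tilde_u_K t) l_diagonal trivial_module trivial_action"
    "vs_isomorphic (hs_page (g_K t) (tilde_u_K t) l_diagonal trivial_module trivial_action 2 (int i) (i + j))
       (hs_E2_term (g_K t) (tilde_u_K t) l_diagonal trivial_module trivial_action i j)"
    "hs_degenerates_at (g_K t) (tilde_u_K t) l_diagonal trivial_module trivial_action 2"
    using S.hs_converges_semidirect S.second_page_isomorphic S.hs_degenerates_semidirect by simp_all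
qed

end

theorem proposition7p3:
  fixes scale :: "complex \<Rightarrow> 'a::ab_group_add \<Rightarrow> 'a"
    and lie :: "'a \<Rightarrow> 'a \<Rightarrow> 'a"
    and h b p :: "'a set"
    and m n :: nat
    and \<alpha> :: "nat \<Rightarrow> 'a \<Rightarrow> complex"
    and t :: "nat \<Rightarrow> complex"
  assumes "standard_parabolic scale lie h b p m n \<alpha>"
  shows "let gK = standard_parabolic.g_K scale lie h b m n \<alpha> t;
             uK = standard_parabolic.tilde_u_K scale lie h b m n \<alpha> t;
             l\<Delta> = standard_parabolic.l_diagonal scale lie h p
         in hs_converges gK uK l\<Delta> trivial_module trivial_action \<and>
            (\<forall>i j. vs_isomorphic
               (hs_page gK uK l\<Delta> trivial_module trivial_action 2 (int i) (i + j))
               (hs_E2_term gK uK l\<Delta> trivial_module trivial_action i j)) \<and>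
            hs_degenerates_at gK uK l\<Delta> trivial_module trivial_action 2"
proof -
  interpret standard_parabolic scale lie h b p m n \<alpha> by fact
  show ?thesis unfolding Let_def using g_K_spectral_sequence by blast
qed

end
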